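(* Let $k$ be a finite field of characteristic $p$ and $\ell\neq p$ a prime. Every irreducible $\mathbb F_\ell^{ac}$-representation $\sigma$ of $GL_2(k)$ is the reduction modulo $\ell$ of a $\mathbb Q_\ell^{ac}$-representation $\tilde\sigma$ of $GL_2(k)$ such that $\tilde\sigma|_{SL_2(k)}$ and $\sigma|_{SL_2(k)}$ have the same length. Every irreducible $\mathbb F_\ell^{ac}$-representation of $SL_2(k)$ is the reduction modulo $\ell$ of a $\mathbb Q_\ell^{ac}$-representation of $SL_2(k)$.
   Context: Representations of the finite groups are finite-dimensional; every $\mathbb Q_\ell^{ac}$-representation of a finite group preserves a lattice over the integers of $\mathbb Q_\ell^{ac}$, and its reduction modulo $\ell$ is the semisimplification of the reduction of such a lattice (independent of the lattice). *)

theory Defs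
  imports "HOL-Algebra.Algebra"
begin

definition Zl :: "nat \<Rightarrow> (nat \<Rightarrow> int) ring" where
  "Zl l = \<lparr> carrier = {f. \<forall>n. 0 \<le> f n \<and> f n < int l ^ n \<and> f (Suc n) mod (int l ^ n) = f n},
            Group.monoid.mult = (\<lambda>f g n. (f n * g n) mod (int l ^ n)),
            Group.monoid.one = (\<lambda>n. 1 mod (int l ^ n)),
            Ring.ring.zero = (\<lambda>n. 0),
            Ring.ring.add = (\<lambda>f g n. (f n + g n) mod (int l ^ n)) \<rparr>"

definition is_Qlac :: "nat \<Rightarrow> 'a ring \<Rightarrow> ((nat \<Rightarrow> int) \<Rightarrow> 'a) \<Rightarrow> bool" where
  "is_Qlac l L \<iota> \<longleftrightarrow> field L \<and> \<iota> \<in> ring_hom (Zl l) L \<and> inj_on \<iota> (carrier (Zl l)) \<and>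
     algebraic_closure L (generate_field L (\<iota> ` carrier (Zl l)))"

definition integers :: "nat \<Rightarrow> 'a ring \<Rightarrow> ((nat \<Rightarrow> int) \<Rightarrow> 'a) \<Rightarrow> 'a set" where
  "integers l L \<iota> = {x \<in> carrier L. \<exists>p. polynomial\<^bsub>L\<^esub> (\<iota> ` carrier (Zl l)) p \<and> p \<noteq> [] \<and>
       lead_coeff p = \<one>\<^bsub>L\<^esub> \<and> ring.eval L p x = \<zero>\<^bsub>L\<^esub>}"

definition is_Flac :: "nat \<Rightarrow> 'b ring \<Rightarrow> bool" where
  "is_Flac l F \<longleftrightarrow> field F \<and> add_pow F l \<one>\<^bsub>F\<^esub> = \<zero>\<^bsub>F\<^esub> \<and>
     algebraic_closure F (generate_field F {\<one>\<^bsub>F\<^esub>})"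

definition is_reduction_map :: "nat \<Rightarrow> 'a ring \<Rightarrow> ((nat \<Rightarrow> int) \<Rightarrow> 'a) \<Rightarrow> 'b ring \<Rightarrow> ('a \<Rightarrow> 'b) \<Rightarrow> bool" where
  "is_reduction_map l L \<iota> F red \<longleftrightarrow>
     (let Oi = integers l L \<iota> in
       red \<in> ring_hom (L\<lparr>carrier := Oi\<rparr>) F \<and> red ` Oi = carrier F \<and>
       (\<forall>x\<in>Oi. red x = \<zero>\<^bsub>F\<^esub> \<longleftrightarrow> x \<notin> Units (L\<lparr>carrier := Oi\<rparr>)))"

type_synonym 'k m2 = "'k \<times> 'k \<times> 'k \<times> 'k"  (* (x11,x12,x21,x22) = the 2x2 matrix with these entries *)

definition m2mul :: "'k::comm_ring_1 m2 \<Rightarrow> 'k m2 \<Rightarrow> 'k m2" where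
  "m2mul x y = (case x of (x11,x12,x21,x22) \<Rightarrow> case y of (y11,y12,y21,y22) \<Rightarrow>
      (x11*y11 + x12*y21, x11*y12 + x12*y22, x21*y11 + x22*y21, x21*y12 + x22*y22))"

definition m2one :: "'k::comm_ring_1 m2" where "m2one = (1,0,0,1)"

definition GL2 :: "'k::field m2 set" where
  "GL2 = {(x11,x12,x21,x22). x11*x22 - x12*x21 \<noteq> 0}"

definition SL2 :: "'k::field m2 set" where
  "SL2 = {(x11,x12,x21,x22). x11*x22 - x12*x21 = 1}"

definition mat_mul :: "('a,'c) ring_scheme \<Rightarrow> nat \<Rightarrow> (nat \<Rightarrow> nat \<Rightarrow> 'a) \<Rightarrow> (nat \<Rightarrow> nat \<Rightarrow> 'a) \<Rightarrow> nat \<Rightarrow> nat \<Rightarrow> 'a" where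
  "mat_mul R n A B = (\<lambda>i j. finsum R (\<lambda>k. A i k \<otimes>\<^bsub>R\<^esub> B k j) {..<n})"

definition mat_one :: "('a,'c) ring_scheme \<Rightarrow> nat \<Rightarrow> nat \<Rightarrow> 'a" where
  "mat_one R = (\<lambda>i j. if i = j then \<one>\<^bsub>R\<^esub> else \<zero>\<^bsub>R\<^esub>)"

definition mat_eq :: "nat \<Rightarrow> (nat \<Rightarrow> nat \<Rightarrow> 'a) \<Rightarrow> (nat \<Rightarrow> nat \<Rightarrow> 'a) \<Rightarrow> bool" where
  "mat_eq n A B \<longleftrightarrow> (\<forall>i<n. \<forall>j<n. A i j = B i j)"

definition mat_in :: "nat \<Rightarrow> 'a set \<Rightarrow> (nat \<Rightarrow> nat \<Rightarrow> 'a) \<Rightarrow> bool" where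
  "mat_in n S A \<longleftrightarrow> (\<forall>i<n. \<forall>j<n. A i j \<in> S)"

definition is_rep :: "('a,'c) ring_scheme \<Rightarrow> 'k::field m2 set \<Rightarrow> nat \<Rightarrow> ('k m2 \<Rightarrow> nat \<Rightarrow> nat \<Rightarrow> 'a) \<Rightarrow> bool" where
  "is_rep R G n \<rho> \<longleftrightarrow> (\<forall>g\<in>G. mat_in n (carrier R) (\<rho> g)) \<and>
     (\<forall>g\<in>G. \<forall>h\<in>G. mat_eq n (\<rho> (m2mul g h)) (mat_mul R n (\<rho> g) (\<rho> h))) \<and>
     mat_eq n (\<rho> m2one) (mat_one R)"

definition vecs :: "('a,'c) ring_scheme \<Rightarrow> nat \<Rightarrow> (nat \<Rightarrow> 'a) set" where
  "vecs R n = {v. (\<forall>i<n. v i \<in> carrier R) \<and> (\<forall>i\<ge>n. v i = \<zero>\<^bsub>R\<^esub>)}"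

definition zvec :: "('a,'c) ring_scheme \<Rightarrow> nat \<Rightarrow> 'a" where
  "zvec R = (\<lambda>i. \<zero>\<^bsub>R\<^esub>)"

definition mat_vec :: "('a,'c) ring_scheme \<Rightarrow> nat \<Rightarrow> (nat \<Rightarrow> nat \<Rightarrow> 'a) \<Rightarrow> (nat \<Rightarrow> 'a) \<Rightarrow> nat \<Rightarrow> 'a" where
  "mat_vec R n A v = (\<lambda>i. if i < n then finsum R (\<lambda>j. A i j \<otimes>\<^bsub>R\<^esub> v j) {..<n} else \<zero>\<^bsub>R\<^esub>)"

definition inv_subspace :: "('a,'c) ring_scheme \<Rightarrow> 'k::field m2 set \<Rightarrow> nat \<Rightarrow> ('k m2 \<Rightarrow> nat \<Rightarrow> nat \<Rightarrow> 'a) \<Rightarrow> (nat \<Rightarrow> 'a) set \<Rightarrow> bool" where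
  "inv_subspace R G n \<rho> W \<longleftrightarrow> W \<subseteq> vecs R n \<and> zvec R \<in> W \<and>
     (\<forall>v\<in>W. \<forall>w\<in>W. (\<lambda>i. v i \<oplus>\<^bsub>R\<^esub> w i) \<in> W) \<and>
     (\<forall>c\<in>carrier R. \<forall>v\<in>W. (\<lambda>i. c \<otimes>\<^bsub>R\<^esub> v i) \<in> W) \<and>
     (\<forall>g\<in>G. \<forall>v\<in>W. mat_vec R n (\<rho> g) v \<in> W)"

definition irreducible_rep :: "('a,'c) ring_scheme \<Rightarrow> 'k::field m2 set \<Rightarrow> nat \<Rightarrow> ('k m2 \<Rightarrow> nat \<Rightarrow> nat \<Rightarrow> 'a) \<Rightarrow> bool" where
  "irreducible_rep R G n \<rho> \<longleftrightarrow> is_rep R G n \<rho> \<and> 0 < n \<and>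
     (\<forall>W. inv_subspace R G n \<rho> W \<longrightarrow> W = {zvec R} \<or> W = vecs R n)"

definition has_length :: "('a,'c) ring_scheme \<Rightarrow> 'k::field m2 set \<Rightarrow> nat \<Rightarrow> ('k m2 \<Rightarrow> nat \<Rightarrow> nat \<Rightarrow> 'a) \<Rightarrow> nat \<Rightarrow> bool" where
  "has_length R G n \<rho> m \<longleftrightarrow> (\<exists>W :: nat \<Rightarrow> (nat \<Rightarrow> 'a) set.
     W 0 = {zvec R} \<and> W m = vecs R n \<and>
     (\<forall>i\<le>m. inv_subspace R G n \<rho> (W i)) \<and>
     (\<forall>i<m. W i \<subset> W (Suc i) \<and>
        \<not> (\<exists>U. inv_subspace R G n \<rho> U \<and> W i \<subset> U \<and> U \<subset> W (Suc i))))"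

definition rep_iso :: "('a,'c) ring_scheme \<Rightarrow> 'k::field m2 set \<Rightarrow> nat \<Rightarrow> ('k m2 \<Rightarrow> nat \<Rightarrow> nat \<Rightarrow> 'a) \<Rightarrow> ('k m2 \<Rightarrow> nat \<Rightarrow> nat \<Rightarrow> 'a) \<Rightarrow> bool" where
  "rep_iso R G n \<rho>1 \<rho>2 \<longleftrightarrow> (\<exists>P Q. mat_in n (carrier R) P \<and> mat_in n (carrier R) Q \<and>
     mat_eq n (mat_mul R n P Q) (mat_one R) \<and> mat_eq n (mat_mul R n Q P) (mat_one R) \<and>
     (\<forall>g\<in>G. mat_eq n (mat_mul R n P (\<rho>1 g)) (mat_mul R n (\<rho>2 g) P)))"

text \<open>sigma (over F) is the reduction mod l of rho (over L): in a suitable basis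
  (i.e. for a suitable G-stable lattice, lattices being free over the integers) rho takes values
  in matrices over the integers, and the entrywise reduction is isomorphic to sigma.
  (For irreducible sigma this is the same as: the semisimplification of the reduction is sigma.)\<close>
definition reduces_to :: "nat \<Rightarrow> 'a ring \<Rightarrow> ((nat \<Rightarrow> int) \<Rightarrow> 'a) \<Rightarrow> 'b ring \<Rightarrow> ('a \<Rightarrow> 'b) \<Rightarrow>
     'k::field m2 set \<Rightarrow> nat \<Rightarrow> ('k m2 \<Rightarrow> nat \<Rightarrow> nat \<Rightarrow> 'a) \<Rightarrow> ('k m2 \<Rightarrow> nat \<Rightarrow> nat \<Rightarrow> 'b) \<Rightarrow> bool" where
  "reduces_to l L \<iota> F red G n \<rho> \<sigma> \<longleftrightarrow> (\<exists>P Q. mat_in n (carrier L) P \<and> mat_in n (carrier L) Q \<and>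
     mat_eq n (mat_mul L n P Q) (mat_one L) \<and> mat_eq n (mat_mul L n Q P) (mat_one L) \<and>
     (\<forall>g\<in>G. mat_in n (integers l L \<iota>) (mat_mul L n (mat_mul L n P (\<rho> g)) Q)) \<and>
     rep_iso F G n (\<lambda>g i j. red (mat_mul L n (mat_mul L n P (\<rho> g)) Q i j)) \<sigma>)"

end

theory Submission
  imports Defs "Jordan_Normal_Form.Char_Poly" "HOL-Library.Cardinality" "HOL-Number_Theory.Residues"
begin

text \<open>In this development \<open>**\<close> is the product of a ring, and the subscript naming a structure is
written \<open>@R\<close>.\<close>

notation Group.monoid.mult (infixl "**\<index>" 70)
syntax "_index" :: "logic => index" ("'@_" [1000] 1000)

section \<open>Finite fields and their quadratic extensions\<close>

text \<open>Let q be the order of k, let psi (\<open>py\<close>) be a nontrivial additive character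
  of k, let U be the upper unipotent group, and let G be \<open>GD D\<close>, that is GL2 or SL2.
  Let sigma be irreducible over \<open>F\<close>. If no nontrivial character of U occurs in sigma,
  then U acts trivially, hence so does SL2 (\<open>degenerate_trivial\<close>); sigma is then a
  character of the determinant and lifts with the root of unity that defines it
  (\<open>lift_degenerate\<close>).

  Otherwise, after rescaling psi, the psi-isotypic part of sigma is nonzero. With e the idempotent
  of psi, the Hecke algebra of e acts on it. By the Bruhat decomposition this algebra is spanned by
  the operators \<open>Tb b\<close>, and its structure constants \<open>stc\<close> involve only
  values of psi and 1/q (\<open>Tb_mult\<close>), so that the same formulas hold over
  \<open>L\<close> and over \<open>F\<close>. An eigenvector of this algebra determines an
  irreducible representation: its eigenvalues give e g v for every g (\<open>hev_pe_act\<close>),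
  and for two irreducible representations with equal eigenvalues the submodule generated by the pair
  of eigenvectors is the graph of an isomorphism (\<open>irr_iso\<close>, \<open>match\<close>).

  Over \<open>L\<close>, eigenvalue systems come from explicit models: the Kirillov model of a
  cuspidal representation, attached to a regular character of the multiplicative group of the
  quadratic extension (\<open>KC_krep\<close>, \<open>hevC\<close>), and the principal series on
  functions on the projective line (\<open>hevP\<close>). Together they separate linear combinations
  of the operators (\<open>separate\<close>). By Fourier inversion over multiplicative characters,
  this comes down to the fact that the Kloosterman sums of the split and of the non-split torus are
  opposite (\<open>kloosterman\<close>). It follows that every nonzero psi-isotypic part over
  \<open>F\<close> contains an eigenvector whose eigenvalues are the reductions of one of these
  systems (\<open>eigenvector_lift\<close>, \<open>eigenvector\<close>).

  It remains to choose a characteristic-zero model with those reduced eigenvalues whose reduction is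
  irreducible, or, for SL2, whose relevant half is. Parameters are first replaced by roots of unity
  of order prime to l with the same reduction (\<open>teich\<close>). A regular character gives a
  cuspidal representation (\<open>lift_C\<close>, \<open>lift_cusp\<close>). A principal series with
  \<open>nu\<close> nontrivial modulo l is treated in \<open>lift_ps\<close>. If \<open>nu\<close>
  is trivial, the Steinberg representation serves as long as q + 1 is nonzero in \<open>F\<close>
  (\<open>lift_steinberg\<close>). If l divides q + 1, the constant functions lie in the Steinberg
  space over \<open>F\<close>; but then the eigenvalues agree with those of a character composed
  with the norm. Multiplying that character by one of l-power order makes it regular without
  changing its reduction, and the cuspidal formula still defines a representation over
  \<open>F\<close>, because the sum over the norm-one elements is q + 1 = 0 (\<open>lift_T\<close>).

  On SL2 a cuspidal model stays irreducible unless nonsquares exist and its Bessel function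
  \<open>J\<close> vanishes at all of them, in which case it has length 2. The principal series with
  nontrivial \<open>nu\<close> has length 2 or 1 according to whether \<open>nu\<close> is quadratic
  or not. The parameters are chosen so that each of these conditions holds over \<open>L\<close>
  exactly when it holds over \<open>F\<close>, which gives equal lengths.\<close>

lemma ffp:
 fixes x :: "'f::{finite,field}"
 assumes "x ~= 0"
 shows "x ^ (CARD('f) - 1) = 1"
proof -
 have "(\<Prod>y\<in>UNIV-{0}. x * y) = x ^ (CARD('f) - 1) * \<Prod>(UNIV-{0})"
  by (simp add: prod.distrib)
 also have "(\<Prod>y\<in>UNIV-{0}. x * y) = (\<Prod>y\<in>UNIV-{0}. y)"
  by (rule prod.reindex_bij_witness[of _ "%y. y / x" "%y. x * y"]) (use assms in auto)
 finally show ?thesis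
  by simp
qed

lemma cge2: "2 <= CARD('f::{finite,field})"
proof -
 have "card {0, 1::'f} <= CARD('f)"
  by (rule card_mono) auto
 then show ?thesis by simp
qed

text \<open>Turns a type-class field into a ring record, so that the record theorem on cyclic
  multiplicative groups applies to it.\<close>

definition ring_of_type :: "'f::field itself => 'f ring" where
 "ring_of_type _ = \<lparr> carrier = UNIV, Group.monoid.mult = (*), Group.monoid.one = 1,
   Ring.ring.zero = 0, Ring.ring.add = (+) \<rparr>"

lemma field_ring_of_type: "Ring.field (ring_of_type TYPE('f::field))"
proof -
 let ?R = "ring_of_type TYPE('f)"
 have "cring ?R"
 proof (rule cringI)
  show "abelian_group ?R"
  proof (rule abelian_groupI)
   fix x assume "x : carrier ?R"
   show "EX y:carrier ?R. y \<oplus>@?R x = \<zero>@?R"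
    by (rule bexI[of _ "- x"]) (auto simp: ring_of_type_def)
  qed (auto simp: ring_of_type_def)
  show "Group.comm_monoid ?R"
   by (rule comm_monoidI) (auto simp: ring_of_type_def)
 qed (auto simp: ring_of_type_def algebra_simps)
 then show ?thesis
 proof (rule cring.cring_fieldI2)
  fix a assume "a : carrier ?R" "a ~= \<zero>@?R"
  then show "EX b:carrier ?R. a **@?R b = \<one>@?R"
   by (intro bexI[of _ "inverse a"]) (auto simp: ring_of_type_def)
 qed (auto simp: ring_of_type_def)
qed

lemma ring_of_type_pow:
 "x [^]@(ring_of_type TYPE('f::field)) (i::nat) = x ^ i"
proof (induction i)
 case 0
 then show ?case by (simp add: nat_pow_def ring_of_type_def)
next
 case (Suc i)
 then show ?case
  by (simp add: nat_pow_def ring_of_type_def mult.commute)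
qed

lemma finite_field_generator:
 "EX g::'f::{finite,field}. g ~= 0 & bij_betw (%i. g ^ i) {..<CARD('f) - 1} (UNIV - {0})"
proof -
 let ?R = "ring_of_type TYPE('f)"
 interpret R: Ring.field ?R by (rule field_ring_of_type)
 obtain g where g: "g : carrier (mult_of ?R)"
  and gen: "carrier (mult_of ?R) = {g [^]@?R i | i::nat. i : UNIV}"
  using R.finite_field_mult_group_has_gen by (auto simp: ring_of_type_def)
 have mc: "carrier (mult_of ?R) = UNIV - {0}"
  by (auto simp: mult_of_def ring_of_type_def)
 have g0: "g ~= 0" using g unfolding mc by blast
 have gen': "UNIV - {0} = range (%i::nat. g ^ i)"
  using gen unfolding mc ring_of_type_pow by blast
 let ?n = "CARD('f) - 1"
 have n: "0 < ?n" using cge2[where 'f='f] by simp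
 have "(%i. g ^ i) ` {..<?n} = UNIV - {0}"
 proof
  show "UNIV - {0} <= (%i. g ^ i) ` {..<?n}"
  proof
   fix x :: 'f assume "x : UNIV - {0}"
   then obtain i where i: "x = g ^ i" using gen' by auto
   have "g ^ i = g ^ (?n * (i div ?n) + i mod ?n)" by simp
   also have "... = g ^ (i mod ?n)"
    unfolding power_add power_mult by (simp only: ffp[OF g0] power_one mult_1)
   finally show "x : (%i. g ^ i) ` {..<?n}" using i n by auto
  qed
 qed (use g0 in auto)
 moreover have "card (UNIV - {0::'f}) = ?n" by (simp add: card_Diff_subset)
 ultimately have "bij_betw (%i. g ^ i) {..<?n} (UNIV - {0})"
  by (simp add: bij_betw_def eq_card_imp_inj_on)
 with g0 show ?thesis by blast
qed

section \<open>The quadratic extension of a finite field: norm, trace, conjugation\<close>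

text \<open>The map sending (x, y) to (x + y, x y) is symmetric, so it is not injective, hence not
  surjective on a finite set. A pair that it misses is the trace and norm of a quadratic polynomial
  without roots.\<close>

lemma irreducible_quadratic:
 "EX p::'k::{finite,field} \<times> 'k. ALL x. x * x - fst p * x + snd p ~= 0"
proof -
 let ?f = "%(x, y). (x + y, x * y) :: 'k \<times> 'k"
 have "~ inj ?f"
 proof
  assume "inj ?f"
  then have "(0::'k, 1::'k) = (1, 0)" by (rule injD) simp
  then show False by simp
 qed
 then have "~ surj ?f"
  using finite_UNIV_surj_inj[of ?f] by auto
 then obtain p where p: "p \<notin> range ?f" by auto
 have "x * x - fst p * x + snd p ~= 0" for x
 proof
  assume "x * x - fst p * x + snd p = 0"
  then have "p = ?f (x, fst p - x)"
   by (auto simp: prod_eq_iff algebra_simps eq_neg_iff_add_eq_0)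
  with p show False by blast
 qed
 then show ?thesis by blast
qed

text \<open>\<open>Q2 x y\<close> stands for x + y alpha, where alpha is a root of the polynomial
  X^2 - \<open>qtr\<close> X + \<open>qnm\<close>.\<close>

datatype 'k q2 = Q2 (qre: 'k) (qim: 'k)

definition qpar :: "'k::{finite,field} \<times> 'k" where
 "qpar = (SOME p. ALL x. x * x - fst p * x + snd p ~= 0)"

abbreviation qtr :: "'k::{finite,field}" where "qtr \<equiv> fst qpar"
abbreviation qnm :: "'k::{finite,field}" where "qnm \<equiv> snd qpar"

lemma qpar: "x * x - qtr * x + qnm ~= (0::'k::{finite,field})"
 using someI_ex[OF irreducible_quadratic] unfolding qpar_def by blast

definition Nm :: "'k::{finite,field} q2 => 'k" where
 "Nm t = qre t * qre t + qtr * qre t * qim t + qnm * qim t * qim t"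
definition Tr :: "'k::{finite,field} q2 => 'k" where
 "Tr t = qre t + qre t + qtr * qim t"
definition emb :: "'k::{finite,field} => 'k q2" where
 "emb x = Q2 x 0"
definition cnj2 :: "'k::{finite,field} q2 => 'k q2" where
 "cnj2 t = Q2 (qre t + qtr * qim t) (- qim t)"

text \<open>For y nonzero the norm of x + y alpha is y^2 times the value of the defining polynomial
  at -x/y, and this polynomial has no root.\<close>

lemma Nm_eq_0: "Nm t = 0 \<longleftrightarrow> t = Q2 0 0"
proof
 assume N: "Nm t = 0"
 show "t = Q2 0 0"
 proof (cases "qim t = 0")
  case True
  with N show ?thesis by (cases t) (auto simp: Nm_def)
 next
  case False
  let ?x = "- qre t / qim t"
  have "(?x * ?x - qtr * ?x + qnm) * (qim t * qim t) = Nm t"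
   using False by (simp add: Nm_def field_simps)
  with N False qpar[of ?x] show ?thesis by simp
 qed
qed (simp add: Nm_def)

instantiation q2 :: ("{finite,field}") field
begin
definition "zero_q2 = Q2 0 0"
definition "one_q2 = Q2 1 0"
definition "plus_q2 s t = Q2 (qre s + qre t) (qim s + qim t)"
definition "uminus_q2 t = Q2 (- qre t) (- qim t)"
definition "minus_q2 s t = Q2 (qre s - qre t) (qim s - qim t)"
definition "times_q2 s t = Q2 (qre s * qre t - qnm * qim s * qim t)
 (qre s * qim t + qim s * qre t + qtr * qim s * qim t)"
definition "inverse_q2 t = Q2 ((qre t + qtr * qim t) / Nm t) (- qim t / Nm t)"
definition "divide_q2 (s::'a q2) t = s * inverse t"

lemmas q2_defs = zero_q2_def one_q2_def plus_q2_def uminus_q2_def minus_q2_def times_q2_def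

instance
proof
 fix a b c :: "'a q2"
 show "a * b * c = a * (b * c)" by (simp add: q2_defs algebra_simps)
 show "a * b = b * a" by (simp add: q2_defs algebra_simps)
 show "1 * a = a" by (simp add: q2_defs)
 show "a + b + c = a + (b + c)" by (simp add: q2_defs algebra_simps)
 show "a + b = b + a" by (simp add: q2_defs algebra_simps)
 show "0 + a = a" by (simp add: q2_defs)
 show "- a + a = 0" by (simp add: q2_defs)
 show "a - b = a + - b" by (simp add: q2_defs)
 show "(a + b) * c = a * c + b * c" by (simp add: q2_defs algebra_simps)
 show "(0::'a q2) ~= 1" by (simp add: q2_defs)
 show "inverse (0::'a q2) = 0" by (simp add: q2_defs inverse_q2_def)
 show "a div b = a * inverse b" by (simp add: divide_q2_def)
 assume "a ~= 0"
 then have N: "Nm a ~= 0" by (simp add: Nm_eq_0 zero_q2_def)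
 have "(qre a + qtr * qim a) * qre a + qnm * qim a * qim a = Nm a"
  by (simp add: Nm_def algebra_simps)
 then show "inverse a * a = 1"
  using N by (simp add: q2_defs inverse_q2_def field_simps)
qed
end

instance q2 :: (finite) finite
proof
 have "t : range (%(x, y). Q2 x y :: 'a q2)" for t
  by (cases t) (auto intro!: image_eqI[of _ _ "(qre t, qim t)"])
 then have "UNIV = range (%(x, y). Q2 x y :: 'a q2)" by blast
 then show "finite (UNIV :: 'a q2 set)" by (metis finite finite_imageI)
qed

lemma card_q2: "CARD('k::{finite,field} q2) = CARD('k) * CARD('k)"
proof -
 have "bij (%(x, y). Q2 x y :: 'k q2)"
  by (rule o_bij[of "%t. (qre t, qim t)"]) (auto simp: fun_eq_iff)
 then show ?thesis
  by (metis bij_betw_same_card card_cartesian_product UNIV_Times_UNIV)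
qed

lemma emb_simps [simp]:
 "emb 0 = 0" "emb 1 = 1" "emb (x + y) = emb x + emb y" "emb (x * y) = emb x * emb y"
 "emb (- x) = - emb x" "emb (x - y) = emb x - emb y" "emb x = emb y \<longleftrightarrow> x = y"
 "emb x = 0 \<longleftrightarrow> x = 0"
 by (auto simp: emb_def q2_defs)

lemma emb_power: "emb (x ^ n) = emb x ^ n"
 by (induction n) auto

lemma cnj2_simps [simp]:
 "cnj2 0 = 0" "cnj2 1 = 1" "cnj2 (s + t) = cnj2 s + cnj2 t" "cnj2 (s * t) = cnj2 s * cnj2 t"
 "cnj2 (- t) = - cnj2 t" "cnj2 (s - t) = cnj2 s - cnj2 t" "cnj2 (cnj2 t) = t" "cnj2 (emb x) = emb x"
 by (auto simp: cnj2_def q2_defs emb_def algebra_simps)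

lemma cnj2_eq_0 [simp]: "cnj2 t = 0 \<longleftrightarrow> t = 0"
 by (metis cnj2_simps(1,7))

lemma emb_Nm: "emb (Nm t) = t * cnj2 t"
 by (simp add: Nm_def emb_def cnj2_def q2_defs algebra_simps)

lemma emb_Tr: "emb (Tr t) = t + cnj2 t"
 by (simp add: Tr_def emb_def cnj2_def q2_defs algebra_simps)

lemma Nm_simps [simp]:
 "Nm 0 = 0" "Nm 1 = 1" "Nm (s * t) = Nm s * Nm t" "Nm (- t) = Nm t" "Nm (cnj2 t) = Nm t"
 "Nm (emb x) = x * x" "Nm t = 0 \<longleftrightarrow> t = 0"
proof -
 show "Nm (s * t) = Nm s * Nm t"
  by (rule emb_simps(7)[THEN iffD1]) (simp add: emb_Nm)
 show "Nm t = 0 \<longleftrightarrow> t = 0" by (simp add: Nm_eq_0 zero_q2_def)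
qed (auto simp: Nm_def emb_def cnj2_def q2_defs algebra_simps)

lemma Nm_power: "Nm (t ^ n) = Nm t ^ n"
 by (induction n) auto

lemma Nm_divide: "Nm (s / t) = Nm s / Nm t"
proof (cases "t = 0")
 case False
 have "Nm (s / t) * Nm t = Nm s"
  unfolding Nm_simps(3)[symmetric] using False by simp
 with False show ?thesis by (simp add: field_simps)
qed simp

lemma Tr_simps [simp]:
 "Tr 0 = 0" "Tr (s + t) = Tr s + Tr t" "Tr (- t) = - Tr t" "Tr (s - t) = Tr s - Tr t"
 "Tr (cnj2 t) = Tr t" "Tr (emb x) = x + x" "Tr (emb x * t) = x * Tr t" "Tr (t * emb x) = x * Tr t"
 by (auto simp: Tr_def emb_def cnj2_def q2_defs algebra_simps)

lemma Nm_add: "Nm (s + t) = Nm s + Tr (s * cnj2 t) + Nm t"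
 by (rule emb_simps(7)[THEN iffD1]) (simp add: emb_Nm emb_Tr algebra_simps)

lemma Tr_cnj_mult: "Tr (cnj2 s * t) = Tr (s * cnj2 t)"
 by (metis Tr_simps(5) cnj2_simps(4,7))

text \<open>Both elements are roots of the same polynomial (X - t)(X -
  \<open>cnj2 t\<close>).\<close>

lemma quadratic_root2:
 assumes "Tr s = Tr t" "Nm s = Nm t"
 shows "s = t \<or> s = cnj2 t"
proof -
 have "(s - t) * (s - cnj2 t) = s * s - emb (Tr t) * s + emb (Nm t)"
  by (simp add: emb_Nm emb_Tr algebra_simps)
 also have "... = s * s - emb (Tr s) * s + emb (Nm s)" by (simp add: assms)
 also have "... = 0" by (simp add: emb_Nm emb_Tr algebra_simps)
 finally show ?thesis by auto
qed

section \<open>Additive subgroups of a finite field and its order\<close>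

lemma CHAR_prime_finite: "Factorial_Ring.prime CHAR('f::{finite,field})"
 by (rule prime_CHAR_semidom) (simp add: finite_imp_CHAR_pos)

text \<open>Negatives come for free: -x is a natural multiple of x, the characteristic being
  positive.\<close>

definition add_subgroup :: "'f::{finite,field} set => bool" where
 "add_subgroup H \<longleftrightarrow> 0 : H & (ALL x:H. ALL y:H. x + y : H)"

lemma add_subgroup_of_nat_mult:
 assumes "add_subgroup H" "x : H"
 shows "of_nat n * x : H"
 using assms by (induction n) (auto simp: add_subgroup_def algebra_simps)

lemma add_subgroup_minus:
 fixes H :: "'f::{finite,field} set"
 assumes "add_subgroup H" "x : H"
 shows "- x : H"
proof -
 have "of_nat (CHAR('f) - 1) * x = - x"
  using CHAR_prime_finite[where 'f='f] prime_gt_0_nat by (subst of_nat_diff) (auto simp: Suc_leI)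
 then show ?thesis using add_subgroup_of_nat_mult[OF assms] by metis
qed

text \<open>The translates of \<open>H\<close> by the multiples i a with i < p are disjoint: if (j -
  i) a lay in \<open>H\<close>, so would a, since j - i is invertible in the prime field.\<close>

lemma add_subgroup_extend:
 fixes H :: "'f::{finite,field} set" and a :: 'f
 assumes H: "add_subgroup H" and a: "a \<notin> H"
 defines "e \<equiv> %(h, i). h + of_nat i * a"
 shows "add_subgroup (e ` (H \<times> {..<CHAR('f)}))" and "inj_on e (H \<times> {..<CHAR('f)})"
proof -
 let ?p = "CHAR('f)"
 have p: "Factorial_Ring.prime ?p" by (rule CHAR_prime_finite)
 have md: "of_nat (n mod ?p) = (of_nat n :: 'f)" for n
 proof -
  have "(of_nat n :: 'f) = of_nat (n mod ?p + ?p * (n div ?p))" by simp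
  also have "... = of_nat (n mod ?p)" by (simp only: of_nat_add of_nat_mult of_nat_CHAR) simp
  finally show ?thesis by simp
 qed
 show "add_subgroup (e ` (H \<times> {..<?p}))"
  unfolding add_subgroup_def
 proof (intro conjI ballI)
  show "0 : e ` (H \<times> {..<?p})"
   using H p prime_gt_0_nat by (auto simp: e_def add_subgroup_def intro!: image_eqI[of _ _ "(0, 0)"])
  fix x y assume "x : e ` (H \<times> {..<?p})" "y : e ` (H \<times> {..<?p})"
  then obtain h i h' i' where x: "x = h + of_nat i * a" "h : H" and y: "y = h' + of_nat i' * a" "h' : H"
   by (auto simp: e_def)
  have "x + y = e (h + h', (i + i') mod ?p)"
   by (simp add: e_def md x y algebra_simps)
  moreover have "h + h' : H" using H x y by (auto simp: add_subgroup_def)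
  ultimately show "x + y : e ` (H \<times> {..<?p})"
   using p prime_gt_0_nat by auto
 qed
 have key: "i = j" if "h + of_nat i * a = h' + of_nat j * a" "h : H" "h' : H" "i <= j" "j < ?p" for h h' i j
 proof (rule ccontr)
  assume "i ~= j"
  then have ij: "0 < j - i" "j - i < ?p" using that by auto
  then have nz: "of_nat (j - i) ~= (0::'f)"
   by (metis nat_dvd_not_less of_nat_eq_0_iff_char_dvd)
  \<comment> \<open>By Fermat, \<open>u\<close> is a natural number that represents the inverse of j
    - i.\<close>
  define u where "u = (j - i) ^ (CARD('f) - 2)"
  have "CARD('f) - 1 = Suc (CARD('f) - 2)" using cge2[where 'f='f] by simp
  then have u: "of_nat u * (of_nat (j - i) :: 'f) = 1"
   using ffp[OF nz] by (simp add: u_def mult.commute)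
  have "of_nat (j - i) * a = h + (- h')"
   using that by (simp add: of_nat_diff algebra_simps)
  then have "of_nat (j - i) * a : H"
   using H that add_subgroup_minus[OF H] by (metis add_subgroup_def)
  then have "of_nat u * (of_nat (j - i) * a) : H" by (rule add_subgroup_of_nat_mult[OF H])
  then show False using a u by (metis mult.assoc mult_1)
 qed
 show "inj_on e (H \<times> {..<?p})"
 proof (rule inj_onI)
  fix s t assume s: "s : H \<times> {..<?p}" and t: "t : H \<times> {..<?p}" and eq: "e s = e t"
  obtain h i where s': "s = (h, i)" by force
  obtain h' j where t': "t = (h', j)" by force
  have "i = j"
   using key[of h i h' j] key[of h' j h i] s t eq s' t' by (cases "i <= j") (auto simp: e_def)
  then show "s = t" using eq s' t' by (auto simp: e_def)
 qed
qed

lemma max_card_member: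
 assumes "K0 : (S :: 'f::finite set set)"
 obtains H where "H : S" "!!K. K : S ==> card K <= card H"
proof -
 have "EX H. H : S & (ALL K. K : S --> card K <= card H)"
  by (rule ex_has_greatest_nat[of _ K0 card "CARD('f) + 1"])
   (use assms in \<open>auto intro!: le_imp_less_Suc card_mono\<close>)
 with that show ?thesis by blast
qed

text \<open>Take a proper subgroup of greatest size: adjoining any outside element must give the
  whole field. This splits the field as \<open>H\<close> plus the prime field times
  \<open>a\<close>, on which an additive character can be written down.\<close>

lemma max_add_subgroup:
 obtains H :: "'f::{finite,field} set" and a
 where "add_subgroup H" "a \<notin> H"
  "bij_betw (%(h, i). h + of_nat i * a) (H \<times> {..<CHAR('f)}) UNIV"
proof -
 let ?S = "{H::'f set. add_subgroup H & H ~= UNIV}"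
 have "{0} : ?S"
  by (auto simp: add_subgroup_def) (metis UNIV_I singletonD zero_neq_one)
 then obtain H where H: "H : ?S" and max: "!!K. K : ?S ==> card K <= card H"
  by (rule max_card_member) (rule that, assumption, assumption)
 then obtain a where a: "a \<notin> H" by auto
 let ?e = "%(h, i). h + of_nat i * a" and ?K = "H \<times> {..<CHAR('f)}"
 have sub: "add_subgroup (?e ` ?K)" and inj: "inj_on ?e ?K"
  using add_subgroup_extend[of H a] H a by auto
 have p: "2 <= CHAR('f)" using CHAR_prime_finite[where 'f='f] prime_ge_2_nat by blast
 have "card (?e ` ?K) = card H * CHAR('f)"
  by (simp add: card_image[OF inj] card_cartesian_product)
 moreover have "0 < card H" using H by (auto simp: add_subgroup_def card_gt_0_iff)
 ultimately have "card H < card (?e ` ?K)" using p by auto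
 then have "?e ` ?K = UNIV" using max[of "?e ` ?K"] sub by force
 with inj show ?thesis using that[of H a] H a by (auto simp: bij_betw_def)
qed

text \<open>Take the largest additive subgroup whose order is a power of p; if it were proper,
  adjoining one element would multiply its order by p.\<close>

lemma card_finite_field: "EX e. CARD('f::{finite,field}) = CHAR('f) ^ e"
proof -
 let ?S = "{H::'f set. add_subgroup H & (EX e. card H = CHAR('f) ^ e)}"
 have "{0} : ?S"
  by (auto simp: add_subgroup_def intro: exI[of _ 0])
 then obtain H where H: "H : ?S" and max: "!!K. K : ?S ==> card K <= card H"
  by (rule max_card_member) (rule that, assumption, assumption)
 have "H = UNIV"
 proof (rule ccontr)
  assume "H ~= UNIV"
  then obtain a where a: "a \<notin> H" by auto
  let ?e = "%(h, i). h + of_nat i * a" and ?K = "H \<times> {..<CHAR('f)}"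
  have sub: "add_subgroup (?e ` ?K)" and inj: "inj_on ?e ?K"
   using add_subgroup_extend[of H a] H a by auto
  have p: "2 <= CHAR('f)" using CHAR_prime_finite[where 'f='f] prime_ge_2_nat by blast
  have c: "card (?e ` ?K) = card H * CHAR('f)"
   by (simp add: card_image[OF inj] card_cartesian_product)
  moreover have "0 < card H" using H by (auto simp: add_subgroup_def card_gt_0_iff)
  ultimately have "card H < card (?e ` ?K)" using p by auto
  moreover obtain e where "card H = CHAR('f) ^ e" using H by auto
  then have "card (?e ` ?K) = CHAR('f) ^ (Suc e)" using c by simp
  then have "?e ` ?K : ?S" using sub by blast
  ultimately show False using max by fastforce
 qed
 then show ?thesis using H by blast
qed

lemma card_power_eq_bound:
 fixes c :: "'f::field"
 assumes "0 < n"
 shows "card {t. t ^ n = c} <= n"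
proof -
 define p where "p = monom 1 n + [:-c:]"
 have deg: "degree p = n"
  using assms unfolding p_def
  by (subst degree_add_eq_left) (auto simp: degree_monom_eq)
 have "p ~= 0" using deg assms by auto
 then have "card {t. poly p t = 0} <= n"
  using card_poly_roots_bound[of p] deg by simp
 also have "{t. poly p t = 0} = {t. t ^ n = c}"
  by (auto simp: p_def poly_monom)
 finally show ?thesis .
qed

text \<open>The Frobenius automorphism of the quadratic extension is the conjugation: it permutes the
 roots of the defining polynomial, and it cannot fix them because \<open>t^q = t\<close> has at most \<open>q\<close> solutions.\<close>

lemma cnj2_eq_power: "cnj2 t = t ^ CARD('k)" for t :: "'k::{finite,field} q2"
proof -
 let ?p = "CHAR('k q2)"
 have pr: "Factorial_Ring.prime ?p"
  by (rule prime_CHAR_semidom) (simp add: finite_imp_CHAR_pos)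
 have char_eq: "CHAR('k) = ?p"
 proof (rule CHAR_eqI)
  have emb_nat: "emb (of_nat n :: 'k) = of_nat n" for n by (induction n) auto
  have iff: "(of_nat n :: 'k) = 0 \<longleftrightarrow> (of_nat n :: 'k q2) = 0" for n
   using emb_simps(8)[of "of_nat n :: 'k"] unfolding emb_nat by simp
  show "of_nat ?p = (0::'k)" using iff by simp
  show "of_nat n = (0::'k) ==> ?p dvd n" for n
   using iff of_nat_eq_0_iff_char_dvd by metis
 qed
 obtain e where e: "CARD('k) = ?p ^ e"
 proof -
  show ?thesis using that char_eq card_finite_field[where 'f='k] by auto
 qed
 define al where "al = (Q2 0 1 :: 'k q2)"
 let ?F = "%t::'k q2. t ^ CARD('k)"
 have F_add: "?F (s + t) = ?F s + ?F t" for s t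
  using freshmans_dream'[OF pr e] .
 have F_emb: "?F (emb x) = emb x" for x
 proof (cases "x = 0")
  case False
  have "x ^ CARD('k) = x * x ^ (CARD('k) - 1)"
   using cge2[where 'f='k] by (simp add: power_eq_if)
  also have "... = x" using ffp[OF False] by simp
  finally show ?thesis by (metis emb_power)
 qed (use cge2[where 'f='k] in auto)
 have F_split: "?F t = emb (qre t) + emb (qim t) * ?F al" for t
 proof -
  have "t = emb (qre t) + emb (qim t) * al"
   by (cases t) (simp add: al_def emb_def q2_defs)
  then have "?F t = ?F (emb (qre t)) + ?F (emb (qim t) * al)" using F_add by metis
  then show ?thesis by (simp add: F_emb power_mult_distrib)
 qed
 have root: "al * al + emb qnm = emb qtr * al"
  by (simp add: al_def emb_def q2_defs)
 have "?F al * ?F al + emb qnm = emb qtr * ?F al"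
  using arg_cong[OF root, of ?F] by (simp add: F_add F_emb power_mult_distrib)
 moreover have "(?F al - al) * (?F al - cnj2 al) = ?F al * ?F al - emb (Tr al) * ?F al + emb (Nm al)"
  by (simp add: emb_Nm emb_Tr algebra_simps)
 moreover have "Tr al = qtr" "Nm al = qnm" by (simp_all add: al_def Tr_def Nm_def)
 ultimately have "(?F al - al) * (?F al - cnj2 al) = 0" by (simp add: algebra_simps)
 \<comment> \<open>If alpha were fixed, everything would be, and t^(q-1) = 1 would have q^2 - 1
   solutions.\<close>
 moreover have "?F al ~= al"
 proof
  assume "?F al = al"
  then have fix': "?F t = t" for t
   unfolding F_split[of t] by (cases t) (simp add: al_def emb_def q2_defs)
  have c2: "2 <= CARD('k)" by (rule cge2)
  have "t ^ (CARD('k) - 1) = 1" if "t ~= 0" for t :: "'k q2"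
  proof -
   have "t * t ^ (CARD('k) - 1) = t * 1"
    using fix'[of t] c2 by (metis One_nat_def Suc_pred mult.right_neutral not_numeral_le_zero power_Suc zero_less_iff_neq_zero)
   with that show ?thesis by simp
  qed
  then have "UNIV - {0} <= {t::'k q2. t ^ (CARD('k) - 1) = 1}" by auto
  then have "card (UNIV - {0::'k q2}) <= card {t::'k q2. t ^ (CARD('k) - 1) = 1}"
   by (intro card_mono) auto
  also have "... <= CARD('k) - 1" using c2 by (intro card_power_eq_bound) auto
  finally have "CARD('k) * CARD('k) - 1 <= CARD('k) - 1"
   by (simp add: card_Diff_subset card_q2)
  moreover have "CARD('k) * 2 <= CARD('k) * CARD('k)" using c2 by (intro mult_le_mono2)
  ultimately show False using c2 by linarith
 qed
 ultimately have "?F al = cnj2 al" by simp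
 then show ?thesis unfolding F_split[of t]
  by (cases t) (simp add: al_def emb_def cnj2_def q2_defs algebra_simps)
qed

text \<open>The norm is t^(q+1), so each fibre has at most q + 1 elements; the q - 1 nonzero fibres
  cover q^2 - 1 elements, so equality holds everywhere.\<close>

lemma card_Nm_fiber:
 fixes d :: "'k::{finite,field}"
 assumes "d ~= 0"
 shows "card {t. Nm t = d} = CARD('k) + 1"
proof -
 let ?q = "CARD('k)"
 have N: "emb (Nm t) = t ^ (?q + 1)" for t :: "'k q2"
  by (simp add: emb_Nm cnj2_eq_power)
 have le: "card {t. Nm t = c} <= ?q + 1" for c :: 'k
 proof -
  have "{t. Nm t = c} = {t. t ^ (?q + 1) = emb c}"
   by (metis N emb_simps(7))
  then show ?thesis using card_power_eq_bound[of "?q + 1" "emb c"] by simp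
 qed
 have "(UNIV::'k q2 set) - {0} = (\<Union>c\<in>UNIV - {0::'k}. {t. Nm t = c})" by auto
 then have "card ((UNIV::'k q2 set) - {0}) = (\<Sum>c\<in>UNIV - {0::'k}. card {t. Nm t = c})"
  by (simp only:) (subst card_UN_disjoint; auto)
 then have eq: "?q * ?q - 1 = (\<Sum>c\<in>UNIV - {0::'k}. card {t. Nm t = c})"
  by (simp add: card_Diff_subset card_q2)
 show ?thesis
 proof (rule ccontr)
  assume "~ ?thesis"
  with le[of d] have lt: "card {t. Nm t = d} < ?q + 1" by simp
  have "(\<Sum>c\<in>UNIV - {0::'k}. card {t. Nm t = c}) < (\<Sum>c\<in>UNIV - {0::'k}. ?q + 1)"
   by (rule sum_strict_mono_ex1) (use le lt assms in auto)
  also have "... = (?q - 1) * (?q + 1)" by (simp add: card_Diff_subset)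
  also have "... = ?q * ?q - 1" by (simp add: algebra_simps)
  finally show False using eq by simp
 qed
qed

lemma Nm_surj:
 assumes "d ~= 0"
 obtains t where "Nm t = d"
 using card_Nm_fiber[OF assms] by (metis (mono_tags, lifting) Collect_empty_eq Suc_eq_plus1 card.empty nat.distinct(1))

text \<open>If the trace vanished, the characteristic would be 2 and \<open>qtr\<close> would be 0.
  Squaring is then bijective, so -\<open>qnm\<close> is a square, and its root is a root of the
  defining polynomial.\<close>

lemma Tr_nonzero: "EX t::'k::{finite,field} q2. Tr t ~= 0"
proof (rule ccontr)
 assume "~ ?thesis"
 then have T: "Tr t = 0" for t :: "'k q2" by blast
 have two: "1 + 1 = (0::'k)" using T[of 1] by (simp add: Tr_def one_q2_def)
 have qt: "qtr = (0::'k)" using T[of "Q2 0 1"] by (simp add: Tr_def)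
 have "inj (%x::'k. x * x)"
 proof (rule injI)
  fix x y :: 'k assume "x * x = y * y"
  have dbl: "c + c = 0" for c :: 'k
   using two by (metis distrib_right mult_1 mult_zero_left)
  have "(x - y) * (x - y) = (x * x + y * y) - (x * y + x * y)" by (simp add: algebra_simps)
  also have "... = 0" unfolding \<open>x * x = y * y\<close> by (simp only: dbl diff_0 minus_zero)
  finally show "x = y" by simp
 qed
 then have "surj (%x::'k. x * x)" by (rule finite_UNIV_inj_surj[rotated]) simp
 then obtain x :: 'k where "- qnm = x * x" by (rule surjE)
 then show False using qpar[of x] qt by (metis add.commute add_uminus_conv_diff diff_zero minus_add_cancel mult_zero_left right_minus)
qed

section \<open>Finite sums in ring records\<close>

context abelian_monoid
begin

lemma fs_closed [simp, intro]:
 "(!!x. x : A ==> f x : carrier G) ==> finsum G f A : carrier G"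
 by (rule finsum_closed) auto

lemma fsc:
 "[|!!x. x : A ==> f x = g x; !!x. x : A ==> g x : carrier G|] ==> finsum G f A = finsum G g A"
 by (rule finsum_cong') auto

lemma fs_add:
 "[|!!x. x : A ==> f x : carrier G; !!x. x : A ==> g x : carrier G|]
  ==> finsum G (%x. f x \<oplus> g x) A = finsum G f A \<oplus> finsum G g A"
 by (rule finsum_addf) auto

lemma fs_zero: "(!!x. x : A ==> f x = \<zero>) ==> finsum G f A = \<zero>"
 by (rule add.finprod_one_eqI)

lemma fsi:
 "[|finite A; i \<notin> A; !!x. x : insert i A ==> f x : carrier G|]
  ==> finsum G f (insert i A) = f i \<oplus> finsum G f A"
 by (rule finsum_insert) auto

lemma fs_split:
 assumes "finite A" "i : A" "!!x. x : A ==> f x : carrier G"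
 shows "finsum G f A = f i \<oplus> finsum G f (A - {i})"
 using fsi[of "A - {i}" i f] assms by (simp add: insert_absorb)

lemma fs_only:
 assumes "finite A" "i : A" "f i : carrier G" "!!j. j : A ==> j ~= i ==> f j = \<zero>"
 shows "finsum G f A = f i"
proof -
 have "!!x. x : A ==> f x : carrier G" using assms by (metis zero_closed)
 then have "finsum G f A = f i \<oplus> finsum G f (A - {i})"
  using assms by (intro fs_split) auto
 also have "finsum G f (A - {i}) = \<zero>" using assms by (intro fs_zero) auto
 finally show ?thesis using assms by simp
qed

lemma fs_swap:
 assumes "finite A" "finite B" "!!i j. i : A ==> j : B ==> f i j : carrier G"
 shows "(\<Oplus>i\<in>A. \<Oplus>j\<in>B. f i j) = (\<Oplus>j\<in>B. \<Oplus>i\<in>A. f i j)"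
 using assms(1,3)
proof (induction A)
 case empty
 show ?case by (simp add: fs_zero)
next
 case (insert x A)
 have "(\<Oplus>i\<in>insert x A. \<Oplus>j\<in>B. f i j) = (\<Oplus>j\<in>B. f x j) \<oplus> (\<Oplus>j\<in>B. \<Oplus>i\<in>A. f i j)"
  using insert by (subst fsi) auto
 also have "... = (\<Oplus>j\<in>B. f x j \<oplus> (\<Oplus>i\<in>A. f i j))"
  using insert by (intro fs_add[symmetric]) auto
 also have "... = (\<Oplus>j\<in>B. \<Oplus>i\<in>insert x A. f i j)"
  using insert by (intro fsc) (auto simp: fsi)
 finally show ?case .
qed

lemma fs_reindex:
 assumes "bij_betw h A B" "!!y. y : B ==> f y : carrier G"
 shows "finsum G f B = finsum G (%x. f (h x)) A"
proof -
 have "finsum G f (h ` A) = finsum G (%x. f (h x)) A"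
  by (rule finsum_reindex) (use assms in \<open>auto simp: bij_betw_def\<close>)
 then show ?thesis using assms by (simp add: bij_betw_def)
qed

lemma fsw:
 assumes "!!x. x : A ==> i (j x) = x" "!!x. x : A ==> j x : B"
  "!!y. y : B ==> j (i y) = y" "!!y. y : B ==> i y : A"
  "!!x. x : A ==> f x = g (j x)" "!!y. y : B ==> g y : carrier G"
 shows "finsum G f A = finsum G g B"
proof -
 have "bij_betw j A B" by (rule bij_betw_byWitness[of _ i]) (use assms in auto)
 then have "finsum G g B = finsum G (%x. g (j x)) A" using assms by (intro fs_reindex) auto
 also have "... = finsum G f A" using assms by (intro fsc) auto
 finally show ?thesis by simp
qed

lemma fs_Un:
 "[|finite A; finite B; A \<inter> B = {}; !!x. x : A \<union> B ==> f x : carrier G|]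
  ==> finsum G f (A \<union> B) = finsum G f A \<oplus> finsum G f B"
 by (rule finsum_Un_disjoint) auto

lemma fs_restrict:
 assumes "finite A" "!!x. x : A ==> P x ==> f x : carrier G"
 shows "(\<Oplus>x\<in>A. if P x then f x else \<zero>) = finsum G f {x\<in>A. P x}"
 by (rule add.finprod_mono_neutral_cong_right) (use assms in auto)

lemma fs_mono:
 assumes "finite B" "A <= B" "!!x. x : B - A ==> f x = \<zero>" "!!x. x : A ==> f x : carrier G"
 shows "finsum G f B = finsum G f A"
 by (rule add.finprod_mono_neutral_cong_right) (use assms in \<open>auto, metis DiffI zero_closed\<close>)

lemma fs_group:
 assumes "finite A" "finite B" "!!x. x : A ==> h x : B" "!!x. x : A ==> f x : carrier G"
 shows "finsum G f A = (\<Oplus>b\<in>B. finsum G f {a\<in>A. h a = b})"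
proof -
 have "finsum G f A = (\<Oplus>a\<in>A. \<Oplus>b\<in>B. if h a = b then f a else \<zero>)"
 proof (rule fsc)
  fix a assume "a : A"
  then show "f a = (\<Oplus>b\<in>B. if h a = b then f a else \<zero>)"
   using fs_only[of B "h a" "%b. if h a = b then f a else \<zero>"] assms by auto
 qed (use assms in auto)
 also have "... = (\<Oplus>b\<in>B. \<Oplus>a\<in>A. if h a = b then f a else \<zero>)"
  using assms by (intro fs_swap) auto
 also have "... = (\<Oplus>b\<in>B. finsum G f {a\<in>A. h a = b})"
  using assms by (intro fsc) (auto simp: fs_restrict)
 finally show ?thesis .
qed

end

lemma (in abelian_group) eq_add_imp_diff:
 "[|x = y \<oplus> z; y : carrier G; z : carrier G|] ==> z = x \<ominus> y"
 by (simp add: a_minus_def a_comm[of y z] a_assoc r_neg)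

context cring
begin

lemma fsr:
 "[|!!x. x : A ==> f x : carrier R; c : carrier R|] ==> (\<Oplus>x\<in>A. c ** f x) = c ** (\<Oplus>x\<in>A. f x)"
proof (cases "finite A")
 case True
 then show "[|!!x. x : A ==> f x : carrier R; c : carrier R|] ==> ?thesis"
  by (subst finsum_rdistr) auto
qed (simp add: finsum_infinite)

lemma fsl:
 "[|!!x. x : A ==> f x : carrier R; c : carrier R|] ==> (\<Oplus>x\<in>A. f x ** c) = (\<Oplus>x\<in>A. f x) ** c"
proof (cases "finite A")
 case True
 then show "[|!!x. x : A ==> f x : carrier R; c : carrier R|] ==> ?thesis"
  by (subst finsum_ldistr) auto
qed (simp add: finsum_infinite)

lemma fs_uminus:
 assumes "!!x. x : A ==> f x : carrier R"
 shows "(\<Oplus>x\<in>A. \<ominus> f x) = \<ominus> (\<Oplus>x\<in>A. f x)"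
proof -
 have "(\<Oplus>x\<in>A. \<ominus> f x) = (\<Oplus>x\<in>A. (\<ominus> \<one>) ** f x)"
  using assms by (intro fsc) (auto simp: l_minus)
 also have "... = \<ominus> (\<Oplus>x\<in>A. f x)" using assms by (simp add: fsr l_minus)
 finally show ?thesis .
qed

lemma fs_const: "[|finite A; c : carrier R|] ==> (\<Oplus>x\<in>A. c) = ([card A] \<cdot> \<one>) ** c"
 by (simp add: add.finprod_const add_pow_ldistr)

end

section \<open>Additive characters and their sums\<close>

text \<open>A nontrivial additive character with values in \<open>R\<close>. Nontriviality is stated
  as orthogonality, and \<open>qi\<close> is 1/q; in this form the axioms pass from \<open>L\<close>
  to the residue field.\<close>

locale achar = Ring.field R for R (structure) +
 fixes py :: "'k::{finite,field} => 'a" and qi :: 'a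
 assumes psi_closed [simp, intro]: "py x : carrier R"
  and psi_add: "py (x + y) = py x ** py y"
  and psi_0 [simp]: "py 0 = \<one>"
  and psi_sum: "b ~= 0 ==> (\<Oplus>x\<in>UNIV. py (b * x)) = \<zero>"
  and qi_closed [simp, intro]: "qi : carrier R"
  and q_qi: "([CARD('k)] \<cdot> \<one>) ** qi = \<one>"
begin

definition qq :: 'a where "qq = [CARD('k)] \<cdot> \<one>"

lemma qq_closed [simp, intro]: "qq : carrier R" by (simp add: qq_def)

lemma qq_qi [simp]: "qq ** qi = \<one>" "qi ** qq = \<one>"
 using q_qi m_comm[of qi "[CARD('k)] \<cdot> \<one>"] by (simp_all add: qq_def)

lemma qi_qq_cancel [simp]:
 "x : carrier R ==> qi ** (qq ** x) = x" "x : carrier R ==> qq ** (qi ** x) = x"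
 by (simp_all add: m_assoc[symmetric])

lemma qq_nonzero: "qq ~= \<zero>" "qi ~= \<zero>"
proof -
 show "qq ~= \<zero>"
 proof
  assume "qq = \<zero>"
  with qq_qi(1) show False by simp
 qed
 show "qi ~= \<zero>"
 proof
  assume "qi = \<zero>"
  with qq_qi(1) show False by simp
 qed
qed

lemma fs_one: "(\<Oplus>x\<in>(UNIV::'k set). c) = qq ** c" if "c : carrier R"
 using that by (simp add: fs_const qq_def)

lemma psi_inv [simp]: "py x ** py (- x) = \<one>" "py (- x) ** py x = \<one>"
 by (simp_all add: psi_add[symmetric])

lemma psi_nonzero [simp]: "py x ~= \<zero>"
proof
 assume "py x = \<zero>"
 with psi_inv(1)[of x] show False by simp
qed

lemma psi_sum_eq: "(\<Oplus>x\<in>UNIV. py (b * x)) = (if b = 0 then qq else \<zero>)"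
 using psi_sum[of b] by (auto simp: fs_one)

lemma psi_sum_eq': "(\<Oplus>x\<in>UNIV. py (x * b)) = (if b = 0 then qq else \<zero>)"
 using psi_sum_eq[of b] by (simp add: mult.commute)

lemma psi_sum_nz: "(\<Oplus>x\<in>UNIV - {0}. py (x * b)) = (if b = 0 then qq \<ominus> \<one> else \<ominus> \<one>)"
proof -
 have "(if b = 0 then qq else \<zero>) = \<one> \<oplus> (\<Oplus>x\<in>UNIV - {0}. py (x * b))"
  unfolding psi_sum_eq'[symmetric] by (subst fs_split[of _ 0]) auto
 then have "(\<Oplus>x\<in>UNIV - {0}. py (x * b)) = (if b = 0 then qq else \<zero>) \<ominus> \<one>"
  by (rule eq_add_imp_diff) auto
 then show ?thesis by (auto simp: a_minus_def)
qed

text \<open>Translating t by x times an element of nonzero trace multiplies the sum by a value of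
  the character; averaging over x then gives 0.\<close>

lemma psi_Tr_sum:
 assumes "be ~= 0"
 shows "(\<Oplus>t\<in>UNIV. py (Tr (t * be))) = \<zero>"
proof -
 let ?S = "\<Oplus>t\<in>UNIV. py (Tr (t::'k q2))"
 obtain be0 :: "'k q2" where b0: "Tr be0 ~= 0" using Tr_nonzero by blast
 have sh: "py (x * Tr be0) ** ?S = ?S" for x
 proof -
  have "?S = (\<Oplus>t\<in>UNIV. py (Tr (t + emb x * be0)))"
   by (rule fsw[of _ "%t. t + emb x * be0" "%t. t - emb x * be0"]) auto
  also have "... = (\<Oplus>t\<in>UNIV. py (x * Tr be0) ** py (Tr t))"
   by (rule fsc) (auto simp: psi_add m_comm)
  finally show ?thesis by (simp add: fsr)
 qed
 have "qq ** ?S = (\<Oplus>x\<in>(UNIV::'k set). ?S)" by (simp add: fs_one)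
 also have "... = (\<Oplus>x\<in>UNIV. py (x * Tr be0) ** ?S)" by (simp add: sh)
 also have "... = \<zero>" using b0 by (subst fsl) (auto simp: psi_sum_eq')
 finally have "?S = \<zero>" using qq_nonzero integral[of qq ?S] by auto
 moreover have "(\<Oplus>t\<in>UNIV. py (Tr (t * be))) = ?S"
  using assms by (intro fsw[of _ "%t. t / be" "%t. t * be"]) auto
 ultimately show ?thesis by simp
qed

text \<open>Grouping by the norm gives 1 + (q + 1)(-1): one element of norm 0, and q + 1 elements
  over every nonzero value.\<close>

lemma psi_Nm_sum:
 assumes "b ~= 0"
 shows "(\<Oplus>t\<in>UNIV. py (b * Nm t)) = \<ominus> qq"
proof -
 have "(\<Oplus>t\<in>UNIV. py (b * Nm t)) = (\<Oplus>d\<in>UNIV. \<Oplus>t\<in>{t\<in>UNIV. Nm t = d}. py (b * Nm t))"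
  by (rule fs_group) auto
 also have "... = (\<Oplus>d\<in>UNIV. ([card {t. Nm t = d}] \<cdot> \<one>) ** py (b * d))"
 proof (rule fsc)
  fix d :: 'k
  have "(\<Oplus>t\<in>{t\<in>UNIV. Nm t = d}. py (b * Nm t)) = (\<Oplus>t\<in>{t. Nm t = d}. py (b * d))"
   by (intro finsum_cong') auto
  then show "(\<Oplus>t\<in>{t\<in>UNIV. Nm t = d}. py (b * Nm t)) = ([card {t. Nm t = d}] \<cdot> \<one>) ** py (b * d)"
   by (simp add: fs_const)
 qed auto
 also have "... = \<one> \<oplus> (\<Oplus>d\<in>UNIV - {0}. ([card {t. Nm t = d}] \<cdot> \<one>) ** py (b * d))"
  by (subst fs_split[of _ 0]) (auto simp: add.nat_pow_Suc)
 also have "(\<Oplus>d\<in>UNIV - {0}. ([card {t. Nm t = d}] \<cdot> \<one>) ** py (b * d))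
  = (\<Oplus>d\<in>UNIV - {0}. (qq \<oplus> \<one>) ** py (d * b))"
  by (rule fsc) (auto simp: card_Nm_fiber qq_def add.nat_pow_Suc mult.commute)
 also have "... = (qq \<oplus> \<one>) ** (\<ominus> \<one>)"
  using assms by (subst fsr) (auto simp: psi_sum_nz)
 also have "\<one> \<oplus> (qq \<oplus> \<one>) ** (\<ominus> \<one>) = \<ominus> qq"
  by (simp add: r_minus minus_add a_comm[of "\<ominus> qq"] r_neg2)
 finally show ?thesis .
qed

lemma psi_Nm_Tr_sum:
 assumes "b ~= 0"
 shows "(\<Oplus>t\<in>UNIV. py (b * Nm t + Tr (t * be))) = \<ominus> qq ** py (- Nm be / b)"
proof -
 \<comment> \<open>Completes the square: the cross term of b Nm(t + \<open>ga\<close>) is Tr(t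
   \<open>be\<close>), and the excess constant is Nm(\<open>be\<close>)/b.\<close>
 define ga where "ga = emb (1 / b) * cnj2 be"
 have e: "b * Nm t + Tr (t * be) = b * Nm (t + ga) + (- Nm be / b)" for t
 proof -
  have "Tr (t * cnj2 ga) = Tr (t * be) / b"
   by (simp add: ga_def) (metis (no_types, lifting) Tr_simps(7) mult.commute mult.left_commute divide_inverse_commute inverse_eq_divide)
  moreover have "Nm ga = Nm be / (b * b)" by (simp add: ga_def)
  ultimately show ?thesis using assms unfolding Nm_add by (simp add: field_simps)
 qed
 have "(\<Oplus>t\<in>UNIV. py (b * Nm t + Tr (t * be))) = (\<Oplus>t\<in>UNIV. py (b * Nm (t + ga)) ** py (- Nm be / b))"
  by (rule fsc) (simp_all only: e psi_add psi_closed m_closed)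
 also have "... = (\<Oplus>t\<in>UNIV. py (b * Nm (t + ga))) ** py (- Nm be / b)"
  by (rule fsl) auto
 also have "(\<Oplus>t\<in>UNIV. py (b * Nm (t + ga))) = (\<Oplus>t\<in>UNIV. py (b * Nm t))"
  by (rule fsw[of _ "%t. t - ga" "%t. t + ga"]) auto
 finally show ?thesis using assms by (simp add: psi_Nm_sum)
qed

text \<open>The Kloosterman sums of the split and of the non-split torus are opposite.\<close>

lemma kloosterman:
 assumes z: "z ~= 0" and d: "d ~= 0"
 shows "(\<Oplus>t\<in>{t. Nm t = d}. py (z * Tr t)) = \<ominus> (\<Oplus>a\<in>UNIV - {0}. py (z * (a + d / a)))"
proof -
 have inner: "\<ominus> qq ** py (z * z / b) = (\<Oplus>t\<in>UNIV. py (z * Tr t) ** py (- b * Nm t))" if "b ~= 0" for b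
 proof -
  have "(\<Oplus>t\<in>UNIV. py (- b * Nm t + Tr (t * emb z))) = \<ominus> qq ** py (z * z / b)"
   using psi_Nm_Tr_sum[of "- b" "emb z"] that by simp
  moreover have "(%t. py (- b * Nm t + Tr (t * emb z))) = (%t. py (z * Tr t) ** py (- b * Nm t))"
   by (rule ext) (simp add: psi_add[symmetric] add.commute)
  ultimately show ?thesis by metis
 qed
 \<comment> \<open>With b = z/a, the argument z (a + d/a) becomes z^2/b + b d. The factor -q
   psi(z^2/b) is a quadratic sum over the extension by \<open>inner\<close>, and the sum over b then
   singles out the elements with Nm t = d.\<close>
 have "\<ominus> qq ** (\<Oplus>a\<in>UNIV - {0}. py (z * (a + d / a)))
   = \<ominus> qq ** (\<Oplus>b\<in>UNIV - {0}. py (z * z / b) ** py (b * d))"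
  by (rule arg_cong[of _ _ "%x. \<ominus> qq ** x"],
    rule fsw[of _ "%a. z / a" "%b. z / b"])
   (use z in \<open>auto simp: psi_add[symmetric] field_simps\<close>)
 also have "... = (\<Oplus>b\<in>UNIV - {0}. \<ominus> qq ** py (z * z / b) ** py (b * d))"
  by (subst fsr[symmetric]) (auto simp: m_assoc)
 also have "... = (\<Oplus>b\<in>UNIV - {0}. \<Oplus>t\<in>UNIV. py (z * Tr t) ** py (b * (d - Nm t)))"
 proof (rule fsc)
  fix b :: 'k assume "b : UNIV - {0}"
  then have "\<ominus> qq ** py (z * z / b) ** py (b * d) = (\<Oplus>t\<in>UNIV. py (z * Tr t) ** py (- b * Nm t) ** py (b * d))"
   by (subst inner) (auto simp: fsl)
  also have "... = (\<Oplus>t\<in>UNIV. py (z * Tr t) ** py (b * (d - Nm t)))"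
   by (rule fsc) (auto simp: m_assoc psi_add[symmetric] algebra_simps)
  finally show "\<ominus> qq ** py (z * z / b) ** py (b * d) = (\<Oplus>t\<in>UNIV. py (z * Tr t) ** py (b * (d - Nm t)))" .
 qed auto
 also have "... = (\<Oplus>t\<in>UNIV. \<Oplus>b\<in>UNIV - {0}. py (z * Tr t) ** py (b * (d - Nm t)))"
  by (rule fs_swap) auto
 also have "... = (\<Oplus>t\<in>UNIV. py (z * Tr t) ** (if d - Nm t = 0 then qq \<ominus> \<one> else \<ominus> \<one>))"
  by (rule fsc) (auto simp: fsr psi_sum_nz)
 also have "... = (\<Oplus>t\<in>UNIV. (if Nm t = d then qq ** py (z * Tr t) else \<zero>) \<oplus> (\<ominus> py (Tr (t * emb z))))"
  by (rule fsc) (auto simp: r_minus l_minus m_comm a_minus_def r_distr)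
 also have "... = (\<Oplus>t\<in>UNIV. if Nm t = d then qq ** py (z * Tr t) else \<zero>) \<oplus> (\<Oplus>t\<in>UNIV. \<ominus> py (Tr (t * emb z)))"
  by (rule fs_add) auto
 also have "(\<Oplus>t\<in>UNIV. \<ominus> py (Tr (t * emb z))) = \<zero>"
  using z psi_Tr_sum[of "emb z"] by (subst fs_uminus) auto
 also have "(\<Oplus>t\<in>UNIV. if Nm t = d then qq ** py (z * Tr t) else \<zero>) = qq ** (\<Oplus>t\<in>{t. Nm t = d}. py (z * Tr t))"
  by (subst fs_restrict) (auto simp: fsr)
 finally have "qq ** (\<Oplus>t\<in>{t. Nm t = d}. py (z * Tr t)) = qq ** (\<ominus> (\<Oplus>a\<in>UNIV - {0}. py (z * (a + d / a))))"
  by (simp add: l_minus r_minus)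
 then show ?thesis using m_lcancel[OF qq_nonzero(1)] by auto
qed

end

section \<open>Representations on functions\<close>

definition mdet :: "'k::field m2 => 'k" where
 "mdet g = (case g of (a, b, c, d) => a * d - b * c)"

text \<open>\<open>D\<close> is the set of admissible determinants. Taking all nonzero elements or
  {1} lets GL2 and SL2 share every argument.\<close>

definition GD :: "'k::field set => 'k m2 set" where
 "GD D = {g. mdet g : D}"

lemma GL2_GD: "GL2 = GD (UNIV - {0})"
 by (auto simp: GL2_def GD_def mdet_def)

lemma SL2_GD: "SL2 = GD {1}"
 by (auto simp: SL2_def GD_def mdet_def)

lemma mdet_mul [simp]: "mdet (m2mul g h) = mdet g * mdet h"
 by (cases g, cases h) (simp add: mdet_def m2mul_def algebra_simps)

lemma mdet_simps [simp]: "mdet (a, b, c, d) = a * d - b * c" "mdet m2one = 1"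
 by (simp_all add: mdet_def m2one_def)

lemma m2mul_assoc: "m2mul (m2mul g h) k = m2mul g (m2mul h k)"
 by (cases g, cases h, cases k) (simp add: m2mul_def algebra_simps)

lemma m2s: "m2mul (a, b, c, d) (a', b', c', d')
 = (a * a' + b * c', a * b' + b * d', c * a' + d * c', c * b' + d * d')"
 by (simp add: m2mul_def)

lemma m2mul_one [simp]: "m2mul g m2one = g" "m2mul m2one g = g"
 by (cases g; simp add: m2mul_def m2one_def)+

text \<open>A matrix representation indexed by an arbitrary set, so that models can live on k^*, on
  the projective line, or on a set of squares.\<close>

definition krep :: "('a,'c) ring_scheme => 'k::field m2 set => 'i set => ('k m2 => 'i => 'i => 'a) => bool" where
 "krep R G I K \<longleftrightarrow> (ALL g:G. ALL i:I. ALL j:I. K g i j : carrier R) &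
   (ALL g:G. ALL h:G. ALL i:I. ALL j:I. K (m2mul g h) i j = finsum R (%k. K g i k **@R K h k j) I) &
   (ALL i:I. ALL j:I. K m2one i j = (if i = j then \<one>@R else \<zero>@R))"

context cring
begin

lemma fs_product:
 assumes "finite A" "finite B" "!!x. x : A ==> f x : carrier R" "!!x. x : B ==> g x : carrier R"
 shows "(\<Oplus>x\<in>A. f x) ** (\<Oplus>y\<in>B. g y) = (\<Oplus>y\<in>B. \<Oplus>x\<in>A. f x ** g y)"
proof -
 have "(\<Oplus>x\<in>A. f x) ** (\<Oplus>y\<in>B. g y) = (\<Oplus>y\<in>B. (\<Oplus>x\<in>A. f x) ** g y)"
  using assms by (intro fsr[symmetric]) auto
 also have "... = (\<Oplus>y\<in>B. \<Oplus>x\<in>A. f x ** g y)"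
  using assms by (intro fsc fsl[symmetric]) auto
 finally show ?thesis .
qed

end

section \<open>Cuspidal representations\<close>

text \<open>A multiplicative character of the quadratic extension; its value at 0 is left
  free.\<close>

locale theta = achar R py qi for R (structure) and py :: "'k::{finite,field} => 'a" and qi +
 fixes te :: "'k q2 => 'a"
 assumes th_closed [simp, intro]: "te t : carrier R"
  and th_mult: "[|s ~= 0; t ~= 0|] ==> te (s * t) = te s ** te t"
  and th_one [simp]: "te 1 = \<one>"
begin

text \<open>The Bessel function of the cuspidal representation attached to
  \<open>te\<close>.\<close>

definition J :: "'k => 'k => 'a" where
 "J c d = \<ominus> qi ** (\<Oplus>t\<in>{t. Nm t = d}. py (- Tr t / c) ** te t)"

text \<open>The Kirillov model on functions on k^*: upper triangular matrices act by rescaling the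
  variable and multiplying by values of psi, and all other matrices act through the Bessel
  function.\<close>

definition KC :: "'k m2 => 'k => 'k => 'a" where
 "KC g x y = (case g of (a, b, c, d) =>
   if c = 0 then (if a * x = d * y then te (emb d) ** py (b * x / d) else \<zero>)
   else py ((a * x + d * y) / c) ** J (c / y) (mdet g * x / y))"

lemma J_closed [simp, intro]: "J c d : carrier R"
 by (auto simp: J_def)

text \<open>Multiplying the summation variable by z maps the fibre of norm d onto that of norm z^2
  d.\<close>

lemma J_scale:
 assumes "z ~= 0" "d ~= 0"
 shows "J (z * c) (z * z * d) = te (emb z) ** J c d"
proof -
 have "(\<Oplus>t\<in>{t. Nm t = z * z * d}. py (- Tr t / (z * c)) ** te t)
   = (\<Oplus>t\<in>{t. Nm t = d}. te (emb z) ** (py (- Tr t / c) ** te t))"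
 proof (rule fsw[of _ "%t. emb z * t" "%t. emb (1 / z) * t"])
  fix t assume t: "t : {t. Nm t = z * z * d}"
  then have t0: "t ~= 0" using assms by auto
  have zt: "emb z * (emb (1 / z) * t) = t"
   using assms by (simp add: mult.assoc[symmetric] emb_simps(4)[symmetric] del: emb_simps(4))
  show "emb z * (emb (1 / z) * t) = t" by (rule zt)
  show "emb (1 / z) * t : {t. Nm t = d}" using t assms by simp
  have "te t = te (emb z) ** te (emb (1 / z) * t)"
   using assms t0 by (subst th_mult[symmetric]) (auto simp: zt)
  then show "py (- Tr t / (z * c)) ** te t
    = te (emb z) ** (py (- Tr (emb (1 / z) * t) / c) ** te (emb (1 / z) * t))"
   using assms by (simp add: m_lcomm)
 next
  fix t assume "t : {t. Nm t = d}"
  then show "emb (1 / z) * (emb z * t) = t" "emb z * t : {t. Nm t = z * z * d}"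
   using assms by (simp_all add: mult.assoc[symmetric] emb_simps(4)[symmetric] del: emb_simps(4))
 qed auto
 then show ?thesis by (simp add: J_def fsr m_lcomm)
qed

text \<open>Every nonempty norm fibre is a translate of the norm-one group.\<close>

lemma th_sum_norm:
 assumes reg: "(\<Oplus>t\<in>{t. Nm t = 1}. te t) = \<zero>" and d: "d ~= 0"
 shows "(\<Oplus>t\<in>{t. Nm t = d}. te t) = \<zero>"
proof -
 obtain u where u: "Nm u = d" using Nm_surj[OF d] .
 then have u0: "u ~= 0" using d by auto
 have "(\<Oplus>t\<in>{t. Nm t = d}. te t) = (\<Oplus>t\<in>{t. Nm t = 1}. te u ** te t)"
 proof (rule fsw[of _ "%t. u * t" "%t. t / u"])
  fix t assume t: "t : {t. Nm t = d}"
  then have "t ~= 0" using d by auto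
  then show "te t = te u ** te (t / u)" using u0 by (subst th_mult[symmetric]) auto
 qed (use u u0 d in \<open>auto simp: Nm_divide\<close>)
 then show ?thesis using reg by (simp add: fsr)
qed

text \<open>In the product of two Bessel sums over t and u, the product r = t u has a norm
  independent of y, while y itself is recovered from Nm u. Exchanging the sums leaves, for each r, a
  sum over u of a quadratic phase.\<close>

lemma J_convolution_aux:
 assumes nz: "c ~= 0" "c' ~= 0" "d ~= 0" "d' ~= 0" "x ~= 0" "z ~= 0"
 shows "(\<Oplus>y\<in>UNIV - {0}. py (s * y) ** (J (c / y) (d * x / y) ** J (c' / z) (d' * y / z)))
  = (qi ** qi) ** (\<Oplus>r\<in>{r. Nm r = d * d' * x / z}. te r **
    (\<Oplus>u\<in>UNIV - {0}. py (s * z / d' * Nm u + Tr (u * - (emb (z / d') * (emb (1 / c) * cnj2 r + emb (d' / c')))))))"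
proof -
 define M where "M = d * d' * x / z"
 \<comment> \<open>The combined phase of the two Bessel sums, rewritten in terms of u and r = t
   u.\<close>
 define P where "P u r = py (Tr (u * - (emb (z / d') * (emb (1 / c) * cnj2 r + emb (d' / c')))))" for u r
 have P_closed [simp, intro]: "P u r : carrier R" for u r by (simp add: P_def)
 have step: "J (c / y) (d * x / y) ** J (c' / z) (d' * y / z)
   = (qi ** qi) ** (\<Oplus>u\<in>{u. Nm u = d' * y / z}. \<Oplus>r\<in>{r. Nm r = M}. te r ** P u r)" if y: "y ~= 0" for y
 proof -
  let ?f = "%t. py (- Tr t / (c / y)) ** te t" and ?g = "%t. py (- Tr t / (c' / z)) ** te t"
  have "J (c / y) (d * x / y) ** J (c' / z) (d' * y / z)
   = (qi ** qi) ** ((\<Oplus>t\<in>{t. Nm t = d * x / y}. ?f t) ** (\<Oplus>t\<in>{t. Nm t = d' * y / z}. ?g t))"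
   by (simp add: J_def l_minus r_minus m_ac)
  also have "(\<Oplus>t\<in>{t. Nm t = d * x / y}. ?f t) ** (\<Oplus>t\<in>{t. Nm t = d' * y / z}. ?g t)
   = (\<Oplus>u\<in>{t. Nm t = d' * y / z}. \<Oplus>t\<in>{t. Nm t = d * x / y}. ?f t ** ?g u)"
   by (rule fs_product) auto
  also have "... = (\<Oplus>u\<in>{u. Nm u = d' * y / z}. \<Oplus>r\<in>{r. Nm r = M}. te r ** P u r)"
  proof (rule fsc)
   fix u assume "u : {t. Nm t = d' * y / z}"
   then have u: "Nm u = d' * y / z" by simp
   then have u0: "u ~= 0" using y nz by auto
   \<comment> \<open>This turns y Tr t into a trace that is linear in u, namely z/d' times Tr(u
     \<open>cnj2\<close> r).\<close>
   have yu: "emb y = emb (z / d') * (u * cnj2 u)"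
    unfolding emb_Nm[symmetric] u emb_simps(4)[symmetric] using nz by simp
   show "(\<Oplus>t\<in>{t. Nm t = d * x / y}. ?f t ** ?g u) = (\<Oplus>r\<in>{r. Nm r = M}. te r ** P u r)"
   proof (rule fsw[of _ "%r. r / u" "%t. t * u"])
    fix t assume t: "t : {t. Nm t = d * x / y}"
    then have t0: "t ~= 0" using y nz by auto
    have Nt: "Nm t = d * x / y" using t by simp
    show "t * u : {r. Nm r = M}" using y nz by (simp add: Nt u M_def)
    have "Tr (t * u * cnj2 u) = Tr (emb (y * d' / z) * t)"
    proof -
     have "emb (y * d' / z) = emb (d' / z) * emb y" by (simp add: emb_simps(4)[symmetric] mult.commute del: emb_simps(4))
     also have "... = emb (d' / z) * emb (z / d') * (u * cnj2 u)" by (simp only: yu mult.assoc)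
     also have "emb (d' / z) * emb (z / d') = 1" using nz by (simp add: emb_simps(4)[symmetric] del: emb_simps(4))
     finally show ?thesis by (simp add: mult_ac)
    qed
    then have T: "Tr (u * cnj2 (t * u)) = (y * d' / z) * Tr t"
     by (metis Tr_cnj_mult Tr_simps(7) cnj2_simps(7) mult.commute mult.left_commute cnj2_simps(4))
    have "Tr (u * - (emb (z / d') * (emb (1 / c) * cnj2 (t * u) + emb (d' / c'))))
     = - ((z / d') * ((1 / c) * Tr (u * cnj2 (t * u)) + (d' / c') * Tr u))"
    proof -
     have "u * - (emb (z / d') * (emb (1 / c) * cnj2 (t * u) + emb (d' / c')))
      = - (emb (z / d') * (emb (1 / c) * (u * cnj2 (t * u)) + emb (d' / c') * u))"
      by (simp add: algebra_simps)
     then show ?thesis by (simp only: Tr_simps)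
    qed
    also have "... = - Tr t / (c / y) + - Tr u / (c' / z)"
     unfolding T using nz y by (simp add: field_simps)
    finally have "P u (t * u) = py (- Tr t / (c / y)) ** py (- Tr u / (c' / z))"
     by (simp only: P_def psi_add)
    then show "?f t ** ?g u = te (t * u) ** P u (t * u)"
     using t0 u0 by (simp add: th_mult m_ac)
   next
    fix r assume r: "r : {r. Nm r = M}"
    then have Nr: "Nm r = d * d' * x / z" by (simp add: M_def)
    show "r / u : {t. Nm t = d * x / y}" using y nz by (simp add: Nm_divide Nr u)
   qed (use u0 in auto)
  qed auto
  finally show ?thesis .
 qed
 have "(\<Oplus>y\<in>UNIV - {0}. py (s * y) ** (J (c / y) (d * x / y) ** J (c' / z) (d' * y / z)))
  = (\<Oplus>y\<in>UNIV - {0}. (qi ** qi) ** (\<Oplus>u\<in>{u\<in>UNIV - {0}. z / d' * Nm u = y}. py (s * z / d' * Nm u) ** (\<Oplus>r\<in>{r. Nm r = M}. te r ** P u r)))"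
 proof (rule fsc)
  fix y :: 'k assume "y : UNIV - {0}"
  then have y: "y ~= 0" by simp
  have set_eq: "{u. Nm u = d' * y / z} = {u\<in>UNIV - {0}. z / d' * Nm u = y}"
   using y nz by (auto simp: field_simps)
  have "py (s * y) ** (J (c / y) (d * x / y) ** J (c' / z) (d' * y / z))
   = (qi ** qi) ** (py (s * y) ** (\<Oplus>u\<in>{u\<in>UNIV - {0}. z / d' * Nm u = y}. \<Oplus>r\<in>{r. Nm r = M}. te r ** P u r))"
   unfolding step[OF y] set_eq by (rule m_lcomm) auto
  also have "py (s * y) ** (\<Oplus>u\<in>{u\<in>UNIV - {0}. z / d' * Nm u = y}. \<Oplus>r\<in>{r. Nm r = M}. te r ** P u r)
   = (\<Oplus>u\<in>{u\<in>UNIV - {0}. z / d' * Nm u = y}. py (s * y) ** (\<Oplus>r\<in>{r. Nm r = M}. te r ** P u r))"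
   by (rule fsr[symmetric]) auto
  also have "... = (\<Oplus>u\<in>{u\<in>UNIV - {0}. z / d' * Nm u = y}. py (s * z / d' * Nm u) ** (\<Oplus>r\<in>{r. Nm r = M}. te r ** P u r))"
   by (rule fsc) (auto simp: mult.assoc)
  finally show "py (s * y) ** (J (c / y) (d * x / y) ** J (c' / z) (d' * y / z)) = (qi ** qi) ** ..." .
 qed auto
 also have "... = (qi ** qi) ** (\<Oplus>y\<in>UNIV - {0}. (\<Oplus>u\<in>{u\<in>UNIV - {0}. z / d' * Nm u = y}. py (s * z / d' * Nm u) ** (\<Oplus>r\<in>{r. Nm r = M}. te r ** P u r)))"
  by (rule fsr) auto
 also have "(\<Oplus>y\<in>UNIV - {0}. (\<Oplus>u\<in>{u\<in>UNIV - {0}. z / d' * Nm u = y}. py (s * z / d' * Nm u) ** (\<Oplus>r\<in>{r. Nm r = M}. te r ** P u r)))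
   = (\<Oplus>u\<in>UNIV - {0}. py (s * z / d' * Nm u) ** (\<Oplus>r\<in>{r. Nm r = M}. te r ** P u r))"
  by (rule fs_group[symmetric]) (use nz in auto)
 also have "... = (\<Oplus>u\<in>UNIV - {0}. \<Oplus>r\<in>{r. Nm r = M}. te r ** (py (s * z / d' * Nm u) ** P u r))"
  by (rule fsc) (auto simp: fsr[symmetric] m_lcomm)
 also have "... = (\<Oplus>r\<in>{r. Nm r = M}. \<Oplus>u\<in>UNIV - {0}. te r ** (py (s * z / d' * Nm u) ** P u r))"
  by (rule fs_swap) auto
 also have "... = (\<Oplus>r\<in>{r. Nm r = M}. te r ** (\<Oplus>u\<in>UNIV - {0}. py (s * z / d' * Nm u) ** P u r))"
  by (rule fsc) (auto simp: fsr)
 finally show ?thesis by (simp only: P_def M_def psi_add)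
qed

text \<open>The inner sum over all u is evaluated by completing the square if s is nonzero, and by
  orthogonality if s = 0, when only one r survives. The missing term u = 0 contributes a sum of
  \<open>te\<close> over a norm fibre, which vanishes by regularity.\<close>

lemma J_convolution:
 assumes reg: "(\<Oplus>t\<in>{t. Nm t = 1}. te t) = \<zero>"
  and nz: "c ~= 0" "c' ~= 0" "d ~= 0" "d' ~= 0" "x ~= 0" "z ~= 0"
 shows "(\<Oplus>y\<in>UNIV - {0}. py (s * y) ** (J (c / y) (d * x / y) ** J (c' / z) (d' * y / z)))
  = (if s = 0 then (if d * x / (c * c) = d' * z / (c' * c') then te (emb (- (c * d' / c'))) else \<zero>)
    else py (- ((d * x / (c * c) + d' * z / (c' * c')) / s)) ** J (c * c' * s / z) (d * d' * x / z))"
proof -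
 define M where "M = d * d' * x / z"
 have M0: "M ~= 0" using nz by (simp add: M_def)
 define be where "be r = - (emb (z / d') * (emb (1 / c) * cnj2 r + emb (d' / c')))" for r
 define W where "W r = (\<Oplus>u\<in>UNIV. py (s * z / d' * Nm u + Tr (u * be r)))" for r
 have W_closed [simp, intro]: "W r : carrier R" for r by (auto simp: W_def)
 have minus1: "(\<Oplus>u\<in>UNIV - {0}. py (s * z / d' * Nm u + Tr (u * be r))) = W r \<ominus> \<one>" for r
  unfolding W_def by (rule eq_add_imp_diff) (subst fs_split[of _ 0], auto)
 have "(\<Oplus>y\<in>UNIV - {0}. py (s * y) ** (J (c / y) (d * x / y) ** J (c' / z) (d' * y / z)))
  = (qi ** qi) ** (\<Oplus>r\<in>{r. Nm r = M}. te r ** (W r \<ominus> \<one>))"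
  unfolding J_convolution_aux[OF nz] M_def[symmetric] be_def[symmetric] minus1 ..
 also have "(\<Oplus>r\<in>{r. Nm r = M}. te r ** (W r \<ominus> \<one>))
   = (\<Oplus>r\<in>{r. Nm r = M}. te r ** W r \<oplus> (\<ominus> \<one>) ** te r)"
  by (rule fsc) (auto simp: a_minus_def r_distr r_minus l_minus)
 also have "... = (\<Oplus>r\<in>{r. Nm r = M}. te r ** W r)"
  by (subst fs_add) (auto simp: fsr th_sum_norm[OF reg M0])
 finally have main: "(\<Oplus>y\<in>UNIV - {0}. py (s * y) ** (J (c / y) (d * x / y) ** J (c' / z) (d' * y / z)))
  = (qi ** qi) ** (\<Oplus>r\<in>{r. Nm r = M}. te r ** W r)" .
 show ?thesis
 proof (cases "s = 0")
  case False
  have W: "W r = \<ominus> qq ** (py (- ((d * x / (c * c) + d' * z / (c' * c')) / s)) ** py (- Tr r / (c * c' * s / z)))"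
   if r: "Nm r = M" for r
  proof -
   have NB: "Nm (be r) = (z / d') * (z / d') * (M / (c * c) + Tr r * d' / (c * c') + d' * d' / (c' * c'))"
   proof -
    have "Nm (be r) = (z / d') * (z / d') * Nm (emb (1 / c) * cnj2 r + emb (d' / c'))"
     by (simp add: be_def)
    also have "Nm (emb (1 / c) * cnj2 r + emb (d' / c')) = M / (c * c) + Tr (emb (1 / c) * cnj2 r * emb (d' / c')) + d' * d' / (c' * c')"
     unfolding Nm_add using r by simp
    also have "Tr (emb (1 / c) * cnj2 r * emb (d' / c')) = Tr r * d' / (c * c')"
     by (simp only: Tr_simps) (simp add: field_simps)
    finally show ?thesis .
   qed
   have "- Nm (be r) / (s * z / d') = - ((d * x / (c * c) + d' * z / (c' * c')) / s) + - Tr r / (c * c' * s / z)"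
    unfolding NB M_def using nz False by (simp add: field_simps)
   then show ?thesis unfolding W_def using False nz
    by (subst psi_Nm_Tr_sum) (simp_all add: psi_add[symmetric])
  qed
  have "(\<Oplus>r\<in>{r. Nm r = M}. te r ** W r)
   = (\<Oplus>r\<in>{r. Nm r = M}. \<ominus> qq ** py (- ((d * x / (c * c) + d' * z / (c' * c')) / s)) ** (py (- Tr r / (c * c' * s / z)) ** te r))"
   by (rule fsc) (auto simp: W m_ac)
  also have "... = \<ominus> qq ** py (- ((d * x / (c * c) + d' * z / (c' * c')) / s)) ** (\<Oplus>r\<in>{r. Nm r = M}. py (- Tr r / (c * c' * s / z)) ** te r)"
   by (rule fsr) auto
  finally show ?thesis unfolding main using False
   by (simp add: J_def M_def[symmetric] l_minus r_minus m_ac)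
 next
  case True
  have W: "W r = (if r = emb (- (c * d' / c')) then qq ** qq else \<zero>)" for r
  proof -
   have "be r = 0 \<longleftrightarrow> emb (1 / c) * cnj2 r + emb (d' / c') = 0"
    using nz by (simp add: be_def)
   also have "... \<longleftrightarrow> cnj2 r = emb (- (c * d' / c'))"
   proof -
    have eq: "emb (1 / c) * cnj2 r + emb (d' / c') = emb (1 / c) * (cnj2 r - emb (- (c * d' / c')))"
     unfolding right_diff_distrib emb_simps(4)[symmetric] using nz by simp
    have "emb (1 / c) ~= 0" using nz by simp
    then show ?thesis unfolding eq mult_eq_0_iff right_minus_eq by blast
   qed
   also have "... \<longleftrightarrow> r = emb (- (c * d' / c'))"
    by (metis cnj2_simps(7,8))
   finally have "be r = 0 \<longleftrightarrow> r = emb (- (c * d' / c'))" .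
   moreover have "W r = (if be r = 0 then qq ** qq else \<zero>)"
   proof (cases "be r = 0")
    case True
    then have "W r = (\<Oplus>u\<in>(UNIV::'k q2 set). \<one>)" unfolding W_def \<open>s = 0\<close> by simp
    also have "... = [(CARD('k) * CARD('k))] \<cdot> \<one>" by (simp add: fs_const card_q2)
    also have "... = qq ** qq" by (simp add: qq_def add_pow_ldistr add.nat_pow_pow)
    finally show ?thesis using True by simp
   qed (use True psi_Tr_sum in \<open>simp add: W_def\<close>)
   ultimately show ?thesis by simp
  qed
  have iff: "Nm (emb (- (c * d' / c'))) = M \<longleftrightarrow> d * x / (c * c) = d' * z / (c' * c')"
   using nz by (auto simp: M_def field_simps)
  have "(\<Oplus>r\<in>{r. Nm r = M}. te r ** W r) = (if d * x / (c * c) = d' * z / (c' * c') then te (emb (- (c * d' / c'))) ** (qq ** qq) else \<zero>)"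
  proof (cases "Nm (emb (- (c * d' / c'))) = M")
   case True
   then have "(\<Oplus>r\<in>{r. Nm r = M}. te r ** W r) = te (emb (- (c * d' / c'))) ** W (emb (- (c * d' / c')))"
    by (intro fs_only) (auto simp: W)
   then show ?thesis using True iff by (simp add: W)
  next
   case False
   then have "(\<Oplus>r\<in>{r. Nm r = M}. te r ** W r) = \<zero>" by (intro fs_zero) (auto simp: W)
   then show ?thesis using False iff by simp
  qed
  then show ?thesis unfolding main using True by (simp add: m_ac)
 qed
qed

lemma KC_closed [simp, intro]: "KC g x y : carrier R"
 by (cases g) (auto simp: KC_def)

lemma KC_upper:
 assumes "d ~= 0" "y ~= a * x / d"
 shows "KC (a, b, 0, d) x y = \<zero>"
 using assms by (auto simp: KC_def field_simps)

text \<open>If one factor is upper triangular, the sum over y has a single nonzero term and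
  \<open>J_scale\<close> suffices. The remaining case is the convolution formula for
  \<open>J\<close>.\<close>

lemma KC_krep:
 assumes reg: "(\<Oplus>t\<in>{t. Nm t = 1}. te t) = \<zero>"
 shows "krep R (GD (UNIV - {0})) (UNIV - {0}) KC"
 unfolding krep_def
proof (intro conjI ballI)
 fix g h :: "'k m2" and x z :: 'k
 assume "g : GD (UNIV - {0})" "h : GD (UNIV - {0})" and xz: "x : UNIV - {0}" "z : UNIV - {0}"
 obtain a b c d where g: "g = (a, b, c, d)" by (cases g)
 obtain a' b' c' d' where h: "h = (a', b', c', d')" by (cases h)
 have x0: "x ~= 0" and z0: "z ~= 0" using xz by auto
 define D where "D = a * d - b * c"
 define D' where "D' = a' * d' - b' * c'"
 have D0: "D ~= 0" and D'0: "D' ~= 0"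
  using \<open>g : _\<close> \<open>h : _\<close> by (auto simp: GD_def g h D_def D'_def)
 have gh: "m2mul g h = (a * a' + b * c', a * b' + b * d', c * a' + d * c', c * b' + d * d')"
  by (simp add: g h m2s)
 have dgh: "mdet (m2mul g h) = D * D'" by (simp add: g h D_def D'_def)
 show "KC (m2mul g h) x z = (\<Oplus>y\<in>UNIV - {0}. KC g x y ** KC h y z)"
 proof (cases "c = 0")
  case c: True
  then have ad: "a ~= 0" "d ~= 0" using D0 by (auto simp: D_def)
  have sum: "(\<Oplus>y\<in>UNIV - {0}. KC g x y ** KC h y z) = KC g x (a * x / d) ** KC h (a * x / d) z"
   by (rule fs_only) (use ad x0 in \<open>auto simp: g c KC_upper\<close>)
  have Kg: "KC g x (a * x / d) = te (emb d) ** py (b * x / d)"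
   using ad by (simp add: g c KC_def)
  show ?thesis
  proof (cases "c' = 0")
   case c': True
   then have ad': "a' ~= 0" "d' ~= 0" using D'0 by (auto simp: D'_def)
   have th: "te (emb (d * d')) = te (emb d) ** te (emb d')"
    using ad ad' by (simp add: th_mult)
   have ps: "py ((a * b' + b * d') * x / (d * d')) = py (b * x / d) ** py (b' * (a * x / d) / d')"
    unfolding psi_add[symmetric] using ad ad' by (intro arg_cong[of _ _ py]) (simp add: field_simps)
   have iff: "a * a' * x = d * d' * z \<longleftrightarrow> a' * (a * x / d) = d' * z"
    using ad by (simp add: field_simps)
   have "KC (m2mul g h) x z = (if a * a' * x = d * d' * z then te (emb (d * d')) ** py ((a * b' + b * d') * x / (d * d')) else \<zero>)"
    unfolding gh KC_def by (simp add: c c' del: emb_simps)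
   moreover have "KC h (a * x / d) z = (if a' * (a * x / d) = d' * z then te (emb d') ** py (b' * (a * x / d) / d') else \<zero>)"
    unfolding h KC_def by (simp add: c')
   ultimately show ?thesis unfolding sum Kg th ps iff by (simp add: m_ac)
  next
   case c': False
   have J: "J (d * c' / z) (D * D' * x / z) = te (emb d) ** J (c' / z) (D' * (a * x / d) / z)"
   proof -
    have m1: "D * D' * x / z = d * d * (D' * (a * x / d) / z)" using ad by (simp add: D_def c field_simps)
    have m2: "d * c' / z = d * (c' / z)" by simp
    show ?thesis unfolding m1 m2 by (rule J_scale) (use ad D'0 x0 z0 in auto)
   qed
   have ps: "py (((a * a' + b * c') * x + (d * d') * z) / (d * c')) = py (b * x / d) ** py ((a' * (a * x / d) + d' * z) / c')"
    unfolding psi_add[symmetric] using ad c' by (intro arg_cong[of _ _ py]) (simp add: field_simps)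
   have "KC (m2mul g h) x z = py (((a * a' + b * c') * x + (d * d') * z) / (d * c')) ** J (d * c' / z) (D * D' * x / z)"
    unfolding KC_def dgh unfolding gh using c c' ad by simp
   moreover have "KC h (a * x / d) z = py ((a' * (a * x / d) + d' * z) / c') ** J (c' / z) (D' * (a * x / d) / z)"
    using c' by (simp add: KC_def h D'_def)
   ultimately show ?thesis unfolding sum Kg J ps by (simp add: m_ac)
  qed
 next
  case c: False
  show ?thesis
  proof (cases "c' = 0")
   case c': True
   then have ad': "a' ~= 0" "d' ~= 0" using D'0 by (auto simp: D'_def)
   have sum: "(\<Oplus>y\<in>UNIV - {0}. KC g x y ** KC h y z) = KC g x (d' * z / a') ** KC h (d' * z / a') z"
   proof (rule fs_only)
    fix y assume "y ~= d' * z / a'"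
    then have "KC h y z = \<zero>" using ad' by (auto simp: h c' KC_def field_simps)
    then show "KC g x y ** KC h y z = \<zero>" by simp
   qed (use ad' z0 in auto)
   have Kh: "KC h (d' * z / a') z = te (emb d') ** py (b' * (d' * z / a') / d')"
    using ad' by (simp add: h c' KC_def)
   have J: "J (c * a' / z) (D * D' * x / z) = te (emb d') ** J (c / (d' * z / a')) (D * x / (d' * z / a'))"
   proof -
    have m1: "D * D' * x / z = d' * d' * (D * x / (d' * z / a'))" using ad' by (simp add: D'_def c' field_simps)
    have m2: "c * a' / z = d' * (c / (d' * z / a'))" using ad' by simp
    show ?thesis unfolding m1 m2 by (rule J_scale) (use ad' D0 x0 z0 in auto)
   qed
   have ps: "py ((a * a' * x + (c * b' + d * d') * z) / (c * a')) = py ((a * x + d * (d' * z / a')) / c) ** py (b' * (d' * z / a') / d')"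
    unfolding psi_add[symmetric] using ad' c by (intro arg_cong[of _ _ py]) (simp add: field_simps)
   have "KC (m2mul g h) x z = py ((a * a' * x + (c * b' + d * d') * z) / (c * a')) ** J (c * a' / z) (D * D' * x / z)"
    unfolding KC_def dgh unfolding gh using c c' ad' by simp
   moreover have "KC g x (d' * z / a') = py ((a * x + d * (d' * z / a')) / c) ** J (c / (d' * z / a')) (D * x / (d' * z / a'))"
    using c by (simp add: KC_def g D_def)
   ultimately show ?thesis unfolding sum Kh J ps by (simp add: m_ac)
  next
   case c': False
   \<comment> \<open>The lower left entry of the product is c c' s, so s = 0 is the case in which
     the product is upper triangular.\<close>
   define s where "s = d / c + a' / c'"
   have C: "c * a' + d * c' = c * c' * s" using c c' by (simp add: s_def field_simps)
   have "(\<Oplus>y\<in>UNIV - {0}. KC g x y ** KC h y z)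
    = (\<Oplus>y\<in>UNIV - {0}. (py (a * x / c) ** py (d' * z / c')) ** (py (s * y) ** (J (c / y) (D * x / y) ** J (c' / z) (D' * y / z))))"
   proof (rule fsc)
    fix y
    have "py ((a * x + d * y) / c) ** py ((a' * y + d' * z) / c') = py (a * x / c) ** py (d' * z / c') ** py (s * y)"
     unfolding psi_add[symmetric] s_def using c c' by (intro arg_cong[of _ _ py]) (simp add: field_simps)
    moreover have "KC g x y = py ((a * x + d * y) / c) ** J (c / y) (D * x / y)"
     "KC h y z = py ((a' * y + d' * z) / c') ** J (c' / z) (D' * y / z)"
     using c c' by (simp_all add: KC_def g h D_def D'_def)
    moreover have "py ((a * x + d * y) / c) ** J (c / y) (D * x / y) ** (py ((a' * y + d' * z) / c') ** J (c' / z) (D' * y / z))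
     = py ((a * x + d * y) / c) ** py ((a' * y + d' * z) / c') ** (J (c / y) (D * x / y) ** J (c' / z) (D' * y / z))"
     by (simp add: m_ac)
    ultimately show "KC g x y ** KC h y z = (py (a * x / c) ** py (d' * z / c')) ** (py (s * y) ** (J (c / y) (D * x / y) ** J (c' / z) (D' * y / z)))"
     by (simp add: m_assoc)
   qed auto
   also have "... = (py (a * x / c) ** py (d' * z / c')) ** (\<Oplus>y\<in>UNIV - {0}. py (s * y) ** (J (c / y) (D * x / y) ** J (c' / z) (D' * y / z)))"
    by (rule fsr) auto
   finally have sum: "(\<Oplus>y\<in>UNIV - {0}. KC g x y ** KC h y z)
    = (py (a * x / c) ** py (d' * z / c')) ** (if s = 0 then (if D * x / (c * c) = D' * z / (c' * c') then te (emb (- (c * D' / c'))) else \<zero>)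
    else py (- ((D * x / (c * c) + D' * z / (c' * c')) / s)) ** J (c * c' * s / z) (D * D' * x / z))"
    unfolding J_convolution[OF reg c c' D0 D'0 x0 z0] .
   show ?thesis
   proof (cases "s = 0")
    case True
    then have dd: "d = - (a' * c / c')" using c c' by (simp add: s_def field_simps eq_neg_iff_add_eq_0)
    have e1: "a * a' + b * c' = - (c' * D / c)" using c c' by (simp add: D_def dd field_simps)
    have e2: "c * b' + d * d' = - (c * D' / c')" using c c' by (simp add: D'_def dd field_simps)
    have iff: "(a * a' + b * c') * x = (c * b' + d * d') * z \<longleftrightarrow> D * x / (c * c) = D' * z / (c' * c')"
     unfolding e1 e2 using c c' by (simp add: field_simps)
    have K: "KC (m2mul g h) x z = (if (a * a' + b * c') * x = (c * b' + d * d') * z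
      then te (emb (c * b' + d * d')) ** py ((a * b' + b * d') * x / (c * b' + d * d')) else \<zero>)"
     unfolding gh KC_def C True by (simp del: emb_simps)
    have ps: "py ((a * b' + b * d') * x / (c * b' + d * d')) = py (a * x / c) ** py (d' * z / c')"
     if eq: "D * x / (c * c) = D' * z / (c' * c')"
    proof -
     have z: "z = D * x * c' * c' / (c * c * D')" using eq c c' D'0 by (simp add: field_simps)
     have "(a * b' + b * d') * x / (c * b' + d * d') = a * x / c + d' * z / c'"
      unfolding e2 z using c c' D'0 D0
      by (simp add: field_simps) (simp add: D_def D'_def dd field_simps c c')
     then show ?thesis by (simp add: psi_add)
    qed
    show ?thesis unfolding sum K iff using True ps e2 by (auto simp: m_ac simp del: emb_simps)
   next
    case False
    have ps: "py (((a * a' + b * c') * x + (c * b' + d * d') * z) / (c * c' * s))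
     = py (a * x / c) ** py (d' * z / c') ** py (- ((D * x / (c * c) + D' * z / (c' * c')) / s))"
    proof -
     have "((a * a' + b * c') * x + (c * b' + d * d') * z) / (c * c' * s)
      = a * x / c + d' * z / c' + - ((D * x / (c * c) + D' * z / (c' * c')) / s)"
     proof -
      have "((a * a' + b * c') * x + (c * b' + d * d') * z) * (c * c')
       = (a * x * c' + d' * z * c) * (c * c' * s) - (D * x * (c' * c') + D' * z * (c * c))"
       unfolding C[symmetric] D_def D'_def by (simp add: algebra_simps)
      then have X: "(a * a' + b * c') * x + (c * b' + d * d') * z
       = ((a * x * c' + d' * z * c) * (c * c' * s) - (D * x * (c' * c') + D' * z * (c * c))) / (c * c')"
       using c c' by (simp add: eq_divide_eq)
      show ?thesis unfolding X using c c' False by (simp add: field_simps)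
     qed
     then show ?thesis by (simp only: psi_add)
    qed
    have "KC (m2mul g h) x z = py (((a * a' + b * c') * x + (c * b' + d * d') * z) / (c * c' * s)) ** J (c * c' * s / z) (D * D' * x / z)"
     unfolding KC_def dgh unfolding gh C using c c' False by simp
    then show ?thesis unfolding sum ps using False by (simp add: m_ac)
   qed
  qed
 qed
next
 fix x y :: 'k assume "x : UNIV - {0}"
 show "KC m2one x y = (if x = y then \<one> else \<zero>)"
  by (simp add: KC_def m2one_def)
qed auto

end

section \<open>Linear maps and invariant subspaces\<close>

definition islin :: "('a,'r) ring_scheme => ('a,'v) module => ('a,'w) module => ('v => 'w) => bool" where
 "islin R M M' T \<longleftrightarrow> (ALL v:carrier M. T v : carrier M') &
   (ALL v:carrier M. ALL w:carrier M. T (v \<oplus>@M w) = T v \<oplus>@M' T w) &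
   (ALL c:carrier R. ALL v:carrier M. T (c \<odot>@M v) = c \<odot>@M' T v)"

definition invsub :: "('a,'r) ring_scheme => ('a,'v) module => 'g set => ('g => 'v => 'v) => 'v set => bool" where
 "invsub R M G act N \<longleftrightarrow> N <= carrier M & \<zero>@M : N &
   (ALL v:N. ALL w:N. v \<oplus>@M w : N) & (ALL c:carrier R. ALL v:N. c \<odot>@M v : N) &
   (ALL g:G. ALL v:N. act g v : N)"

text \<open>The zero subspace satisfies this too; where a length is computed, non-vanishing is
  supplied separately.\<close>

definition irrsub :: "('a,'r) ring_scheme => ('a,'v) module => 'g set => ('g => 'v => 'v) => 'v set => bool" where
 "irrsub R M G act N \<longleftrightarrow> invsub R M G act N &
   (ALL N'. invsub R M G act N' --> N' <= N --> N' = {\<zero>@M} \<or> N' = N)"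

lemma islc: "islin R M M' T ==> v : carrier M ==> T v : carrier M'"
 and islin_add: "islin R M M' T ==> v : carrier M ==> w : carrier M ==> T (v \<oplus>@M w) = T v \<oplus>@M' T w"
 and islin_smult: "islin R M M' T ==> c : carrier R ==> v : carrier M ==> T (c \<odot>@M v) = c \<odot>@M' T v"
 by (auto simp: islin_def)

lemma islin_zero:
 assumes "module R M" "module R M'" "islin R M M' T"
 shows "T \<zero>@M = \<zero>@M'"
proof -
 interpret M: module R M by fact
 interpret M': module R M' by fact
 have "T \<zero>@M = T (\<zero>@R \<odot>@M \<zero>@M)" by simp
 also have "... = \<zero>@R \<odot>@M' T \<zero>@M" by (rule islin_smult[OF assms(3)]) auto
 also have "... = \<zero>@M'" using islc[OF assms(3)] by simp
 finally show ?thesis .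
qed

lemma islin_sum:
 assumes "module R M" "module R M'" "islin R M M' T" "!!x. x : A ==> f x : carrier M"
 shows "T (finsum M f A) = finsum M' (%x. T (f x)) A"
proof -
 interpret M: module R M by fact
 interpret M': module R M' by fact
 show ?thesis
  using assms(4)
 proof (induction A rule: infinite_finite_induct)
  case (insert x A)
  have "T (finsum M f (insert x A)) = T (f x) \<oplus>@M' T (finsum M f A)"
   using insert by (subst M.M.fsi) (auto simp: islin_add[OF assms(3)] M.M.fs_closed)
  also have "... = finsum M' (%x. T (f x)) (insert x A)"
   using insert islc[OF assms(3)] by (subst M'.M.fsi) auto
  finally show ?case .
 qed (auto simp: islin_zero[OF assms(1-3)] M.M.finsum_infinite M'.M.finsum_infinite)
qed

lemma invsub_sum:
 assumes "module R M" "invsub R M G act N" "!!x. x : A ==> f x : N"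
 shows "finsum M f A : N"
proof -
 interpret M: module R M by fact
 show ?thesis
  using assms(3)
 proof (induction A rule: infinite_finite_induct)
  case (insert x A)
  then show ?case using assms(2)
   by (subst M.M.fsi) (auto simp: invsub_def)
 qed (use assms(2) in \<open>auto simp: invsub_def M.M.finsum_infinite\<close>)
qed

lemma invsub_zero: "invsub R M G act N ==> \<zero>@M : N"
 and invsub_add: "invsub R M G act N ==> v : N ==> w : N ==> v \<oplus>@M w : N"
 and ivm: "invsub R M G act N ==> c : carrier R ==> v : N ==> c \<odot>@M v : N"
 and invsub_act: "invsub R M G act N ==> g : G ==> v : N ==> act g v : N"
 and invsub_sub: "invsub R M G act N ==> v : N ==> v : carrier M"
 by (auto simp: invsub_def)

lemma invsub_diff:
 assumes "module R M" "invsub R M G act N" "v : N" "w : N"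
 shows "v \<ominus>@M w : N"
proof -
 interpret M: module R M by fact
 have w: "w : carrier M" using assms invsub_sub by metis
 have "\<ominus>@M w = (\<ominus>@R \<one>@R) \<odot>@M w" using w by (simp add: M.smult_l_minus)
 then have "\<ominus>@M w : N" using assms(2,4) by (simp add: ivm)
 then show ?thesis using assms(2,3) by (simp add: a_minus_def invsub_add)
qed

lemma ivc:
 assumes "Ring.field R" "module R M" "invsub R M G act N" "c : carrier R" "c ~= \<zero>@R" "v : carrier M" "c \<odot>@M v : N"
 shows "v : N"
proof -
 interpret Ring.field R by fact
 interpret M: module R M by fact
 have u: "c : Units R" using assms by (simp add: field_Units)
 then have "inv@R c \<odot>@M (c \<odot>@M v) = v"
  using assms by (simp add: M.smult_assoc1[symmetric])
 moreover have "inv@R c \<odot>@M (c \<odot>@M v) : N"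
  by (rule ivm[OF assms(3)]) (use u assms in auto)
 ultimately show ?thesis by simp
qed

section \<open>The unipotent radical and the Hecke algebra of a non-degenerate character\<close>

text \<open>Upper unipotent, diagonal and antidiagonal matrices; \<open>mc c d\<close> has
  determinant d.\<close>

definition nm :: "'k::field => 'k m2" where "nm b = (1, b, 0, 1)"
definition dg :: "'k::field => 'k => 'k m2" where "dg a d = (a, 0, 0, d)"
definition mc :: "'k::field => 'k => 'k m2" where "mc c d = (0, - d / c, c, 0)"

text \<open>A pair \<open>(c, d)\<close> stands for the matrix \<open>mc c d\<close> of determinant \<open>d\<close> if \<open>c ~= 0\<close>,
 and for the scalar matrix \<open>d\<close> if \<open>c = 0\<close>.\<close>

definition bel :: "'k::field \<times> 'k => 'k m2" where
 "bel b = (if fst b = 0 then dg (snd b) (snd b) else mc (fst b) (snd b))"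
text \<open>The indices of the double cosets of U that can contribute to the Hecke algebra: a
  nonscalar diagonal matrix moves psi to a different character and gives 0.\<close>

definition BD :: "'k::field set => ('k \<times> 'k) set" where
 "BD D = {(c, d). if c = 0 then d * d : D else d : D}"
text \<open>The index of the Hecke operator produced by the middle element n(s) in a product of two
  such operators. The value (0, 1) is a default for nonscalar diagonal products: \<open>stc\<close>
  is 0 there, and (0, 1) keeps the index inside \<open>BD D\<close>.\<close>

definition nxt :: "'k::field \<times> 'k => 'k \<times> 'k => 'k => 'k \<times> 'k" where
 "nxt b b' s = (case b of (c, d) => case b' of (c', d') =>
   if c ~= 0 & c' ~= 0 then
    (if s = 0 then (0, if d * c' / c = c * d' / c' then - (d * c' / c) else 1) else (c * c' * s, d * d'))
   else if c = 0 & c' = 0 then (0, d * d') else if c = 0 then (d * c', d * d * d') else (c * d', d * d' * d'))"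

definition subgrp :: "'k::field set => bool" where
 "subgrp D \<longleftrightarrow> 1 : D & 0 \<notin> D & (ALL x:D. ALL y:D. x * y : D) & (ALL x:D. inverse x : D)"

lemma sgc: "subgrp (UNIV - {0})" "subgrp {1}"
 by (auto simp: subgrp_def)

lemma nxt_BD:
 assumes D: "subgrp D" and "b : BD D" "b' : BD D"
 shows "nxt b b' s : BD D"
proof -
 obtain c d where b: "b = (c, d)" by force
 obtain c' d' where b': "b' = (c', d')" by force
 have one: "1 : D" and mul: "!!x y. x : D ==> y : D ==> x * y : D"
  using D by (auto simp: subgrp_def)
 show ?thesis
 proof (cases "c = 0")
  case c: True
  then have d: "d * d : D" using assms(2) by (simp add: b BD_def)
  show ?thesis
  proof (cases "c' = 0")
   case True
   then have "(d * d) * (d' * d') : D" using mul[OF d, of "d' * d'"] assms(3) by (simp add: b' BD_def)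
   then show ?thesis using c True by (simp add: b b' nxt_def BD_def mult_ac)
  next
   case False
   then have "(d * d) * d' : D" using mul[OF d, of d'] assms(3) by (simp add: b' BD_def)
   moreover have "d ~= 0" using d D by (auto simp: subgrp_def)
   ultimately show ?thesis using c False by (simp add: b b' nxt_def BD_def)
  qed
 next
  case c: False
  then have d: "d : D" using assms(2) by (simp add: b BD_def)
  show ?thesis
  proof (cases "c' = 0")
   case True
   then have d': "d' * d' : D" using assms(3) by (simp add: b' BD_def)
   then have "d' ~= 0" using D by (auto simp: subgrp_def)
   then show ?thesis using mul[OF d d'] c True by (simp add: b b' nxt_def BD_def mult.assoc)
  next
   case c': False
   then have dd: "d * d' : D" using d assms(3) by (intro mul) (auto simp: b' BD_def)
   \<comment> \<open>The product of the two matrices is scalar in this case, and its square is the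
     product of the determinants.\<close>
   have sq: "(- (d * c' / c)) * (- (d * c' / c)) = d * d'" if eq: "d * c' / c = c * d' / c'"
   proof -
    have "(- (d * c' / c)) * (- (d * c' / c)) = (d * c' / c) * (c * d' / c')"
     by (simp only: eq minus_mult_minus)
    also have "... = d * d'" using c c' by simp
    finally show ?thesis .
   qed
   show ?thesis
   proof (cases "s = 0")
    case True
    then have "nxt b b' s = (0, if d * c' / c = c * d' / c' then - (d * c' / c) else 1)"
     using c c' by (simp add: b b' nxt_def)
    then show ?thesis using sq dd one by (auto simp add: BD_def simp del: minus_mult_minus)
   qed (use c c' dd in \<open>simp add: b b' nxt_def BD_def\<close>)
  qed
 qed
qed

lemma m2r:
 "m2mul (nm a) (nm b) = nm (a + b)"
 "nm 0 = m2one"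
 "a ~= 0 ==> m2mul (nm b) (dg a d) = m2mul (dg a d) (nm (b * d / a))"
 "z ~= 0 ==> c ~= 0 ==> m2mul (dg z z) (mc c d) = mc (z * c) (z * z * d)"
 "z ~= 0 ==> c ~= 0 ==> m2mul (mc c d) (dg z z) = mc (c * z) (d * z * z)"
 "m2mul (dg z z) (dg z' z') = dg (z * z') (z * z')"
 "mdet (nm b) = 1" "mdet (dg a d) = a * d" "c ~= 0 ==> mdet (mc c d) = d"
 by (auto simp: m2s nm_def dg_def mc_def m2one_def field_simps)

lemma bruhat:
 assumes "c ~= 0"
 shows "(a, b, c, d) = m2mul (nm (a / c)) (m2mul (mc c (a * d - b * c)) (nm (d / c)))"
 using assms by (simp add: m2s nm_def mc_def field_simps)

lemma borel:
 assumes "d ~= 0"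
 shows "(a, b, 0, d) = m2mul (nm (b / d)) (dg a d)"
 using assms by (simp add: m2s nm_def dg_def)

lemma bruhat_product:
 assumes "c ~= 0" "c' ~= 0" "s ~= 0"
 shows "m2mul (mc c d) (m2mul (nm s) (mc c' d'))
  = m2mul (nm (- (d / (c * c)) / s)) (m2mul (mc (c * c' * s) (d * d')) (nm (- (d' / (c' * c')) / s)))"
 using assms by (simp add: m2s nm_def mc_def field_simps)

lemma bruhat_product_0:
 assumes "c ~= 0" "c' ~= 0"
 shows "m2mul (mc c d) (m2mul (nm 0) (mc c' d')) = dg (- (d * c' / c)) (- (c * d' / c'))"
 using assms by (simp add: m2s nm_def mc_def dg_def field_simps)

context achar
begin

text \<open>Only values of psi and 1/q enter, so the constants are integral away from p and reduce
  to the same expression over the residue field.\<close>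

definition stc :: "'k \<times> 'k => 'k \<times> 'k => 'k => 'a" where
 "stc b b' s = (case b of (c, d) => case b' of (c', d') =>
   if c ~= 0 & c' ~= 0 then
    (if s = 0 then (if d * c' / c = c * d' / c' then qi else \<zero>)
    else qi ** py (- s - (d / (c * c) + d' / (c' * c')) / s))
   else if s = 0 then \<one> else \<zero>)"

text \<open>The coefficient of v in the psi-projection of g v, for a Hecke eigenvector v with
  eigenvalues \<open>lam\<close>.\<close>

definition mcoef :: "('k \<times> 'k => 'a) => 'k m2 => 'a" where
 "mcoef lam g = (case g of (a, b, c, d) =>
   if c ~= 0 then py (a / c + d / c) ** lam (c, mdet g)
   else if a = d then py (b / d) ** lam (0, d) else \<zero>)"

lemma stc_closed [simp, intro]: "stc b b' s : carrier R"
 by (auto simp: stc_def split: prod.splits)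

end

locale linact = R: Ring.field R + M: module R M for R :: "('a,'r) ring_scheme" and M :: "('a,'v) module" +
 fixes D :: "'k::{finite,field} set" and act :: "'k m2 => 'v => 'v"
 assumes D: "subgrp D"
  and act_closed [simp, intro]: "g : GD D ==> v : carrier M ==> act g v : carrier M"
  and act_add: "g : GD D ==> v : carrier M ==> w : carrier M ==> act g (v \<oplus>@M w) = act g v \<oplus>@M act g w"
  and act_smult: "g : GD D ==> v : carrier M ==> c : carrier R ==> act g (c \<odot>@M v) = c \<odot>@M act g v"
  and act_mul: "g : GD D ==> h : GD D ==> v : carrier M ==> act (m2mul g h) v = act g (act h v)"
  and act_one: "v : carrier M ==> act m2one v = v"
begin

lemma D_simps [simp, intro]: "1 : D" "0 \<notin> D" "x : D ==> y : D ==> x * y : D" "x : D ==> inverse x : D"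
 using D by (auto simp: subgrp_def)

lemma nm_GD [simp, intro]: "nm b : GD D" by (simp add: GD_def m2r)
lemma mul_GD [simp, intro]: "g : GD D ==> h : GD D ==> m2mul g h : GD D" by (simp add: GD_def)
lemma dg_GD [simp]: "dg a d : GD D \<longleftrightarrow> a * d : D" by (simp add: GD_def m2r)
lemma mc_GD [simp]: "c ~= 0 ==> mc c d : GD D \<longleftrightarrow> d : D" by (simp add: GD_def m2r)
lemma bel_GD [simp, intro]: "b : BD D ==> bel b : GD D"
 by (auto simp: bel_def BD_def split: if_splits)
lemma one_GD [simp]: "m2one : GD D" by (simp add: GD_def)

lemma islin_act: "g : GD D ==> islin R M M (act g)"
 by (auto simp: islin_def act_add act_smult)

lemma act_sum: "[|g : GD D; !!x. x : A ==> f x : carrier M|]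
  ==> act g (finsum M f A) = finsum M (%x. act g (f x)) A"
 by (rule islin_sum[OF M.module_axioms M.module_axioms islin_act])

lemma fs_smult:
 "[|c : carrier R; !!x. x : A ==> f x : carrier M|]
  ==> c \<odot>@M finsum M f A = finsum M (%x. c \<odot>@M f x) A"
 by (rule islin_sum[OF M.module_axioms M.module_axioms])
  (auto simp: islin_def M.smult_r_distr M.smult_assoc1[symmetric] R.m_comm)

lemma fs_smult_l:
 assumes "v : carrier M" "!!x. x : A ==> f x : carrier R"
 shows "finsum R f A \<odot>@M v = finsum M (%x. f x \<odot>@M v) A"
 using assms(2)
proof (induction A rule: infinite_finite_induct)
 case (insert x A)
 then show ?case using assms(1)
  by (simp add: R.fsi M.M.fsi M.smult_l_distr)
qed (use assms(1) in \<open>auto simp: R.finsum_infinite M.M.finsum_infinite\<close>)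

abbreviation "inv_sub \<equiv> invsub R M (GD D) act"

end

locale grep = achar R py qi + linact R M D act
 for R (structure) and py :: "'k::{finite,field} => 'a" and qi and M :: "('a,'v) module"
  and D :: "'k set" and act :: "'k m2 => 'v => 'v"
begin

text \<open>The idempotent that projects onto the vectors on which U acts by the character psi(a x);
  \<open>psv a\<close> describes such vectors.\<close>

definition pe :: "'k => 'v => 'v" where
 "pe a v = (\<Oplus>@M b\<in>UNIV. (qi ** py (- (a * b))) \<odot>@M act (nm b) v)"

definition psv :: "'k => 'v => bool" where
 "psv a v \<longleftrightarrow> v : carrier M & (ALL b. act (nm b) v = py (a * b) \<odot>@M v)"

lemma psvD: "psv a v ==> v : carrier M" "psv a v ==> act (nm b) v = py (a * b) \<odot>@M v"
 by (auto simp: psv_def)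

lemma pe_closed [simp, intro]: "v : carrier M ==> pe a v : carrier M"
 by (auto simp: pe_def)

lemma islin_pe: "islin R M M (pe a)"
 unfolding islin_def
proof (intro conjI ballI)
 fix v w assume v: "v : carrier M" and w: "w : carrier M"
 show "pe a v : carrier M" using v by simp
 show "pe a (v \<oplus>@M w) = pe a v \<oplus>@M pe a w"
  using v w unfolding pe_def
  by (subst M.M.fs_add[symmetric]) (auto simp: act_add M.smult_r_distr intro!: M.M.fsc)
next
 fix c v assume c: "c : carrier R" and v: "v : carrier M"
 show "pe a (c \<odot>@M v) = c \<odot>@M pe a v"
  using c v unfolding pe_def
  by (subst fs_smult) (auto simp: act_smult M.smult_assoc1[symmetric] m_ac intro!: M.M.fsc)
qed

lemmas pe_add = islin_add[OF islin_pe] and pe_smult = islin_smult[OF islin_pe]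
 and pe_sum = islin_sum[OF M.module_axioms M.module_axioms islin_pe]

lemma pe_invsub:
 assumes N: "inv_sub N" and v: "v : N"
 shows "pe a v : N"
 unfolding pe_def
proof (rule invsub_sum[OF M.module_axioms N])
 fix b
 have "act (nm b) v : N" by (rule invsub_act[OF N _ v]) simp
 then show "(qi ** py (- (a * b))) \<odot>@M act (nm b) v : N"
  by (rule ivm[OF N, rotated]) simp
qed

lemma act_nm_pe:
 assumes v: "v : carrier M"
 shows "act (nm c) (pe a v) = py (a * c) \<odot>@M pe a v"
proof -
 have "act (nm c) (pe a v) = (\<Oplus>@M b\<in>UNIV. (qi ** py (- (a * b))) \<odot>@M act (nm (c + b)) v)"
  using v unfolding pe_def
  by (subst act_sum) (auto simp: act_smult act_mul[symmetric] m2r)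
 also have "... = (\<Oplus>@M b\<in>UNIV. (qi ** py (- (a * (b - c)))) \<odot>@M act (nm b) v)"
  by (rule M.M.fsw[of _ "%b. b - c" "%b. c + b"]) (use v in auto)
 also have "... = (\<Oplus>@M b\<in>UNIV. py (a * c) \<odot>@M ((qi ** py (- (a * b))) \<odot>@M act (nm b) v))"
 proof (rule M.M.fsc)
  fix b
  have "- (a * (b - c)) = a * c + - (a * b)" by (simp add: algebra_simps)
  then show "(qi ** py (- (a * (b - c)))) \<odot>@M act (nm b) v = py (a * c) \<odot>@M ((qi ** py (- (a * b))) \<odot>@M act (nm b) v)"
   using v by (simp only: psi_add) (simp add: M.smult_assoc1[symmetric] m_ac)
 qed (use v in auto)
 also have "... = py (a * c) \<odot>@M pe a v"
  using v unfolding pe_def by (subst fs_smult) auto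
 finally show ?thesis .
qed

lemma psv_pe: "v : carrier M ==> psv a (pe a v)"
 by (simp add: psv_def act_nm_pe)

lemma pe_psv:
 assumes "psv a' v"
 shows "pe a v = (if a = a' then v else \<zero>@M)"
proof -
 have v: "v : carrier M" using assms psvD by blast
 have "pe a v = (\<Oplus>@M b\<in>UNIV. (qi ** py ((a' - a) * b)) \<odot>@M v)"
  unfolding pe_def
 proof (rule M.M.fsc)
  fix b
  have "(a' - a) * b = - (a * b) + a' * b" by (simp add: algebra_simps)
  then show "(qi ** py (- (a * b))) \<odot>@M act (nm b) v = (qi ** py ((a' - a) * b)) \<odot>@M v"
   using v by (simp only: psi_add psvD(2)[OF assms]) (simp add: M.smult_assoc1[symmetric] m_ac)
 qed (use v in auto)
 also have "... = (\<Oplus>b\<in>UNIV. qi ** py ((a' - a) * b)) \<odot>@M v"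
  using v by (subst fs_smult_l) auto
 also have "(\<Oplus>b\<in>UNIV. qi ** py ((a' - a) * b)) = (if a = a' then \<one> else \<zero>)"
  by (subst fsr) (auto simp: psi_sum_eq)
 finally show ?thesis using v by simp
qed

lemma pe_nm:
 assumes v: "v : carrier M"
 shows "pe a (act (nm c) v) = py (a * c) \<odot>@M pe a v"
proof -
 have "pe a (act (nm c) v) = (\<Oplus>@M b\<in>UNIV. act (nm c) ((qi ** py (- (a * b))) \<odot>@M act (nm b) v))"
  unfolding pe_def by (rule M.M.fsc) (use v in \<open>auto simp: act_smult act_mul[symmetric] m2r add.commute\<close>)
 also have "... = act (nm c) (pe a v)"
  unfolding pe_def using v by (subst act_sum) auto
 finally show ?thesis using v by (simp add: act_nm_pe)
qed

lemma pe_total: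
 assumes v: "v : carrier M"
 shows "(\<Oplus>@M a\<in>UNIV. pe a v) = v"
proof -
 have "(\<Oplus>@M a\<in>UNIV. pe a v) = (\<Oplus>@M b\<in>UNIV. \<Oplus>@M a\<in>UNIV. (qi ** py (- (a * b))) \<odot>@M act (nm b) v)"
  unfolding pe_def using v by (intro M.M.fs_swap) auto
 also have "... = (\<Oplus>@M b\<in>UNIV. (\<Oplus>a\<in>UNIV. qi ** py (a * - b)) \<odot>@M act (nm b) v)"
  using v by (intro M.M.fsc) (auto simp: fs_smult_l)
 also have "... = (\<Oplus>@M b\<in>UNIV. (if b = 0 then \<one> else \<zero>) \<odot>@M act (nm b) v)"
  using v by (intro M.M.fsc, subst fsr) (auto simp: psi_sum_eq' simp del: mult_minus_right)
 also have "... = v"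
  using v by (subst M.M.fs_only[of _ 0]) (auto simp: m2r act_one)
 finally show ?thesis .
qed

lemma psv_dg:
 assumes v: "psv x v" and a: "a * d : D"
 shows "psv (x * d / a) (act (dg a d) v)"
proof -
 have vM: "v : carrier M" using v psvD by blast
 have a0: "a ~= 0" using a by auto
 have "act (nm b) (act (dg a d) v) = py (x * d / a * b) \<odot>@M act (dg a d) v" for b
 proof -
  have "act (nm b) (act (dg a d) v) = act (dg a d) (act (nm (b * d / a)) v)"
   using vM a a0 by (simp add: act_mul[symmetric] m2r)
  then show ?thesis using vM a by (simp add: psvD(2)[OF v] act_smult mult_ac)
 qed
 then show ?thesis using vM a by (simp add: psv_def)
qed

text \<open>The Hecke operator e m e with m = \<open>bel b\<close>; on psi-isotypic vectors the
  right-hand e acts as the identity.\<close>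

definition Tb :: "'k \<times> 'k => 'v => 'v" where
 "Tb b v = pe 1 (act (bel b) v)"

lemma Tb_psv: "b : BD D ==> v : carrier M ==> psv 1 (Tb b v)"
 by (simp add: Tb_def psv_pe)

lemma Tb_scalar:
 assumes "psv 1 v" "(0, z) : BD D"
 shows "Tb (0, z) v = act (dg z z) v" "psv 1 (act (dg z z) v)"
proof -
 have z: "z * z : D" using assms(2) by (simp add: BD_def)
 then have "z ~= 0" by auto
 then show "psv 1 (act (dg z z) v)" using psv_dg[OF assms(1) z] by simp
 then show "Tb (0, z) v = act (dg z z) v" by (simp add: Tb_def bel_def pe_psv)
qed

lemma pe_bruhat:
 assumes v: "psv 1 v" and c: "c ~= 0" and d: "d : D"
 shows "pe 1 (act (m2mul (nm x) (m2mul (mc c d) (nm y))) v) = py (x + y) \<odot>@M Tb (c, d) v"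
proof -
 have vM: "v : carrier M" using v psvD by blast
 have "pe 1 (act (m2mul (nm x) (m2mul (mc c d) (nm y))) v) = pe 1 (act (nm x) (act (mc c d) (act (nm y) v)))"
  using c d vM by (simp add: act_mul)
 also have "... = py y \<odot>@M (py x \<odot>@M pe 1 (act (mc c d) v))"
  using c d vM by (simp add: psvD(2)[OF v] act_smult pe_nm pe_smult)
 finally show ?thesis using c d vM by (simp add: Tb_def bel_def psi_add m_comm[of "py x"] M.smult_assoc1)
qed

text \<open>Structure constants of the Hecke algebra: the middle unipotent element of
 \<open>e m e m' e\<close> is expanded, and each \<open>m n(s) m'\<close> is brought into Bruhat form.\<close>

lemma Tb_mult:
 assumes v: "psv 1 v" and b: "b : BD D" and b': "b' : BD D"
 shows "Tb b (Tb b' v) = (\<Oplus>@M s\<in>UNIV. stc b b' s \<odot>@M Tb (nxt b b' s) v)"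
proof -
 have vM: "v : carrier M" using v psvD by blast
 obtain c d where bb: "b = (c, d)" by force
 obtain c' d' where bb': "b' = (c', d')" by force
 have Tc [simp, intro]: "Tb (nxt b b' s) v : carrier M" for s
  using nxt_BD[OF D b b'] vM Tb_psv psvD by blast
 show ?thesis
 proof (cases "c ~= 0 & c' ~= 0")
  case True
  then have c: "c ~= 0" and c': "c' ~= 0" by auto
  have d: "d : D" and d': "d' : D" using b b' c c' by (auto simp: bb bb' BD_def)
  have "Tb b (Tb b' v) = pe 1 (act (mc c d) (pe 1 (act (mc c' d') v)))"
   using c c' by (simp add: Tb_def bb bb' bel_def)
  also have "... = (\<Oplus>@M s\<in>UNIV. (qi ** py (- s)) \<odot>@M pe 1 (act (m2mul (mc c d) (m2mul (nm s) (mc c' d'))) v))"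
   unfolding pe_def[of 1 "act (mc c' d') v"] using c c' d d' vM
   by (simp add: act_sum pe_sum act_smult pe_smult act_mul)
  also have "... = (\<Oplus>@M s\<in>UNIV. stc b b' s \<odot>@M Tb (nxt b b' s) v)"
  proof (rule M.M.fsc)
   fix s
   show "(qi ** py (- s)) \<odot>@M pe 1 (act (m2mul (mc c d) (m2mul (nm s) (mc c' d'))) v)
    = stc b b' s \<odot>@M Tb (nxt b b' s) v"
   proof (cases "s = 0")
    case False
    have "pe 1 (act (m2mul (mc c d) (m2mul (nm s) (mc c' d'))) v)
     = py (- (d / (c * c)) / s + - (d' / (c' * c')) / s) \<odot>@M Tb (c * c' * s, d * d') v"
     unfolding bruhat_product[OF c c' False] by (rule pe_bruhat[OF v]) (use c c' False d d' in auto)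
    moreover have "py (- s - (d / (c * c) + d' / (c' * c')) / s) = py (- s) ** py (- (d / (c * c)) / s + - (d' / (c' * c')) / s)"
     unfolding psi_add[symmetric] by (intro arg_cong[of _ _ py]) (simp add: add_divide_distrib)
    moreover have "Tb (c * c' * s, d * d') v : carrier M" using Tc[of s] False c c' by (simp add: bb bb' nxt_def)
    ultimately show ?thesis using False c c'
     by (simp add: stc_def nxt_def bb bb' M.smult_assoc1[symmetric] m_assoc)
   next
    case True
    let ?x = "- (d * c' / c)" and ?y = "- (c * d' / c')"
    have xy: "?x * ?y = d * d'" using c c' by simp
    have e: "act (m2mul (mc c d) (m2mul (nm s) (mc c' d'))) v = act (dg ?x ?y) v"
     unfolding True bruhat_product_0[OF c c'] ..
    show ?thesis
    proof (cases "d * c' / c = c * d' / c'")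
     case eq: True
     then have "?x * ?x = d * d'" using xy by simp
     then have "(0, ?x) : BD D" using d d' by (simp add: BD_def)
     then have "Tb (0, ?x) v : carrier M" by (rule psvD(1)[OF Tb_psv[OF _ vM]])
     moreover have "pe 1 (act (dg ?x ?y) v) = Tb (0, ?x) v" using eq by (simp add: Tb_def bel_def)
     ultimately show ?thesis unfolding e using True eq c c' by (simp add: stc_def nxt_def bb bb')
    next
     case neq: False
     have xD: "?x * ?y : D" unfolding xy using d d' by simp
     then have "?x ~= 0" by (metis D_simps(2) mult_zero_left)
     \<comment> \<open>A nonscalar diagonal matrix carries psi to another character, so the
       psi-projection is 0.\<close>
     then have "?y / ?x ~= 1" using neq by (metis divide_eq_1_iff neg_equal_iff_equal)
     then have ne: "1 ~= 1 * ?y / ?x" by (metis mult_1)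
     then have "pe 1 (act (dg ?x ?y) v) = \<zero>@M"
      using pe_psv[OF psv_dg[OF v xD], of 1] unfolding if_not_P[OF ne] by blast
     then show ?thesis unfolding e using True neq c c' vM Tc[of 0] by (simp add: stc_def nxt_def bb bb')
    qed
   qed
  qed auto
  finally show ?thesis .
 next
  case False
  have nx: "nxt b b' s = nxt b b' 0" for s using False by (auto simp: nxt_def bb bb')
  have "(\<Oplus>@M s\<in>UNIV. stc b b' s \<odot>@M Tb (nxt b b' s) v) = stc b b' 0 \<odot>@M Tb (nxt b b' 0) v"
   by (rule M.M.fs_only) (use Tc False in \<open>auto simp: stc_def bb bb'\<close>)
  also have "... = Tb (nxt b b' 0) v"
   using Tc[of 0] False by (auto simp: stc_def bb bb')
  also have "... = Tb b (Tb b' v)"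
  proof -
   consider "c = 0" | "c ~= 0" "c' = 0" using False by blast
   then show ?thesis
   proof cases
    case 1
    then have z: "(0, d) : BD D" "d * d : D" "d ~= 0" using b by (auto simp: bb BD_def)
    have "Tb b (Tb b' v) = act (dg d d) (Tb b' v)"
     using Tb_scalar(1)[OF Tb_psv[OF b' vM] z(1)] by (simp add: bb 1)
    also have "... = pe 1 (act (dg d d) (act (bel b') v))"
    proof -
     let ?w = "act (bel b') v"
     have w: "?w : carrier M" using b' vM by simp
     have "act (dg d d) (pe 1 ?w) = (\<Oplus>@M s\<in>UNIV. (qi ** py (- (1 * s))) \<odot>@M act (nm s) (act (dg d d) ?w))"
      unfolding pe_def using w z
      by (subst act_sum) (auto simp: act_smult act_mul[symmetric] m2r intro!: M.M.fsc)
     then show ?thesis by (simp add: Tb_def pe_def)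
    qed
    also have "act (dg d d) (act (bel b') v) = act (bel (nxt b b' 0)) v"
     using z b' vM by (auto simp: act_mul[symmetric] bb bb' 1 bel_def nxt_def m2r BD_def)
    finally show ?thesis by (simp add: Tb_def)
   next
    case 2
    then have z: "(0, d') : BD D" "d' * d' : D" "d' ~= 0" and d: "d : D" using b' b by (auto simp: bb bb' BD_def)
    have "Tb b (Tb b' v) = pe 1 (act (mc c d) (act (dg d' d') v))"
     using Tb_scalar(1)[OF v z(1)] 2 by (simp add: bb bb' Tb_def bel_def)
    also have "... = Tb (nxt b b' 0) v"
     using 2 z d vM by (simp add: act_mul[symmetric] bb bb' Tb_def bel_def nxt_def m2r)
    finally show ?thesis by simp
   qed
  qed
  finally show ?thesis by simp
 qed
qed

definition hev :: "('k \<times> 'k => 'a) => 'v => bool" where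
 "hev lam v \<longleftrightarrow> psv 1 v & v ~= \<zero>@M & (ALL b:BD D. lam b : carrier R & Tb b v = lam b \<odot>@M v)"

text \<open>The Bruhat decomposition writes g as an element of U times a monomial matrix times an
  element of U, and psi absorbs the outer factors. Hence the eigenvalues determine all these
  projections.\<close>

lemma hev_pe_act:
 assumes "hev lam v" and g: "g : GD D"
 shows "pe 1 (act g v) = mcoef lam g \<odot>@M v"
proof -
 have v: "psv 1 v" and ev: "!!b. b : BD D ==> lam b : carrier R & Tb b v = lam b \<odot>@M v"
  using assms(1) by (auto simp: hev_def)
 have vM: "v : carrier M" using v psvD by blast
 obtain a b c d where gg: "g = (a, b, c, d)" by (cases g)
 have det: "mdet g : D" using g by (simp add: GD_def)
 show ?thesis
 proof (cases "c = 0")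
  case False
  have e: "g = m2mul (nm (a / c)) (m2mul (mc c (mdet g)) (nm (d / c)))"
   unfolding gg mdet_simps by (rule bruhat[OF False])
  have "(c, mdet g) : BD D" using det False by (simp add: BD_def)
  then show ?thesis using ev vM False
   by (subst e, subst pe_bruhat[OF v False det]) (simp add: mcoef_def gg M.smult_assoc1)
 next
  case True
  have ad: "a * d : D" using det by (simp add: gg True)
  then have d0: "d ~= 0" and a0: "a ~= 0" by auto
  have e: "g = m2mul (nm (b / d)) (dg a d)" using borel[OF d0, of a b] by (simp add: gg True)
  have "pe 1 (act g v) = py (b / d) \<odot>@M pe 1 (act (dg a d) v)"
   unfolding e using ad vM by (simp add: act_mul pe_nm)
  also have "pe 1 (act (dg a d) v) = (if a = d then Tb (0, d) v else \<zero>@M)"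
   using pe_psv[OF psv_dg[OF v ad], of 1] a0 by (auto simp: Tb_def bel_def)
  also have "py (b / d) \<odot>@M ... = mcoef lam g \<odot>@M v"
   using ev[of "(0, d)"] ad vM by (auto simp: mcoef_def gg True BD_def M.smult_assoc1)
  finally show ?thesis .
 qed
qed

text \<open>A representation without non-degenerate vectors is trivial on \<open>SL2\<close>, which is generated by
 the upper and lower unipotent matrices.\<close>

lemma degenerate_trivial:
 assumes deg: "!!a v. a ~= 0 ==> v : carrier M ==> pe a v = \<zero>@M"
  and g: "mdet g = 1" and v: "v : carrier M"
 shows "act g v = v"
proof -
 have up: "act (nm b) v = v" if v: "v : carrier M" for b v
 proof -
  have "v = pe 0 v"
   using M.M.fs_only[of UNIV 0 "%a. pe a v"] pe_total[OF v] v deg by simp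
  then show ?thesis using act_nm_pe[OF v, of b 0] v by simp
 qed
 define w where "w = mc 1 (1::'k)"
 have w: "w : GD D" "m2mul w w : GD D" by (simp_all add: w_def)
 define lw :: "'k => 'k m2" where "lw c = (1, 0, c, 1)" for c
 have lwG: "lw c : GD D" for c by (simp add: lw_def GD_def)
 have low: "act (lw c) v = v" if v: "v : carrier M" for c v
 proof -
  \<comment> \<open>Conjugation by \<open>w\<close> turns lower unipotent matrices into upper ones,
    which already act trivially. As \<open>w\<close> has fourth power 1, the vector \<open>u\<close>
    below is a preimage of \<open>v\<close> under \<open>w\<close>.\<close>
  have wl: "m2mul w (m2mul (lw c) w) = m2mul (nm (- c)) (m2mul w w)"
   by (simp add: w_def lw_def mc_def nm_def m2s)
  have inv: "m2mul w (m2mul w (m2mul w w)) = m2one"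
   by (simp add: w_def mc_def m2s m2one_def)
  define u where "u = act w (act w (act w v))"
  have uM: "u : carrier M" using v w by (simp add: u_def)
  have wu: "act w u = v" using v w inv by (simp add: u_def act_mul[symmetric] act_one)
  have "act w (act (lw c) v) = act (m2mul w (m2mul (lw c) w)) u"
   using uM w lwG by (simp add: act_mul wu)
  also have "... = act w (act w u)"
   unfolding wl using uM w up by (simp add: act_mul)
  finally have "act w (act (lw c) v) = act w v" by (simp add: wu)
  moreover have "act w (act w (act w (act w x))) = x" if "x : carrier M" for x
   using that w inv by (simp add: act_mul[symmetric] act_one)
  ultimately show ?thesis using v lwG by (metis act_closed)
 qed
 obtain a b c d where gg: "g = (a, b, c, d)" by (cases g)
 have dt: "a * d - b * c = 1" using g by (simp add: gg)
 have gen: "act (a', b', c', d') u = u" if "c' ~= 0" "a' * d' - b' * c' = 1" "u : carrier M" for a' b' c' d' u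
 proof -
  have "(a', b', c', d') = m2mul (nm ((a' - 1) / c')) (m2mul (lw c') (nm ((d' - 1) / c')))"
   using that by (simp add: nm_def lw_def m2s field_simps)
  then show ?thesis using that up low lwG by (simp add: act_mul)
 qed
 show ?thesis
 proof (cases "c = 0")
  case False
  then show ?thesis using gen dt v by (simp add: gg)
 next
  case True
  then have a0: "a ~= 0" using dt by auto
  have gG: "g : GD D" using g by (simp add: GD_def)
  \<comment> \<open>Adding the first row to the second makes the lower left entry equal to a, which
    is nonzero.\<close>
  have "act (lw 1) (act g v) = act (a, b, a, b + d) v"
   using gG lwG v by (simp add: act_mul[symmetric]) (simp add: lw_def gg True m2s)
  also have "... = v" by (rule gen) (use a0 dt v True in \<open>auto simp: algebra_simps\<close>)
  finally show ?thesis using low gG v by simp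
 qed
qed

end

section \<open>Equivariant isomorphisms\<close>

lemma (in abelian_group) dze:
 assumes "a \<ominus> b = \<zero>" "a : carrier G" "b : carrier G"
 shows "a = b"
proof -
 have "a = (a \<ominus> b) \<oplus> b" using assms(2,3) by (simp add: a_minus_def a_assoc l_neg)
 then show ?thesis using assms by simp
qed

definition eqv :: "('a,'r) ring_scheme => ('a,'v) module => ('g => 'v => 'v) => 'v set
  => ('a,'w) module => ('g => 'w => 'w) => 'w set => 'g set => ('v => 'w) => bool" where
 "eqv R M act N M' act' N' G T \<longleftrightarrow> bij_betw T N N' &
   (ALL v:N. ALL w:N. T (v \<oplus>@M w) = T v \<oplus>@M' T w) &
   (ALL c:carrier R. ALL v:N. T (c \<odot>@M v) = c \<odot>@M' T v) &
   (ALL g:G. ALL v:N. T (act g v) = act' g (T v))"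

lemma eqv_subset: "eqv R M act N M' act' N' G T ==> G' <= G ==> eqv R M act N M' act' N' G' T"
 by (auto simp: eqv_def)

lemma eqv_trans:
 assumes "eqv R M act N M' act' N' G T" "eqv R M' act' N' M'' act'' N'' G T'"
 shows "eqv R M act N M'' act'' N'' G (T' \<circ> T)"
proof -
 have "T v : N'" if "v : N" for v using assms that by (auto simp: eqv_def bij_betw_def)
 then show ?thesis using assms by (auto simp: eqv_def intro: bij_betw_trans)
qed

lemma eqv_inv:
 assumes T: "eqv R M act N M' act' N' G T" and N: "invsub R M G act N"
 shows "eqv R M' act' N' M act N G (inv_into N T)"
proof -
 let ?S = "inv_into N T"
 have bij: "bij_betw T N N'" using T by (auto simp: eqv_def)
 then have bS: "bij_betw ?S N' N" by (rule bij_betw_inv_into)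
 have S: "?S w : N" "T (?S w) = w" if "w : N'" for w
  using bij that by (auto simp: bij_betw_def inv_into_into f_inv_into_f)
 have S': "?S (T v) = v" if "v : N" for v
  using bij that by (auto simp: bij_betw_def)
 have "?S (v \<oplus>@M' w) = ?S v \<oplus>@M ?S w" if "v : N'" "w : N'" for v w
 proof -
  have "T (?S v \<oplus>@M ?S w) = v \<oplus>@M' w" using T S that by (auto simp: eqv_def)
  then show ?thesis using S'[of "?S v \<oplus>@M ?S w"] S that N by (auto simp: invsub_def)
 qed
 moreover have "?S (c \<odot>@M' v) = c \<odot>@M ?S v" if "v : N'" "c : carrier R" for v c
 proof -
  have "T (c \<odot>@M ?S v) = c \<odot>@M' v" using T S that by (auto simp: eqv_def)
  then show ?thesis using S'[of "c \<odot>@M ?S v"] S that N by (auto simp: invsub_def)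
 qed
 moreover have "?S (act' g v) = act g (?S v)" if "v : N'" "g : G" for v g
 proof -
  have "T (act g (?S v)) = act' g v" using T S that by (auto simp: eqv_def)
  then show ?thesis using S'[of "act g (?S v)"] S that N by (auto simp: invsub_def)
 qed
 ultimately show ?thesis using bS by (auto simp: eqv_def)
qed

lemma eqv_zero:
 assumes "module R M" "module R M'" "eqv R M act N M' act' N' G T" "invsub R M G act N" "N' <= carrier M'"
 shows "T \<zero>@M = \<zero>@M'"
proof -
 interpret M: module R M by fact
 interpret M': module R M' by fact
 have z: "\<zero>@M : N" using assms by (auto simp: invsub_def)
 then have "T \<zero>@M : carrier M'" using assms by (auto simp: eqv_def bij_betw_def)
 moreover have "T (\<zero>@R \<odot>@M \<zero>@M) = \<zero>@R \<odot>@M' T \<zero>@M"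
  using assms(3) z M.R.zero_closed unfolding eqv_def by blast
 ultimately show ?thesis using z assms(4) by (simp add: M.smult_r_null)
qed

lemma eqv_image:
 assumes "module R M" "module R M'" "eqv R M act N M' act' N' G T" "invsub R M G act N" "N' <= carrier M'"
  and U: "invsub R M G act U" "U <= N"
 shows "invsub R M' G act' (T ` U)"
proof -
 have z: "T \<zero>@M = \<zero>@M'" by (rule eqv_zero[OF assms(1-5)])
 have T: "T v \<oplus>@M' T w = T (v \<oplus>@M w)" "c : carrier R ==> c \<odot>@M' T v = T (c \<odot>@M v)"
  "g : G ==> act' g (T v) = T (act g v)" if "v : U" "w : U" for v w c g
  using assms(3) U(2) that by (auto simp: eqv_def subset_iff)
 have sub: "T ` U <= carrier M'" using assms(3,5) U(2) by (auto simp: eqv_def bij_betw_def)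
 show ?thesis
  unfolding invsub_def
 proof (intro conjI ballI)
  show "T ` U <= carrier M'" by (rule sub)
  show "\<zero>@M' : T ` U" using z U(1) by (metis imageI invsub_zero)
  fix x assume "x : T ` U"
  then obtain v where v: "v : U" "x = T v" by blast
  show "x \<oplus>@M' y : T ` U" if y: "y : T ` U" for y
  proof -
   obtain w where w: "w : U" "y = T w" using y by blast
   then show ?thesis using T(1)[OF v(1) w(1)] invsub_add[OF U(1) v(1) w(1)] v by simp
  qed
  show "c \<odot>@M' x : T ` U" if c: "c : carrier R" for c
   using T(2)[OF v(1) v(1) c] ivm[OF U(1) c v(1)] v by simp
  show "act' g x : T ` U" if g: "g : G" for g
   using T(3)[OF v(1) v(1) g] invsub_act[OF U(1) g v(1)] v by simp
 qed
qed

text \<open>\<open>has_length\<close> transcribed to invariant subspaces of an arbitrary module, so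
  that it can be carried along equivariant isomorphisms.\<close>

definition hlen :: "('a,'r) ring_scheme => ('a,'v) module => 'g set => ('g => 'v => 'v) => 'v set => nat => bool" where
 "hlen R M G act N m \<longleftrightarrow> (EX W. W 0 = {\<zero>@M} & W m = N & (ALL i<=m. invsub R M G act (W i)) &
   (ALL i<m. W i \<subset> W (Suc i) & ~ (EX U. invsub R M G act U & W i \<subset> U & U \<subset> W (Suc i))))"

lemma hlen_eqv:
 assumes M: "module R M" and M': "module R M'" and T: "eqv R M act N M' act' N' G T"
  and N: "invsub R M G act N" and N': "invsub R M' G act' N'" and h: "hlen R M G act N m"
 shows "hlen R M' G act' N' m"
proof -
 obtain W where W0: "W 0 = {\<zero>@M} & W m = N & (ALL i<=m. invsub R M G act (W i)) &
   (ALL i<m. W i \<subset> W (Suc i) & ~ (EX U. invsub R M G act U & W i \<subset> U & U \<subset> W (Suc i)))"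
  using h unfolding hlen_def by (elim exE) (rule that)
 have W: "W 0 = {\<zero>@M}" "W m = N" "!!i. i <= m ==> invsub R M G act (W i)"
  "!!i. i < m ==> W i \<subset> W (Suc i)"
  "!!i. i < m ==> ~ (EX U. invsub R M G act U & W i \<subset> U & U \<subset> W (Suc i))"
  using W0 by simp_all
 have N's: "N' <= carrier M'" and Ns: "N <= carrier M" using N' N by (auto simp: invsub_def)
 have bij: "bij_betw T N N'" using T by (auto simp: eqv_def)
 have WN: "W i <= N" if "i <= m" for i
  using that
 proof (induction i rule: inc_induct)
  case (step n) then show ?case using W(4)[of n] by auto
 qed (simp add: W(2))
 let ?S = "inv_into N T"
 have S: "eqv R M' act' N' M act N G ?S" by (rule eqv_inv[OF T N])
 have TS: "T ` (?S ` U) = U" if "U <= N'" for U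
  using that bij by (force simp: bij_betw_def f_inv_into_f image_iff)
 have strict: "T ` A \<subset> T ` B" if "A \<subset> B" "B <= N" for A B
  using that bij inj_on_image_eq_iff[of T N A B] by (auto simp: bij_betw_def)
 have strict': "?S ` A \<subset> ?S ` B" if "A \<subset> B" "B <= N'" for A B
  using that S inj_on_image_eq_iff[of ?S N' A B] by (auto simp: eqv_def bij_betw_def)
 have ST: "?S ` (T ` A) = A" if "A <= N" for A
  using that bij by (force simp: bij_betw_def image_iff)
 show ?thesis
  unfolding hlen_def
 proof (intro exI[of _ "%i. T ` W i"] conjI allI impI)
  show "T ` W 0 = {\<zero>@M'}" using eqv_zero[OF M M' T N N's] W(1) by simp
  show "T ` W m = N'" using W(2) bij by (simp add: bij_betw_def)
  show "invsub R M' G act' (T ` W i)" if "i <= m" for i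
   by (rule eqv_image[OF M M' T N N's W(3)[OF that] WN[OF that]])
  show "T ` W i \<subset> T ` W (Suc i)" if "i < m" for i
   using strict[OF W(4)[OF that]] WN[of "Suc i"] that by auto
  show "~ (EX U. invsub R M' G act' U & T ` W i \<subset> U & U \<subset> T ` W (Suc i))" if i: "i < m" for i
  proof
   assume "EX U. invsub R M' G act' U & T ` W i \<subset> U & U \<subset> T ` W (Suc i)"
   then obtain U where U: "invsub R M' G act' U" "T ` W i \<subset> U" "U \<subset> T ` W (Suc i)" by blast
   have Wn: "W i <= N" "W (Suc i) <= N" using WN i by auto
   then have TN: "T ` W (Suc i) <= N'" using bij by (auto simp: bij_betw_def)
   have UN: "U <= N'" using U(3) TN by blast
   have "invsub R M G act (?S ` U)" by (rule eqv_image[OF M' M S N' Ns U(1) UN])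
   moreover have "W i \<subset> ?S ` U" using strict'[OF U(2) UN] ST[OF Wn(1)] by simp
   moreover have "?S ` U \<subset> W (Suc i)" using strict'[OF U(3) TN] ST[OF Wn(2)] by simp
   ultimately show False using W(5)[OF i] by blast
  qed
 qed
qed

context linact
begin

lemma act_zero: "g : GD D ==> act g \<zero>@M = \<zero>@M"
 by (rule islin_zero[OF M.module_axioms M.module_axioms islin_act])

lemma invsub_zero_space: "inv_sub {\<zero>@M}"
 by (auto simp: invsub_def act_zero)

lemma hlen_1:
 assumes "irrsub R M (GD D) act N" "N ~= {\<zero>@M}"
 shows "hlen R M (GD D) act N 1"
proof -
 have N: "inv_sub N" and irr: "!!U. inv_sub U ==> U <= N ==> U = {\<zero>@M} \<or> U = N"
  using assms by (auto simp: irrsub_def)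
 have z: "\<zero>@M : N" using N by (auto simp: invsub_def)
 define W where "W i = (if i = 0 then {\<zero>@M} else N)" for i :: nat
 have "~ (EX U. inv_sub U & {\<zero>@M} \<subset> U & U \<subset> N)" using irr by blast
 then show ?thesis
  unfolding hlen_def
  by (intro exI[of _ W]) (use z assms(2) N invsub_zero_space in \<open>auto simp: W_def\<close>)
qed

lemma hlen_2:
 assumes "inv_sub N" "inv_sub N1" "\<zero>@M : N1" "N1 ~= {\<zero>@M}" "N1 \<subset> N"
  and irr1: "!!U. inv_sub U ==> U \<subset> N1 ==> U = {\<zero>@M}"
  and irr2: "!!U. inv_sub U ==> N1 \<subset> U ==> U <= N ==> U = N"
 shows "hlen R M (GD D) act N 2"
proof -
 define W where "W i = (if i = 0 then {\<zero>@M} else if i = 1 then N1 else N)" for i :: nat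
 have "{\<zero>@M} \<subset> N1" using assms by auto
 moreover have "~ (EX U. inv_sub U & {\<zero>@M} \<subset> U & U \<subset> N1)" using irr1 by blast
 moreover have "~ (EX U. inv_sub U & N1 \<subset> U & U \<subset> N)" using irr2 by blast
 ultimately show ?thesis
  unfolding hlen_def
  by (intro exI[of _ W]) (use assms(1,2,5) invsub_zero_space in \<open>auto simp: W_def less_2_cases_iff\<close>)
qed

lemma inverse_GD:
 assumes "g : GD D"
 obtains h where "h : GD D" "m2mul g h = m2one" "m2mul h g = m2one"
proof -
 obtain a b c d where g: "g = (a, b, c, d)" by (cases g)
 let ?D = "a * d - b * c"
 have D: "?D : D" using assms by (simp add: GD_def g)
 then have D0: "?D ~= 0" by auto
 define e where "e = inverse ?D"
 have e: "a * d * e - b * c * e = 1"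
  using D0 by (simp add: e_def left_diff_distrib[symmetric])
 let ?h = "(d * e, - b * e, - c * e, a * e)"
 have "mdet ?h = (a * d * e - b * c * e) * e" by (simp add: algebra_simps)
 then have "mdet ?h = e" by (simp add: e)
 moreover have "e : D" using D by (simp add: e_def)
 ultimately have "?h : GD D" by (simp only: GD_def mem_Collect_eq)
 moreover have "m2mul g ?h = m2one" "m2mul ?h g = m2one"
  using e by (simp_all add: g m2s m2one_def algebra_simps)
 ultimately show ?thesis using that by blast
qed

end

text \<open>The submodule generated by \<open>(v, v')\<close> in the sum of two irreducible modules.\<close>

inductive gam :: "('a,'r) ring_scheme => 'g set => ('a,'v) module => ('g => 'v => 'v) => 'v
  => ('a,'w) module => ('g => 'w => 'w) => 'w => 'v => 'w => bool"
 for R G M act v M' act' v' where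
 gen: "gam R G M act v M' act' v' v v'"
| add: "gam R G M act v M' act' v' x x' ==> gam R G M act v M' act' v' y y'
  ==> gam R G M act v M' act' v' (x \<oplus>@M y) (x' \<oplus>@M' y')"
| smult: "gam R G M act v M' act' v' x x' ==> c : carrier R
  ==> gam R G M act v M' act' v' (c \<odot>@M x) (c \<odot>@M' x')"
| act: "gam R G M act v M' act' v' x x' ==> g : G
  ==> gam R G M act v M' act' v' (act g x) (act' g x')"

text \<open>A Goursat argument. Equal matrix coefficients prevent the submodule generated by (v, v')
  from containing (v, 0) or (0, v'). By irreducibility its intersections with both summands vanish
  and its projections are onto, so it is the graph of an isomorphism.\<close>

lemma irr_iso:
 fixes R :: "('a,'r) ring_scheme" and D :: "'k::{finite,field} set"
 assumes "linact R M D act" "linact R M' D act'"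
  and irr: "irrsub R M (GD D) act N" and irr': "irrsub R M' (GD D) act' N'"
  and v: "v : N" "v ~= \<zero>@M" and v': "v' : N'" "v' ~= \<zero>@M'"
  and E: "islin R M M E" "E v = v" and E': "islin R M' M' E'" "E' v' = v'"
  and m: "!!g. g : GD D ==> lam g : carrier R & E (act g v) = lam g \<odot>@M v & E' (act' g v') = lam g \<odot>@M' v'"
 shows "EX T. eqv R M act N M' act' N' (GD D) T"
proof -
 interpret A: linact R M D act by fact
 interpret A': linact R M' D act' by fact
 have N: "invsub R M (GD D) act N" and N': "invsub R M' (GD D) act' N'"
  using irr irr' by (auto simp: irrsub_def)
 let ?g = "gam R (GD D) M act v M' act' v'"
 have mem: "x : N & x' : N'" if "?g x x'" for x x'
  using that by induction (use v v' N N' in \<open>auto simp: invsub_def\<close>)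
 have memM: "x : carrier M" "x' : carrier M'" if "?g x x'" for x x'
  using mem[OF that] N N' by (auto simp: invsub_def)
 have vM: "v : carrier M" "v' : carrier M'" using v v' N N' by (auto simp: invsub_def)
 \<comment> \<open>On every pair in the submodule, both projections of a translate read off the same
   scalar.\<close>
 have ev: "ALL h:GD D. EX c:carrier R. E (act h x) = c \<odot>@M v & E' (act' h x') = c \<odot>@M' v'" if "?g x x'" for x x'
  using that
 proof induction
  case gen
  then show ?case using m by blast
 next
  case (add x x' y y')
  show ?case
  proof
   fix h assume h: "h : GD D"
   obtain c c' where c: "c : carrier R" "E (act h x) = c \<odot>@M v" "E' (act' h x') = c \<odot>@M' v'"
    and c': "c' : carrier R" "E (act h y) = c' \<odot>@M v" "E' (act' h y') = c' \<odot>@M' v'"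
    using add.IH h by blast
   have "E (act h (x \<oplus>@M y)) = (c \<oplus>@R c') \<odot>@M v"
    using memM[OF add.hyps(1)] memM[OF add.hyps(2)] h c c' vM
    by (simp add: A.act_add islin_add[OF E(1)] A.M.smult_l_distr)
   moreover have "E' (act' h (x' \<oplus>@M' y')) = (c \<oplus>@R c') \<odot>@M' v'"
    using memM[OF add.hyps(1)] memM[OF add.hyps(2)] h c c' vM
    by (simp add: A'.act_add islin_add[OF E'(1)] A'.M.smult_l_distr)
   ultimately show "EX c:carrier R. E (act h (x \<oplus>@M y)) = c \<odot>@M v & E' (act' h (x' \<oplus>@M' y')) = c \<odot>@M' v'"
    using c c' by blast
  qed
 next
  case (smult x x' b)
  show ?case
  proof
   fix h assume h: "h : GD D"
   obtain c where c: "c : carrier R" "E (act h x) = c \<odot>@M v" "E' (act' h x') = c \<odot>@M' v'"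
    using smult.IH h by blast
   have "E (act h (b \<odot>@M x)) = (b **@R c) \<odot>@M v"
    using memM[OF smult.hyps(1)] smult.hyps h c vM
    by (simp add: A.act_smult islin_smult[OF E(1)] A.M.smult_assoc1)
   moreover have "E' (act' h (b \<odot>@M' x')) = (b **@R c) \<odot>@M' v'"
    using memM[OF smult.hyps(1)] smult.hyps h c vM
    by (simp add: A'.act_smult islin_smult[OF E'(1)] A'.M.smult_assoc1)
   ultimately show "EX c:carrier R. E (act h (b \<odot>@M x)) = c \<odot>@M v & E' (act' h (b \<odot>@M' x')) = c \<odot>@M' v'"
    using c smult.hyps by blast
  qed
 next
  case (act x x' g)
  show ?case
  proof
   fix h assume h: "h : GD D"
   then have "E (act h (act g x)) = E (act (m2mul h g) x)" "E' (act' h (act' g x')) = E' (act' (m2mul h g) x')"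
    using memM[OF act.hyps(1)] act.hyps by (simp_all add: A.act_mul A'.act_mul)
   then show "EX c:carrier R. E (act h (act g x)) = c \<odot>@M v & E' (act' h (act' g x')) = c \<odot>@M' v'"
    using act.IH h act.hyps A.mul_GD by metis
  qed
 qed
 have one: "m2one : GD D" by simp
 have smult_zero: "c = \<zero>@R" if "c : carrier R" "c \<odot>@M v = \<zero>@M" for c
 proof (rule ccontr)
  assume "c ~= \<zero>@R"
  then have "v : {\<zero>@M}"
   using ivc[OF A.R.field_axioms A.M.module_axioms A.invsub_zero_space, of c v] that vM by blast
  then show False using v by simp
 qed
 have smult_zero': "c = \<zero>@R" if "c : carrier R" "c \<odot>@M' v' = \<zero>@M'" for c
 proof (rule ccontr)
  assume "c ~= \<zero>@R"
  then have "v' : {\<zero>@M'}"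
   using ivc[OF A.R.field_axioms A'.M.module_axioms A'.invsub_zero_space, of c v'] that vM by blast
  then show False using v' by simp
 qed
 have E0: "E \<zero>@M = \<zero>@M" "E' \<zero>@M' = \<zero>@M'"
  by (rule islin_zero[OF A.M.module_axioms A.M.module_axioms E(1)])
    (rule islin_zero[OF A'.M.module_axioms A'.M.module_axioms E'(1)])
 have zero_gam: "?g \<zero>@M \<zero>@M'"
  using gam.smult[OF gam.gen, of "\<zero>@R" R "GD D" M act v M' act' v'] vM by simp
 \<comment> \<open>With h = 1, the second component forces the common scalar to be 0, and the first
   forces it to be 1.\<close>
 have not_v: "~ ?g v \<zero>@M'"
 proof
  assume "?g v \<zero>@M'"
  then obtain c where c: "c : carrier R" "E (act m2one v) = c \<odot>@M v" "E' (act' m2one \<zero>@M') = c \<odot>@M' v'"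
   using ev one by blast
  then have "c = \<zero>@R" using smult_zero' E0 A'.act_zero[OF one] by simp
  then show False using c vM v by (simp add: A.act_one E)
 qed
 have not_v': "~ ?g \<zero>@M v'"
 proof
  assume "?g \<zero>@M v'"
  then obtain c where c: "c : carrier R" "E (act m2one \<zero>@M) = c \<odot>@M v" "E' (act' m2one v') = c \<odot>@M' v'"
   using ev one by blast
  then have "c = \<zero>@R" using smult_zero E0 A.act_zero[OF one] by simp
  then show False using c vM v' by (simp add: A'.act_one E')
 qed
 have "invsub R M (GD D) act {x. ?g x \<zero>@M'}"
  unfolding invsub_def
 proof (intro conjI ballI)
  show "{x. ?g x \<zero>@M'} <= carrier M" using memM by blast
  show "\<zero>@M : {x. ?g x \<zero>@M'}" using zero_gam by simp
  fix x assume x: "x : {x. ?g x \<zero>@M'}"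
  show "x \<oplus>@M y : {x. ?g x \<zero>@M'}" if "y : {x. ?g x \<zero>@M'}" for y
   using gam.add[of R "GD D" M act v M' act' v' x "\<zero>@M'" y "\<zero>@M'"] x that by simp
  show "c \<odot>@M x : {x. ?g x \<zero>@M'}" if "c : carrier R" for c
   using gam.smult[of R "GD D" M act v M' act' v' x "\<zero>@M'" c] x that by simp
  show "act g x : {x. ?g x \<zero>@M'}" if "g : GD D" for g
   using gam.act[of R "GD D" M act v M' act' v' x "\<zero>@M'" g] x that A'.act_zero by simp
 qed
 moreover have "{x. ?g x \<zero>@M'} <= N" using mem by blast
 ultimately have K: "{x. ?g x \<zero>@M'} = {\<zero>@M}"
  using irr not_v v unfolding irrsub_def by blast
 have "invsub R M' (GD D) act' {x'. ?g \<zero>@M x'}"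
  unfolding invsub_def
 proof (intro conjI ballI)
  show "{x. ?g \<zero>@M x} <= carrier M'" using memM by blast
  show "\<zero>@M' : {x. ?g \<zero>@M x}" using zero_gam by simp
  fix x assume x: "x : {x. ?g \<zero>@M x}"
  show "x \<oplus>@M' y : {x. ?g \<zero>@M x}" if "y : {x. ?g \<zero>@M x}" for y
   using gam.add[of R "GD D" M act v M' act' v' "\<zero>@M" x "\<zero>@M" y] x that by simp
  show "c \<odot>@M' x : {x. ?g \<zero>@M x}" if "c : carrier R" for c
   using gam.smult[of R "GD D" M act v M' act' v' "\<zero>@M" x c] x that by simp
  show "act' g x : {x. ?g \<zero>@M x}" if "g : GD D" for g
   using gam.act[of R "GD D" M act v M' act' v' "\<zero>@M" x g] x that A.act_zero by simp
 qed
 moreover have "{x. ?g \<zero>@M x} <= N'" using mem by blast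
 ultimately have K': "{x. ?g \<zero>@M x} = {\<zero>@M'}"
  using irr' not_v' v' unfolding irrsub_def by blast
 have "invsub R M (GD D) act {x. EX x'. ?g x x'}"
  unfolding invsub_def using memM zero_gam by (auto intro: gam.intros)
 moreover have "{x. EX x'. ?g x x'} <= N" using mem by blast
 moreover have "v : {x. EX x'. ?g x x'}" using gam.gen[of R "GD D" M act v M' act' v'] by blast
 ultimately have P: "{x. EX x'. ?g x x'} = N"
  using irr v unfolding irrsub_def by blast
 have "invsub R M' (GD D) act' {x'. EX x. ?g x x'}"
  unfolding invsub_def using memM zero_gam by (auto intro: gam.intros)
 moreover have "{x'. EX x. ?g x x'} <= N'" using mem by blast
 moreover have "v' : {x'. EX x. ?g x x'}" using gam.gen[of R "GD D" M act v M' act' v'] by blast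
 ultimately have P': "{x'. EX x. ?g x x'} = N'"
  using irr' v' unfolding irrsub_def by blast
 have minus: "?g (x \<oplus>@M (\<ominus>@R \<one>@R) \<odot>@M y) (x' \<oplus>@M' (\<ominus>@R \<one>@R) \<odot>@M' y')" if "?g x x'" "?g y y'" for x x' y y'
  by (rule gam.add[OF that(1) gam.smult[OF that(2)]]) simp
 have func: "x' = y'" if "?g x x'" "?g x y'" for x x' y'
 proof -
  have "x \<oplus>@M (\<ominus>@R \<one>@R) \<odot>@M x = \<zero>@M" using memM[OF that(1)] by (simp add: A.M.smult_l_minus A.M.M.r_neg)
  then have "x' \<oplus>@M' (\<ominus>@R \<one>@R) \<odot>@M' y' = \<zero>@M'" using minus[OF that] K' by auto
  then have "x' \<ominus>@M' y' = \<zero>@M'" using memM[OF that(2)] by (simp add: A'.M.smult_l_minus a_minus_def)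
  then show ?thesis using memM[OF that(1)] memM[OF that(2)] A'.M.M.dze by blast
 qed
 have inj: "x = y" if "?g x x'" "?g y x'" for x x' y
 proof -
  have "x' \<oplus>@M' (\<ominus>@R \<one>@R) \<odot>@M' x' = \<zero>@M'" using memM[OF that(1)] by (simp add: A'.M.smult_l_minus A'.M.M.r_neg)
  then have "x \<oplus>@M (\<ominus>@R \<one>@R) \<odot>@M y = \<zero>@M" using minus[OF that] K by auto
  then have "x \<ominus>@M y = \<zero>@M" using memM[OF that(2)] by (simp add: A.M.smult_l_minus a_minus_def)
  then show ?thesis using memM[OF that(1)] memM[OF that(2)] A.M.M.dze by blast
 qed
 define T where "T x = (THE x'. ?g x x')" for x
 have T: "?g x (T x)" if "x : N" for x
  unfolding T_def by (rule theI') (use that P func in blast)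
 have T_eq: "T x = x'" if "?g x x'" for x x'
  using T[of x] mem[OF that] func that by blast
 have "bij_betw T N N'"
  unfolding bij_betw_def
 proof
  show "inj_on T N" by (rule inj_onI) (metis T inj)
  show "T ` N = N'" using mem T T_eq P' by (auto simp: image_iff) metis
 qed
 then have "eqv R M act N M' act' N' (GD D) T"
  unfolding eqv_def by (auto intro!: T_eq gam.add gam.smult gam.act T)
 then show ?thesis by blast
qed

section \<open>Function modules and their matrices\<close>

text \<open>Functions on \<open>I\<close> are extended by zero, so that equal vectors are equal
  functions.\<close>

definition fmod :: "('a,'r) ring_scheme => 'i set => ('a, 'i => 'a) module" where
 "fmod R I = \<lparr> carrier = {v. (ALL i:I. v i : carrier R) & (ALL i. i \<notin> I --> v i = \<zero>@R)},
   Group.monoid.mult = (%v w. v), Group.monoid.one = (%i. \<zero>@R), Ring.ring.zero = (%i. \<zero>@R),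
   Ring.ring.add = (%v w i. v i \<oplus>@R w i), Module.module.smult = (%c v i. c **@R v i) \<rparr>"

definition kact :: "('a,'r) ring_scheme => 'i set => ('g => 'i => 'i => 'a) => 'g => ('i => 'a) => 'i => 'a" where
 "kact R I K g v = (%i. if i : I then finsum R (%j. K g i j **@R v j) I else \<zero>@R)"

definition dl :: "('a,'r) ring_scheme => 'i => 'i => 'a" where
 "dl R i = (%j. if j = i then \<one>@R else \<zero>@R)"

lemma fmod_simps [simp]:
 "\<zero>@(fmod R I) = (%i. \<zero>@R)"
 "v \<oplus>@(fmod R I) w = (%i. v i \<oplus>@R w i)"
 "c \<odot>@(fmod R I) v = (%i. c **@R v i)"
 by (auto simp: fmod_def)

lemma fmr: "v : carrier (fmod R I) \<longleftrightarrow> (ALL i:I. v i : carrier R) & (ALL i. i \<notin> I --> v i = \<zero>@R)"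
 by (auto simp: fmod_def)

context Ring.field
begin

lemma fmc: "v : carrier (fmod R I) ==> v i : carrier R"
 by (cases "i : I") (auto simp: fmr)

lemma fmm: "module R (fmod R I)"
proof (rule moduleI)
 show "abelian_group (fmod R I)"
 proof (rule abelian_groupI)
  fix x assume x: "x : carrier (fmod R I)"
  show "EX y:carrier (fmod R I). y \<oplus>@(fmod R I) x = \<zero>@(fmod R I)"
   by (rule bexI[of _ "%i. \<ominus> x i"]) (use x fmc[OF x] in \<open>auto simp: fmr l_neg\<close>)
 next
  fix x y z assume x: "x : carrier (fmod R I)" and y: "y : carrier (fmod R I)" and z: "z : carrier (fmod R I)"
  note cl = fmc[OF x] fmc[OF y] fmc[OF z]
  show "x \<oplus>@(fmod R I) y : carrier (fmod R I)" using x y by (auto simp: fmr)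
  show "x \<oplus>@(fmod R I) y = y \<oplus>@(fmod R I) x" using cl by (simp add: a_comm)
  show "x \<oplus>@(fmod R I) y \<oplus>@(fmod R I) z = x \<oplus>@(fmod R I) (y \<oplus>@(fmod R I) z)" using cl by (simp add: a_assoc)
  show "\<zero>@(fmod R I) \<oplus>@(fmod R I) x = x" using cl by simp
 qed (simp add: fmr)
 show "a \<odot>@(fmod R I) x : carrier (fmod R I)" if "a : carrier R" "x : carrier (fmod R I)" for a x
  using that by (auto simp: fmr)
 show "(a \<oplus> b) \<odot>@(fmod R I) x = a \<odot>@(fmod R I) x \<oplus>@(fmod R I) b \<odot>@(fmod R I) x"
  if "a : carrier R" "b : carrier R" "x : carrier (fmod R I)" for a b x
  using that(1,2) fmc[OF that(3)] by (simp add: l_distr)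
 show "a \<odot>@(fmod R I) (x \<oplus>@(fmod R I) y) = a \<odot>@(fmod R I) x \<oplus>@(fmod R I) a \<odot>@(fmod R I) y"
  if "a : carrier R" "x : carrier (fmod R I)" "y : carrier (fmod R I)" for a x y
  using that(1) fmc[OF that(2)] fmc[OF that(3)] by (simp add: r_distr)
 show "(a ** b) \<odot>@(fmod R I) x = a \<odot>@(fmod R I) (b \<odot>@(fmod R I) x)"
  if "a : carrier R" "b : carrier R" "x : carrier (fmod R I)" for a b x
  using that(1,2) fmc[OF that(3)] by (simp add: m_assoc)
 show "\<one> \<odot>@(fmod R I) x = x" if "x : carrier (fmod R I)" for x
  using fmc[OF that] by simp
qed (rule is_cring)

lemma fmod_sum:
 assumes "!!x. x : A ==> f x : carrier (fmod R I)"
 shows "finsum (fmod R I) f A i = (\<Oplus>x\<in>A. f x i)"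
proof -
 interpret M: module R "fmod R I" by (rule fmm)
 show ?thesis
  using assms
 proof (induction A rule: infinite_finite_induct)
  case (insert x A)
  then show ?case
   by (subst M.M.fsi, simp, simp, simp, subst fsi) (auto intro!: fmc[of _ I])
 qed (auto simp: finsum_infinite M.M.finsum_infinite)
qed

lemma dl_closed [simp, intro]: "i : I ==> dl R i : carrier (fmod R I)"
 by (auto simp: dl_def fmr)

lemma fmod_expand:
 assumes "finite I" "v : carrier (fmod R I)"
 shows "v = finsum (fmod R I) (%i. v i \<odot>@(fmod R I) dl R i) I"
proof
 interpret M: module R "fmod R I" by (rule fmm)
 fix j
 have "finsum (fmod R I) (%i. v i \<odot>@(fmod R I) dl R i) I j = (\<Oplus>i\<in>I. (v i \<odot>@(fmod R I) dl R i) j)"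
  by (rule fmod_sum) (use fmc[OF assms(2)] in \<open>intro M.smult_closed; auto\<close>)
 also have "... = v j"
 proof (cases "j : I")
  case True
  then show ?thesis using assms fmc[OF assms(2)]
   by (subst fs_only[of I j]) (auto simp: dl_def)
 next
  case False
  then show ?thesis using assms fmc[OF assms(2)]
   by (subst fs_zero) (auto simp: dl_def fmr)
 qed
 finally show "v j = finsum (fmod R I) (%i. v i \<odot>@(fmod R I) dl R i) I j" by simp
qed

lemma kact_closed:
 assumes "!!i j. i : I ==> j : I ==> K g i j : carrier R" "v : carrier (fmod R I)"
 shows "kact R I K g v : carrier (fmod R I)"
 using assms by (auto simp: fmr kact_def)

lemma kact_dl:
 assumes "finite I" "i : I" "j : I" "!!i j. i : I ==> j : I ==> K g i j : carrier R"
 shows "kact R I K g (dl R j) i = K g i j"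
 using assms unfolding kact_def
 by (subst fs_only[of I j]) (auto simp: dl_def)

lemma krep_linact:
 fixes D :: "'k::{finite,field} set"
 assumes K: "krep R (GD D) I K" and D: "subgrp D" and I: "finite I"
 shows "linact R (fmod R I) D (kact R I K)"
proof (intro linact.intro linact_axioms.intro)
 have Kc: "K g i j : carrier R" if "g : GD D" "i : I" "j : I" for g i j
  using K that by (auto simp: krep_def)
 show "Ring.field R" by (rule field_axioms)
 show "module R (fmod R I)" by (rule fmm)
 show "subgrp D" by fact
 fix g :: "'k m2" and v w assume g: "g : GD D" and v: "v : carrier (fmod R I)"
 show "kact R I K g v : carrier (fmod R I)" by (rule kact_closed) (use Kc g v in auto)
 show "kact R I K g (v \<oplus>@(fmod R I) w) = kact R I K g v \<oplus>@(fmod R I) kact R I K g w" if w: "w : carrier (fmod R I)"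
 proof
  fix i
  show "kact R I K g (v \<oplus>@(fmod R I) w) i = (kact R I K g v \<oplus>@(fmod R I) kact R I K g w) i"
  proof (cases "i : I")
   case True
   note cl = Kc[OF g] fmc[OF v] fmc[OF w]
   have "(\<Oplus>j\<in>I. K g i j ** (v j \<oplus> w j)) = (\<Oplus>j\<in>I. K g i j ** v j \<oplus> K g i j ** w j)"
    by (rule fsc) (use cl True in \<open>auto simp: r_distr\<close>)
   also have "... = (\<Oplus>j\<in>I. K g i j ** v j) \<oplus> (\<Oplus>j\<in>I. K g i j ** w j)"
    by (rule fs_add) (use cl True in auto)
   finally show ?thesis using True by (simp add: kact_def)
  qed (simp add: kact_def)
 qed
 show "kact R I K g (c \<odot>@(fmod R I) v) = c \<odot>@(fmod R I) kact R I K g v" if c: "c : carrier R" for c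
 proof
  fix i
  show "kact R I K g (c \<odot>@(fmod R I) v) i = (c \<odot>@(fmod R I) kact R I K g v) i"
  proof (cases "i : I")
   case True
   note cl = Kc[OF g] fmc[OF v] c
   have "(\<Oplus>j\<in>I. K g i j ** (c ** v j)) = (\<Oplus>j\<in>I. c ** (K g i j ** v j))"
    by (rule fsc) (use cl True in \<open>auto simp: m_lcomm\<close>)
   also have "... = c ** (\<Oplus>j\<in>I. K g i j ** v j)"
    by (rule fsr) (use cl True in auto)
   finally show ?thesis using True by (simp add: kact_def)
  qed (use c in \<open>simp add: kact_def\<close>)
 qed
 show "kact R I K (m2mul g h) v = kact R I K g (kact R I K h v)" if h: "h : GD D" for h
 proof
  fix i
  show "kact R I K (m2mul g h) v i = kact R I K g (kact R I K h v) i"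
  proof (cases "i : I")
   case True
   have "kact R I K (m2mul g h) v i = (\<Oplus>j\<in>I. (\<Oplus>k\<in>I. K g i k ** K h k j) ** v j)"
   proof -
    have "(\<Oplus>j\<in>I. K (m2mul g h) i j ** v j) = (\<Oplus>j\<in>I. (\<Oplus>k\<in>I. K g i k ** K h k j) ** v j)"
     by (rule fsc) (use True K Kc g h fmc[OF v] in \<open>auto simp: krep_def\<close>)
    then show ?thesis using True by (simp add: kact_def)
   qed
   also have "... = (\<Oplus>j\<in>I. \<Oplus>k\<in>I. K g i k ** (K h k j ** v j))"
   proof (rule fsc)
    fix j assume j: "j : I"
    have "(\<Oplus>k\<in>I. K g i k ** K h k j) ** v j = (\<Oplus>k\<in>I. K g i k ** K h k j ** v j)"
     by (rule fsl[symmetric]) (use j True Kc g h fmc[OF v] in auto)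
    also have "... = (\<Oplus>k\<in>I. K g i k ** (K h k j ** v j))"
     by (rule fsc) (use j True Kc g h fmc[OF v] in \<open>auto simp: m_assoc\<close>)
    finally show "(\<Oplus>k\<in>I. K g i k ** K h k j) ** v j = (\<Oplus>k\<in>I. K g i k ** (K h k j ** v j))" .
   qed (use True Kc g h fmc[OF v] in auto)
   also have "... = (\<Oplus>k\<in>I. \<Oplus>j\<in>I. K g i k ** (K h k j ** v j))"
    using True Kc g h fmc[OF v] I by (intro fs_swap) auto
   also have "... = kact R I K g (kact R I K h v) i"
   proof -
    have "(\<Oplus>k\<in>I. \<Oplus>j\<in>I. K g i k ** (K h k j ** v j)) = (\<Oplus>k\<in>I. K g i k ** (\<Oplus>j\<in>I. K h k j ** v j))"
    proof (rule fsc)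
     fix k assume k: "k : I"
     show "(\<Oplus>j\<in>I. K g i k ** (K h k j ** v j)) = K g i k ** (\<Oplus>j\<in>I. K h k j ** v j)"
      by (rule fsr) (use k True Kc g h fmc[OF v] in auto)
    qed (use True Kc g h fmc[OF v] in auto)
    also have "... = (\<Oplus>k\<in>I. K g i k ** kact R I K h v k)"
     by (rule fsc) (use True Kc g h fmc[OF v] in \<open>auto simp: kact_def\<close>)
    finally show ?thesis using True by (simp add: kact_def)
   qed
   finally show ?thesis .
  qed (simp add: kact_def)
 qed
next
 fix v assume v: "v : carrier (fmod R I)"
 show "kact R I K m2one v = v"
 proof
  fix i
  show "kact R I K m2one v i = v i"
  proof (cases "i : I")
   case True
   have "kact R I K m2one v i = (\<Oplus>j\<in>I. (if i = j then \<one> else \<zero>) ** v j)"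
   proof -
    have "(\<Oplus>j\<in>I. K m2one i j ** v j) = (\<Oplus>j\<in>I. (if i = j then \<one> else \<zero>) ** v j)"
     by (rule fsc) (use True K fmc[OF v] in \<open>auto simp: krep_def\<close>)
    then show ?thesis using True by (simp add: kact_def)
   qed
   also have "... = v i" using True I fmc[OF v] by (subst fs_only[of I i]) auto
   finally show ?thesis .
  qed (use v in \<open>simp add: kact_def fmr\<close>)
 qed
qed

text \<open>Gaussian elimination: induction on the target, removing one coordinate with the help of
  one pivot basis vector of the source.\<close>

lemma islin_kernel_nonzero:
 assumes "finite J" "finite I" "card J < card I" "islin R (fmod R I) (fmod R J) T"
 shows "EX v:carrier (fmod R I). v ~= (%i. \<zero>) & T v = (%i. \<zero>)"
 using assms
proof (induction J arbitrary: I T rule: finite_induct)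
 case empty
 then obtain i where i: "i : I" by fastforce
 have "dl R i i ~= \<zero>" by (simp add: dl_def)
 then have "dl R i ~= (%i. \<zero>)" by metis
 moreover have "T (dl R i) = (%i. \<zero>)"
  using islc[OF empty(3) dl_closed[OF i]] by (auto simp: fmr)
 ultimately show ?case using i by blast
next
 case (insert j J)
 have T: "islin R (fmod R I) (fmod R (insert j J)) T" by fact
 interpret M: module R "fmod R I" by (rule fmm)
 show ?case
 proof (cases "ALL v:carrier (fmod R I). T v j = \<zero>")
  case True
  have "islin R (fmod R I) (fmod R J) T"
   unfolding islin_def
  proof (intro conjI ballI)
   fix v assume v: "v : carrier (fmod R I)"
   show "T v : carrier (fmod R J)"
    using islc[OF T v] True v unfolding fmr[of "T v"] by (metis insert_iff)
  qed (use T in \<open>simp_all add: islin_def\<close>)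
  then show ?thesis using insert by (intro insert.IH) auto
 next
  case False
  have "EX i:I. T (dl R i) j ~= \<zero>"
  proof (rule ccontr)
   assume "~ ?thesis"
   then have z: "T (dl R i) j = \<zero>" if "i : I" for i using that by blast
   have "T v j = \<zero>" if v: "v : carrier (fmod R I)" for v
   proof -
    have sc: "v i \<odot>@(fmod R I) dl R i : carrier (fmod R I)" if "i : I" for i
     using that v by (intro M.smult_closed) (auto simp: fmc)
    have "T v = finsum (fmod R (insert j J)) (%i. T (v i \<odot>@(fmod R I) dl R i)) I"
     by (subst fmod_expand[OF insert(4) v], rule islin_sum[OF fmm fmm T]) (rule sc)
    then have "T v j = finsum (fmod R (insert j J)) (%i. T (v i \<odot>@(fmod R I) dl R i)) I j"
     by (rule fun_cong)
    also have "... = (\<Oplus>i\<in>I. T (v i \<odot>@(fmod R I) dl R i) j)"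
     by (rule fmod_sum) (use islc[OF T] sc in auto)
    also have "... = \<zero>"
    proof (rule fs_zero)
     fix i assume i: "i : I"
     have "T (v i \<odot>@(fmod R I) dl R i) = v i \<odot>@(fmod R (insert j J)) T (dl R i)"
      by (rule islin_smult[OF T]) (use v i in \<open>auto simp: fmc\<close>)
     then show "T (v i \<odot>@(fmod R I) dl R i) j = \<zero>" using z[OF i] fmc[OF v] by simp
    qed
    finally show ?thesis .
   qed
   then show False using False by blast
  qed
  then obtain i0 where i0: "i0 : I" and c0: "T (dl R i0) j ~= \<zero>" by blast
  define w where "w = T (dl R i0)"
  have wM: "w : carrier (fmod R (insert j J))" unfolding w_def by (rule islc[OF T dl_closed[OF i0]])
  define c where "c = inv (w j)"
  have wj: "w j : Units R" using c0 fmc[OF wM, of j] by (simp add: w_def field_Units)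
  then have c: "c : carrier R" "c ** w j = \<one>" by (auto simp: c_def)
  \<comment> \<open>Subtracts a multiple of the pivot column \<open>w\<close>, so that the
    coordinate j of every image vanishes.\<close>
  define T' where "T' v = (%k. T v k \<oplus> \<ominus> (T v j ** c) ** w k)" for v
  have sub: "v : carrier (fmod R I)" if "v : carrier (fmod R (I - {i0}))" for v
   using that by (auto simp: fmr)
  have Tc: "T v k : carrier R" if "v : carrier (fmod R I)" for v k
   by (rule fmc[OF islc[OF T that]])
  note wc = fmc[OF wM]
  have T'_j: "T' v j = \<zero>" if "v : carrier (fmod R I)" for v
   using Tc[OF that] c wc by (simp add: T'_def l_minus m_assoc r_neg)
  have "islin R (fmod R (I - {i0})) (fmod R J) T'"
   unfolding islin_def
  proof (intro conjI ballI)
   fix v assume v: "v : carrier (fmod R (I - {i0}))"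
   have "T' v k = \<zero>" if "k \<notin> insert j J" for k
    using islc[OF T sub[OF v]] wM that Tc[OF sub[OF v]] c by (auto simp: T'_def fmr)
   then show "T' v : carrier (fmod R J)"
    using T'_j[OF sub[OF v]] Tc[OF sub[OF v]] wc c unfolding fmr
    by (metis (no_types, lifting) T'_def a_closed a_inv_closed insert_iff m_closed)
   show "T' (v \<oplus>@(fmod R (I - {i0})) w') = T' v \<oplus>@(fmod R J) T' w'" if w': "w' : carrier (fmod R (I - {i0}))" for w'
   proof
    fix k
    have "T (%i. v i \<oplus> w' i) = (%i. T v i \<oplus> T w' i)"
     using islin_add[OF T sub[OF v] sub[OF w']] by simp
    then show "T' (v \<oplus>@(fmod R (I - {i0})) w') k = (T' v \<oplus>@(fmod R J) T' w') k"
     using Tc[OF sub[OF v]] Tc[OF sub[OF w']] wc c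
     by (simp add: T'_def l_distr minus_add) (simp add: l_distr a_ac)
   qed
   show "T' (b \<odot>@(fmod R (I - {i0})) v) = b \<odot>@(fmod R J) T' v" if b: "b : carrier R" for b
   proof
    fix k
    have "T (%i. b ** v i) = (%i. b ** T v i)"
     using islin_smult[OF T b sub[OF v]] by simp
    then show "T' (b \<odot>@(fmod R (I - {i0})) v) k = (b \<odot>@(fmod R J) T' v) k"
     using Tc[OF sub[OF v]] wc c b
     by (simp add: T'_def r_distr l_minus r_minus m_assoc)
   qed
  qed
  moreover have "card J < card (I - {i0})" using insert i0 by (simp add: card_Diff_singleton)
  ultimately obtain v where v: "v : carrier (fmod R (I - {i0}))" "v ~= (%i. \<zero>)" "T' v = (%i. \<zero>)"
   using insert.IH[of "I - {i0}" T'] insert.prems by auto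
  define a where "a = \<ominus> (T v j ** c)"
  have a: "a : carrier R" using Tc[OF sub[OF v(1)]] c by (simp add: a_def)
  \<comment> \<open>Adding the right multiple of the pivot vector turns T' v = 0 into T u = 0. As
    \<open>v\<close> has no i0-coordinate, a nonzero coordinate of \<open>v\<close> survives in
    \<open>u\<close>.\<close>
  define u where "u = v \<oplus>@(fmod R I) a \<odot>@(fmod R I) dl R i0"
  have uM: "u : carrier (fmod R I)"
   unfolding u_def by (rule M.M.a_closed[OF sub[OF v(1)] M.smult_closed[OF a dl_closed[OF i0]]])
  have "T u = T v \<oplus>@(fmod R (insert j J)) a \<odot>@(fmod R (insert j J)) w"
   unfolding u_def w_def
   by (simp only: islin_add[OF T sub[OF v(1)] M.smult_closed[OF a dl_closed[OF i0]]] islin_smult[OF T a dl_closed[OF i0]])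
  then have "T u = (%i. \<zero>)" using v(3) by (simp add: T'_def a_def)
  moreover have "u ~= (%i. \<zero>)"
  proof -
   obtain i where i: "v i ~= \<zero>" using v(2) by auto
   then have "i ~= i0" using v(1) by (auto simp: fmr)
   then have "u i = v i" using a fmc[OF v(1)] by (simp add: u_def dl_def)
   then show ?thesis using i by auto
  qed
  ultimately show ?thesis using uM by blast
 qed
qed

lemma eqv_card:
 assumes "finite I" "finite J"
  and T: "eqv R (fmod R I) act (carrier (fmod R I)) (fmod R J) act' (carrier (fmod R J)) G T"
  and inv: "invsub R (fmod R I) G act (carrier (fmod R I))"
 shows "card I = card J"
proof -
 have le: "card I <= card J"
  if fin: "finite I" "finite J" and T: "eqv R (fmod R I) act (carrier (fmod R I)) (fmod R J) act' (carrier (fmod R J)) G T"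
  and inv: "invsub R (fmod R I) G act (carrier (fmod R I))" for I J act act' T
 proof (rule ccontr)
  interpret M: module R "fmod R I" by (rule fmm)
  assume "~ card I <= card J"
  moreover have "islin R (fmod R I) (fmod R J) T"
   using T by (auto simp: eqv_def islin_def bij_betw_def)
  ultimately obtain v where v: "v : carrier (fmod R I)" "v ~= (%i. \<zero>)" "T v = (%i. \<zero>)"
   using islin_kernel_nonzero[of J I T] fin by auto
  have "T (%i. \<zero>) = (%i. \<zero>)"
   using eqv_zero[OF fmm fmm T inv] by simp
  moreover have "(%i. \<zero>) : carrier (fmod R I)" by (simp add: fmr)
  ultimately show False using v T by (auto simp: eqv_def bij_betw_def inj_on_def)
 qed
 have "invsub R (fmod R J) G act' (carrier (fmod R J))"
  using eqv_image[OF fmm fmm T inv subset_refl inv] T by (simp add: eqv_def bij_betw_def)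
 then have "card J <= card I" by (rule le[OF assms(2,1) eqv_inv[OF T inv]])
 moreover have "card I <= card J" by (rule le[OF assms])
 ultimately show ?thesis by simp
qed

end

context linact
begin

text \<open>The matrices of the action on \<open>N\<close> in the basis \<open>b\<close>. The
  coordinate functionals are given on all of \<open>M\<close>, which keeps the entries explicit
  enough to check that they reduce correctly.\<close>

lemma basis_model:
 fixes J :: "'j set"
 assumes N: "inv_sub N" and J: "finite J" and b: "!!j. j : J ==> b j : N"
  and kc: "!!j f. j : J ==> f : carrier M ==> \<kappa> j f : carrier R"
  and ka: "!!j f f'. j : J ==> f : carrier M ==> f' : carrier M ==> \<kappa> j (f \<oplus>@M f') = \<kappa> j f \<oplus>@R \<kappa> j f'"
  and ks: "!!j c f. j : J ==> c : carrier R ==> f : carrier M ==> \<kappa> j (c \<odot>@M f) = c **@R \<kappa> j f"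
  and dual: "!!i j. i : J ==> j : J ==> \<kappa> i (b j) = (if i = j then \<one>@R else \<zero>@R)"
  and expand: "!!f. f : N ==> f = finsum M (%j. \<kappa> j f \<odot>@M b j) J"
 defines "K \<equiv> %g i j. \<kappa> i (act g (b j))"
 shows "krep R (GD D) J K"
  and "EX T. eqv R (fmod R J) (kact R J K) (carrier (fmod R J)) M act N (GD D) T"
proof -
 have bM: "b j : carrier M" if "j : J" for j using b[OF that] N by (auto simp: invsub_def)
 have NM: "f : carrier M" if "f : N" for f using that N by (auto simp: invsub_def)
 have k0: "\<kappa> j \<zero>@M = \<zero>@R" if "j : J" for j
 proof -
  have "\<kappa> j (\<zero>@R \<odot>@M \<zero>@M) = \<zero>@R **@R \<kappa> j \<zero>@M" by (rule ks[OF that]) auto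
  then show ?thesis using kc[OF that] by simp
 qed
 have ksum: "\<kappa> j (finsum M f A) = finsum R (%x. \<kappa> j (f x)) A" if j: "j : J" and f: "!!x. x : A ==> f x : carrier M" for j f and A :: "'j set"
  using f
 proof (induction A rule: infinite_finite_induct)
  case (insert x A)
  then have "\<kappa> j (finsum M f (insert x A)) = \<kappa> j (f x) \<oplus>@R \<kappa> j (finsum M f A)"
   by (subst M.M.fsi) (auto simp: ka[OF j] M.M.fs_closed)
  then show ?case using insert kc[OF j] by (simp add: R.fsi)
 qed (auto simp: k0[OF j] R.finsum_infinite M.M.finsum_infinite)
 define T where "T v = finsum M (%j. v j \<odot>@M b j) J" for v
 have Ksum: "\<kappa> i (finsum M (%j. v j \<odot>@M act g (b j)) J) = finsum R (%j. K g i j **@R v j) J"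
  if "i : J" "!!j. j : J ==> v j : carrier R" "g : GD D" for i v g
  using that bM by (subst ksum[OF that(1)]) (auto simp: ks K_def R.m_comm kc intro!: R.fsc)
 have Kc: "K g i j : carrier R" if "g : GD D" "i : J" "j : J" for g i j
  using that bM kc by (simp add: K_def)
 show krep: "krep R (GD D) J K"
  unfolding krep_def
 proof (intro conjI ballI)
  fix g h i j assume g: "g : GD D" and h: "h : GD D" and i: "i : J" and j: "j : J"
  have e: "act h (b j) = finsum M (%k. K h k j \<odot>@M b k) J"
   unfolding K_def by (rule expand) (rule invsub_act[OF N h b[OF j]])
  have "act (m2mul g h) (b j) = act g (finsum M (%k. K h k j \<odot>@M b k) J)"
   using g h bM[OF j] by (simp add: act_mul e)
  also have "... = finsum M (%k. K h k j \<odot>@M act g (b k)) J"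
   using g j bM Kc[OF h] by (subst act_sum) (auto simp: act_smult intro!: M.M.fsc)
  finally have e2: "act (m2mul g h) (b j) = finsum M (%k. K h k j \<odot>@M act g (b k)) J" .
  have "K (m2mul g h) i j = \<kappa> i (act (m2mul g h) (b j))" by (simp add: K_def)
  also have "... = finsum R (%k. K g i k **@R K h k j) J"
   unfolding e2 by (rule Ksum[OF i _ g]) (use Kc[OF h] j in auto)
  finally show "K (m2mul g h) i j = finsum R (%k. K g i k **@R K h k j) J" .
 next
  fix i j assume "i : J" "j : J"
  then show "K m2one i j = (if i = j then \<one>@R else \<zero>@R)"
   using bM by (simp add: K_def act_one dual)
 qed (rule Kc)
 have vb: "v j \<odot>@M b j : carrier M" "v j \<odot>@M b j : N" if "v : carrier (fmod R J)" "j : J" for v j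
  using that bM b R.fmc[of v J] by (auto intro: ivm[OF N])
 have TN: "T v : N" if "v : carrier (fmod R J)" for v
  unfolding T_def by (rule invsub_sum[OF M.module_axioms N]) (rule vb(2)[OF that])
 have kT: "\<kappa> i (T v) = v i" if v: "v : carrier (fmod R J)" and i: "i : J" for v i
 proof -
  have "\<kappa> i (T v) = finsum R (%j. \<kappa> i (v j \<odot>@M b j)) J"
   unfolding T_def by (rule ksum[OF i]) (rule vb(1)[OF v])
  also have "... = finsum R (%j. v j **@R (if i = j then \<one>@R else \<zero>@R)) J"
   by (rule R.fsc) (use R.fmc[OF v] bM i in \<open>auto simp: ks dual\<close>)
  also have "... = v i" by (subst R.fs_only[of J i]) (use J i R.fmc[OF v] in auto)
  finally show ?thesis .
 qed
 define S where "S f = (%j. if j : J then \<kappa> j f else \<zero>@R)" for f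
 have Sc: "S f : carrier (fmod R J)" if "f : N" for f
  using kc NM[OF that] by (auto simp: S_def fmr)
 have TS: "T (S f) = f" if "f : N" for f
 proof -
  have "T (S f) = finsum M (%j. \<kappa> j f \<odot>@M b j) J"
   unfolding T_def by (rule M.M.fsc) (use kc NM[OF that] bM in \<open>auto simp: S_def\<close>)
  then show ?thesis using expand[OF that] by simp
 qed
 have ST: "S (T v) = v" if "v : carrier (fmod R J)" for v
  using kT[OF that] that by (auto simp: S_def fmr fun_eq_iff)
 have "bij_betw T (carrier (fmod R J)) N"
  by (rule bij_betw_byWitness[of _ S]) (use ST TS TN Sc in auto)
 moreover have "T (v \<oplus>@(fmod R J) w) = T v \<oplus>@M T w" if "v : carrier (fmod R J)" "w : carrier (fmod R J)" for v w
 proof -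
  have "T (v \<oplus>@(fmod R J) w) = finsum M (%j. v j \<odot>@M b j \<oplus>@M w j \<odot>@M b j) J"
   unfolding T_def
   by (rule M.M.fsc) (use that vb bM R.fmc[OF that(1)] R.fmc[OF that(2)] in \<open>auto simp: M.smult_l_distr\<close>)
  then show ?thesis unfolding T_def using M.M.fs_add[of J] vb(1)[OF that(1)] vb(1)[OF that(2)] by simp
 qed
 moreover have "T (c \<odot>@(fmod R J) v) = c \<odot>@M T v" if "c : carrier R" "v : carrier (fmod R J)" for c v
 proof -
  have "T (c \<odot>@(fmod R J) v) = finsum M (%j. c \<odot>@M (v j \<odot>@M b j)) J"
   unfolding T_def
   by (rule M.M.fsc) (use that vb bM R.fmc[OF that(2)] in \<open>auto simp: M.smult_assoc1\<close>)
  then show ?thesis unfolding T_def using fs_smult[OF that(1), of J] vb(1)[OF that(2)] by simp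
 qed
 moreover have "T (kact R J K g v) = act g (T v)" if g: "g : GD D" and v: "v : carrier (fmod R J)" for g v
 proof -
  have gN: "act g (T v) : N" by (rule invsub_act[OF N g TN[OF v]])
  have "act g (T v) = finsum M (%j. v j \<odot>@M act g (b j)) J"
   unfolding T_def using g vb(1)[OF v] bM R.fmc[OF v]
   by (subst act_sum) (auto simp: act_smult intro!: M.M.fsc)
  then have "S (act g (T v)) = kact R J K g v"
   using Ksum[of _ v g] R.fmc[OF v] g by (auto simp: S_def kact_def)
  then show ?thesis using TS[OF gN] by simp
 qed
 ultimately show "EX T. eqv R (fmod R J) (kact R J K) (carrier (fmod R J)) M act N (GD D) T"
  unfolding eqv_def by blast
qed

end

section \<open>Passage to matrices indexed by natural numbers\<close>

lemma is_rep_krep: "is_rep R G n \<rho> \<longleftrightarrow> krep R G {..<n} \<rho>"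
 by (auto simp: is_rep_def krep_def mat_in_def mat_eq_def mat_mul_def mat_one_def)

lemma vecs_fmod: "vecs R n = carrier (fmod R {..<n})"
 by (auto simp: vecs_def fmr)

lemma mat_vec_kact: "(%g. mat_vec R n (\<rho> g)) = kact R {..<n} \<rho>"
 by (auto simp: mat_vec_def kact_def fun_eq_iff)

lemma inv_subspace_invsub: "inv_subspace R G n \<rho> W \<longleftrightarrow> invsub R (fmod R {..<n}) G (kact R {..<n} \<rho>) W"
 by (simp add: inv_subspace_def invsub_def vecs_fmod zvec_def mat_vec_kact[symmetric])

lemma has_length_hlen:
 "has_length R G n \<rho> m \<longleftrightarrow> hlen R (fmod R {..<n}) G (kact R {..<n} \<rho>) (carrier (fmod R {..<n})) m"
 by (simp add: has_length_def hlen_def inv_subspace_invsub vecs_fmod zvec_def)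

lemma krep_subset: "krep R G I K ==> G' <= G ==> krep R G' I K"
 by (auto simp: krep_def subset_iff)

lemma kri:
 assumes "Ring.field R" "finite I" "krep R G I K"
 shows "invsub R (fmod R I) G (kact R I K) (carrier (fmod R I))"
proof -
 interpret Ring.field R by fact
 interpret M: module R "fmod R I" by (rule fmm)
 have "kact R I K g v : carrier (fmod R I)" if "g : G" "v : carrier (fmod R I)" for g v
  by (rule kact_closed) (use assms that in \<open>auto simp: krep_def\<close>)
 then show ?thesis unfolding invsub_def
  using M.M.zero_closed M.M.a_closed M.smult_closed by blast
qed

lemma irreducible_rep_irrsub:
 assumes "irreducible_rep R G n \<rho>" "Ring.field R"
 shows "irrsub R (fmod R {..<n}) G (kact R {..<n} \<rho>) (carrier (fmod R {..<n}))" "is_rep R G n \<rho>" "0 < n"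
proof -
 show rep: "is_rep R G n \<rho>" and "0 < n" using assms by (auto simp: irreducible_rep_def)
 have "invsub R (fmod R {..<n}) G (kact R {..<n} \<rho>) (carrier (fmod R {..<n}))"
  by (rule kri) (use assms rep in \<open>auto simp: is_rep_krep\<close>)
 then show "irrsub R (fmod R {..<n}) G (kact R {..<n} \<rho>) (carrier (fmod R {..<n}))"
  using assms(1) unfolding irrsub_def irreducible_rep_def inv_subspace_invsub vecs_fmod zvec_def by simp
qed

lemma kact_relabel:
 assumes R: "Ring.field R" and b: "bij_betw b I J" and fin: "finite I"
  and K: "!!g i j. g : G ==> i : J ==> j : J ==> K g i j : carrier R"
 shows "EX T. eqv R (fmod R J) (kact R J K) (carrier (fmod R J))
   (fmod R I) (kact R I (%g i j. K g (b i) (b j))) (carrier (fmod R I)) G T"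
proof -
 interpret Ring.field R by fact
 define T where "T v = (%i. if i : I then v (b i) else \<zero>@R)" for v
 define S where "S w = (%j. if j : J then w (inv_into I b j) else \<zero>@R)" for w
 have bJ: "b i : J" if "i : I" for i using b that by (auto simp: bij_betw_def)
 have ib: "inv_into I b j : I" "b (inv_into I b j) = j" if "j : J" for j
  using b that by (auto simp: bij_betw_def inv_into_into f_inv_into_f)
 have bi: "inv_into I b (b i) = i" if "i : I" for i using b that by (auto simp: bij_betw_def)
 have "bij_betw T (carrier (fmod R J)) (carrier (fmod R I))"
  by (rule bij_betw_byWitness[of _ S])
   (use bJ ib bi in \<open>auto simp: T_def S_def fmr fun_eq_iff\<close>)
 moreover have "T (kact R J K g v) = kact R I (%g i j. K g (b i) (b j)) g (T v)"
  if g: "g : G" and v: "v : carrier (fmod R J)" for g v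
 proof
  fix i
  show "T (kact R J K g v) i = kact R I (%g i j. K g (b i) (b j)) g (T v) i"
  proof (cases "i : I")
   case True
   have "(\<Oplus>@R j\<in>J. K g (b i) j **@R v j) = (\<Oplus>@R j\<in>I. K g (b i) (b j) **@R v (b j))"
    by (rule fs_reindex[OF b]) (use K g bJ True fmc[OF v] in auto)
   also have "... = (\<Oplus>@R j\<in>I. K g (b i) (b j) **@R T v j)"
    by (rule fsc) (use K g bJ True fmc[OF v] in \<open>auto simp: T_def\<close>)
   finally show ?thesis using True bJ by (simp add: T_def kact_def)
  qed (simp add: T_def kact_def)
 qed
 ultimately have "eqv R (fmod R J) (kact R J K) (carrier (fmod R J))
   (fmod R I) (kact R I (%g i j. K g (b i) (b j))) (carrier (fmod R I)) G T"
  unfolding eqv_def by (auto simp: T_def fun_eq_iff)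
 then show ?thesis by blast
qed

lemma islin_matrix:
 assumes R: "Ring.field R" and I: "finite I" and T: "islin R (fmod R I) (fmod R I') T"
  and v: "v : carrier (fmod R I)"
 shows "T v i = finsum R (%j. T (dl R j) i **@R v j) I"
proof -
 interpret Ring.field R by fact
 interpret M: module R "fmod R I" by (rule fmm)
 have sc: "v i \<odot>@(fmod R I) dl R i : carrier (fmod R I)" if "i : I" for i
  using that v by (intro M.smult_closed) (auto simp: fmc)
 have "T v = finsum (fmod R I') (%j. T (v j \<odot>@(fmod R I) dl R j)) I"
  by (subst fmod_expand[OF I v], rule islin_sum[OF fmm fmm T]) (rule sc)
 then have "T v i = finsum (fmod R I') (%j. T (v j \<odot>@(fmod R I) dl R j)) I i" by (rule fun_cong)
 also have "... = finsum R (%j. T (v j \<odot>@(fmod R I) dl R j) i) I"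
  by (rule fmod_sum) (use islc[OF T] sc in auto)
 also have "... = finsum R (%j. T (dl R j) i **@R v j) I"
 proof (rule fsc)
  fix j assume j: "j : I"
  have d: "dl R j : carrier (fmod R I)" by (rule dl_closed[OF j])
  have "T (v j \<odot>@(fmod R I) dl R j) = v j \<odot>@(fmod R I') T (dl R j)"
   by (rule islin_smult[OF T _ d]) (rule fmc[OF v])
  then show "T (v j \<odot>@(fmod R I) dl R j) i = T (dl R j) i **@R v j"
   using fmc[OF v, of j] fmc[OF islc[OF T d], of i] by (simp add: m_comm)
  show "T (dl R j) i **@R v j : carrier R"
   using fmc[OF v, of j] fmc[OF islc[OF T d], of i] by simp
 qed
 finally show ?thesis .
qed

text \<open>The matrices of T and of its inverse are the required \<open>P\<close> and
  \<open>Q\<close>.\<close>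

lemma eqv_rep_iso:
 assumes R: "Ring.field R" and r1: "krep R G {..<n} \<rho>1" and r2: "krep R G {..<n} \<rho>2"
  and T: "eqv R (fmod R {..<n}) (kact R {..<n} \<rho>1) (carrier (fmod R {..<n}))
    (fmod R {..<n}) (kact R {..<n} \<rho>2) (carrier (fmod R {..<n})) G T"
 shows "rep_iso R G n \<rho>1 \<rho>2"
proof -
 interpret Ring.field R by fact
 let ?V = "fmod R {..<n}"
 let ?S = "inv_into (carrier ?V) T"
 have S: "eqv R ?V (kact R {..<n} \<rho>2) (carrier ?V) ?V (kact R {..<n} \<rho>1) (carrier ?V) G ?S"
  by (rule eqv_inv[OF T kri[OF R _ r1]]) simp
 have linT: "islin R ?V ?V T" using T by (auto simp: eqv_def islin_def bij_betw_def)
 have linS: "islin R ?V ?V ?S" using S by (auto simp: eqv_def islin_def bij_betw_def)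
 have d: "dl R j : carrier ?V" if "j < n" for j using that by auto
 have TS: "T (?S v) = v" "?S (T v) = v" if "v : carrier ?V" for v
  using T that by (auto simp: eqv_def bij_betw_def f_inv_into_f)
 define P where "P i j = T (dl R j) i" for i j
 define Q where "Q i j = ?S (dl R j) i" for i j
 have PQ: "mat_mul R n P Q i j = mat_one R i j" if "i < n" "j < n" for i j
 proof -
  have "mat_mul R n P Q i j = T (?S (dl R j)) i"
   unfolding mat_mul_def P_def Q_def
   by (rule islin_matrix[symmetric, OF R _ linT islc[OF linS d[OF that(2)]]]) simp
  then show ?thesis using TS(1)[OF d[OF that(2)]] by (simp add: dl_def mat_one_def)
 qed
 have QP: "mat_mul R n Q P i j = mat_one R i j" if "i < n" "j < n" for i j
 proof -
  have "mat_mul R n Q P i j = ?S (T (dl R j)) i"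
   unfolding mat_mul_def P_def Q_def
   by (rule islin_matrix[symmetric, OF R _ linS islc[OF linT d[OF that(2)]]]) simp
  then show ?thesis using TS(2)[OF d[OF that(2)]] by (simp add: dl_def mat_one_def)
 qed
 have "mat_mul R n P (\<rho>1 g) i j = mat_mul R n (\<rho>2 g) P i j" if g: "g : G" and i: "i < n" and j: "j < n" for g i j
 proof -
  have r1c: "\<rho>1 g k j : carrier R" if "k < n" for k using r1 g j that by (auto simp: krep_def)
  have r2c: "\<rho>2 g i k : carrier R" if "k < n" for k using r2 g i that by (auto simp: krep_def)
  have kc: "kact R {..<n} \<rho>1 g (dl R j) : carrier ?V"
   using kri[OF R _ r1] g d[OF j] by (auto intro: invsub_act)
  have e: "kact R {..<n} \<rho>1 g (dl R j) k = \<rho>1 g k j" if "k < n" for k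
   by (rule kact_dl) (use that j g r1 in \<open>auto simp: krep_def\<close>)
  have "mat_mul R n P (\<rho>1 g) i j = (\<Oplus>@R k\<in>{..<n}. T (dl R k) i **@R kact R {..<n} \<rho>1 g (dl R j) k)"
   unfolding mat_mul_def P_def
   by (rule fsc) (use e r1c fmc[OF islc[OF linT d]] in auto)
  also have "... = T (kact R {..<n} \<rho>1 g (dl R j)) i"
   by (rule islin_matrix[symmetric, OF R _ linT kc]) simp
  also have "... = kact R {..<n} \<rho>2 g (T (dl R j)) i"
   using T g d[OF j] by (auto simp: eqv_def)
  also have "... = mat_mul R n (\<rho>2 g) P i j"
   using i by (simp add: kact_def mat_mul_def P_def)
  finally show ?thesis .
 qed
 moreover have "P i j : carrier R" "Q i j : carrier R" if "i < n" "j < n" for i j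
  using fmc[OF islc[OF linT d[OF that(2)]]] fmc[OF islc[OF linS d[OF that(2)]]]
  by (auto simp: P_def Q_def)
 ultimately show ?thesis
  unfolding rep_iso_def
  by (intro exI[of _ P] exI[of _ Q]) (auto simp: mat_in_def mat_eq_def PQ QP)
qed

lemma mat_one_mul:
 assumes "Ring.field R" "mat_in n (carrier R) A" "i < n" "j < n"
 shows "mat_mul R n (mat_mul R n (mat_one R) A) (mat_one R) i j = A i j"
  "mat_mul R n (mat_one R) (mat_one R) i j = mat_one R i j"
proof -
 interpret Ring.field R by fact
 have A: "A i j : carrier R" if "i < n" "j < n" for i j using assms that by (auto simp: mat_in_def)
 have l: "mat_mul R n (mat_one R) A i j = A i j" if "i < n" "j < n" for i j
  unfolding mat_mul_def by (subst fs_only[of _ i]) (use that A in \<open>auto simp: mat_one_def\<close>)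
 show "mat_mul R n (mat_mul R n (mat_one R) A) (mat_one R) i j = A i j"
  unfolding mat_mul_def[of R n "mat_mul R n (mat_one R) A"]
  by (subst fs_only[of _ j]) (use assms A l in \<open>auto simp: mat_one_def\<close>)
 show "mat_mul R n (mat_one R) (mat_one R) i j = mat_one R i j"
  unfolding mat_mul_def by (subst fs_only[of _ i]) (use assms in \<open>auto simp: mat_one_def\<close>)
qed

text \<open>A model with integral entries, once its index set is numbered, already lies in a lattice
  basis, so the base change in \<open>reduces_to\<close> is the identity.\<close>

lemma pack:
 fixes L :: "'a ring" and F :: "'b ring" and K :: "'k::field m2 => 'j => 'j => 'a"
 assumes L: "Ring.field L" and F: "Ring.field F" and J: "finite J" and KL: "krep L G J K"
  and int: "!!g i j. g : G ==> i : J ==> j : J ==> K g i j : integers l L \<iota>"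
  and KF: "krep F G J (%g i j. red (K g i j))"
  and \<sigma>: "is_rep F G n \<sigma>"
  and T: "eqv F (fmod F J) (kact F J (%g i j. red (K g i j))) (carrier (fmod F J))
   (fmod F {..<n}) (kact F {..<n} \<sigma>) (carrier (fmod F {..<n})) G T"
 shows "EX \<rho>. is_rep L G n \<rho> & reduces_to l L \<iota> F red G n \<rho> \<sigma> &
   (ALL G' m. G' <= G --> hlen L (fmod L J) G' (kact L J K) (carrier (fmod L J)) m --> has_length L G' n \<rho> m)"
proof -
 interpret L: Ring.field L by fact
 interpret F: Ring.field F by fact
 \<comment> \<open>The dimension of the model is read off from the isomorphism over the residue
   field.\<close>
 have "card J = card {..<n}"
  by (rule F.eqv_card[OF J _ T kri[OF F J KF]]) simp
 then obtain b where b: "bij_betw b {..<n} J"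
  using J by (metis bij_betw_iff_card finite_lessThan)
 have bJ: "b i : J" if "i < n" for i using b that by (auto simp: bij_betw_def)
 define \<rho> where "\<rho> g i j = K g (b i) (b j)" for g i j
 obtain TL where TL: "eqv L (fmod L J) (kact L J K) (carrier (fmod L J))
   (fmod L {..<n}) (kact L {..<n} \<rho>) (carrier (fmod L {..<n})) G TL"
  using kact_relabel[OF L b, of G K] KL unfolding \<rho>_def by (auto simp: krep_def)
 obtain TF where TF: "eqv F (fmod F J) (kact F J (%g i j. red (K g i j))) (carrier (fmod F J))
   (fmod F {..<n}) (kact F {..<n} (%g i j. red (\<rho> g i j))) (carrier (fmod F {..<n})) G TF"
  using kact_relabel[OF F b, of G "%g i j. red (K g i j)"] KF unfolding \<rho>_def by (auto simp: krep_def)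
 have relab: "krep R G {..<n} (%g i j. K' g (b i) (b j))" if "Ring.field R" "krep R G J K'" for R K'
 proof -
  interpret Ring.field R by fact
  have inj: "b i = b j \<longleftrightarrow> i = j" if "i < n" "j < n" for i j
   using b that by (auto simp: bij_betw_def inj_on_def)
  have "(\<Oplus>@R k\<in>J. K' g (b i) k **@R K' h k (b j)) = (\<Oplus>@R k\<in>{..<n}. K' g (b i) (b k) **@R K' h (b k) (b j))"
   if "g : G" "h : G" "i < n" "j < n" for g h i j
   by (rule fs_reindex[OF b]) (use that bJ \<open>krep R G J K'\<close> in \<open>auto simp: krep_def\<close>)
  then show ?thesis using \<open>krep R G J K'\<close> bJ inj unfolding krep_def by auto
 qed
 have \<rho>L: "krep L G {..<n} \<rho>" unfolding \<rho>_def by (rule relab[OF L KL])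
 have \<rho>F: "krep F G {..<n} (%g i j. red (\<rho> g i j))" unfolding \<rho>_def by (rule relab[OF F KF])
 have "eqv F (fmod F {..<n}) (kact F {..<n} (%g i j. red (\<rho> g i j))) (carrier (fmod F {..<n}))
   (fmod F {..<n}) (kact F {..<n} \<sigma>) (carrier (fmod F {..<n})) G (T \<circ> inv_into (carrier (fmod F J)) TF)"
  by (rule eqv_trans[OF eqv_inv[OF TF kri[OF F J KF]] T])
 then have iso: "rep_iso F G n (%g i j. red (\<rho> g i j)) \<sigma>"
  using \<sigma> by (intro eqv_rep_iso[OF F \<rho>F]) (auto simp: is_rep_krep)
 have \<rho>in: "mat_in n (carrier L) (\<rho> g)" if "g : G" for g
  using \<rho>L that by (auto simp: krep_def mat_in_def)
 note M1 = mat_one_mul(1)[OF L \<rho>in] and M2 = mat_one_mul(2)[OF L]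
 let ?N = "%g. mat_mul L n (mat_mul L n (mat_one L) (\<rho> g)) (mat_one L)"
 have one_in: "mat_in n (carrier L) (mat_one L)" by (auto simp: mat_in_def mat_one_def)
 have "rep_iso F G n (%g i j. red (?N g i j)) \<sigma>"
 proof -
  obtain P Q where PQ: "mat_in n (carrier F) P" "mat_in n (carrier F) Q"
   "mat_eq n (mat_mul F n P Q) (mat_one F)" "mat_eq n (mat_mul F n Q P) (mat_one F)"
   "!!g. g : G ==> mat_eq n (mat_mul F n P (%i j. red (\<rho> g i j))) (mat_mul F n (\<sigma> g) P)"
   using iso unfolding rep_iso_def by blast
  have "mat_mul F n P (%i j. red (?N g i j)) i j = mat_mul F n P (%i j. red (\<rho> g i j)) i j"
   if "g : G" "i < n" "j < n" for g i j
   unfolding mat_mul_def[of F]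
   by (rule F.fsc) (use that M1 PQ(1) \<rho>F in \<open>auto simp: mat_in_def krep_def\<close>)
  then have "mat_eq n (mat_mul F n P (%i j. red (?N g i j))) (mat_mul F n (\<sigma> g) P)" if "g : G" for g
   using PQ(5)[OF that] that by (auto simp: mat_eq_def)
  then show ?thesis unfolding rep_iso_def using PQ by blast
 qed
 moreover have "mat_in n (integers l L \<iota>) (?N g)" if "g : G" for g
  using M1[OF that] int[OF that] bJ by (auto simp: mat_in_def \<rho>_def)
 ultimately have "reduces_to l L \<iota> F red G n \<rho> \<sigma>"
  unfolding reduces_to_def using M2[OF one_in] one_in
  by (intro exI[of _ "mat_one L"]) (auto simp: mat_eq_def)
 moreover have "has_length L G' n \<rho> m"
  if "G' <= G" "hlen L (fmod L J) G' (kact L J K) (carrier (fmod L J)) m" for G' m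
  unfolding has_length_hlen
  by (rule hlen_eqv[OF L.fmm L.fmm eqv_subset[OF TL that(1)] _ _ that(2)])
   (use kri[OF L _ krep_subset[OF KL that(1)]] kri[OF L _ krep_subset[OF \<rho>L that(1)]] J in auto)
 ultimately show ?thesis using \<rho>L unfolding is_rep_krep by blast
qed

section \<open>Lifting eigenvectors from the residue field\<close>

locale redn = L: Ring.field L + F: Ring.field F for L :: "'a ring" (structure) and F :: "'b ring" +
 fixes A :: "'a set" and red :: "'a => 'b"
 assumes A_sub: "x : A ==> x : carrier L"
  and A_zero [simp, intro]: "\<zero> : A" and A_one [simp, intro]: "\<one> : A"
  and A_add [simp, intro]: "x : A ==> y : A ==> x \<oplus> y : A"
  and A_mult [simp, intro]: "x : A ==> y : A ==> x ** y : A"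
  and A_minus [simp, intro]: "x : A ==> \<ominus> x : A"
  and red_closed [simp, intro]: "x : A ==> red x : carrier F"
  and red_add: "x : A ==> y : A ==> red (x \<oplus> y) = red x \<oplus>@F red y"
  and red_mult: "x : A ==> y : A ==> red (x ** y) = red x **@F red y"
  and red_one [simp]: "red \<one> = \<one>@F"
begin

lemma red_zero [simp]: "red \<zero> = \<zero>@F"
proof -
 have "red \<zero> \<oplus>@F red \<zero> = red \<zero>"
  using red_add[of "\<zero>" "\<zero>"] by simp
 then show ?thesis using F.add.l_cancel_one[of "red \<zero>" "red \<zero>"] by simp
qed

lemma red_minus: "x : A ==> red (\<ominus> x) = \<ominus>@F red x"
proof -
 assume x: "x : A"
 have "red (\<ominus> x) \<oplus>@F red x = \<zero>@F"
  using red_add[of "\<ominus> x" x] x A_sub[OF x] by (simp add: L.l_neg)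
 then show ?thesis using F.minus_equality[of "red (\<ominus> x)" "red x"] x by simp
qed

lemma A_finsum: "(!!x. x : B ==> f x : A) ==> finsum L f B : A"
proof (induction B rule: infinite_finite_induct)
 case (insert x B)
 then show ?case using A_sub by (simp add: L.fsi)
qed (auto simp: L.finsum_infinite)

lemma red_finsum: "(!!x. x : B ==> f x : A) ==> red (finsum L f B) = finsum F (%x. red (f x)) B"
proof (induction B rule: infinite_finite_induct)
 case (insert x B)
 then show ?case using A_sub A_finsum[of B f] by (simp add: L.fsi F.fsi red_add)
qed (auto simp: L.finsum_infinite F.finsum_infinite)

text \<open>The operators \<open>ta b\<close> satisfy the same multiplication rules as the values \<open>lam x b\<close> of
 finitely many characters \<open>x\<close> which separate linear combinations; hence a product over all
 \<open>x\<close> of operators \<open>ta b - red (lam x b)\<close> vanishes, and \<open>v\<close> cannot survive every factor.\<close>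

lemma eigenvector_lift:
 fixes M :: "('b,'v) module" and B :: "'i set" and Xs :: "'x set" and S :: "'s set"
 assumes M: "module F M" and V: "!!u. u : V ==> u : carrier M" "\<zero>@M : V"
  "!!u w. u : V ==> w : V ==> u \<oplus>@M w : V" "!!c u. c : carrier F ==> u : V ==> c \<odot>@M u : V"
  and fin: "finite B" "finite Xs"
  and tV: "!!b u. b : B ==> u : V ==> ta b u : V"
  and tadd: "!!b u w. b : B ==> u : V ==> w : V ==> ta b (u \<oplus>@M w) = ta b u \<oplus>@M ta b w"
  and tsm: "!!b c u. b : B ==> c : carrier F ==> u : V ==> ta b (c \<odot>@M u) = c \<odot>@M ta b u"
  and lamA: "!!x b. x : Xs ==> b : B ==> lam x b : A"
  and stA: "!!b b' s. b : B ==> b' : B ==> s : S ==> st b b' s : A"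
  and nxB: "!!b b' s. b : B ==> b' : B ==> s : S ==> nx b b' s : B"
  and multL: "!!x b b'. x : Xs ==> b : B ==> b' : B ==>
    lam x b ** lam x b' = finsum L (%s. st b b' s ** lam x (nx b b' s)) S"
  and multV: "!!b b' u. b : B ==> b' : B ==> u : V ==>
    ta b (ta b' u) = finsum M (%s. red (st b b' s) \<odot>@M ta (nx b b' s) u) S"
  and b0: "b0 : B" "!!x. x : Xs ==> lam x b0 = \<one>" "!!u. u : V ==> ta b0 u = u"
  and sep: "!!Ph b. (!!b. b : B ==> Ph b : A) ==>
    (!!x. x : Xs ==> finsum L (%b. Ph b ** lam x b) B = \<zero>) ==> b : B ==> Ph b = \<zero>"
  and v: "v : V" "v ~= \<zero>@M"
 shows "EX w:V. w ~= \<zero>@M & (EX x:Xs. ALL b:B. ta b w = red (lam x b) \<odot>@M w)"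
proof -
 interpret M: module F M by fact
 \<comment> \<open>Pairs of a function of the characters and an operator with the same coefficients
   in \<open>A\<close>. They form an algebra on both sides at once, because the two multiplication
   rules agree modulo reduction; \<open>P_left\<close> is what is needed of this.\<close>
 define P where "P f t \<longleftrightarrow> (EX Ph. (ALL b:B. Ph b : A) & (ALL x:Xs. f x = finsum L (%b. Ph b ** lam x b) B)
   & (ALL u:V. t u = finsum M (%b. red (Ph b) \<odot>@M ta b u) B))" for f :: "'x => 'a" and t :: "'v => 'v"
 have lamL: "lam x b : carrier L" if "x : Xs" "b : B" for x b using lamA[OF that] A_sub by blast
 have tM: "ta b u : carrier M" if "b : B" "u : V" for b u using tV[OF that] V(1) by blast
 have Pf: "f x : A" if "P f t" "x : Xs" for f t x
  using that lamA unfolding P_def by (auto intro!: A_finsum)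
 have VS: "finsum M f C : V" if "!!c. c : C ==> f c : V" for f and C :: "'c set"
  using that
 proof (induction C rule: infinite_finite_induct)
  case (insert x C)
  then show ?case using V by (simp add: M.M.fsi)
 qed (auto simp: M.M.finsum_infinite V(2))
 have Pt: "t u : V" if "P f t" "u : V" for f t u
 proof -
  obtain Ph where "ALL b:B. Ph b : A" "t u = finsum M (%b. red (Ph b) \<odot>@M ta b u) B"
   using \<open>P f t\<close> \<open>u : V\<close> unfolding P_def by blast
  then show ?thesis using tV that by (auto intro!: VS V(4))
 qed
 have P_cong: "P f' t'" if "P f t" "!!x. x : Xs ==> f' x = f x" "!!u. u : V ==> t' u = t u" for f t f' t'
  using that unfolding P_def by metis
 have P_zero: "P (%x. \<zero>) (%u. \<zero>@M)"
  unfolding P_def by (rule exI[of _ "%b. \<zero>"]) (use lamL tM in \<open>auto simp: L.fs_zero M.M.fs_zero\<close>)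
 have P_add: "P (%x. f x \<oplus> f' x) (%u. t u \<oplus>@M t' u)" if "P f t" "P f' t'" for f t f' t'
 proof -
  obtain Ph Ph' where A: "ALL b:B. Ph b : A" "ALL b:B. Ph' b : A"
   and f: "ALL x:Xs. f x = finsum L (%b. Ph b ** lam x b) B" "ALL x:Xs. f' x = finsum L (%b. Ph' b ** lam x b) B"
   and t: "ALL u:V. t u = finsum M (%b. red (Ph b) \<odot>@M ta b u) B" "ALL u:V. t' u = finsum M (%b. red (Ph' b) \<odot>@M ta b u) B"
   using \<open>P f t\<close> \<open>P f' t'\<close> unfolding P_def by blast
  have AL: "Ph b : carrier L" "Ph' b : carrier L" if "b : B" for b using A that A_sub by auto
  have "finsum L (%b. (Ph b \<oplus> Ph' b) ** lam x b) B = f x \<oplus> f' x" if x: "x : Xs" for x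
  proof -
   have "finsum L (%b. (Ph b \<oplus> Ph' b) ** lam x b) B = finsum L (%b. Ph b ** lam x b \<oplus> Ph' b ** lam x b) B"
    by (rule L.fsc) (use AL lamL x in \<open>auto simp: L.l_distr\<close>)
   then show ?thesis using f x AL lamL by (simp add: L.fs_add)
  qed
  moreover have "finsum M (%b. red (Ph b \<oplus> Ph' b) \<odot>@M ta b u) B = t u \<oplus>@M t' u" if u: "u : V" for u
  proof -
   have "finsum M (%b. red (Ph b \<oplus> Ph' b) \<odot>@M ta b u) B = finsum M (%b. red (Ph b) \<odot>@M ta b u \<oplus>@M red (Ph' b) \<odot>@M ta b u) B"
    by (rule M.M.fsc) (use A tM u in \<open>auto simp: red_add M.smult_l_distr\<close>)
   then show ?thesis using t u A tM by (simp add: M.M.fs_add)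
  qed
  ultimately show ?thesis unfolding P_def using A by (intro exI[of _ "%b. Ph b \<oplus> Ph' b"]) auto
 qed
 have P_scale: "P (%x. a ** f x) (%u. red a \<odot>@M t u)" if "P f t" and a: "a : A" for f t a
 proof -
  obtain Ph where A: "ALL b:B. Ph b : A"
   and f: "ALL x:Xs. f x = finsum L (%b. Ph b ** lam x b) B"
   and t: "ALL u:V. t u = finsum M (%b. red (Ph b) \<odot>@M ta b u) B"
   using \<open>P f t\<close> unfolding P_def by blast
  have AL: "Ph b : carrier L" if "b : B" for b using A that A_sub by auto
  have "finsum L (%b. (a ** Ph b) ** lam x b) B = a ** f x" if x: "x : Xs" for x
  proof -
   have "finsum L (%b. (a ** Ph b) ** lam x b) B = finsum L (%b. a ** (Ph b ** lam x b)) B"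
    by (rule L.fsc) (use AL lamL x A_sub[OF a] in \<open>auto simp: L.m_assoc\<close>)
   then show ?thesis using f x AL lamL A_sub[OF a] by (simp add: L.fsr)
  qed
  moreover have "finsum M (%b. red (a ** Ph b) \<odot>@M ta b u) B = red a \<odot>@M t u" if u: "u : V" for u
  proof -
   have "finsum M (%b. red (a ** Ph b) \<odot>@M ta b u) B = finsum M (%b. red a \<odot>@M (red (Ph b) \<odot>@M ta b u)) B"
    by (rule M.M.fsc) (use A a tM u in \<open>auto simp: red_mult M.smult_assoc1\<close>)
   also have "... = red a \<odot>@M finsum M (%b. red (Ph b) \<odot>@M ta b u) B"
    by (rule M.finsum_smult_ldistr[symmetric]) (use A a tM u fin in auto)
   finally show ?thesis using t u by simp
  qed
  ultimately show ?thesis unfolding P_def using A a by (intro exI[of _ "%b. a ** Ph b"]) auto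
 qed
 have P_sum: "P (%x. finsum L (%c. f c x) C) (%u. finsum M (%c. t c u) C)" if "!!c. c : C ==> P (f c) (t c)" for f t and C :: "'c set"
  using that
 proof (induction C rule: infinite_finite_induct)
  case (insert c C)
  have "P (%x. f c x \<oplus> finsum L (%c. f c x) C) (%u. t c u \<oplus>@M finsum M (%c. t c u) C)"
   using insert by (intro P_add) auto
  then show ?case
  proof (rule P_cong)
   fix x assume "x : Xs"
   then have "f d x : carrier L" if "d : insert c C" for d using Pf insert.prems[OF that] A_sub by blast
   then show "finsum L (%c. f c x) (insert c C) = f c x \<oplus> finsum L (%c. f c x) C"
    using insert.hyps by (intro L.fsi) auto
  next
   fix u assume "u : V"
   then have "t d u : carrier M" if "d : insert c C" for d using Pt insert.prems[OF that] V(1) by blast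
   then show "finsum M (%c. t c u) (insert c C) = t c u \<oplus>@M finsum M (%c. t c u) C"
    using insert.hyps by (intro M.M.fsi) auto
  qed
 qed (simp_all add: L.finsum_infinite M.M.finsum_infinite P_zero)
 have P_basis: "P (%x. lam x b) (ta b)" if b: "b : B" for b
  unfolding P_def
 proof (intro exI[of _ "%b'. if b' = b then \<one> else \<zero>"] conjI ballI)
  show "lam x b = finsum L (%b'. (if b' = b then \<one> else \<zero>) ** lam x b') B" if "x : Xs" for x
   by (subst L.fs_only[of B b]) (use fin b lamL that in auto)
  show "ta b u = finsum M (%b'. red (if b' = b then \<one> else \<zero>) \<odot>@M ta b' u) B" if "u : V" for u
   by (subst M.M.fs_only[of B b]) (use fin b tM that in auto)
 qed auto
 have P_left: "P (%x. lam x c ** f x) (%u. ta c (t u))" if "P f t" and c: "c : B" for f t c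
 proof -
  obtain Ph where A: "ALL b:B. Ph b : A"
   and f: "ALL x:Xs. f x = finsum L (%b. Ph b ** lam x b) B"
   and t: "ALL u:V. t u = finsum M (%b. red (Ph b) \<odot>@M ta b u) B"
   using \<open>P f t\<close> unfolding P_def by blast
  have AL: "Ph b : carrier L" if "b : B" for b using A that A_sub by auto
  have Pb: "P (%x. lam x c ** lam x b) (%u. ta c (ta b u))" if b: "b : B" for b
  proof (rule P_cong)
   show "P (%x. finsum L (%s. st c b s ** lam x (nx c b s)) S) (%u. finsum M (%s. red (st c b s) \<odot>@M ta (nx c b s) u) S)"
    by (rule P_sum, rule P_scale[OF P_basis]) (use stA nxB b c in auto)
  qed (use multL multV b c in auto)
  have "P (%x. finsum L (%b. Ph b ** (lam x c ** lam x b)) B) (%u. finsum M (%b. red (Ph b) \<odot>@M ta c (ta b u)) B)"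
   by (rule P_sum, rule P_scale[OF Pb]) (use A in auto)
  then show ?thesis
  proof (rule P_cong)
   fix x assume x: "x : Xs"
   have "lam x c ** f x = finsum L (%b. lam x c ** (Ph b ** lam x b)) B"
    using f x AL lamL c by (simp add: L.fsr)
   also have "... = finsum L (%b. Ph b ** (lam x c ** lam x b)) B"
    by (rule L.fsc) (use AL lamL c x in \<open>auto simp: L.m_lcomm\<close>)
   finally show "lam x c ** f x = ..." .
  next
   fix u assume u: "u : V"
   have sc: "red (Ph b) \<odot>@M ta b u : V" if "b : B" for b using A that tV u V(4) by auto
   have "ta c (finsum M (%b. red (Ph b) \<odot>@M ta b u) C) = finsum M (%b. red (Ph b) \<odot>@M ta c (ta b u)) C" if "C <= B" for C
    using finite_subset[OF that fin(1)] that
   proof (induction C rule: finite_induct)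
    case empty
    have "ta c (\<zero>@F \<odot>@M \<zero>@M) = \<zero>@F \<odot>@M ta c \<zero>@M" by (rule tsm[OF c _ V(2)]) simp
    then show ?case using tM[OF c V(2)] by simp
   next
    case (insert b C)
    have "ta c (red (Ph b) \<odot>@M ta b u \<oplus>@M finsum M (%b. red (Ph b) \<odot>@M ta b u) C)
     = ta c (red (Ph b) \<odot>@M ta b u) \<oplus>@M ta c (finsum M (%b. red (Ph b) \<odot>@M ta b u) C)"
     by (rule tadd[OF c]) (use insert sc in \<open>auto intro!: VS\<close>)
    also have "ta c (red (Ph b) \<odot>@M ta b u) = red (Ph b) \<odot>@M ta c (ta b u)"
     by (rule tsm[OF c]) (use insert A tV u in auto)
    finally show ?case using insert A tM tV c u V(1)[OF sc]
     by (subst (1 2) M.M.fsi) auto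
   qed
   then show "ta c (t u) = finsum M (%b. red (Ph b) \<odot>@M ta c (ta b u)) B" using t u by simp
  qed
 qed
 show ?thesis
 proof (rule ccontr)
  assume neg: "~ ?thesis"
  \<comment> \<open>Assuming that there is no eigenvector, an operator not killing v is built whose
    function vanishes on more and more characters. Once it vanishes on all of them, separation makes
    the operator 0.\<close>
  have "EX f t. P f t & (ALL x:Y. f x = \<zero>) & t v ~= \<zero>@M" if "Y <= Xs" for Y
   using finite_subset[OF that fin(2)] that
  proof (induction Y rule: finite_induct)
   case empty
   show ?case using P_basis[OF b0(1)] b0(3)[OF v(1)] v(2) by fastforce
  next
   case (insert x Y)
   then obtain f t where ft: "P f t" "ALL x:Y. f x = \<zero>" "t v ~= \<zero>@M" by blast
   have w: "t v : V" by (rule Pt[OF ft(1) v(1)])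
   have x: "x : Xs" using insert by simp
   obtain b where b: "b : B" "ta b (t v) ~= red (lam x b) \<odot>@M t v"
    using neg w ft(3) x by blast
   let ?a = "\<ominus> lam x b"
   have a: "?a : A" using lamA[OF x b(1)] by simp
   \<comment> \<open>Multiplication by the difference of \<open>b\<close> and its value at x: the
     function now vanishes at x, and t v is not killed because it is not an eigenvector for
     x.\<close>
   let ?f = "%y. lam y b ** f y \<oplus> ?a ** f y" and ?t = "%u. ta b (t u) \<oplus>@M red ?a \<odot>@M t u"
   have "P ?f ?t" by (rule P_add[OF P_left[OF ft(1) b(1)] P_scale[OF ft(1) a]])
   moreover have "?f y = \<zero>" if y: "y : insert x Y" for y
   proof (cases "y = x")
    case True
    have "f x : carrier L" using Pf[OF ft(1) x] A_sub by blast
    then show ?thesis using True lamL[OF x b(1)] by (simp add: L.l_minus L.r_neg)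
   next
    case False
    then have "f y = \<zero>" "y : Xs" using ft(2) y insert by auto
    then show ?thesis using lamL[OF _ b(1)] x by simp
   qed
   moreover have "?t v ~= \<zero>@M"
   proof
    assume z: "?t v = \<zero>@M"
    have "?t v = ta b (t v) \<ominus>@M red (lam x b) \<odot>@M t v"
     using lamA[OF x b(1)] V(1)[OF w] by (simp add: red_minus M.smult_l_minus a_minus_def)
    then have "ta b (t v) = red (lam x b) \<odot>@M t v"
     using z M.M.dze tM[OF b(1) w] lamA[OF x b(1)] V(1)[OF w] by simp
    then show False using b(2) by simp
   qed
   ultimately show ?case by blast
  qed
  then obtain f t where ft: "P f t" "ALL x:Xs. f x = \<zero>" "t v ~= \<zero>@M" by blast
  then obtain Ph where A: "ALL b:B. Ph b : A"
   and f: "ALL x:Xs. f x = finsum L (%b. Ph b ** lam x b) B"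
   and t: "ALL u:V. t u = finsum M (%b. red (Ph b) \<odot>@M ta b u) B"
   unfolding P_def by blast
  have "Ph b = \<zero>" if "b : B" for b by (rule sep[OF _ _ that]) (use A f ft(2) in auto)
  then have "t v = \<zero>@M" using t v(1) tM by (auto intro!: M.M.fs_zero)
  then show False using ft(3) by simp
 qed
qed

end

section \<open>Squares in a finite field\<close>

definition sq :: "'k::field => bool" where "sq x \<longleftrightarrow> (EX t. x = t * t)"

lemma sq_mult: "sq x ==> sq y ==> sq (x * y)"
 unfolding sq_def by (metis mult.assoc mult.left_commute)

lemma sq_1 [simp]: "sq 1" unfolding sq_def by (metis mult_1)

lemma sq_inverse: "sq x ==> sq (inverse x)"
 unfolding sq_def by (metis inverse_mult_distrib)

lemma sq_square [simp]: "sq (t * t)" unfolding sq_def by blast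

text \<open>With respect to a generator, nonsquares have odd exponents, and two odd exponents add up
  to an even one.\<close>

lemma nonsq_mult:
 fixes x y :: "'k::{finite,field}"
 assumes "~ sq x" "~ sq y"
 shows "sq (x * y)"
proof -
 obtain g :: 'k where g: "bij_betw (%i. g ^ i) {..<CARD('k) - 1} (UNIV - {0})"
  using finite_field_generator by blast
 have "x ~= 0" "y ~= 0" using assms sq_square[of 0] by auto
 then obtain i j where ij: "x = g ^ i" "y = g ^ j"
  using g by (metis (no_types, lifting) DiffI UNIV_I bij_betw_imp_surj_on imageE singletonD)
 have ev: "sq (g ^ n)" if ev: "even n" for n
 proof -
  obtain m where "n = m + m" using ev by (metis evenE mult_2)
  then show ?thesis by (simp add: power_add)
 qed
 have "odd i" "odd j" using ev assms ij by auto
 then have "even (i + j)" by simp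
 then show ?thesis using ev[of "i + j"] by (simp add: ij power_add)
qed

lemma (in Ring.field) smc:
 assumes "module R M" "invsub R M G act N" "c : carrier R" "c ~= \<zero>" "v : carrier M" "c \<odot>@M v : N"
 shows "v : N"
 by (rule ivc[OF field_axioms assms])

lemma (in Ring.field) invsub_dl_expand:
 assumes I: "finite I" and N: "invsub R (fmod R I) G act N" and v: "v : carrier (fmod R I)"
  and dl: "!!i. i : I ==> v i ~= \<zero> ==> dl R i : N"
 shows "v : N"
proof -
 interpret M: module R "fmod R I" by (rule fmm)
 have "v = finsum (fmod R I) (%i. v i \<odot>@(fmod R I) dl R i) I" by (rule fmod_expand[OF I v])
 also have "... : N"
 proof (rule invsub_sum[OF fmm N])
  fix i assume i: "i : I"
  show "v i \<odot>@(fmod R I) dl R i : N"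
  proof (cases "v i = \<zero>")
   case True
   then show ?thesis using M.smult_l_null[OF dl_closed[OF i]] invsub_zero[OF N] by metis
  next
   case False
   show ?thesis by (rule ivm[OF N fmc[OF v] dl[OF i False]])
  qed
 qed
 finally show ?thesis .
qed

section \<open>Invariant subspaces of the cuspidal representations\<close>

text \<open>Regularity is stated as a vanishing sum, not as nontriviality on the norm-one group:
  over the residue field the sum may vanish for a trivial restriction, because q + 1 = 0.\<close>

locale cusp = theta R py qi te for R (structure) and py :: "'k::{finite,field} => 'a" and qi te +
 assumes reg: "(\<Oplus>t\<in>{t. Nm t = 1}. te t) = \<zero>"
begin

abbreviation "KX \<equiv> UNIV - {0::'k}"
abbreviation "actC \<equiv> kact R KX KC"

definition lamC :: "'k \<times> 'k => 'a" where
 "lamC b = (if fst b = 0 then te (emb (snd b)) else J (fst b) (snd b))"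

lemma krepC: "subgrp D ==> krep R (GD D) KX KC"
 by (rule krep_subset[OF KC_krep[OF reg]]) (auto simp: GD_def subgrp_def)

lemma grepC: "subgrp D ==> grep R py qi (fmod R KX) D actC"
 by (intro grep.intro achar_axioms krep_linact krepC) auto

lemma th_unit: "t ~= 0 ==> te t ~= \<zero>"
 using th_mult[of t "inverse t"] by fastforce

lemma actC_upper:
 assumes v: "v : carrier (fmod R KX)" and d: "d ~= 0" "a ~= 0" and x: "x ~= 0"
 shows "actC (a, b, 0, d) v x = te (emb d) ** py (b * x / d) ** v (a * x / d)"
proof -
 have "actC (a, b, 0, d) v x = KC (a, b, 0, d) x (a * x / d) ** v (a * x / d)"
  unfolding kact_def using x d
  by (subst fs_only[of _ "a * x / d"]) (auto simp: KC_upper fmc[OF v])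
 then show ?thesis using d by (simp add: KC_def)
qed

lemma actC_dl: "y ~= 0 ==> x ~= 0 ==> actC g (dl R y) x = KC g x y"
 by (rule kact_dl) auto

lemma actC_dl_diag:
 assumes "y ~= 0" "a ~= 0" "d ~= 0"
 shows "actC (dg a d) (dl R y) = te (emb d) \<odot>@(fmod R KX) dl R (y * d / a)"
proof
 fix x
 show "actC (dg a d) (dl R y) x = (te (emb d) \<odot>@(fmod R KX) dl R (y * d / a)) x"
 proof (cases "x = 0")
  case False
  then show ?thesis using assms actC_upper[of "dl R y" d a x 0]
   by (auto simp: dg_def dl_def field_simps fmr)
 next
  case True
  then show ?thesis using assms by (simp add: kact_def dl_def)
 qed
qed

text \<open>In the Kirillov model U acts diagonally by psi(b x), so the projection picks out one
  coordinate.\<close>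

lemma peC:
 fixes D :: "'k set"
 assumes D: "subgrp D" and v: "v : carrier (fmod R KX)" and a: "a ~= 0"
 shows "grep.pe R py qi (fmod R KX) actC a v = v a \<odot>@(fmod R KX) dl R a"
proof
 interpret G: grep R py qi "fmod R KX" D actC by (rule grepC[OF D])
 fix x
 have c: "(qi ** py (- (a * b))) \<odot>@(fmod R KX) actC (nm b) v : carrier (fmod R KX)" for b
  by (intro G.M.smult_closed G.act_closed v) auto
 have "G.pe a v x = (\<Oplus>b\<in>UNIV. ((qi ** py (- (a * b))) \<odot>@(fmod R KX) actC (nm b) v) x)"
  unfolding G.pe_def by (rule fmod_sum) (rule c)
 also have "... = (v a \<odot>@(fmod R KX) dl R a) x"
 proof (cases "x = 0")
  case True
  then show ?thesis using v a by (simp add: kact_def dl_def fs_zero fmc[OF v])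
 next
  case False
  have "(\<Oplus>b\<in>UNIV. ((qi ** py (- (a * b))) \<odot>@(fmod R KX) actC (nm b) v) x) = (\<Oplus>b\<in>UNIV. py (b * (x - a)) ** (qi ** v x))"
  proof (rule fsc)
   fix b
   have "py (b * (x - a)) = py (- (a * b)) ** py (b * x)"
    unfolding psi_add[symmetric] by (simp add: algebra_simps)
   then show "((qi ** py (- (a * b))) \<odot>@(fmod R KX) actC (nm b) v) x = py (b * (x - a)) ** (qi ** v x)"
    using actC_upper[OF v, of 1 1 x b] False fmc[OF v] by (simp add: nm_def m_ac)
  qed (use fmc[OF v] in auto)
  also have "... = (if x = a then qq else \<zero>) ** (qi ** v x)"
   using fmc[OF v] by (subst fsl) (auto simp: psi_sum_eq')
  finally show ?thesis using fmc[OF v] by (auto simp: dl_def)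
 qed
 finally show "G.pe a v x = (v a \<odot>@(fmod R KX) dl R a) x" .
qed

lemma hevC:
 assumes D: "subgrp D"
 shows "grep.hev R py qi (fmod R KX) D actC lamC (dl R 1)"
proof -
 interpret G: grep R py qi "fmod R KX" D actC by (rule grepC[OF D])
 have d1: "dl R (1::'k) : carrier (fmod R KX)" by auto
 have "G.psv 1 (dl R 1)"
  using G.psv_pe[OF d1, of 1] unfolding peC[OF D d1 one_neq_zero] by (simp add: dl_def)
 moreover have "dl R (1::'k) 1 ~= \<zero>" by (simp add: dl_def)
 then have "dl R (1::'k) ~= (%i. \<zero>)" by metis
 moreover have "lamC b : carrier R & G.Tb b (dl R 1) = lamC b \<odot>@(fmod R KX) dl R 1" if b: "b : BD D" for b
 proof -
  have gb: "bel b : GD D" by (rule G.bel_GD[OF b])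
  have nz: "snd b ~= 0" if "fst b = 0" using b that D by (cases b) (auto simp: BD_def subgrp_def)
  have "actC (bel b) (dl R 1) 1 = KC (bel b) 1 1" by (rule actC_dl) auto
  also have "... = lamC b" using nz by (auto simp: bel_def lamC_def KC_def dg_def mc_def)
  finally have "G.Tb b (dl R 1) = lamC b \<odot>@(fmod R KX) dl R 1"
   unfolding G.Tb_def peC[OF D G.act_closed[OF gb d1] one_neq_zero] by simp
  then show ?thesis by (simp add: lamC_def)
 qed
 ultimately show ?thesis by (simp add: G.hev_def)
qed

lemma invsubC_dl:
 assumes D: "subgrp D" and N: "invsub R (fmod R KX) (GD D) actC N" and v: "v : N" and x: "v x ~= \<zero>"
 shows "x ~= 0" "dl R x : N"
proof -
 interpret G: grep R py qi "fmod R KX" D actC by (rule grepC[OF D])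
 have vM: "v : carrier (fmod R KX)" by (rule invsub_sub[OF N v])
 show x0: "x ~= 0" using x vM by (auto simp: fmr)
 have "v x \<odot>@(fmod R KX) dl R x : N" using G.pe_invsub[OF N v, of x] peC[OF D vM x0] by simp
 then show "dl R x : N"
  by (rule smc[OF fmm N fmc[OF vM] x, rotated]) (use x0 in auto)
qed

lemma invsubC_diag:
 assumes D: "subgrp D" and N: "invsub R (fmod R KX) (GD D) actC N" and y: "y ~= 0" "dl R y : N" and ad: "a * d : D"
 shows "dl R (y * d / a) : N"
proof -
 have nz: "a ~= 0" "d ~= 0" using ad D by (auto simp: subgrp_def)
 have "actC (dg a d) (dl R y) : N" by (rule invsub_act[OF N _ y(2)]) (use ad in \<open>simp add: GD_def m2r\<close>)
 then have "te (emb d) \<odot>@(fmod R KX) dl R (y * d / a) : N" using actC_dl_diag[OF y(1) nz] by simp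
 then show ?thesis
  by (rule smc[OF fmm N th_closed th_unit, rotated 2]) (use nz y in auto)
qed

lemma invsubC_full:
 assumes N: "invsub R (fmod R KX) G actC N" and "!!x. x ~= 0 ==> dl R x : N"
 shows "N = carrier (fmod R KX)"
proof
 show "N <= carrier (fmod R KX)" using N by (auto simp: invsub_def)
 show "carrier (fmod R KX) <= N" by (rule subsetI, rule invsub_dl_expand[OF _ N]) (use assms in auto)
qed

lemma nonzero_member:
 assumes "invsub R (fmod R I) G act N" "N ~= {%i. \<zero>}"
 obtains v x where "v : N" "v x ~= \<zero>"
proof -
 obtain v where "v : N" "v ~= (%i. \<zero>)" using assms invsub_zero[OF assms(1)] by auto
 then show ?thesis using that by blast
qed

text \<open>A nonzero invariant subspace contains a delta function, by projecting to a character of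
  U, and diagonal matrices move it to every point of k^*.\<close>

lemma cusp_irr_GL: "irrsub R (fmod R KX) (GD KX) actC (carrier (fmod R KX))"
 unfolding irrsub_def
proof (intro conjI allI impI)
 have D: "subgrp KX" by (rule sgc)
 show "invsub R (fmod R KX) (GD KX) actC (carrier (fmod R KX))"
  by (rule kri[OF field_axioms _ krepC[OF D]]) simp
 fix N assume N: "invsub R (fmod R KX) (GD KX) actC N"
 show "N = {\<zero>@(fmod R KX)} \<or> N = carrier (fmod R KX)"
 proof (cases "N = {%i. \<zero>}")
  case False
  then obtain v x where v: "v : N" "v x ~= \<zero>" by (rule nonzero_member[OF N])
  note x = invsubC_dl[OF D N v]
  have "dl R y : N" if "y ~= 0" for y
   using invsubC_diag[OF D N x, of 1 "y / x"] x that by simp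
  then show ?thesis using invsubC_full[OF N] by blast
 qed simp
qed

lemma invsubC_sq:
 assumes N: "invsub R (fmod R KX) (GD {1}) actC N" and y: "y ~= 0" "dl R y : N" and s: "sq (z / y)" and z: "z ~= 0"
 shows "dl R z : N"
proof -
 obtain t where t: "z / y = t * t" using s by (auto simp: sq_def)
 then have t0: "t ~= 0" using y z by auto
 have "z = y * (t * t)" using t y by (simp add: field_simps)
 then show ?thesis using invsubC_diag[OF sgc(2) N y, of "1 / t" t] t0 by (simp add: mult.assoc)
qed

text \<open>Diagonal matrices of determinant 1 move delta functions only within a square class; a
  nonzero value of \<open>J\<close> at a nonsquare links the two classes.\<close>

lemma cusp_irr_SL:
 assumes nd: "!!x. x ~= 0 ==> ~ sq (x::'k) ==> EX c d. c ~= 0 & d ~= 0 & ~ sq d & J c d ~= \<zero>"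
 shows "irrsub R (fmod R KX) (GD {1}) actC (carrier (fmod R KX))"
 unfolding irrsub_def
proof (intro conjI allI impI)
 have D: "subgrp {1::'k}" by (rule sgc)
 show "invsub R (fmod R KX) (GD {1}) actC (carrier (fmod R KX))"
  by (rule kri[OF field_axioms _ krepC[OF D]]) simp
 fix N assume N: "invsub R (fmod R KX) (GD {1}) actC N"
 show "N = {\<zero>@(fmod R KX)} \<or> N = carrier (fmod R KX)"
 proof (cases "N = {%i. \<zero>}")
  case False
  then obtain v x where v: "v : N" "v x ~= \<zero>" by (rule nonzero_member[OF N])
  note x = invsubC_dl[OF D N v]
  have "dl R z : N" if z: "z ~= 0" for z
  proof (cases "sq (z / x)")
   case True
   then show ?thesis using invsubC_sq[OF N x] z by blast
  next
   case ns: False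
   then obtain c d where cd: "c ~= 0" "d ~= 0" "~ sq d" "J c d ~= \<zero>"
    using nd[of "z / x"] x z by auto
   have g: "mc (c * x) 1 : GD {1}" using cd x by (simp add: GD_def m2r)
   \<comment> \<open>The matrix is chosen so that its entry between x and d x is exactly
     \<open>J c d\<close>.\<close>
   have "actC (mc (c * x) 1) (dl R x) (d * x) = KC (mc (c * x) 1) (d * x) x"
    by (rule actC_dl) (use cd x in auto)
   also have "... = J c d" using cd x by (simp add: KC_def mc_def)
   finally have "actC (mc (c * x) 1) (dl R x) (d * x) ~= \<zero>" using cd by simp
   then have dx: "dl R (d * x) : N" by (rule invsubC_dl(2)[OF D N invsub_act[OF N g x(2)]])
   have "~ sq (inverse d)" using sq_inverse[of "inverse d"] cd by auto
   then have "sq (z / x * inverse d)" by (rule nonsq_mult[OF ns])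
   then have "sq (z / (d * x))" by (simp add: field_simps)
   then show ?thesis by (rule invsubC_sq[OF N _ dx _ z, rotated]) (use cd x in auto)
  qed
  then show ?thesis using invsubC_full[OF N] by blast
 qed simp
qed

definition sqC :: "('k => 'a) set" where
 "sqC = {v : carrier (fmod R KX). ALL x. v x ~= \<zero> --> sq x}"

text \<open>Upper triangular matrices of determinant 1 rescale by squares, and every other entry
  contains \<open>J\<close> at x/y.\<close>

lemma KC_sq_zero:
 assumes J0: "!!c d. c ~= 0 ==> d ~= 0 ==> ~ sq d ==> J c d = \<zero>"
  and g: "g : GD {1}" and xy: "x ~= 0" "y ~= 0" and ns: "~ sq (x / y)"
 shows "KC g x y = \<zero>"
proof -
 obtain a b c d where gg: "g = (a, b, c, d)" by (cases g)
 have det: "a * d - b * c = 1" using g by (simp add: GD_def gg)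
 show ?thesis
 proof (cases "c = 0")
  case True
  then have ad: "a * d = 1" using det by simp
  have "a * x ~= d * y"
  proof
   assume e: "a * x = d * y"
   have "x = a * d * x" using ad by simp
   also have "... = d * (a * x)" by (simp only: mult_ac)
   also have "... = d * d * y" by (simp only: e mult.assoc)
   finally have "x / y = d * d" using xy by simp
   then show False using ns by simp
  qed
  then show ?thesis by (simp add: KC_def gg True)
 next
  case False
  then show ?thesis using J0[of "c / y" "x / y"] xy ns by (simp add: KC_def gg det)
 qed
qed

lemma sqC_invsub:
 assumes J0: "!!c d. c ~= 0 ==> d ~= 0 ==> ~ sq d ==> J c d = \<zero>"
 shows "invsub R (fmod R KX) (GD {1}) actC sqC"
 unfolding invsub_def
proof (intro conjI ballI)
 interpret G: grep R py qi "fmod R KX" "{1}" actC by (rule grepC[OF sgc(2)])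
 show "sqC <= carrier (fmod R KX)" by (auto simp: sqC_def)
 show "\<zero>@(fmod R KX) : sqC" by (auto simp: sqC_def fmr)
 fix v assume v: "v : sqC"
 then have vM: "v : carrier (fmod R KX)" by (simp add: sqC_def)
 show "v \<oplus>@(fmod R KX) w : sqC" if "w : sqC" for w
 proof -
  have "sq x" if "v x \<oplus> w x ~= \<zero>" for x
  proof (rule ccontr)
   assume "~ sq x"
   then have "v x = \<zero>" "w x = \<zero>" using v \<open>w : sqC\<close> by (auto simp: sqC_def)
   then show False using that by simp
  qed
  then show ?thesis using v that by (auto simp: sqC_def fmr)
 qed
 show "c \<odot>@(fmod R KX) v : sqC" if "c : carrier R" for c
  using v that by (auto simp: sqC_def fmr) (metis r_null)
 fix g assume g: "g : GD {1::'k}"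
 have "actC g v x = \<zero>" if ns: "~ sq x" for x
 proof (cases "x = 0")
  case False
  have "KC g x y ** v y = \<zero>" if y: "y : KX" for y
  proof (cases "v y = \<zero>")
   case False
   then have "sq y" using v by (auto simp: sqC_def)
   then have "~ sq (x / y)" using ns sq_mult[of "x / y" y] y by auto
   then show ?thesis using KC_sq_zero[OF J0 g _ _, of x y] \<open>x ~= 0\<close> y fmc[OF vM] by simp
  qed simp
  then have "(\<Oplus>y\<in>KX. KC g x y ** v y) = \<zero>" by (rule fs_zero)
  then show ?thesis by (simp add: kact_def)
 qed (simp add: kact_def)
 then show "actC g v : sqC" using G.act_closed[OF g vM] by (auto simp: sqC_def)
qed

lemma sqC_irr:
 assumes J0: "!!c d. c ~= 0 ==> d ~= 0 ==> ~ sq d ==> J c d = \<zero>"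
 shows "irrsub R (fmod R KX) (GD {1}) actC sqC"
 unfolding irrsub_def
proof (intro conjI allI impI)
 show "invsub R (fmod R KX) (GD {1}) actC sqC" by (rule sqC_invsub[OF J0])
 fix N assume N: "invsub R (fmod R KX) (GD {1}) actC N" and sub: "N <= sqC"
 show "N = {\<zero>@(fmod R KX)} \<or> N = sqC"
 proof (cases "N = {%i. \<zero>}")
  case False
  then obtain v x where v: "v : N" "v x ~= \<zero>" by (rule nonzero_member[OF N])
  note x = invsubC_dl[OF sgc(2) N v]
  have sx: "sq x" using v sub by (auto simp: sqC_def)
  have dlN: "dl R z : N" if "z ~= 0" "sq z" for z
   using invsubC_sq[OF N x _ that(1)] sq_mult[OF that(2) sq_inverse[OF sx]] by (simp add: divide_inverse)
  have "sqC <= N"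
  proof
   fix f assume f: "f : sqC"
   then have fM: "f : carrier (fmod R KX)" and fs: "!!x. f x ~= \<zero> ==> sq x" by (auto simp: sqC_def)
   show "f : N"
    by (rule invsub_dl_expand[OF _ N fM]) (simp, rule dlN, simp, rule fs)
  qed
  then show ?thesis using sub by blast
 qed simp
qed

text \<open>\<open>sqC\<close> is irreducible. An invariant subspace strictly above it contains a
  delta function at a nonsquare, hence all delta functions.\<close>

lemma cusp_hlen_2:
 assumes J0: "!!c d. c ~= 0 ==> d ~= 0 ==> ~ sq d ==> J c d = \<zero>" and ns: "~ sq (e::'k)"
 shows "hlen R (fmod R KX) (GD {1}) actC (carrier (fmod R KX)) 2"
proof -
 interpret G: grep R py qi "fmod R KX" "{1}" actC by (rule grepC[OF sgc(2)])
 have e0: "e ~= 0" using ns sq_square[of 0] by auto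
 have d1: "dl R (1::'k) : sqC" by (auto simp: sqC_def dl_def fmr)
 have nz: "dl R x ~= (%i. \<zero>)" for x :: 'k
  by (rule notI, drule fun_cong[of _ _ x]) (simp add: dl_def)
 have de: "dl R e : carrier (fmod R KX)" "dl R e \<notin> sqC" using e0 ns by (auto simp: sqC_def dl_def fmr)
 show ?thesis
 proof (rule G.hlen_2[of _ sqC])
  show "invsub R (fmod R KX) (GD {1}) actC (carrier (fmod R KX))"
   by (rule kri[OF field_axioms _ krepC[OF sgc(2)]]) simp
  show I: "invsub R (fmod R KX) (GD {1}) actC sqC" by (rule sqC_invsub[OF J0])
  show "\<zero>@(fmod R KX) : sqC" by (rule invsub_zero[OF I])
  show "sqC ~= {\<zero>@(fmod R KX)}" using d1 nz[of 1] by auto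
  show "sqC \<subset> carrier (fmod R KX)" using de by (auto simp: sqC_def)
  show "U = {\<zero>@(fmod R KX)}" if "invsub R (fmod R KX) (GD {1}) actC U" "U \<subset> sqC" for U
   using sqC_irr[OF J0] that unfolding irrsub_def by blast
  fix U assume U: "invsub R (fmod R KX) (GD {1}) actC U" "sqC \<subset> U" "U <= carrier (fmod R KX)"
  then obtain v where v: "v : U" "v \<notin> sqC" by blast
  then obtain x where x: "v x ~= \<zero>" "~ sq x" using U(3) by (auto simp: sqC_def)
  note x' = invsubC_dl[OF sgc(2) U(1) v(1) x(1)]
  have "dl R z : U" if z: "z ~= 0" for z
  proof (cases "sq z")
   case True
   then have "dl R z : sqC" using z by (auto simp: sqC_def dl_def fmr)
   then show ?thesis using U by blast
  next
   case False
   have "~ sq (inverse x)" using sq_inverse[of "inverse x"] x by auto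
   then have "sq (z / x)" using nonsq_mult[OF False] by (simp add: divide_inverse)
   then show ?thesis using invsubC_sq[OF U(1) x' _ z] by blast
  qed
  then show "U = carrier (fmod R KX)" by (rule invsubC_full[OF U(1)])
 qed
qed

end

section \<open>Principal series\<close>

text \<open>Points of the projective line are represented by the vectors \<open>hv None = (1, 0)\<close> and
 \<open>hv (Some t) = (t, 1)\<close>; then \<open>g (hv x) = cc g x * hv (pt g x)\<close>.\<close>

definition hv :: "'k::field option => 'k \<times> 'k" where
 "hv x = (case x of None => (1, 0) | Some t => (t, 1))"
definition gv :: "'k::field m2 => 'k \<times> 'k => 'k \<times> 'k" where
 "gv g u = (case g of (a, b, c, d) => (a * fst u + b * snd u, c * fst u + d * snd u))"
definition cc :: "'k::field m2 => 'k option => 'k" where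
 "cc g x = (let (u, w) = gv g (hv x) in if w ~= 0 then w else u)"
definition pt :: "'k::field m2 => 'k option => 'k option" where
 "pt g x = (let (u, w) = gv g (hv x) in if w ~= 0 then Some (u / w) else None)"

lemma gv_mul: "gv (m2mul g h) u = gv g (gv h u)"
 by (cases g, cases h) (simp add: gv_def m2s algebra_simps)

lemma gv_scale: "gv g (l * fst u, l * snd u) = (l * fst (gv g u), l * snd (gv g u))"
 by (cases g) (simp add: gv_def algebra_simps)

lemma gv_hv:
 assumes "mdet g ~= 0"
 shows "cc g x ~= 0" "gv g (hv x) = (cc g x * fst (hv (pt g x)), cc g x * snd (hv (pt g x)))"
proof -
 obtain a b c d where g: "g = (a, b, c, d)" by (cases g)
 have det: "a * d - b * c ~= 0" using assms by (simp add: g)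
 obtain u w where hx: "hv x = (u, w)" by force
 have uw: "u ~= 0 \<or> w ~= 0" using hx by (auto simp: hv_def split: option.splits)
 have "a * u + b * w ~= 0" if "c * u + d * w = 0"
 proof
  assume z: "a * u + b * w = 0"
  have "(a * d - b * c) * u = d * (a * u + b * w) - b * (c * u + d * w)" by (simp add: algebra_simps)
  moreover have "(a * d - b * c) * w = a * (c * u + d * w) - c * (a * u + b * w)" by (simp add: algebra_simps)
  ultimately show False using z that det uw by simp
 qed
 moreover have gx: "gv g (hv x) = (a * u + b * w, c * u + d * w)" by (simp add: gv_def g hx)
 ultimately show "cc g x ~= 0" "gv g (hv x) = (cc g x * fst (hv (pt g x)), cc g x * snd (hv (pt g x)))"
  unfolding cc_def pt_def gx by (auto simp: hv_def)
qed

lemma hv_unique: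
 assumes "l ~= 0" "m ~= 0" "l * fst (hv y) = m * fst (hv z)" "l * snd (hv y) = m * snd (hv z)"
 shows "y = z" "l = m"
 using assms by (auto simp: hv_def split: option.splits)

lemma pt_cc_mul:
 assumes g: "mdet g ~= 0" and h: "mdet h ~= 0"
 shows "pt (m2mul g h) x = pt g (pt h x)" "cc (m2mul g h) x = cc g (pt h x) * cc h x"
proof -
 let ?l = "cc (m2mul g h) x" and ?m = "cc h x * cc g (pt h x)"
 have gh: "mdet (m2mul g h) ~= 0" using g h by simp
 have e: "gv (m2mul g h) (hv x) = (?m * fst (hv (pt g (pt h x))), ?m * snd (hv (pt g (pt h x))))"
  unfolding gv_mul gv_hv(2)[OF h] gv_scale gv_hv(2)[OF g] by (simp add: mult.assoc)
 have "?l * fst (hv (pt (m2mul g h) x)) = ?m * fst (hv (pt g (pt h x)))"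
  "?l * snd (hv (pt (m2mul g h) x)) = ?m * snd (hv (pt g (pt h x)))"
  using e unfolding gv_hv(2)[OF gh] by simp_all
 from hv_unique[OF gv_hv(1)[OF gh] _ this] gv_hv(1)[OF g] gv_hv(1)[OF h]
 show "pt (m2mul g h) x = pt g (pt h x)" "cc (m2mul g h) x = cc g (pt h x) * cc h x" by auto
qed

lemma pt_cc_one: "pt m2one x = x" "cc m2one x = 1"
 by (auto simp: pt_def cc_def gv_def m2one_def hv_def split: option.splits)

locale psr = achar R py qi for R (structure) and py :: "'k::{finite,field} => 'a" and qi +
 fixes cx nu :: "'k => 'a"
 assumes ch_closed [simp, intro]: "cx t : carrier R" and nu_closed [simp, intro]: "nu t : carrier R"
  and ch_mult: "[|s ~= 0; t ~= 0|] ==> cx (s * t) = cx s ** cx t"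
  and nu_mult: "[|s ~= 0; t ~= 0|] ==> nu (s * t) = nu s ** nu t"
  and ch_one [simp]: "cx 1 = \<one>" and nu_one [simp]: "nu 1 = \<one>"
begin

abbreviation "KX \<equiv> UNIV - {0::'k}"
abbreviation "MP \<equiv> fmod R (UNIV :: 'k option set)"

text \<open>The principal series: matrices permute the projective line, up to a factor given by
  \<open>cx\<close> of the determinant and \<open>nu\<close> of the scaling
  \<open>cc\<close>.\<close>

definition KP :: "'k m2 => 'k option => 'k option => 'a" where
 "KP g y x = (if y = pt g x then cx (mdet g) ** nu (cc g x) else \<zero>)"

abbreviation "actP \<equiv> kact R UNIV KP"

lemma KP_closed [simp, intro]: "KP g y x : carrier R" by (simp add: KP_def)

lemma nu_unit: "t ~= 0 ==> nu t ~= \<zero>"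
 using nu_mult[of t "inverse t"] by fastforce

lemma ch_unit: "t ~= 0 ==> cx t ~= \<zero>"
 using ch_mult[of t "inverse t"] by fastforce

lemma krepP0: "krep R (GD KX) UNIV KP"
 unfolding krep_def
proof (intro conjI ballI)
 fix g h z x assume "g : GD KX" "h : GD KX"
 then have g: "mdet g ~= 0" and h: "mdet h ~= 0" by (auto simp: GD_def)
 have "(\<Oplus>y\<in>UNIV. KP g z y ** KP h y x) = KP g z (pt h x) ** KP h (pt h x) x"
  by (rule fs_only) (auto simp: KP_def)
 also have "... = KP (m2mul g h) z x"
  using g h gv_hv(1)[OF h, of x] gv_hv(1)[OF g, of "pt h x"]
  by (simp add: KP_def pt_cc_mul ch_mult nu_mult m_ac)
 finally show "KP (m2mul g h) z x = (\<Oplus>y\<in>UNIV. KP g z y ** KP h y x)" ..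
qed (auto simp: KP_def pt_cc_one)

lemma krepP: "subgrp D ==> krep R (GD D) UNIV KP"
 by (rule krep_subset[OF krepP0]) (auto simp: GD_def subgrp_def)

lemma grepP: "subgrp D ==> grep R py qi MP D actP"
 by (intro grep.intro achar_axioms krep_linact krepP) auto

lemma inv_fullP: "subgrp D ==> invsub R MP (GD D) actP (carrier MP)"
 by (rule kri[OF field_axioms _ krepP]) simp

lemma actP_pt:
 assumes v: "v : carrier MP" and g: "mdet g ~= 0"
 shows "actP g v (pt g x) = cx (mdet g) ** nu (cc g x) ** v x"
proof -
 interpret G: grep R py qi MP KX actP by (rule grepP[OF sgc(1)])
 obtain h where h: "h : GD KX" "m2mul h g = m2one"
  by (rule G.inverse_GD[of g]) (use g in \<open>auto simp: GD_def\<close>)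
 then have "mdet h ~= 0" by (simp add: GD_def)
 then have inj: "pt h (pt g y) = y" for y using pt_cc_mul(1)[of h g y] g h pt_cc_one by metis
 have "(\<Oplus>y\<in>UNIV. KP g (pt g x) y ** v y) = KP g (pt g x) x ** v x"
 proof (rule fs_only)
  fix y assume "y ~= x"
  then have "pt g x ~= pt g y" using inj by metis
  then show "KP g (pt g x) y ** v y = \<zero>" using fmc[OF v] by (simp add: KP_def)
 qed (auto simp: fmc[OF v])
 then show ?thesis by (simp add: kact_def KP_def)
qed

lemma actP_nm:
 assumes v: "v : carrier MP"
 shows "actP (nm b) v None = v None" "actP (nm b) v (Some t) = v (Some (t - b))"
 using actP_pt[OF v, of "nm b" None] actP_pt[OF v, of "nm b" "Some (t - b)"]
 by (simp_all add: nm_def pt_def cc_def gv_def hv_def fmc[OF v])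

lemma actP_dg:
 assumes v: "v : carrier MP" and ad: "a ~= 0" "d ~= 0"
 shows "actP (dg a d) v None = cx (a * d) ** nu a ** v None"
  "actP (dg a d) v (Some t) = cx (a * d) ** nu d ** v (Some (d * t / a))"
 using actP_pt[OF v, of "dg a d" None] actP_pt[OF v, of "dg a d" "Some (d * t / a)"] ad
 by (simp_all add: dg_def pt_def cc_def gv_def hv_def)

lemma actP_mc:
 assumes v: "v : carrier MP" and cd: "c ~= 0" "d ~= 0"
 shows "actP (mc c d) v (Some 0) = cx d ** nu c ** v None"
  "actP (mc c d) v None = cx d ** nu (- d / c) ** v (Some 0)"
  "t ~= 0 ==> actP (mc c d) v (Some (- d / (c * t))) = cx d ** nu t ** v (Some (t / c))"
 using actP_pt[OF v, of "mc c d" None] actP_pt[OF v, of "mc c d" "Some 0"] actP_pt[OF v, of "mc c d" "Some (t / c)"] cd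
 by (simp_all add: mc_def pt_def cc_def gv_def hv_def)

text \<open>\<open>mv a\<close> spans the part of the module that transforms by psi(a x) under U,
  for a nonzero; the vectors \<open>wv\<close> are fixed by U; \<open>chat\<close> is the Fourier
  transform on the affine line.\<close>

definition mv :: "'k => 'k option => 'a" where
 "mv a = (%y. case y of None => \<zero> | Some x => py (- (a * x)))"
definition wv :: "'a => 'a => 'k option => 'a" where
 "wv al ga = (%y. case y of None => al | Some x => ga)"
definition chat :: "'k => ('k option => 'a) => 'a" where
 "chat a v = qi ** (\<Oplus>x\<in>UNIV. py (a * x) ** v (Some x))"

lemma MPc: "v : carrier MP \<longleftrightarrow> (ALL y. v y : carrier R)"
 by (simp add: fmr)

lemma mv_closed [simp, intro]: "mv a : carrier MP"
 by (auto simp: MPc mv_def split: option.splits)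
lemma wv_closed [simp, intro]: "al : carrier R ==> ga : carrier R ==> wv al ga : carrier MP"
 by (auto simp: MPc wv_def split: option.splits)
lemma chat_closed [simp, intro]: "v : carrier MP ==> chat a v : carrier R"
 by (auto simp: chat_def MPc)

lemma mv_simps [simp]: "mv a None = \<zero>" "mv a (Some x) = py (- (a * x))" "wv al ga None = al" "wv al ga (Some x) = ga"
 by (simp_all add: mv_def wv_def)

lemma chat_add: "v : carrier MP ==> w : carrier MP ==> chat a (v \<oplus>@MP w) = chat a v \<oplus> chat a w"
proof -
 assume v: "v : carrier MP" and w: "w : carrier MP"
 have "(\<Oplus>x\<in>UNIV. py (a * x) ** (v (Some x) \<oplus> w (Some x))) = (\<Oplus>x\<in>UNIV. py (a * x) ** v (Some x) \<oplus> py (a * x) ** w (Some x))"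
  by (rule fsc) (use v w in \<open>auto simp: MPc r_distr\<close>)
 then show ?thesis using v w by (simp add: chat_def fs_add MPc r_distr)
qed

lemma chat_smult: "c : carrier R ==> v : carrier MP ==> chat a (c \<odot>@MP v) = c ** chat a v"
proof -
 assume c: "c : carrier R" and v: "v : carrier MP"
 have "(\<Oplus>x\<in>UNIV. py (a * x) ** (c ** v (Some x))) = (\<Oplus>x\<in>UNIV. c ** (py (a * x) ** v (Some x)))"
  by (rule fsc) (use v c in \<open>auto simp: MPc m_lcomm\<close>)
 then show ?thesis using v c by (simp add: chat_def fsr MPc m_lcomm)
qed

lemma chat_mv: "chat a (mv b) = (if a = b then \<one> else \<zero>)"
proof -
 have "(\<Oplus>x\<in>UNIV. py (a * x) ** mv b (Some x)) = (\<Oplus>x\<in>UNIV. py ((a - b) * x))"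
  by (rule fsc) (auto simp: psi_add[symmetric] algebra_simps)
 then show ?thesis by (simp add: chat_def psi_sum_eq)
qed

lemma chat_wv: "al : carrier R ==> ga : carrier R ==> chat a (wv al ga) = (if a = 0 then ga else \<zero>)"
 by (simp add: chat_def fsl psi_sum_eq)

lemma peP:
 fixes D :: "'k set"
 assumes D: "subgrp D" and v: "v : carrier MP"
 shows "grep.pe R py qi MP actP a v = (%y. case y of None => if a = 0 then v None else \<zero> | Some x => chat a v ** py (- (a * x)))"
proof
 interpret G: grep R py qi MP D actP by (rule grepP[OF D])
 fix y
 note vc = fmc[OF v]
 have c: "(qi ** py (- (a * b))) \<odot>@MP actP (nm b) v : carrier MP" for b
  by (intro G.M.smult_closed G.act_closed v) auto
 have "G.pe a v y = (\<Oplus>b\<in>UNIV. ((qi ** py (- (a * b))) \<odot>@MP actP (nm b) v) y)"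
  unfolding G.pe_def by (rule fmod_sum) (rule c)
 also have "... = (case y of None => if a = 0 then v None else \<zero> | Some x => chat a v ** py (- (a * x)))"
 proof (cases y)
  case None
  have "(\<Oplus>b\<in>UNIV. qi ** py (- (a * b)) ** v None) = (\<Oplus>b\<in>UNIV. py (- a * b) ** (qi ** v None))"
   by (rule fsc) (auto simp: vc m_ac)
  also have "... = (if a = 0 then v None else \<zero>)"
   using vc by (subst fsl) (auto simp: psi_sum_eq simp del: mult_minus_left)
  finally show ?thesis using None by (simp add: actP_nm[OF v])
 next
  case (Some t)
  have "(\<Oplus>b\<in>UNIV. qi ** py (- (a * b)) ** v (Some (t - b))) = (\<Oplus>x\<in>UNIV. (qi ** py (- (a * t))) ** (py (a * x) ** v (Some x)))"
  proof (rule fsw[of _ "%x. t - x" "%b. t - b"])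
   fix b
   have "py (- (a * b)) = py (- (a * t)) ** py (a * (t - b))"
    unfolding psi_add[symmetric] by (simp add: algebra_simps)
   then show "qi ** py (- (a * b)) ** v (Some (t - b)) = (qi ** py (- (a * t))) ** (py (a * (t - b)) ** v (Some (t - b)))"
    by (simp add: vc m_assoc)
  qed (auto simp: vc)
  also have "... = chat a v ** py (- (a * t))"
   by (subst fsr) (auto simp: vc chat_def m_ac)
  finally show ?thesis using Some by (simp add: actP_nm[OF v])
 qed
 finally show "G.pe a v y = (case y of None => if a = 0 then v None else \<zero> | Some x => chat a v ** py (- (a * x)))" .
qed

lemma peP_0: "subgrp (D::'k set) ==> v : carrier MP ==> grep.pe R py qi MP actP 0 v = wv (v None) (chat 0 v)"
 by (subst peP) (auto simp: wv_def fun_eq_iff split: option.splits)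

lemma peP_nz: "subgrp (D::'k set) ==> v : carrier MP ==> a ~= 0 ==> grep.pe R py qi MP actP a v = chat a v \<odot>@MP mv a"
 by (subst peP) (auto simp: mv_def fun_eq_iff split: option.splits)

lemma fourierP:
 assumes v: "v : carrier MP"
 shows "v = wv (v None) (chat 0 v) \<oplus>@MP finsum MP (%a. chat a v \<odot>@MP mv a) KX"
proof -
 interpret G: grep R py qi MP "{1}" actP by (rule grepP[OF sgc(2)])
 have "v = finsum MP (%a. G.pe a v) UNIV" using G.pe_total[OF v] ..
 also have "... = G.pe 0 v \<oplus>@MP finsum MP (%a. G.pe a v) KX"
  by (rule G.M.M.fs_split) (auto simp: G.pe_closed[OF v])
 also have "finsum MP (%a. G.pe a v) KX = finsum MP (%a. chat a v \<odot>@MP mv a) KX"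
 proof (rule G.M.M.fsc)
  fix a assume "a : KX"
  then show "G.pe a v = chat a v \<odot>@MP mv a" by (intro peP_nz[OF sgc(2) v]) simp
  show "chat a v \<odot>@MP mv a : carrier MP" by (intro G.M.smult_closed chat_closed v mv_closed)
 qed
 also have "G.pe 0 v = wv (v None) (chat 0 v)" by (rule peP_0[OF sgc(2) v])
 finally show ?thesis .
qed

text \<open>Off the scalars these are Kloosterman sums twisted by \<open>nu\<close>.\<close>

definition lamP :: "'k \<times> 'k => 'a" where
 "lamP b = (if fst b = 0 then cx (snd b * snd b) ** nu (snd b)
   else qi ** (\<Oplus>t\<in>KX. cx (snd b) ** nu t ** py (- (t + snd b / t) / fst b)))"

lemma hevP:
 assumes D: "subgrp D"
 shows "grep.hev R py qi MP D actP lamP (mv 1)"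
proof -
 interpret G: grep R py qi MP D actP by (rule grepP[OF D])
 have "G.pe 1 (mv 1) = chat 1 (mv 1) \<odot>@MP mv 1" by (rule peP_nz[OF D mv_closed one_neq_zero])
 also have "... = mv 1" unfolding chat_mv using G.M.smult_one[OF mv_closed] by simp
 finally have "G.psv 1 (mv 1)" using G.psv_pe[of "mv 1" 1] by simp
 moreover have "mv 1 (Some 0) ~= \<zero>" by simp
 then have "mv 1 ~= (%i. \<zero>)" by metis
 moreover have "lamP b : carrier R & G.Tb b (mv 1) = lamP b \<odot>@MP mv 1" if b: "b : BD D" for b
 proof -
  obtain c d where bb: "b = (c, d)" by force
  have d0: "d ~= 0" using b D by (auto simp: bb BD_def subgrp_def split: if_splits)
  have gb: "bel b : GD D" by (rule G.bel_GD[OF b])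
  have lc: "lamP b : carrier R" by (auto simp: lamP_def)
  have "chat 1 (actP (bel b) (mv 1)) = lamP b"
  proof (cases "c = 0")
   case True
   have "chat 1 (actP (bel b) (mv 1)) = chat 1 ((cx (d * d) ** nu d) \<odot>@MP mv 1)"
    unfolding chat_def using d0 by (simp add: bel_def bb True actP_dg)
   then show ?thesis by (subst (asm) chat_smult) (auto simp: chat_mv lamP_def bb True)
  next
   case False
   have w: "actP (mc c d) (mv 1) y : carrier R" for y
    using G.act_closed[OF gb mv_closed] False by (simp add: bel_def bb MPc)
   have "(\<Oplus>x\<in>UNIV. py (1 * x) ** actP (mc c d) (mv 1) (Some x)) = (\<Oplus>x\<in>KX. py (1 * x) ** actP (mc c d) (mv 1) (Some x))"
    by (rule fs_mono) (use w False d0 in \<open>auto simp: actP_mc\<close>)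
   also have "... = (\<Oplus>t\<in>KX. cx d ** nu t ** py (- (t + d / t) / c))"
   proof (rule fsw[of _ "%t. - d / (c * t)" "%x. - d / (c * x)"])
    fix x assume x: "x : KX"
    let ?t = "- d / (c * x)"
    have xe: "x = - d / (c * ?t)" using x False d0 by simp
    have t0: "?t ~= 0" using x False d0 by simp
    have "actP (mc c d) (mv 1) (Some x) = cx d ** nu ?t ** py (- (?t / c))"
     using actP_mc(3)[OF mv_closed False d0 t0, of 1] unfolding xe[symmetric] by simp
    moreover have "py (- (?t + d / ?t) / c) = py x ** py (- (?t / c))"
     unfolding psi_add[symmetric] using x False d0 by (intro arg_cong[of _ _ py]) (simp add: field_simps)
    ultimately show "py (1 * x) ** actP (mc c d) (mv 1) (Some x) = cx d ** nu ?t ** py (- (?t + d / ?t) / c)"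
     by (simp add: m_ac)
   qed (use False d0 in auto)
   finally show ?thesis using False by (simp add: chat_def bel_def bb lamP_def)
  qed
  then have "G.Tb b (mv 1) = lamP b \<odot>@MP mv 1"
   unfolding G.Tb_def peP_nz[OF D G.act_closed[OF gb mv_closed] one_neq_zero] by simp
  then show ?thesis using lc by simp
 qed
 ultimately show ?thesis by (simp add: G.hev_def)
qed

lemma wv_add: "wv al ga \<oplus>@MP wv al' ga' = wv (al \<oplus> al') (ga \<oplus> ga')"
 and wv_smult: "c \<odot>@MP wv al ga = wv (c ** al) (c ** ga)"
 by (auto simp: wv_def fun_eq_iff split: option.splits)

lemma wv_None: "wv \<one> \<zero> = dl R None"
 by (auto simp: wv_def dl_def fun_eq_iff split: option.splits)

lemma SL2_sub: "subgrp D ==> mdet g = 1 ==> g : GD D"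
 by (auto simp: GD_def subgrp_def)

lemma invsubP_full:
 assumes D: "subgrp D" and N: "invsub R MP (GD D) actP N" and i: "dl R None : N"
 shows "N = carrier MP"
proof -
 have iM: "dl R None : carrier MP" by (rule dl_closed) simp
 have dN: "dl R (Some b) : N" for b
 proof -
  let ?g = "m2mul (nm b) (mc 1 1)"
  have g: "mdet ?g = 1" by (simp add: m2r)
  have "pt ?g None = Some b" "cc ?g None = 1"
   by (simp_all add: nm_def mc_def m2s pt_def cc_def gv_def hv_def)
  have "actP ?g (dl R None) y = dl R (Some b) y" for y
   using \<open>pt ?g None = Some b\<close> \<open>cc ?g None = 1\<close> g by (subst kact_dl) (auto simp: KP_def dl_def)
  then have "actP ?g (dl R None) = dl R (Some b)" by blast
  then show ?thesis using invsub_act[OF N SL2_sub[OF D g] i] by simp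
 qed
 have dN': "dl R y : N" for y using i dN by (cases y) simp_all
 have "carrier MP <= N"
 proof
  fix f assume "f : carrier MP"
  then show "f : N" by (rule invsub_dl_expand[OF _ N, rotated]) (rule dN', simp)
 qed
 then show ?thesis using N by (auto simp: invsub_def)
qed

text \<open>Two independent vectors fixed by U combine to the delta function at infinity, which
  generates everything.\<close>

lemma invsubP_det:
 assumes D: "subgrp D" and N: "invsub R MP (GD D) actP N"
  and c: "al : carrier R" "ga : carrier R" "al' : carrier R" "ga' : carrier R"
  and w: "wv al ga : N" "wv al' ga' : N" and det: "al ** ga' \<ominus> al' ** ga ~= \<zero>"
 shows "N = carrier MP"
proof -
 have "ga' \<odot>@MP wv al ga \<oplus>@MP (\<ominus> ga) \<odot>@MP wv al' ga' : N"
  by (intro invsub_add[OF N] ivm[OF N] w) (use c in auto)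
 also have "ga' \<odot>@MP wv al ga \<oplus>@MP (\<ominus> ga) \<odot>@MP wv al' ga' = (al ** ga' \<ominus> al' ** ga) \<odot>@MP wv \<one> \<zero>"
  unfolding wv_add wv_smult using c by (simp add: l_minus r_minus a_minus_def m_comm r_neg)
 finally have "dl R None : N" unfolding wv_None
  by (rule smc[OF fmm N _ det, rotated 2]) (use c in auto)
 then show ?thesis by (rule invsubP_full[OF D N])
qed

text \<open>An element of SL2 moves a nonzero value to infinity, and averaging over U preserves the
  value there.\<close>

lemma invsubP_wv:
 assumes D: "subgrp D" and N: "invsub R MP (GD D) actP N" and ne: "N ~= {%i. \<zero>}"
 obtains be where "be : carrier R" "wv \<one> be : N"
proof -
 interpret G: grep R py qi MP D actP by (rule grepP[OF D])
 obtain v x where v: "v : N" "v x ~= \<zero>"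
 proof -
  obtain v where "v : N" "v ~= (%i. \<zero>)" using ne invsub_zero[OF N] by auto
  then show thesis using that by blast
 qed
 define g where "g = (case x of None => m2one | Some t => m2mul (mc 1 1) (nm (- t)))"
 have g: "mdet g = 1" by (auto simp: g_def m2r split: option.splits)
 have px: "pt g x = None"
  by (auto simp: g_def pt_def gv_def hv_def nm_def mc_def m2one_def m2s split: option.splits)
 define w where "w = actP g v"
 have wN: "w : N" unfolding w_def by (rule invsub_act[OF N SL2_sub[OF D g] v(1)])
 have wM: "w : carrier MP" by (rule invsub_sub[OF N wN])
 have vM: "v : carrier MP" by (rule invsub_sub[OF N v(1)])
 have "w None = nu (cc g x) ** v x"
  using actP_pt[OF vM, of g x] g px by (simp add: w_def)
 then have w0: "w None ~= \<zero>"
  using v(2) integral[of "nu (cc g x)" "v x"] nu_unit[of "cc g x"] gv_hv(1)[of g x] g fmc[OF vM] by auto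
 have "G.pe 0 w : N" by (rule G.pe_invsub[OF N wN])
 then have wv: "wv (w None) (chat 0 w) : N" by (simp add: peP_0[OF D wM])
 have u: "w None : Units R" using w0 fmc[OF wM] by (simp add: field_Units)
 have "inv (w None) \<odot>@MP wv (w None) (chat 0 w) : N"
  by (rule ivm[OF N _ wv]) (use u in auto)
 then have "wv \<one> (inv (w None) ** chat 0 w) : N" using u by (simp add: wv_smult del: fmod_simps)
 then show ?thesis using that[of "inv (w None) ** chat 0 w"] u wM by auto
qed

lemma actP_dg_wv:
 assumes "a ~= 0" "d ~= 0" "al : carrier R" "ga : carrier R"
 shows "actP (dg a d) (wv al ga) = wv (cx (a * d) ** nu a ** al) (cx (a * d) ** nu d ** ga)"
proof
 fix y
 show "actP (dg a d) (wv al ga) y = wv (cx (a * d) ** nu a ** al) (cx (a * d) ** nu d ** ga) y"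
  using assms by (cases y) (simp_all add: actP_dg)
qed

text \<open>The diagonal matrix scales the two coordinates of \<open>wv\<close> by different
  factors, which yields a second independent vector unless one coordinate is 0 already.\<close>

lemma PS_irr:
 assumes D: "subgrp D" and a: "a * d : D" and ne: "nu a ~= nu d"
 shows "irrsub R MP (GD D) actP (carrier MP)"
 unfolding irrsub_def
proof (intro conjI allI impI)
 have nz: "a ~= 0" "d ~= 0" using a D by (auto simp: subgrp_def)
 show "invsub R MP (GD D) actP (carrier MP)" by (rule inv_fullP[OF D])
 fix N assume N: "invsub R MP (GD D) actP N"
 show "N = {\<zero>@MP} \<or> N = carrier MP"
 proof (cases "N = {%i. \<zero>}")
  case False
  then obtain be where b: "be : carrier R" "wv \<one> be : N" by (rule invsubP_wv[OF D N])
  show ?thesis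
  proof (cases "be = \<zero>")
   case True
   then show ?thesis using invsubP_full[OF D N] b wv_None by simp
  next
   case b0: False
   let ?c = "cx (a * d)"
   have "actP (dg a d) (wv \<one> be) : N" by (rule invsub_act[OF N _ b(2)]) (use a in \<open>simp add: GD_def m2r\<close>)
   then have w2: "wv (?c ** nu a ** \<one>) (?c ** nu d ** be) : N" using actP_dg_wv[OF nz one_closed b(1)] by simp
   have "\<one> ** (?c ** nu d ** be) \<ominus> (?c ** nu a ** \<one>) ** be = ?c ** (nu d \<ominus> nu a) ** be"
    using b(1) by (simp add: a_minus_def l_distr r_distr l_minus r_minus)
   moreover have "... ~= \<zero>"
   proof -
    have "nu d \<ominus> nu a ~= \<zero>" using ne dze[of "nu d" "nu a"] by auto
    then show ?thesis using b0 b(1) ch_unit[of "a * d"] nz integral by (metis ch_closed m_closed minus_closed no_zero_divisors nu_closed)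
   qed
   ultimately show ?thesis using invsubP_det[OF D N one_closed b(1) _ _ b(2) w2] b(1) by simp
  qed
 qed simp
qed

end

section \<open>The reducible principal series of \<open>SL2\<close>\<close>

text \<open>\<open>nu\<close> is a nontrivial quadratic character; such a character can only take
  values in \<open>R\<close> if 2 is nonzero there (\<open>two_nonzero\<close>).\<close>

locale psq = psr R py qi cx nu for R (structure) and py :: "'k::{finite,field} => 'a" and qi cx nu +
 assumes nu_quad: "t ~= 0 ==> nu t ** nu t = \<one>" and nu_nontriv: "EX t. t ~= 0 & nu t ~= \<one>"
begin

lemma nu_pm: "t ~= 0 ==> nu t = \<one> \<or> nu t = \<ominus> \<one>"
 using nu_quad[of t] square_eq_one by blast

lemma two_nonzero: "\<one> \<oplus> \<one> ~= \<zero>" "\<ominus> \<one> ~= \<one>"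
proof -
 show a: "\<ominus> \<one> ~= \<one>" using nu_nontriv nu_pm by metis
 show "\<one> \<oplus> \<one> ~= \<zero>"
 proof
  assume "\<one> \<oplus> \<one> = \<zero>"
  then have "\<ominus> \<one> = \<one>" by (rule minus_equality) auto
  with a show False by simp
 qed
qed

lemma nu_inverse: "t ~= 0 ==> nu (inverse t) = nu t"
proof -
 assume t: "t ~= 0"
 have "nu (inverse t) = nu t ** nu t ** nu (inverse t)" using t nu_quad by simp
 also have "... = nu t ** nu (t * inverse t)" using t by (subst nu_mult) (auto simp: m_assoc)
 finally show ?thesis using t by simp
qed

lemma nu_sum: "(\<Oplus>t\<in>KX. nu t) = \<zero>"
proof -
 obtain u where u: "u ~= 0" "nu u ~= \<one>" using nu_nontriv by blast
 have "(\<Oplus>t\<in>KX. nu t) = (\<Oplus>t\<in>KX. nu u ** nu t)"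
  by (rule fsw[of _ "%t. u * t" "%t. t / u"]) (use u in \<open>auto simp: nu_mult[symmetric]\<close>)
 then have "(nu u \<ominus> \<one>) ** (\<Oplus>t\<in>KX. nu t) = \<zero>"
  by (subst (asm) fsr) (auto simp: a_minus_def l_distr l_minus r_neg)
 then show ?thesis using integral[of "nu u \<ominus> \<one>"] dze[of "nu u" \<one>] u by auto
qed

lemma nu_sq: "t ~= 0 ==> nu t = \<one> \<longleftrightarrow> sq t"
proof
 assume t: "t ~= 0" and "sq t"
 then obtain s where "t = s * s" "s ~= 0" by (auto simp: sq_def)
 then show "nu t = \<one>" using nu_quad by (simp add: nu_mult)
next
 assume t: "t ~= 0" and n: "nu t = \<one>"
 obtain u where u: "u ~= 0" "nu u ~= \<one>" using nu_nontriv by blast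
 have sq1: "nu s = \<one>" if "s ~= 0" "sq s" for s
 proof -
  obtain r where "s = r * r" "r ~= 0" using \<open>sq s\<close> \<open>s ~= 0\<close> by (auto simp: sq_def)
  then show ?thesis using nu_quad by (simp add: nu_mult)
 qed
 show "sq t"
 proof (rule ccontr)
  assume "~ sq t"
  moreover have "~ sq u" using sq1 u by blast
  ultimately have "sq (t * u)" by (rule nonsq_mult)
  then have "nu t ** nu u = \<one>" using sq1[of "t * u"] t u by (simp add: nu_mult)
  then show False using n u by simp
 qed
qed

definition gauss :: 'a where "gauss = (\<Oplus>t\<in>KX. nu t ** py t)"

lemma gauss_closed [simp, intro]: "gauss : carrier R" by (auto simp: gauss_def)

lemma gauss_scale:
 assumes a: "a ~= 0"
 shows "(\<Oplus>t\<in>KX. nu t ** py (a / t)) = nu a ** gauss"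
proof -
 have "(\<Oplus>t\<in>KX. nu t ** py (a / t)) = (\<Oplus>s\<in>KX. nu a ** (nu s ** py s))"
 proof (rule fsw[of _ "%s. a / s" "%t. a / t"])
  fix t assume t: "t : KX"
  have "nu t = nu a ** (nu a ** nu t)" using a nu_quad by (simp add: m_assoc[symmetric])
  also have "nu a ** nu t = nu (a / t)" using a t by (simp add: divide_inverse nu_mult nu_inverse)
  finally show "nu t ** py (a / t) = nu a ** (nu (a / t) ** py (a / t))" by (simp add: m_assoc)
 qed (use a in auto)
 then show ?thesis by (simp add: fsr gauss_def)
qed

text \<open>Substituting x = y z makes the sum over y geometric: only z = -1 contributes beyond a
  multiple of the sum of \<open>nu\<close>, which is 0.\<close>

lemma gauss_square: "gauss ** gauss = nu (- 1) ** qq"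
proof -
 have "gauss ** gauss = (\<Oplus>y\<in>KX. \<Oplus>x\<in>KX. nu x ** py x ** (nu y ** py y))"
  unfolding gauss_def by (rule fs_product) auto
 also have "... = (\<Oplus>y\<in>KX. \<Oplus>z\<in>KX. nu z ** py (y * (z + 1)))"
 proof (rule fsc)
  fix y assume y: "y : KX"
  show "(\<Oplus>x\<in>KX. nu x ** py x ** (nu y ** py y)) = (\<Oplus>z\<in>KX. nu z ** py (y * (z + 1)))"
  proof (rule fsw[of _ "%z. y * z" "%x. x / y"])
   fix x assume x: "x : KX"
   have "nu (x / y) = nu x ** nu y" using x y by (simp add: divide_inverse nu_mult nu_inverse)
   moreover have "py (y * (x / y + 1)) = py x ** py y" using y by (simp add: psi_add[symmetric] algebra_simps)
   ultimately show "nu x ** py x ** (nu y ** py y) = nu (x / y) ** py (y * (x / y + 1))" by (simp add: m_ac)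
  qed (use y in auto)
 qed auto
 also have "... = (\<Oplus>z\<in>KX. \<Oplus>y\<in>KX. nu z ** py (y * (z + 1)))" by (rule fs_swap) auto
 also have "... = (\<Oplus>z\<in>KX. (if z = - 1 then nu (- 1) ** qq else \<zero>) \<oplus> (\<ominus> nu z))"
 proof (rule fsc)
  fix z
  have "(\<Oplus>y\<in>KX. nu z ** py (y * (z + 1))) = nu z ** (if z + 1 = 0 then qq \<ominus> \<one> else \<ominus> \<one>)"
   by (subst fsr) (auto simp: psi_sum_nz)
  moreover have "z + 1 = 0 \<longleftrightarrow> z = - 1" by (rule eq_neg_iff_add_eq_0[symmetric])
  ultimately show "(\<Oplus>y\<in>KX. nu z ** py (y * (z + 1))) = (if z = - 1 then nu (- 1) ** qq else \<zero>) \<oplus> (\<ominus> nu z)"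
   by (auto simp: a_minus_def r_distr r_minus)
 qed auto
 also have "... = (\<Oplus>z\<in>KX. if z = - 1 then nu (- 1) ** qq else \<zero>) \<oplus> (\<Oplus>z\<in>KX. \<ominus> nu z)"
  by (rule fs_add) auto
 also have "(\<Oplus>z\<in>KX. \<ominus> nu z) = \<zero>" by (simp add: fs_uminus nu_sum)
 also have "(\<Oplus>z\<in>KX. if z = - 1 then nu (- 1) ** qq else \<zero>) = nu (- 1) ** qq"
  by (subst fs_only[of _ "- 1"]) auto
 finally show ?thesis by simp
qed

text \<open>The ratio for which the U-fixed vectors \<open>wv\<close> with coordinates 1 and plus or
  minus \<open>b0\<close> generate the two halves: its square is \<open>nu\<close> (-1) / q.\<close>

definition b0 :: 'a where "b0 = qi ** gauss"

lemma b0_closed [simp, intro]: "b0 : carrier R" by (simp add: b0_def)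

lemma b0_square: "b0 ** b0 = qi ** nu (- 1)"
proof -
 have "b0 ** b0 = (qi ** qi) ** (gauss ** gauss)" by (simp add: b0_def m_ac)
 then show ?thesis by (simp add: gauss_square m_ac)
qed

lemma b0_nonzero: "b0 ~= \<zero>"
proof
 assume "b0 = \<zero>"
 then have "qi ** nu (- 1) = \<zero>" using b0_square by simp
 then show False using integral[of qi "nu (- 1)"] qq_nonzero(2) nu_unit[of "- 1"] by auto
qed

lemma b0_gauss: "b0 ** gauss = nu (- 1)"
proof -
 have "b0 ** gauss = qi ** (gauss ** gauss)" by (simp add: b0_def m_assoc)
 then show ?thesis unfolding gauss_square by (simp add: m_assoc m_lcomm[of qi])
qed

definition w0 :: "'k m2" where "w0 = mc 1 1"

lemma w0_det: "mdet w0 = 1" by (simp add: w0_def m2r)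

lemma actP_w0_wv:
 assumes "be : carrier R"
 shows "actP w0 (wv \<one> be) None = nu (- 1) ** be"
  "a ~= 0 ==> chat a (actP w0 (wv \<one> be)) = qi ** (\<one> \<oplus> be ** (nu (- a) ** gauss))"
  "chat 0 (actP w0 (wv \<one> be)) = qi"
proof -
 have w: "wv \<one> be : carrier MP" using assms by auto
 show "actP w0 (wv \<one> be) None = nu (- 1) ** be"
  using actP_mc(2)[OF w, of 1 1] assms by (simp add: w0_def)
 interpret G: grep R py qi MP "{1}" actP by (rule grepP[OF sgc(2)])
 have cl: "actP w0 (wv \<one> be) y : carrier R" for y
  using G.act_closed[OF SL2_sub[OF sgc(2) w0_det] w] by (simp add: MPc)
 have gen: "chat a (actP w0 (wv \<one> be)) = qi ** (\<one> \<oplus> be ** (\<Oplus>t\<in>KX. nu t ** py (- a / t)))" for a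
 proof -
  have "(\<Oplus>x\<in>UNIV. py (a * x) ** actP w0 (wv \<one> be) (Some x))
   = \<one> \<oplus> (\<Oplus>x\<in>KX. py (a * x) ** actP w0 (wv \<one> be) (Some x))"
   using cl actP_mc(1)[OF w, of 1 1] by (subst fs_split[of _ 0]) (auto simp: w0_def)
  also have "(\<Oplus>x\<in>KX. py (a * x) ** actP w0 (wv \<one> be) (Some x)) = (\<Oplus>t\<in>KX. be ** (nu t ** py (- a / t)))"
  proof (rule fsw[of _ "%t. - 1 / t" "%x. - 1 / x"])
   fix x assume x: "x : KX"
   have "actP w0 (wv \<one> be) (Some (- 1 / (1 * (- 1 / x)))) = cx 1 ** nu (- 1 / x) ** wv \<one> be (Some (- 1 / x / 1))"
    unfolding w0_def by (rule actP_mc(3)[OF w]) (use x in auto)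
   then have "actP w0 (wv \<one> be) (Some x) = nu (- 1 / x) ** be" using x by simp
   then show "py (a * x) ** actP w0 (wv \<one> be) (Some x) = be ** (nu (- 1 / x) ** py (- a / (- 1 / x)))"
    using x assms by (simp add: m_ac)
  qed (use assms in auto)
  finally show ?thesis using assms by (simp add: chat_def fsr)
 qed
 show "chat a (actP w0 (wv \<one> be)) = qi ** (\<one> \<oplus> be ** (nu (- a) ** gauss))" if "a ~= 0"
  unfolding gen using gauss_scale[of "- a"] that by simp
 show "chat 0 (actP w0 (wv \<one> be)) = qi"
  unfolding gen using assms nu_sum by simp
qed

text \<open>For \<open>ep = \<plusminus>1\<close>, this is the \<open>SL2\<close>-submodule generated by the vector \<open>wv 1 (ep b0)\<close>,
 cut out by its Fourier coefficients.\<close>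

definition Nh :: "'a => ('k option => 'a) set" where
 "Nh ep = {f : carrier MP. (ALL a. a ~= 0 --> nu a ~= ep --> chat a f = \<zero>) & chat 0 f = ep ** b0 ** f None}"

definition yv :: "'a => 'k option => 'a" where "yv ep = wv \<one> (ep ** b0)"

lemma bruhat_SL2:
 fixes g :: "'k m2"
 assumes "mdet g = 1"
 shows "(EX b a. a ~= 0 & g = m2mul (nm b) (dg a (1 / a))) \<or>
   (EX b a b'. a ~= 0 & g = m2mul (nm b) (m2mul (dg a (1 / a)) (m2mul w0 (nm b'))))"
proof -
 obtain a b c d where g: "g = (a, b, c, d)" by (cases g)
 have det: "a * d - b * c = 1" using assms by (simp add: g)
 show ?thesis
 proof (cases "c = 0")
  case True
  then have d: "d ~= 0" "a ~= 0" using det by auto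
  have d3: "d = 1 / a" using det d True by (simp add: nonzero_eq_divide_eq mult.commute)
  have "g = m2mul (nm (b / d)) (dg a (1 / a))" using borel[OF d(1), of a b] d3 by (simp add: g True)
  then show ?thesis using d by blast
 next
  case False
  have "m2mul (mc c 1) (nm (d / c)) = m2mul (dg (1 / c) (1 / (1 / c))) (m2mul w0 (nm (d / c)))"
   using False by (simp add: w0_def mc_def dg_def nm_def m2s)
  then have "g = m2mul (nm (a / c)) (m2mul (dg (1 / c) (1 / (1 / c))) (m2mul w0 (nm (d / c))))"
   using bruhat[OF False, of a b d] det by (simp add: g)
  moreover have "1 / c ~= 0" using False by simp
  ultimately show ?thesis by blast
 qed
qed

context
 fixes ep assumes eps: "ep = \<one> \<or> ep = \<ominus> \<one>"
begin

lemma eps_closed [simp, intro]: "ep : carrier R" and eps_sq: "ep ** ep = \<one>"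
 using eps by (auto simp: l_minus r_minus)

lemma yv_closed [simp, intro]: "yv ep : carrier MP" by (auto simp: yv_def)

lemma Nh_sub: "f : Nh ep ==> f : carrier MP" by (simp add: Nh_def)

lemma Nh_add: "f : Nh ep ==> h : Nh ep ==> f \<oplus>@MP h : Nh ep"
 unfolding Nh_def mem_Collect_eq chat_add
 using abelian_group.axioms(1)[OF module.axioms(2)[OF fmm]]
 by (simp add: chat_add MPc r_distr del: fmod_simps) (simp add: r_distr chat_add MPc)

lemma Nh_smult: "c : carrier R ==> f : Nh ep ==> c \<odot>@MP f : Nh ep"
 unfolding Nh_def mem_Collect_eq
 by (auto simp: chat_smult[unfolded fmod_simps] MPc m_lcomm)

lemma Nh_zero: "\<zero>@MP : Nh ep"
 by (simp add: Nh_def MPc chat_def fs_zero)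

lemma Nh_sum: "(!!x. x : S ==> f x : Nh ep) ==> finsum MP f S : Nh ep"
proof (induction S rule: infinite_finite_induct)
 case (insert x S)
 interpret M: module R MP by (rule fmm)
 have "finsum MP f (insert x S) = f x \<oplus>@MP finsum MP f S"
  using insert by (intro M.M.fsi) (auto simp: Nh_sub)
 then show ?case using insert Nh_add by (simp del: fmod_simps)
next
 case (infinite S)
 interpret M: module R MP by (rule fmm)
 show ?case using infinite Nh_zero M.M.finsum_infinite by simp
next
 case empty
 interpret M: module R MP by (rule fmm)
 show ?case using Nh_zero M.M.finsum_empty by simp
qed

lemma yv_Nh: "yv ep : Nh ep"
 by (auto simp: Nh_def yv_def chat_wv)

lemma mv_Nh: "a ~= 0 ==> nu a = ep ==> mv a : Nh ep"
 by (auto simp: Nh_def chat_mv)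

text \<open>The Fourier coefficient at a is (1 + ep \<open>nu\<close> a)/q, so it vanishes when
  \<open>nu\<close> a = -ep. The condition at 0 is the equation for the square of
  \<open>b0\<close>.\<close>

lemma w0_yv_Nh: "actP w0 (yv ep) : Nh ep"
  "a ~= 0 ==> nu a = ep ==> chat a (actP w0 (yv ep)) = qi ** (\<one> \<oplus> \<one>)"
proof -
 interpret G: grep R py qi MP "{1}" actP by (rule grepP[OF sgc(2)])
 have c: "actP w0 (yv ep) : carrier MP" by (rule G.act_closed[OF SL2_sub[OF sgc(2) w0_det]]) auto
 have ch: "chat a (actP w0 (yv ep)) = qi ** (\<one> \<oplus> ep ** nu a)" if a: "a ~= 0" for a
 proof -
  have "ep ** b0 ** (nu (- a) ** gauss) = ep ** (nu (- a) ** (b0 ** gauss))" by (simp add: m_ac)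
  also have "nu (- a) ** (b0 ** gauss) = nu a"
   unfolding b0_gauss using nu_mult[of "- a" "- 1"] a by simp
  finally show ?thesis using actP_w0_wv(2)[of "ep ** b0" a] a by (simp add: yv_def)
 qed
 show "chat a (actP w0 (yv ep)) = qi ** (\<one> \<oplus> \<one>)" if "a ~= 0" "nu a = ep"
  using ch[OF that(1)] that eps_sq by simp
 have "chat a (actP w0 (yv ep)) = \<zero>" if a: "a ~= 0" "nu a ~= ep" for a
 proof -
  have "nu a = \<ominus> ep" using nu_pm[OF a(1)] a(2) eps by auto
  then show ?thesis using ch[OF a(1)] eps_sq by (simp add: r_minus r_neg)
 qed
 moreover have "chat 0 (actP w0 (yv ep)) = ep ** b0 ** actP w0 (yv ep) None"
 proof -
  have "ep ** b0 ** (nu (- 1) ** (ep ** b0)) = (ep ** ep) ** (nu (- 1) ** (b0 ** b0))" by (simp add: m_ac)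
  also have "... = nu (- 1) ** nu (- 1) ** qi" unfolding eps_sq b0_square by (simp add: m_ac)
  also have "... = qi" using nu_quad[of "- 1"] by simp
  finally show ?thesis using actP_w0_wv[of "ep ** b0"] by (simp add: yv_def)
 qed
 ultimately show "actP w0 (yv ep) : Nh ep" using c by (simp add: Nh_def)
qed

lemma Nh_nm: "f : Nh ep ==> actP (nm b) f : Nh ep"
proof -
 assume f: "f : Nh ep"
 then have fM: "f : carrier MP" by (rule Nh_sub)
 interpret G: grep R py qi MP "{1}" actP by (rule grepP[OF sgc(2)])
 have c: "actP (nm b) f : carrier MP" by (rule G.act_closed[OF G.nm_GD fM])
 have "chat a (actP (nm b) f) = py (a * b) ** chat a f" for a
  using fun_cong[OF G.pe_nm[OF fM, of a b], of "Some 0"] peP[OF sgc(2) fM, of a] peP[OF sgc(2) c, of a] fM c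
  by simp
 then show ?thesis using f c actP_nm[OF fM] fmc[OF fM] by (auto simp: Nh_def)
qed

lemma Nh_dg:
 assumes f: "f : Nh ep" and t: "t ~= 0"
 shows "actP (dg t (1 / t)) f : Nh ep"
proof -
 have fM: "f : carrier MP" using f by (rule Nh_sub)
 note fc = fmc[OF fM]
 interpret G: grep R py qi MP "{1}" actP by (rule grepP[OF sgc(2)])
 have c: "actP (dg t (1 / t)) f : carrier MP" by (rule G.act_closed[OF _ fM]) (use t in simp)
 have nt: "nu (1 / t) = nu t" using nu_inverse[OF t] by (simp add: inverse_eq_divide)
 have ch: "chat a (actP (dg t (1 / t)) f) = nu t ** chat (a * (t * t)) f" for a
 proof -
  have "(\<Oplus>x\<in>UNIV. py (a * x) ** actP (dg t (1 / t)) f (Some x)) = (\<Oplus>x\<in>UNIV. nu t ** (py (a * (t * t) * x) ** f (Some x)))"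
   by (rule fsw[of _ "%x. t * t * x" "%x. x / (t * t)"])
    (use t fc in \<open>auto simp: actP_dg[OF fM] nt m_ac\<close>)
  then show ?thesis using fc by (simp add: chat_def fsr m_lcomm)
 qed
 have nat: "nu (a * (t * t)) = nu a" if "a ~= 0" for a
  using that t nu_quad[OF t] by (simp add: nu_mult)
 have "actP (dg t (1 / t)) f None = nu t ** f None" using t fc by (simp add: actP_dg[OF fM])
 then show ?thesis using f c t fc by (auto simp: Nh_def ch nat m_lcomm)
qed

lemma yv_nm: "actP (nm b) (yv ep) = yv ep"
proof
 fix y show "actP (nm b) (yv ep) y = yv ep y"
  by (cases y) (simp_all add: actP_nm[OF yv_closed], simp_all add: yv_def)
qed

lemma g_yv_Nh:
 assumes g: "mdet g = 1"
 shows "actP g (yv ep) : Nh ep"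
proof -
 interpret G: grep R py qi MP "{1}" actP by (rule grepP[OF sgc(2)])
 have w: "w0 : GD {1}" by (rule SL2_sub[OF sgc(2) w0_det])
 note cl = Nh_sub[OF w0_yv_Nh(1)] Nh_sub[OF Nh_dg[OF w0_yv_Nh(1)]] Nh_sub[OF Nh_dg[OF yv_Nh]]
 from bruhat_SL2[OF g] show ?thesis
 proof (elim disjE exE conjE)
  fix b a assume "a ~= 0" "g = m2mul (nm b) (dg a (1 / a))"
  then show ?thesis using Nh_nm[OF Nh_dg[OF yv_Nh]] by (simp add: G.act_mul)
 next
  fix b a b' assume "a ~= 0" "g = m2mul (nm b) (m2mul (dg a (1 / a)) (m2mul w0 (nm b')))"
  then show ?thesis using Nh_nm[OF Nh_dg[OF w0_yv_Nh(1)]] w by (simp add: G.act_mul yv_nm)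
 qed
qed

text \<open>\<open>mv a\<close> is a multiple of the projection of \<open>w0 yv\<close>, hence a combination of translates of \<open>yv\<close>.\<close>

lemma mv_from_yv:
 assumes N: "invsub R MP (GD {1}) actP N" and y: "yv ep : N" and a: "a ~= 0" "nu a = ep"
 shows "mv a : N"
proof -
 interpret G: grep R py qi MP "{1}" actP by (rule grepP[OF sgc(2)])
 have w: "w0 : GD {1}" by (rule SL2_sub[OF sgc(2) w0_det])
 have wy: "actP w0 (yv ep) : N" by (rule invsub_act[OF N w y])
 have mN: "(qi ** (\<one> \<oplus> \<one>)) \<odot>@MP mv a : N"
  using G.pe_invsub[OF N wy, of a] unfolding peP_nz[OF sgc(2) invsub_sub[OF N wy] a(1)] w0_yv_Nh(2)[OF a] .
 have "qi ** (\<one> \<oplus> \<one>) ~= \<zero>"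
  using integral[of qi "\<one> \<oplus> \<one>"] two_nonzero qq_nonzero by auto
 then show ?thesis by (rule smc[OF fmm N _ _ mv_closed mN, rotated]) simp
qed

lemma g_mv_Nh:
 assumes g: "mdet g = 1" and a: "a ~= 0" "nu a = ep"
 shows "actP g (mv a) : Nh ep"
proof -
 interpret G: grep R py qi MP "{1}" actP by (rule grepP[OF sgc(2)])
 have w: "w0 : GD {1}" and gG: "g : GD {1}" by (rule SL2_sub[OF sgc(2)], use w0_det g in simp)+
 let ?c = "qi ** (\<one> \<oplus> \<one>)"
 have c0: "?c ~= \<zero>" using integral[of qi "\<one> \<oplus> \<one>"] two_nonzero qq_nonzero by auto
 have wy: "actP w0 (yv ep) : carrier MP" by (rule Nh_sub[OF w0_yv_Nh(1)])
 have "?c \<odot>@MP actP g (mv a) = actP g (?c \<odot>@MP mv a)"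
  by (rule G.act_smult[symmetric, OF gG mv_closed]) simp
 also have "?c \<odot>@MP mv a = G.pe a (actP w0 (yv ep))"
  unfolding peP_nz[OF sgc(2) wy a(1)] w0_yv_Nh(2)[OF a] ..
 also have "actP g (G.pe a (actP w0 (yv ep))) = finsum MP (%b. (qi ** py (- (a * b))) \<odot>@MP actP (m2mul g (m2mul (nm b) w0)) (yv ep)) UNIV"
  unfolding G.pe_def using wy gG w
  by (subst G.act_sum) (auto simp: G.act_smult G.act_mul simp del: fmod_simps intro!: G.M.M.fsc G.M.smult_closed G.act_closed)
 also have "... : Nh ep"
  by (rule Nh_sum, rule Nh_smult, simp, rule g_yv_Nh) (use g w0_det in \<open>simp add: m2r\<close>)
 finally have cN: "?c \<odot>@MP actP g (mv a) : Nh ep" .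
 have "inv ?c \<odot>@MP (?c \<odot>@MP actP g (mv a)) : Nh ep"
  by (rule Nh_smult[OF _ cN]) (use c0 in \<open>auto simp: field_Units\<close>)
 also have "inv ?c \<odot>@MP (?c \<odot>@MP actP g (mv a)) = (inv ?c ** ?c) \<odot>@MP actP g (mv a)"
  by (rule G.M.smult_assoc1[symmetric]) (use c0 gG in \<open>auto simp: field_Units\<close>)
 also have "... = actP g (mv a)"
  using c0 G.M.smult_one[OF G.act_closed[OF gG mv_closed]] by (simp add: field_Units del: fmod_simps)
 finally show ?thesis .
qed

lemma Nh_expand:
 assumes f: "f : Nh ep"
 shows "f = f None \<odot>@MP yv ep \<oplus>@MP finsum MP (%a. chat a f \<odot>@MP mv a) {a. a ~= 0 & nu a = ep}"
proof -
 interpret M: module R MP by (rule fmm)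
 have fM: "f : carrier MP" using f by (rule Nh_sub)
 have "finsum MP (%a. chat a f \<odot>@MP mv a) KX = finsum MP (%a. chat a f \<odot>@MP mv a) {a. a ~= 0 & nu a = ep}"
 proof (rule M.M.fs_mono)
  fix a assume "a : KX - {a. a ~= 0 & nu a = ep}"
  then have "chat a f = \<zero>" using f by (auto simp: Nh_def)
  then show "chat a f \<odot>@MP mv a = \<zero>@MP" by (simp only: M.smult_l_null[OF mv_closed])
 qed (use fM in \<open>auto intro!: M.smult_closed simp del: fmod_simps\<close>)
 moreover have "wv (f None) (chat 0 f) = f None \<odot>@MP yv ep"
  unfolding yv_def wv_smult using f fmc[OF fM] by (simp add: Nh_def m_comm)
 ultimately show ?thesis using fourierP[OF fM] by simp
qed

text \<open>By Fourier expansion \<open>Nh ep\<close> is spanned by \<open>yv ep\<close> and the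
  vectors \<open>mv a\<close> with \<open>nu a\<close> = ep, and the translates of both kinds are
  already known to stay inside.\<close>

lemma Nh_invsub: "invsub R MP (GD {1}) actP (Nh ep)"
 unfolding invsub_def
proof (intro conjI ballI)
 interpret G: grep R py qi MP "{1}" actP by (rule grepP[OF sgc(2)])
 fix g :: "'k m2" and f assume gG: "g : GD {1}" and f: "f : Nh ep"
 then have g: "mdet g = 1" by (simp add: GD_def)
 have fM: "f : carrier MP" using f by (rule Nh_sub)
 let ?S = "{a. a ~= 0 & nu a = ep}"
 have sc: "chat a f \<odot>@MP mv a : carrier MP" for a by (intro G.M.smult_closed chat_closed fM mv_closed)
 have "actP g f = actP g (f None \<odot>@MP yv ep \<oplus>@MP finsum MP (%a. chat a f \<odot>@MP mv a) ?S)"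
  using Nh_expand[OF f] by simp
 also have "... = actP g (f None \<odot>@MP yv ep) \<oplus>@MP actP g (finsum MP (%a. chat a f \<odot>@MP mv a) ?S)"
  by (rule G.act_add[OF gG G.M.smult_closed[OF fmc[OF fM] yv_closed] G.M.M.fs_closed]) (rule sc)
 also have "actP g (f None \<odot>@MP yv ep) = f None \<odot>@MP actP g (yv ep)"
  by (rule G.act_smult[OF gG yv_closed fmc[OF fM]])
 also have "actP g (finsum MP (%a. chat a f \<odot>@MP mv a) ?S) = finsum MP (%a. actP g (chat a f \<odot>@MP mv a)) ?S"
  by (rule G.act_sum[OF gG]) (rule sc)
 also have "f None \<odot>@MP actP g (yv ep) \<oplus>@MP finsum MP (%a. actP g (chat a f \<odot>@MP mv a)) ?S : Nh ep"
 proof (rule Nh_add[OF Nh_smult[OF fmc[OF fM] g_yv_Nh[OF g]] Nh_sum])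
  fix a assume a: "a : ?S"
  have "actP g (chat a f \<odot>@MP mv a) = chat a f \<odot>@MP actP g (mv a)"
   by (rule G.act_smult[OF gG mv_closed chat_closed[OF fM]])
  also have "... : Nh ep" by (rule Nh_smult[OF chat_closed[OF fM] g_mv_Nh[OF g]]) (use a in auto)
  finally show "actP g (chat a f \<odot>@MP mv a) : Nh ep" .
 qed
 finally show "actP g f : Nh ep" .
qed (use Nh_sub Nh_add Nh_smult Nh_zero in auto)

lemma Nh_subset_of:
 assumes N: "invsub R MP (GD {1}) actP N" and y: "yv ep : N"
 shows "Nh ep <= N"
proof
 fix f assume f: "f : Nh ep"
 have fM: "f : carrier MP" using f by (rule Nh_sub)
 have "f None \<odot>@MP yv ep \<oplus>@MP finsum MP (%a. chat a f \<odot>@MP mv a) {a. a ~= 0 & nu a = ep} : N"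
  by (intro invsub_add[OF N ivm[OF N fmc[OF fM] y]] invsub_sum[OF fmm N]
    ivm[OF N chat_closed[OF fM]] mv_from_yv[OF N y]) auto
 then show "f : N" using Nh_expand[OF f] by simp
qed

lemma Nh_irr: "irrsub R MP (GD {1}) actP (Nh ep)"
 unfolding irrsub_def
proof (intro conjI allI impI)
 show "invsub R MP (GD {1}) actP (Nh ep)" by (rule Nh_invsub)
 fix N assume N: "invsub R MP (GD {1}) actP N" and sub: "N <= Nh ep"
 show "N = {\<zero>@MP} \<or> N = Nh ep"
 proof (cases "N = {%i. \<zero>}")
  case False
  then obtain be where b: "be : carrier R" "wv \<one> be : N" by (rule invsubP_wv[OF sgc(2) N])
  then have "wv \<one> be : Nh ep" using sub by blast
  then have "be = ep ** b0" using b by (simp add: Nh_def chat_wv)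
  then show ?thesis using Nh_subset_of[OF N] b sub by (auto simp: yv_def)
 qed simp
qed

end

text \<open>Let U be invariant and strictly above \<open>Nh\<close> 1. Either its projection to the
  U-fixed vectors is larger than that of \<open>Nh\<close> 1, or it contains some
  \<open>mv a\<close> with \<open>nu a\<close> = -1 and hence all of \<open>Nh\<close> (-1). In both
  cases two independent U-fixed vectors make it everything.\<close>

lemma PS_hlen_2: "hlen R MP (GD {1}) actP (carrier MP) 2"
proof -
 interpret G: grep R py qi MP "{1}" actP by (rule grepP[OF sgc(2)])
 obtain u where u: "u ~= 0" "nu u ~= \<one>" using nu_nontriv by blast
 have um: "nu u = \<ominus> \<one>" using nu_pm u by blast
 have mu: "mv u \<notin> Nh \<one>" using u by (auto simp: Nh_def chat_mv)
 have y1: "yv \<one> : Nh \<one>" by (rule yv_Nh) simp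
 have I: "invsub R MP (GD {1}) actP (Nh \<one>)" by (rule Nh_invsub) simp
 show ?thesis
 proof (rule G.hlen_2[of _ "Nh \<one>"])
  show "invsub R MP (GD {1}) actP (carrier MP)" by (rule inv_fullP[OF sgc(2)])
  show "invsub R MP (GD {1}) actP (Nh \<one>)" by (rule I)
  show "\<zero>@MP : Nh \<one>" by (rule invsub_zero[OF I])
  have "yv \<one> None ~= \<zero>" by (simp add: yv_def)
  then show "Nh \<one> ~= {\<zero>@MP}" using y1 by auto
  show "Nh \<one> \<subset> carrier MP" using mu mv_closed[of u] Nh_sub[of \<one>] by blast
  show "U = {\<zero>@MP}" if "invsub R MP (GD {1}) actP U" "U \<subset> Nh \<one>" for U
   using Nh_irr[of \<one>] that unfolding irrsub_def by blast
  fix U assume U: "invsub R MP (GD {1}) actP U" "Nh \<one> \<subset> U" "U <= carrier MP"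
  have y: "wv \<one> b0 : U" using U(2) y1 by (auto simp: yv_def)
  obtain f where f: "f : U" "f \<notin> Nh \<one>" using U by blast
  have fM: "f : carrier MP" using f U by blast
  note fc = fmc[OF fM]
  show "U = carrier MP"
  proof (cases "chat 0 f = \<one> ** b0 ** f None")
   case False
   have "G.pe 0 f : U" by (rule G.pe_invsub[OF U(1) f(1)])
   then have w: "wv (f None) (chat 0 f) : U" by (simp add: peP_0[OF sgc(2) fM])
   have "\<one> ** chat 0 f \<ominus> f None ** b0 ~= \<zero>"
    using False dze[of "chat 0 f" "f None ** b0"] fM fc by (auto simp: m_comm)
   then show ?thesis
    by (rule invsubP_det[OF sgc(2) U(1) one_closed b0_closed fc chat_closed[OF fM] y w])
  next
   case True
   then obtain a where a: "a ~= 0" "nu a ~= \<one>" "chat a f ~= \<zero>" using f(2) fM by (auto simp: Nh_def)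
   have na: "nu a = \<ominus> \<one>" using nu_pm a by blast
   have "chat a f \<odot>@MP mv a : U"
    using G.pe_invsub[OF U(1) f(1), of a] by (simp add: peP_nz[OF sgc(2) fM a(1)])
   then have mU: "mv a : U"
    by (intro smc[OF fmm U(1) chat_closed[OF fM] a(3) mv_closed])
   have eps: "\<ominus> \<one> = \<one> \<or> \<ominus> \<one> = \<ominus> \<one>" by simp
   have mN: "mv a : Nh (\<ominus> \<one>)" by (rule mv_Nh[OF eps a(1) na])
   \<comment> \<open>The intersection is a nonzero invariant subspace of the irreducible other
     half.\<close>
   have "invsub R MP (GD {1}) actP (U \<inter> Nh (\<ominus> \<one>))"
    using U(1) Nh_invsub[OF eps] by (auto simp: invsub_def)
   moreover have "mv a (Some 0) ~= \<zero>@MP (Some 0)" by simp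
   then have "mv a ~= \<zero>@MP" by metis
   then have "U \<inter> Nh (\<ominus> \<one>) ~= {\<zero>@MP}" using mU mN by blast
   ultimately have "U \<inter> Nh (\<ominus> \<one>) = Nh (\<ominus> \<one>)"
    using Nh_irr[OF eps] unfolding irrsub_def by blast
   then have y': "wv \<one> (\<ominus> \<one> ** b0) : U" using yv_Nh[OF eps] by (auto simp: yv_def)
   have "\<one> ** (\<ominus> \<one> ** b0) \<ominus> \<one> ** b0 = \<ominus> ((\<one> \<oplus> \<one>) ** b0)"
    by (simp add: l_minus a_minus_def l_distr minus_add)
   moreover have "(\<one> \<oplus> \<one>) ** b0 ~= \<zero>" using integral[of "\<one> \<oplus> \<one>" b0] two_nonzero b0_nonzero by auto
   ultimately have "\<one> ** (\<ominus> \<one> ** b0) \<ominus> \<one> ** b0 ~= \<zero>" using add.inv_eq_1_iff by simp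
   then show ?thesis
    by (rule invsubP_det[OF sgc(2) U(1) one_closed b0_closed one_closed m_closed[OF a_inv_closed[OF one_closed] b0_closed] y y'])
  qed
 qed
qed

end

section \<open>An integral basis of one half of the reducible principal series\<close>

context psq
begin

text \<open>Index 0 carries the U-fixed generator and each nonzero square a carries
  \<open>mv a\<close>, so the index set is that of all squares, 0 included. \<open>kH\<close> reads
  off the coordinates.\<close>

definition bH :: "'k => 'k option => 'a" where "bH a = (if a = 0 then yv \<one> else mv a)"
definition kH :: "'k => ('k option => 'a) => 'a" where "kH a f = (if a = 0 then f None else chat a f)"
definition KH :: "'k m2 => 'k => 'k => 'a" where "KH g i j = kH i (actP g (bH j))"

lemma half_model:
 shows "krep R (GD {1}) {a. sq a} KH"
  and "EX T. eqv R (fmod R {a. sq a}) (kact R {a. sq a} KH) (carrier (fmod R {a. sq a})) MP actP (Nh \<one>) (GD {1}) T"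
  and "hlen R (fmod R {a. sq a}) (GD {1}) (kact R {a. sq a} KH) (carrier (fmod R {a. sq a})) 1"
proof -
 let ?J = "{a::'k. sq a}"
 interpret G: grep R py qi MP "{1}" actP by (rule grepP[OF sgc(2)])
 have e: "\<one> = \<one> \<or> \<one> = \<ominus> \<one>" by simp
 have J: "a : ?J \<longleftrightarrow> a = 0 \<or> (a ~= 0 & nu a = \<one>)" for a
  using nu_sq[of a] by (cases "a = 0") (auto simp: sq_def)
 have s0: "sq (0::'k)" by (auto simp: sq_def)
 have I: "invsub R MP (GD {1}) actP (Nh \<one>)" by (rule Nh_invsub[OF e])
 have bN: "bH j : Nh \<one>" if "j : ?J" for j
  using that yv_Nh[OF e] mv_Nh[OF e, of j] unfolding J by (auto simp: bH_def)
 have expand: "f = finsum MP (%j. kH j f \<odot>@MP bH j) ?J" if f: "f : Nh \<one>" for f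
 proof -
  have fM: "f : carrier MP" using f by (rule Nh_sub[OF e])
  have Je: "?J = insert 0 {a. a ~= 0 & nu a = \<one>}" using J by blast
  have c: "kH j f \<odot>@MP bH j : carrier MP" for j
   unfolding bH_def kH_def using fM yv_closed[OF e] by (auto simp del: fmod_simps intro!: G.M.smult_closed fmc[OF fM])
  have "finsum MP (%j. kH j f \<odot>@MP bH j) ?J
   = kH 0 f \<odot>@MP bH 0 \<oplus>@MP finsum MP (%j. kH j f \<odot>@MP bH j) {a. a ~= 0 & nu a = \<one>}"
   unfolding Je by (rule G.M.M.fsi) (use c in auto)
  also have "finsum MP (%j. kH j f \<odot>@MP bH j) {a. a ~= 0 & nu a = \<one>} = finsum MP (%a. chat a f \<odot>@MP mv a) {a. a ~= 0 & nu a = \<one>}"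
   by (rule G.M.M.fsc) (use fM in \<open>auto simp: kH_def bH_def simp del: fmod_simps intro!: G.M.smult_closed\<close>)
  also have "kH 0 f \<odot>@MP bH 0 = f None \<odot>@MP yv \<one>" by (simp add: kH_def bH_def)
  finally show ?thesis using Nh_expand[OF e f] by simp
 qed
 have dual: "kH i (bH j) = (if i = j then \<one> else \<zero>)" if "i : ?J" "j : ?J" for i j
  by (auto simp: kH_def bH_def chat_mv yv_def chat_wv)
 note bm = G.basis_model[OF I finite[of ?J] bN, where \<kappa>=kH]
 show k: "krep R (GD {1}) ?J KH" unfolding KH_def
  by (rule bm(1)[OF _ _ _ _ _ expand]) (use dual chat_add chat_smult fmc in \<open>auto simp: kH_def\<close>)
 show T: "EX T. eqv R (fmod R ?J) (kact R ?J KH) (carrier (fmod R ?J)) MP actP (Nh \<one>) (GD {1}) T" unfolding KH_def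
  by (rule bm(2)[OF _ _ _ _ _ expand]) (use dual chat_add chat_smult fmc in \<open>auto simp: kH_def\<close>)
 then obtain T where T: "eqv R (fmod R ?J) (kact R ?J KH) (carrier (fmod R ?J)) MP actP (Nh \<one>) (GD {1}) T" ..
 have inv: "invsub R (fmod R ?J) (GD {1}) (kact R ?J KH) (carrier (fmod R ?J))"
  by (rule kri[OF field_axioms finite k])
 have "yv \<one> None ~= \<zero>@MP None" by (simp add: yv_def)
 then have "yv \<one> ~= \<zero>@MP" by metis
 then have "Nh \<one> ~= {\<zero>@MP}" using yv_Nh[OF e] by blast
 then have "hlen R MP (GD {1}) actP (Nh \<one>) 1" by (rule G.hlen_1[OF Nh_irr[OF e]])
 then show "hlen R (fmod R ?J) (GD {1}) (kact R ?J KH) (carrier (fmod R ?J)) 1"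
  by (rule hlen_eqv[OF G.M.module_axioms fmm eqv_inv[OF T inv] I inv])
qed

end

section \<open>The Steinberg representation\<close>

text \<open>The Steinberg space \<open>N0\<close> consists of the functions of sum 0; the assumption
  on q + 1 keeps the constants out of it.\<close>

locale stb = psr R py qi cx nu for R (structure) and py :: "'k::{finite,field} => 'a" and qi cx nu +
 assumes nu1: "t ~= 0 ==> nu t = \<one>" and q1: "qq \<oplus> \<one> ~= \<zero>"
begin

definition N0 :: "('k option => 'a) set" where
 "N0 = {f : carrier MP. (\<Oplus>x\<in>UNIV. f x) = \<zero>}"

lemma actP_eq:
 assumes D: "subgrp D" and g: "g : GD D" and v: "v : carrier MP"
 obtains h where "h : GD D" "!!x. pt h (pt g x) = x" "!!x. pt g (pt h x) = x"
  "!!y. actP g v y = cx (mdet g) ** v (pt h y)"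
proof -
 interpret G: grep R py qi MP D actP by (rule grepP[OF D])
 obtain h where h: "h : GD D" "m2mul g h = m2one" "m2mul h g = m2one" by (rule G.inverse_GD[OF g])
 have d: "mdet g ~= 0" "mdet h ~= 0" using g h D by (auto simp: GD_def subgrp_def)
 have p: "pt h (pt g x) = x" "pt g (pt h x) = x" for x
  unfolding pt_cc_mul(1)[OF d(2,1), symmetric] pt_cc_mul(1)[OF d, symmetric] h(2,3) pt_cc_one by simp_all
 have "actP g v y = cx (mdet g) ** v (pt h y)" for y
  using actP_pt[OF v d(1), of "pt h y"] p nu1 gv_hv(1)[OF d(1)] by simp
 then show ?thesis using that h p by blast
qed

lemma N0_invsub:
 fixes D :: "'k set"
 assumes D: "subgrp D"
 shows "invsub R MP (GD D) actP N0"
 unfolding invsub_def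
proof (intro conjI ballI)
 interpret G: grep R py qi MP D actP by (rule grepP[OF D])
 show "N0 <= carrier MP" by (auto simp: N0_def)
 show "\<zero>@MP : N0" by (simp add: N0_def MPc fs_zero)
 fix f h assume f: "f : N0" and h: "h : N0"
 then have fh: "f y : carrier R" "h y : carrier R" for y by (auto simp: N0_def MPc)
 show "f \<oplus>@MP h : N0" using f h fh by (simp add: N0_def fs_add MPc)
next
 fix c f assume c: "c : carrier R" and f: "f : N0"
 then have ff: "f y : carrier R" for y by (auto simp: N0_def MPc)
 show "c \<odot>@MP f : N0" using c f ff by (simp add: N0_def fsr MPc)
next
 fix g :: "'k m2" and f assume g: "g : GD D" and f: "f : N0"
 interpret G: grep R py qi MP D actP by (rule grepP[OF D])
 have fM: "f : carrier MP" using f by (simp add: N0_def)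
 have ff: "f y : carrier R" for y using fM by (simp add: MPc)
 obtain h where h: "h : GD D" "!!x. pt h (pt g x) = x" "!!x. pt g (pt h x) = x"
  "!!y. actP g f y = cx (mdet g) ** f (pt h y)" using actP_eq[OF D g fM] by blast
 have "(\<Oplus>y\<in>UNIV. actP g f y) = (\<Oplus>x\<in>UNIV. cx (mdet g) ** f x)"
  by (rule fsw[of _ "pt g" "pt h"]) (use h ff in auto)
 also have "... = \<zero>" using f ff by (simp add: fsr N0_def)
 finally show "actP g f : N0" using G.act_closed[OF g fM] by (simp add: N0_def)
qed

text \<open>A multiple of the projection of a delta function to \<open>N0\<close>; these vectors are
  permuted by SL2 like the points of the line.\<close>

definition sv :: "'k option => 'k option => 'a" where "sv x y = (if y = x then \<one> else \<ominus> qi)"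

lemma sv_closed: "sv x y : carrier R" "sv x : carrier MP" by (auto simp: sv_def MPc)

lemma sv_act: assumes g: "mdet g = 1" shows "actP g (sv x) = sv (pt g x)"
proof
 fix y
 have gG: "g : GD {1}" using g by (simp add: GD_def)
 obtain h where h: "!!x. pt h (pt g x) = x" "!!x. pt g (pt h x) = x"
  "!!y. actP g (sv x) y = cx (mdet g) ** sv x (pt h y)"
  using actP_eq[OF sgc(2) gG sv_closed(2)] by metis
 have "pt h y = x \<longleftrightarrow> y = pt g x" using h by metis
 then show "actP g (sv x) y = sv (pt g x) y" unfolding h(3) g using sv_closed by (simp add: sv_def)
qed

text \<open>A nonzero invariant subspace contains a U-fixed vector, which having sum 0 must be
  \<open>sv None\<close>, and hence every \<open>sv x\<close>. Summing f(x) \<open>sv x\<close>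
  gives (1 + 1/q) f for each f in \<open>N0\<close>, and 1 + 1/q is invertible.\<close>

lemma N0_irr_SL: "irrsub R MP (GD {1}) actP N0"
 unfolding irrsub_def
proof (intro conjI allI impI)
 show "invsub R MP (GD {1}) actP N0" by (rule N0_invsub[OF sgc(2)])
 fix N assume N: "invsub R MP (GD {1}) actP N" and sub: "N <= N0"
 interpret G: grep R py qi MP "{1}" actP by (rule grepP[OF sgc(2)])
 show "N = {\<zero>@MP} \<or> N = N0"
 proof (cases "N = {%i. \<zero>}")
  case False
  then obtain be where b: "be : carrier R" "wv \<one> be : N" by (rule invsubP_wv[OF sgc(2) N])
  have "(\<Oplus>x\<in>UNIV. wv \<one> be x) = \<one> \<oplus> (\<Oplus>x\<in>range Some. wv \<one> be x)"
   unfolding UNIV_option_conv by (subst fsi) (use b in auto)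
  also have "(\<Oplus>x\<in>range Some. wv \<one> be x) = (\<Oplus>x\<in>(UNIV::'k set). be)"
   by (rule fsw[of _ Some the]) (use b in auto)
  also have "... = qq ** be" using b by (simp add: fs_const qq_def)
  finally have "\<one> \<oplus> qq ** be = \<zero>" using b sub by (auto simp: N0_def)
  then have "qi ** (\<one> \<oplus> qq ** be) = \<zero>" by simp
  then have "qi \<oplus> be = \<zero>" using b by (simp add: r_distr m_assoc[symmetric])
  then have beta: "be = \<ominus> qi" using b minus_equality[of be qi] by (simp add: a_comm)
  have "wv \<one> (\<ominus> qi) = sv None" by (rule ext) (auto simp: wv_def sv_def split: option.splits)
  then have svN: "sv None : N" using b beta by simp
  have svx: "sv x : N" for x
  proof (cases x)
   case (Some t)
   have "mdet (t, -1, 1, 0) = 1" by simp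
   then have "actP (t, -1, 1, 0) (sv None) = sv x" using sv_act[of "(t,-1,1,0)" None] Some
    by (simp add: pt_def gv_def hv_def)
   then show ?thesis using invsub_act[OF N _ svN, of "(t,-1,1,0)"] by (simp add: GD_def)
  qed (use svN in simp)
  have "f : N" if f: "f : N0" for f
  proof -
   have fM: "f : carrier MP" using f by (simp add: N0_def)
   have ff: "f y : carrier R" for y using fM by (simp add: MPc)
   have sc: "f x \<odot>@MP sv x : carrier MP" for x by (rule G.M.smult_closed[OF ff sv_closed(2)])
   have "finsum MP (%x. f x \<odot>@MP sv x) UNIV = (\<one> \<oplus> qi) \<odot>@MP f"
   proof
    fix y
    have "finsum MP (%x. f x \<odot>@MP sv x) UNIV y = (\<Oplus>x\<in>UNIV. (f x \<odot>@MP sv x) y)"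
     by (rule fmod_sum) (rule sc)
    also have "... = (\<Oplus>x\<in>UNIV. f x ** sv x y)" by simp
    also have "... = f y ** sv y y \<oplus> (\<Oplus>x\<in>UNIV - {y}. f x ** sv x y)"
     by (subst fs_split[of _ y]) (use ff sv_closed in auto)
    also have "(\<Oplus>x\<in>UNIV - {y}. f x ** sv x y) = (\<Oplus>x\<in>UNIV - {y}. f x ** (\<ominus> qi))"
     by (rule fsc) (use ff in \<open>auto simp: sv_def\<close>)
    also have "... = (\<Oplus>x\<in>UNIV - {y}. f x) ** (\<ominus> qi)" by (rule fsl) (use ff in auto)
    also have "(\<Oplus>x\<in>UNIV - {y}. f x) = \<ominus> f y"
    proof -
     have "f y \<oplus> (\<Oplus>x\<in>UNIV - {y}. f x) = \<zero>"
      using f fs_split[of UNIV y f] ff by (simp add: N0_def)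
     then have "(\<Oplus>x\<in>UNIV - {y}. f x) \<oplus> f y = \<zero>" using ff by (simp add: a_comm fs_closed)
     then show ?thesis using ff by (intro minus_equality[symmetric]) (auto intro: fs_closed)
    qed
    also have "f y ** sv y y \<oplus> (\<ominus> f y) ** (\<ominus> qi) = ((\<one> \<oplus> qi) \<odot>@MP f) y"
     using ff[of y] by (simp add: sv_def l_distr r_distr l_minus r_minus m_comm)
    finally show "finsum MP (%x. f x \<odot>@MP sv x) UNIV y = ((\<one> \<oplus> qi) \<odot>@MP f) y" .
   qed
   moreover have "finsum MP (%x. f x \<odot>@MP sv x) UNIV : N"
    by (rule invsub_sum[OF fmm N], rule ivm[OF N ff svx])
   ultimately have "(\<one> \<oplus> qi) \<odot>@MP f : N" by simp
   moreover have "\<one> \<oplus> qi ~= \<zero>"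
   proof
    assume "\<one> \<oplus> qi = \<zero>"
    then have "qq ** (\<one> \<oplus> qi) = \<zero>" by simp
    then show False using q1 by (simp add: r_distr)
   qed
   ultimately show "f : N" by (intro smc[OF fmm N _ _ fM, of "\<one> \<oplus> qi"]) auto
  qed
  then show ?thesis using sub by blast
 qed simp
qed

lemma N0_irr:
 fixes D :: "'k set"
 assumes D: "subgrp D" shows "irrsub R MP (GD D) actP N0"
proof -
 have "GD {1} <= GD D" using D by (auto simp: GD_def subgrp_def)
 then have "invsub R MP (GD D) actP N ==> invsub R MP (GD {1}) actP N" for N by (auto simp: invsub_def)
 then show ?thesis using N0_irr_SL N0_invsub[OF D] unfolding irrsub_def by blast
qed

lemma mv_N0: "mv 1 : N0"
proof -
 have "(\<Oplus>x\<in>UNIV. mv 1 x) = (\<Oplus>x\<in>range Some. mv 1 x)"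
  by (rule fs_mono) (auto simp: UNIV_option_conv)
 also have "... = (\<Oplus>x\<in>UNIV. py ((-1) * x))"
  by (rule fsw[of _ Some the]) auto
 also have "... = \<zero>" by (rule psi_sum) simp
 finally show ?thesis by (simp add: N0_def)
qed

text \<open>Delta functions on the affine line minus the one at infinity. Coordinates are the values
  on the affine line, so no denominators appear.\<close>

definition bS :: "'k => 'k option => 'a" where
 "bS x y = (if y = None then \<ominus> \<one> else if y = Some x then \<one> else \<zero>)"
definition KS :: "'k m2 => 'k => 'k => 'a" where "KS g i j = actP g (bS j) (Some i)"

lemma steinberg_model:
 fixes D :: "'k set"
 assumes D: "subgrp D"
 shows "krep R (GD D) UNIV KS"
  and "EX T. eqv R (fmod R UNIV) (kact R UNIV KS) (carrier (fmod R UNIV)) MP actP N0 (GD D) T"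
  and "hlen R (fmod R UNIV) (GD {1}) (kact R UNIV KS) (carrier (fmod R UNIV)) 1"
proof -
 have bM: "bS j : carrier MP" for j by (auto simp: bS_def MPc)
 have bN: "bS j : N0" for j
 proof -
  have "(\<Oplus>x\<in>UNIV. bS j x) = \<ominus> \<one> \<oplus> (\<Oplus>x\<in>range Some. bS j x)"
   unfolding UNIV_option_conv by (subst fsi) (auto simp: bS_def)
  also have "(\<Oplus>x\<in>range Some. bS j x) = \<one>"
   by (subst fs_only[of _ "Some j"]) (auto simp: bS_def)
  finally show ?thesis using bM by (simp add: N0_def l_neg)
 qed
 have expand: "f = finsum MP (%j. f (Some j) \<odot>@MP bS j) UNIV" if f: "f : N0" for f
 proof
  fix y
  have fM: "f : carrier MP" using f by (simp add: N0_def)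
  interpret M: module R MP by (rule fmm)
  have ff: "f y : carrier R" for y using fM by (simp add: MPc)
  have bR: "bS j y : carrier R" for j y using bM by (simp add: MPc)
  have "finsum MP (%j. f (Some j) \<odot>@MP bS j) UNIV y = (\<Oplus>j\<in>UNIV. (f (Some j) \<odot>@MP bS j) y)"
   by (rule fmod_sum) (rule M.smult_closed[OF ff bM])
  also have "... = (\<Oplus>j\<in>UNIV. f (Some j) ** bS j y)" by simp
  also have "... = f y"
  proof (cases y)
   case None
   have "f None \<oplus> (\<Oplus>j\<in>range Some. f j) = \<zero>"
    using f ff fsi[of "range Some" None f] by (simp add: N0_def UNIV_option_conv)
   moreover have "(\<Oplus>j\<in>range Some. f j) = (\<Oplus>j\<in>UNIV. f (Some j))"
    by (rule fsw[of _ Some the]) (use ff in auto)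
   ultimately have "f None \<oplus> (\<Oplus>j\<in>UNIV. f (Some j)) = \<zero>" by simp
   then have "f None = \<ominus> (\<Oplus>j\<in>UNIV. f (Some j))"
    using ff by (intro minus_equality[symmetric]) (auto intro: fs_closed)
   then show ?thesis using None ff by (simp add: bS_def r_minus fs_uminus)
  next
   case (Some x)
   show ?thesis by (subst fs_only[of _ x]) (use ff Some in \<open>auto simp: bS_def\<close>)
  qed
  finally show "f y = finsum MP (%j. f (Some j) \<odot>@MP bS j) UNIV y" by simp
 qed
 have dual: "bS j (Some i) = (if i = j then \<one> else \<zero>)" for i j by (auto simp: bS_def)
 have gen: "krep R (GD D) UNIV KS & (EX T. eqv R (fmod R UNIV) (kact R UNIV KS) (carrier (fmod R UNIV)) MP actP N0 (GD D) T)"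
  if D: "subgrp D" for D :: "'k set"
 proof -
  interpret G: grep R py qi MP D actP by (rule grepP[OF D])
  note bm = G.basis_model[OF N0_invsub[OF D] finite[of UNIV] bN, where \<kappa>="%i f. f (Some i)"]
  show ?thesis unfolding KS_def
  proof
   show "krep R (GD D) UNIV (%g i j. actP g (bS j) (Some i))"
    by (rule bm(1)[OF _ _ _ dual expand]) (auto simp: MPc)
   show "EX T. eqv R (fmod R UNIV) (kact R UNIV (%g i j. actP g (bS j) (Some i))) (carrier (fmod R UNIV)) MP actP N0 (GD D) T"
    by (rule bm(2)[OF _ _ _ dual expand]) (auto simp: MPc)
  qed
 qed
 show "krep R (GD D) UNIV KS" "EX T. eqv R (fmod R UNIV) (kact R UNIV KS) (carrier (fmod R UNIV)) MP actP N0 (GD D) T"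
  using gen[OF D] by auto
 interpret G: grep R py qi MP "{1}" actP by (rule grepP[OF sgc(2)])
 obtain T where T: "eqv R (fmod R UNIV) (kact R UNIV KS) (carrier (fmod R UNIV)) MP actP N0 (GD {1}) T"
  and k: "krep R (GD {1}) UNIV KS"
  using gen[OF sgc(2)] by blast
 have inv: "invsub R (fmod R UNIV) (GD {1}) (kact R UNIV KS) (carrier (fmod R UNIV))"
  by (rule kri[OF field_axioms finite k])
 have "mv 1 (Some 0) ~= \<zero>@MP (Some 0)" by simp
 then have "mv 1 ~= \<zero>@MP" by metis
 then have "N0 ~= {\<zero>@MP}" using mv_N0 by blast
 then have "hlen R MP (GD {1}) actP N0 1" by (rule G.hlen_1[OF N0_irr_SL])
 then show "hlen R (fmod R UNIV) (GD {1}) (kact R UNIV KS) (carrier (fmod R UNIV)) 1"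
  by (rule hlen_eqv[OF G.M.module_axioms fmm eqv_inv[OF T inv] N0_invsub[OF sgc(2)] inv])
qed

end

section \<open>Characters of the determinant\<close>

context psr
begin

definition KD :: "'k m2 => unit => unit => 'a" where "KD g i j = cx (mdet g)"

lemma krepD: "subgrp D ==> krep R (GD D) {()} KD"
 unfolding krep_def KD_def
 by (auto simp: GD_def subgrp_def ch_mult m2one_def intro!: ch_mult)

lemma actD:
 assumes "v : carrier (fmod R {()})"
 shows "kact R {()} KD g v = cx (mdet g) \<odot>@(fmod R {()}) v"
 using fmc[OF assms] by (auto simp: kact_def KD_def fun_eq_iff)

lemma KD_irr:
 assumes D: "subgrp D"
 shows "irrsub R (fmod R {()}) (GD D) (kact R {()} KD) (carrier (fmod R {()}))"
 unfolding irrsub_def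
proof (intro conjI allI impI)
 let ?M = "fmod R {()}"
 show "invsub R ?M (GD D) (kact R {()} KD) (carrier ?M)"
  by (rule kri[OF field_axioms _ krepD[OF D]]) simp
 fix N assume N: "invsub R ?M (GD D) (kact R {()} KD) N" "N <= carrier ?M"
 show "N = {\<zero>@?M} \<or> N = carrier ?M"
 proof (cases "N = {\<zero>@?M}")
  case False
  then have "N ~= {%i. \<zero>}" by simp
  then obtain v where "v : N" "v ~= (%i. \<zero>)" using invsub_zero[OF N(1)] by auto
  then obtain x where "v : N" "v x ~= \<zero>" by blast
  then have v: "v : N" "v () ~= \<zero>" by simp_all
  have vM: "v : carrier ?M" using v N by blast
  have u: "v () : Units R" using v fmc[OF vM] by (simp add: field_Units)
  have "f : N" if f: "f : carrier ?M" for f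
  proof -
   have "(f () ** inv (v ())) \<odot>@?M v : N"
    by (rule ivm[OF N(1) _ v(1)]) (use fmc[OF f] u in auto)
   moreover have "(f () ** inv (v ())) \<odot>@?M v = f"
    using fmc[OF f] fmc[OF vM] u by (auto simp: fun_eq_iff m_assoc)
   ultimately show ?thesis by simp
  qed
  then show ?thesis using N by blast
 qed simp
qed

lemma KD_hlen: "hlen R (fmod R {()}) (GD {1}) (kact R {()} KD) (carrier (fmod R {()})) 1"
proof -
 interpret linact R "fmod R {()}" "{1}" "kact R {()} KD"
  by (rule krep_linact[OF krepD]) (auto simp: subgrp_def)
 have "dl R () () ~= \<zero>@(fmod R {()}) ()" by (simp add: dl_def)
 then have "dl R () ~= \<zero>@(fmod R {()})" by metis
 then have "carrier (fmod R {()}) ~= {\<zero>@(fmod R {()})}" using dl_closed[of "()" "{()}"] by blast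
 then show ?thesis by (rule hlen_1[OF KD_irr[OF sgc(2)]])
qed

end

section \<open>Roots of unity and integrality\<close>

context Ring.cring
begin

definition icast :: "int => 'a" where "icast k = [k] \<cdot> \<one>"

lemma icast_closed [simp, intro]: "icast k : carrier R" by (simp add: icast_def)
lemma icast_nat: "icast (int n) = [n] \<cdot> \<one>" by (simp add: icast_def add_pow_def int_pow_int)
lemma icast_simps [simp]: "icast 0 = \<zero>" "icast 1 = \<one>"
 using icast_nat[of 0] icast_nat[of 1] by simp_all
lemma icast_add: "icast (i + j) = icast i \<oplus> icast j" by (simp add: icast_def add.int_pow_mult)
lemma icast_minus: "icast (- i) = \<ominus> icast i" by (simp add: icast_def add.int_pow_neg)
lemma icast_mult: "icast (i * j) = icast i ** icast j"
proof -
 have "icast i ** icast j = [i] \<cdot> ([j] \<cdot> \<one>)" by (simp add: icast_def add_pow_ldistr_int)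
 then show ?thesis by (simp add: icast_def add.int_pow_pow mult.commute)
qed

text \<open>Evaluates integer polynomials at an element of a ring record, giving access to
  polynomial and matrix theory over the integers.\<close>

definition ev :: "'a => int poly => 'a" where
 "ev x p = fold_coeffs (%c a. icast c \<oplus> x ** a) p \<zero>"

lemma ev_0 [simp]: "ev x 0 = \<zero>" by (simp add: ev_def)

context
 fixes x assumes x [simp, intro]: "x : carrier R"
begin

lemma ev_pCons: "ev x (pCons c p) = icast c \<oplus> x ** ev x p"
 by (cases "c = 0"; cases "p = 0") (simp_all add: ev_def)

lemma ev_closed [simp, intro]: "ev x p : carrier R"
 by (induction p) (auto simp: ev_pCons)

lemma ev_add: "ev x (p + q) = ev x p \<oplus> ev x q"
proof (induction p q rule: poly_induct2)
 case (pCons a p b q)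
 then show ?case by (simp add: ev_pCons icast_add r_distr a_ac)
qed simp

lemma ev_smult: "ev x (Polynomial.smult c p) = icast c ** ev x p"
 by (induction p) (auto simp: ev_pCons icast_mult r_distr m_lcomm)

lemma ev_mult: "ev x (p * q) = ev x p ** ev x q"
 by (induction p) (auto simp: ev_pCons ev_add ev_smult l_distr m_assoc)

lemma ev_const [simp]: "ev x [:c:] = icast c" by (simp add: ev_pCons)
lemma ev_X: "ev x [:0, 1:] = x" by (simp add: ev_pCons)
lemma ev_1 [simp]: "ev x 1 = \<one>" unfolding one_pCons by simp
lemma ev_minus: "ev x (- p) = \<ominus> ev x p"
 using ev_smult[of "-1" p] by (simp add: icast_minus l_minus)

lemma ev_power: "ev x (p ^ n) = ev x p [^] n"
 by (induction n) (auto simp: ev_mult m_comm)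

lemma ev_sum: "ev x (\<Sum>i\<in>S. f i) = (\<Oplus>i\<in>S. ev x (f i))"
proof (induction S rule: infinite_finite_induct)
 case (insert a S)
 then show ?case by (simp add: ev_add fsi)
qed (auto simp: finsum_infinite)

lemma ev_expand: "Polynomial.degree p < m ==> ev x p = (\<Oplus>i\<in>{..<m}. icast (Polynomial.coeff p i) ** x [^] i)"
proof -
 assume d: "Polynomial.degree p < m"
 have "p = (\<Sum>i<m. Polynomial.monom (Polynomial.coeff p i) i)"
  using poly_as_sum_of_monoms'[of p "m - 1"] d by (simp add: lessThan_Suc_atMost[symmetric])
 then have "ev x p = (\<Oplus>i\<in>{..<m}. ev x (Polynomial.monom (Polynomial.coeff p i) i))"
  using ev_sum[of "%i. Polynomial.monom (Polynomial.coeff p i) i" "{..<m}"] by simp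
 also have "... = (\<Oplus>i\<in>{..<m}. icast (Polynomial.coeff p i) ** x [^] i)"
  by (intro fsc) (auto simp: monom_altdef ev_smult ev_power ev_X)
 finally show ?thesis .
qed

lemma geometric: "(\<Oplus>i\<in>{..<n}. x [^] i) ** (x \<ominus> \<one>) = x [^] (n::nat) \<ominus> \<one>"
proof (induction n)
 case (Suc n)
 have c: "(\<Oplus>i\<in>{..<n}. x [^] i) : carrier R" by (auto intro: fs_closed)
 have "(\<Oplus>i\<in>{..<Suc n}. x [^] i) ** (x \<ominus> \<one>) = x [^] n ** (x \<ominus> \<one>) \<oplus> (x [^] n \<ominus> \<one>)"
  unfolding lessThan_Suc by (subst fsi) (use c in \<open>auto simp: l_distr Suc\<close>)
 also have "... = x [^] n ** x \<ominus> \<one> \<oplus> (x [^] n \<ominus> x [^] n)"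
  by (simp add: a_minus_def r_distr r_minus a_ac)
 finally show ?case by (simp add: a_minus_def r_neg)
qed (simp add: a_minus_def r_neg)

end

lemma eval_map_rev:
 assumes "x : carrier R" "!!i. i < n ==> f i : carrier R"
 shows "eval (map f (rev [0..<n])) x = (\<Oplus>i\<in>{..<n}. f i ** x [^] i)"
 using assms(2)
proof (induction n)
 case (Suc n)
 have "eval (map f (rev [0..<Suc n])) x = f n ** x [^] n \<oplus> eval (map f (rev [0..<n])) x" by simp
 also have "... = (\<Oplus>i\<in>{..<Suc n}. f i ** x [^] i)"
  unfolding lessThan_Suc using Suc assms(1) by (subst fsi) auto
 finally show ?case .
qed simp

end

lemma (in Ring.domain) geometric_zero:
 assumes "x : carrier R" "x [^] (n::nat) = \<one>" "x ~= \<one>"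
 shows "(\<Oplus>i\<in>{..<n}. x [^] i) = \<zero>"
proof -
 have "(\<Oplus>i\<in>{..<n}. x [^] i) ** (x \<ominus> \<one>) = \<zero>" using geometric[OF assms(1), of n] assms by (simp add: a_minus_def r_neg)
 moreover have "x \<ominus> \<one> ~= \<zero>" using dze[of x \<one>] assms by auto
 ultimately show ?thesis using integral[of "\<Oplus>i\<in>{..<n}. x [^] i" "x \<ominus> \<one>"] assms by (auto intro: fs_closed)
qed

lemma (in algebraically_closed) exists_root_sum:
 assumes n: "n > 0" and f: "!!i. i <= n ==> f i : carrier L" "f n ~= \<zero>"
 shows "EX x:carrier L. (\<Oplus>i\<in>{..<Suc n}. f i ** x [^] i) = \<zero>"
proof -
 let ?p = "map f (rev [0..<Suc n])"
 have p: "?p : carrier (poly_ring L)"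
  unfolding univ_poly_def polynomial_def using f by (auto simp: less_Suc_eq_le)
 have "size (roots ?p) = n" using roots_over_carrier[OF p] by (simp add: splitted_def)
 then have "roots ?p ~= {#}" using n by auto
 then obtain x where "x \<in># roots ?p" by blast
 then have "is_root ?p x" using roots_mem_iff_is_root[OF p] by simp
 then have "x : carrier L" "eval ?p x = \<zero>" by (auto simp: is_root_def)
 then show ?thesis using eval_map_rev[of x "Suc n" f] f(1) by auto
qed

lemma (in algebraically_closed) exists_nth_root:
 assumes n: "n > 0" and a: "a : carrier L"
 shows "EX x:carrier L. x [^] (n::nat) = a"
proof -
 let ?f = "%i. if i = n then \<one> else if i = 0 then \<ominus> a else \<zero>"
 obtain x where x: "x : carrier L" "(\<Oplus>i\<in>{..<Suc n}. ?f i ** x [^] i) = \<zero>"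
  using exists_root_sum[OF n, of ?f] a by (metis (mono_tags, lifting) a_inv_closed one_closed one_not_zero zero_closed)
 have "(\<Oplus>i\<in>{..<Suc n}. ?f i ** x [^] i) = x [^] n \<oplus> (\<Oplus>i\<in>{..<n}. ?f i ** x [^] i)"
  unfolding lessThan_Suc by (subst fsi) (use x a in auto)
 also have "(\<Oplus>i\<in>{..<n}. ?f i ** x [^] i) = \<ominus> a"
  by (subst fs_only[of _ 0]) (use n x a in auto)
 finally have "x [^] n \<oplus> (\<ominus> a) = \<zero>" using x by simp
 then show ?thesis using dze[of "x [^] n" a] x a by (auto simp: a_minus_def)
qed

text \<open>Induction on n = r m with r prime. If r divides m, an r-th root of a primitive m-th root
  works. Otherwise multiply it by a root of 1 + X + ... + X^(r-1), which differs from 1 in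
  characteristic 0.\<close>

lemma (in algebraically_closed) exists_primitive_root:
 assumes char0: "!!n. n > 0 ==> add_pow L (n::nat) \<one> ~= \<zero>" and n: "n > 0"
 shows "EX x:carrier L. ALL j::nat. x [^] j = \<one> \<longleftrightarrow> n dvd j"
 using n
proof (induction n rule: less_induct)
 case (less n)
 show ?case
 proof (cases "n = 1")
  case False
  then obtain r where r: "Factorial_Ring.prime r" "r dvd n" using prime_factor_nat by blast
  then obtain m where m: "n = r * m" by blast
  have r1: "r > 1" using r prime_gt_1_nat by blast
  have "m < n" "m > 0" using m less.prems r1 by auto
  then obtain z where z: "z : carrier L" "!!j::nat. z [^] j = \<one> \<longleftrightarrow> m dvd j" using less.IH by blast
  show ?thesis
  proof (cases "r dvd m")
   case True
   obtain x where x: "x : carrier L" "x [^] r = z" using exists_nth_root[of r z] z r1 by auto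
   have pw: "x [^] (r * j) = z [^] j" for j using x nat_pow_pow[of x r j] by simp
   have "x [^] j = \<one> \<longleftrightarrow> n dvd j" for j :: nat
   proof
    assume j: "x [^] j = \<one>"
    have "z [^] j = (x [^] j) [^] r" using x nat_pow_pow[of x j r] pw[of j] by (simp add: mult.commute)
    then have "z [^] j = \<one>" using j by simp
    then have "r dvd j" using z True dvd_trans by blast
    then obtain j' where "j = r * j'" by blast
    then show "n dvd j" using j pw z m by simp
   next
    assume "n dvd j"
    then obtain c where "j = n * c" by blast
    then have "j = r * (m * c)" using m by simp
    then show "x [^] j = \<one>" using pw z by simp
   qed
   then show ?thesis using x by blast
  next
   case False
   obtain w where w: "w : carrier L" "(\<Oplus>i\<in>{..<Suc (r - 1)}. \<one> ** w [^] i) = \<zero>"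
    using exists_root_sum[of "r - 1" "%_. \<one>"] r1 by auto
   have "Suc (r - 1) = r" using r1 by simp
   then have w0: "(\<Oplus>i\<in>{..<r}. w [^] i) = \<zero>" using w by simp
   have "w [^] r \<ominus> \<one> = \<zero>" using geometric[OF w(1), of r] w0 w by simp
   then have wr: "w [^] r = \<one>" using dze[of "w [^] r" \<one>] w by auto
   have w1: "w ~= \<one>"
   proof
    assume "w = \<one>"
    then have "(\<Oplus>i\<in>{..<r}. \<one>) = \<zero>" using w0 by simp
    then show False using char0[of r] r1 by (simp add: fs_const)
   qed
   have wj: "w [^] j = \<one> \<longleftrightarrow> r dvd j" for j :: nat
   proof
    assume j: "w [^] j = \<one>"
    show "r dvd j"
    proof (rule ccontr)
     assume "~ r dvd j"
     then have "coprime j r" using r prime_imp_coprime coprime_commute by blast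
     then obtain u where "[j * u = Suc 0] (mod r)" using cong_solve_coprime_nat by blast
     then have "j * u mod r = 1" using r1 by (simp add: cong_def)
     then have "j * u = r * (j * u div r) + 1" using mult_div_mod_eq[of r "j * u"] by simp
     then obtain v where uv: "j * u = r * v + 1" by blast
     have "w [^] (j * u) = \<one>" "w [^] (r * v) = \<one>"
      unfolding nat_pow_pow[OF w(1), symmetric] j wr by simp_all
     then show False using uv w(1) w1 by simp
    qed
   next
    assume "r dvd j"
    then show "w [^] j = \<one>" using wr w nat_pow_pow[of w r] by (auto elim!: dvdE)
   qed
   have "(z ** w) [^] j = \<one> \<longleftrightarrow> n dvd j" for j :: nat
   proof
    assume j: "(z ** w) [^] j = \<one>"
    then have zw: "z [^] j ** w [^] j = \<one>" using z w by (simp add: nat_pow_distrib)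
    have "(z ** w) [^] (j * r) = \<one>" using j z w nat_pow_pow[of "z ** w" j r] by simp
    moreover have "w [^] (j * r) = \<one>" using wj by simp
    ultimately have "z [^] (j * r) = \<one>" using z w by (simp add: nat_pow_distrib)
    then have "m dvd j * r" using z by simp
    moreover have "coprime m r" using False r prime_imp_coprime coprime_commute by blast
    ultimately have mj: "m dvd j" using coprime_dvd_mult_left_iff by blast
    have "z [^] j = \<one>" using mj z(2) by blast
    then have "w [^] j = \<one>" using zw z(1) w(1) by simp
    then have "r dvd j" using wj by simp
    moreover obtain t where t: "j = m * t" using mj by blast
    ultimately have "r dvd t" using \<open>coprime m r\<close> by (simp add: coprime_commute coprime_dvd_mult_right_iff)
    then show "n dvd j" using m t by (auto simp: mult.commute)
   next
    assume "n dvd j"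
    then have "m dvd j" "r dvd j" using m dvd_mult_left dvd_mult_right by blast+
    then have "z [^] j = \<one>" "w [^] j = \<one>" using z(2) wj by blast+
    then show "(z ** w) [^] j = \<one>" using z(1) w(1) by (simp add: nat_pow_distrib)
   qed
   then show ?thesis using z w by blast
  qed
 qed (auto intro: bexI[of _ \<one>])
qed

text \<open>Multiplication by \<open>ev z f\<close> permutes the span of the powers of the root of unity \<open>z\<close>, so that
 \<open>ev z f\<close> is a root of the characteristic polynomial of an integer matrix.\<close>

context Ring.cring
begin

text \<open>Multiplication by z shifts the coefficients cyclically.\<close>

lemma root_of_unity_reduce:
 assumes z: "z : carrier R" and n: "n > 0" "z [^] (n::nat) = \<one>"
 shows "EX r::nat => int. ev z f = (\<Oplus>j\<in>{..<n}. icast (r j) ** z [^] j)"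
proof (induction f)
 case 0
 show ?case by (rule exI[of _ "%_. 0"]) (simp add: z fs_zero)
next
 case (pCons c f)
 then obtain r :: "nat => int" where r: "ev z f = (\<Oplus>j\<in>{..<n}. icast (r j) ** z [^] j)" by blast
 define r' where "r' j = (if j = 0 then c + r (n - 1) else r (j - 1))" for j
 obtain m where m: "n = Suc m" using n by (cases n) auto
 have nn: "{..<n} = insert 0 (Suc ` {..<m})" unfolding m by (auto simp: lessThan_Suc_eq_insert_0)
 have cl: "icast (a j) ** z [^] (j::nat) : carrier R" for j and a :: "nat => int" using z by simp
 have "z ** ev z f = (\<Oplus>j\<in>{..<n}. z ** (icast (r j) ** z [^] j))" unfolding r by (rule fsr[symmetric]) (use z in auto)
 also have "... = (\<Oplus>j\<in>{..<n}. icast (r j) ** z [^] Suc j)" by (rule fsc) (use z in \<open>auto simp: m_ac\<close>)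
 also have "... = icast (r m) \<oplus> (\<Oplus>j\<in>{..<m}. icast (r j) ** z [^] Suc j)"
  unfolding m lessThan_Suc using z n m by (subst fsi) (auto intro!: m_closed)
 finally have "ev z (pCons c f) = icast (c + r m) \<oplus> (\<Oplus>j\<in>{..<m}. icast (r j) ** z [^] Suc j)"
  using z n m by (simp add: ev_pCons icast_add a_assoc fs_closed)
 also have "(\<Oplus>j\<in>{..<m}. icast (r j) ** z [^] Suc j) = (\<Oplus>j\<in>Suc ` {..<m}. icast (r' j) ** z [^] j)"
  by (rule fsw[of _ "%j. j - 1" Suc]) (use cl z in \<open>auto simp: r'_def\<close>)
 also have "icast (c + r m) \<oplus> ... = (\<Oplus>j\<in>{..<n}. icast (r' j) ** z [^] j)"
  unfolding nn using z cl by (subst fsi) (auto simp: r'_def m)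
 finally show ?case by blast
qed

lemma root_of_unity_integral:
 assumes z: "z : carrier R" and n: "n > 0" "z [^] (n::nat) = \<one>"
 shows "EX p. Polynomial.coeff p (Polynomial.degree p) = 1 & ev (ev z f) p = \<zero>"
proof -
 let ?y = "ev z f"
 have y: "?y : carrier R" using z by simp
 have "ALL i. EX r::nat => int. ev z (f * [:0, 1:] ^ i) = (\<Oplus>j\<in>{..<n}. icast (r j) ** z [^] j)"
  using root_of_unity_reduce[OF z n] by blast
 then obtain r :: "nat => nat => int" where
  r: "!!i. ev z (f * [:0, 1:] ^ i) = (\<Oplus>j\<in>{..<n}. icast (r i j) ** z [^] j)" by metis
 then have r: "?y ** z [^] i = (\<Oplus>j\<in>{..<n}. icast (r i j) ** z [^] j)" for i
  using z by (simp add: ev_mult ev_power ev_X)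
 define M where "M = mat n n (%(i, j). r i j)"
 have M: "M : carrier_mat n n" by (simp add: M_def)
 define B where "B = char_poly_matrix M"
 have B: "B : carrier_mat n n" using M by (simp add: B_def)
 have Bij: "B $$ (i, j) = (if i = j then [:0, 1:] else 0) + [:- r i j:]" if "i < n" "j < n" for i j
  using that by (simp add: B_def char_poly_matrix_def M_def)
 note adj = adj_mat[OF B]
 have Brow: "(\<Oplus>j\<in>{..<n}. ev ?y (B $$ (i, j)) ** z [^] j) = \<zero>" if i: "i < n" for i
 proof -
  have "(\<Oplus>j\<in>{..<n}. ev ?y (B $$ (i, j)) ** z [^] j)
   = (\<Oplus>j\<in>{..<n}. (if j = i then ?y ** z [^] j else \<zero>) \<oplus> (\<ominus> (icast (r i j) ** z [^] j)))"
   by (rule fsc) (use i z y in \<open>auto simp: Bij ev_add[OF y] ev_X[OF y] ev_const[OF y] icast_minus l_distr l_minus\<close>)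
  also have "... = (\<Oplus>j\<in>{..<n}. if j = i then ?y ** z [^] j else \<zero>) \<oplus> (\<Oplus>j\<in>{..<n}. \<ominus> (icast (r i j) ** z [^] j))"
   by (rule fs_add) (use z y in auto)
  also have "(\<Oplus>j\<in>{..<n}. if j = i then ?y ** z [^] j else \<zero>) = ?y ** z [^] i"
   by (subst fs_only[of _ i]) (use i z y in auto)
  also have "(\<Oplus>j\<in>{..<n}. \<ominus> (icast (r i j) ** z [^] j)) = \<ominus> (?y ** z [^] i)"
   unfolding r using z by (subst fs_uminus) auto
  finally show ?thesis using z y by (simp add: r_neg)
 qed
 \<comment> \<open>Row 0 of adj(B) B is applied to the vector of powers of z. Summed one way it is
   0, as B kills that vector; summed the other way it is the characteristic polynomial at
   \<open>?y\<close> times z^0 = 1.\<close>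
 have "(\<Oplus>j\<in>{..<n}. (\<Oplus>i\<in>{..<n}. ev ?y (adj_mat B $$ (0, i)) ** (ev ?y (B $$ (i, j)) ** z [^] j)))
   = (\<Oplus>i\<in>{..<n}. (\<Oplus>j\<in>{..<n}. ev ?y (adj_mat B $$ (0, i)) ** (ev ?y (B $$ (i, j)) ** z [^] j)))"
  by (rule fs_swap) (use z y in auto)
 also have "... = (\<Oplus>i\<in>{..<n}. \<zero>)"
 proof (rule fsc)
  fix i assume i: "i : {..<n}"
  have "(\<Oplus>j\<in>{..<n}. ev ?y (adj_mat B $$ (0, i)) ** (ev ?y (B $$ (i, j)) ** z [^] j))
   = ev ?y (adj_mat B $$ (0, i)) ** (\<Oplus>j\<in>{..<n}. ev ?y (B $$ (i, j)) ** z [^] j)"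
   by (rule fsr) (use z y in auto)
  then show "(\<Oplus>j\<in>{..<n}. ev ?y (adj_mat B $$ (0, i)) ** (ev ?y (B $$ (i, j)) ** z [^] j)) = \<zero>"
   using Brow i y by simp
 qed auto
 also have "... = \<zero>" by (simp add: fs_zero)
 finally have z1: "(\<Oplus>j\<in>{..<n}. (\<Oplus>i\<in>{..<n}. ev ?y (adj_mat B $$ (0, i)) ** (ev ?y (B $$ (i, j)) ** z [^] j))) = \<zero>" .
 have "(\<Oplus>i\<in>{..<n}. ev ?y (adj_mat B $$ (0, i)) ** (ev ?y (B $$ (i, j)) ** z [^] j))
   = (if j = 0 then ev ?y (char_poly M) else \<zero>)" if j: "j < n" for j
 proof -
  have "(\<Oplus>i\<in>{..<n}. ev ?y (adj_mat B $$ (0, i)) ** (ev ?y (B $$ (i, j)) ** z [^] j))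
   = (\<Oplus>i\<in>{..<n}. ev ?y (adj_mat B $$ (0, i) * B $$ (i, j)) ** z [^] j)"
   by (rule fsc) (use z y in \<open>auto simp: ev_mult m_assoc\<close>)
  also have "... = (\<Oplus>i\<in>{..<n}. ev ?y (adj_mat B $$ (0, i) * B $$ (i, j))) ** z [^] j"
   by (rule fsl) (use z y in auto)
  also have "(\<Oplus>i\<in>{..<n}. ev ?y (adj_mat B $$ (0, i) * B $$ (i, j))) = ev ?y (\<Sum>i<n. adj_mat B $$ (0, i) * B $$ (i, j))"
   by (rule ev_sum[OF y, symmetric])
  also have "(\<Sum>i<n. adj_mat B $$ (0, i) * B $$ (i, j)) = (adj_mat B * B) $$ (0, j)"
   using adj(1) B j n by (auto simp: scalar_prod_def atLeast0LessThan intro!: sum.cong)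
  also have "... = (if j = 0 then char_poly M else 0)"
   using adj(3) j n by (auto simp: char_poly_def B_def)
  finally show ?thesis using y z by auto
 qed
 then have "(\<Oplus>j\<in>{..<n}. (\<Oplus>i\<in>{..<n}. ev ?y (adj_mat B $$ (0, i)) ** (ev ?y (B $$ (i, j)) ** z [^] j)))
  = (\<Oplus>j\<in>{..<n}. if j = 0 then ev ?y (char_poly M) else \<zero>)" by (intro fsc) (use y in auto)
 also have "... = ev ?y (char_poly M)" by (subst fs_only[of _ 0]) (use n y in auto)
 finally have "ev ?y (char_poly M) = \<zero>" using z1 by simp
 then show ?thesis using degree_monic_char_poly[OF M] by metis
qed

end

locale padic = algebraically_closed L for L :: "'a ring" (structure) +
 fixes l :: nat and \<iota> :: "(nat => int) => 'a"
 assumes l_prime: "Factorial_Ring.prime l" and iota: "\<iota> : Ring.ring_hom (Zl l) L" "inj_on \<iota> (carrier (Zl l))"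
begin

abbreviation "KZ \<equiv> \<iota> ` carrier (Zl l)"

text \<open>The image of an ordinary integer as a compatible system of residues.\<close>

definition zint :: "int => nat => int" where "zint k n = k mod int l ^ n"

lemma l_pos: "(0::int) < int l ^ n" using l_prime prime_gt_0_nat by simp

lemma zint_closed: "zint k : carrier (Zl l)"
 using l_pos by (auto simp: Zl_def zint_def mod_mod_cancel le_imp_power_dvd)

lemma Zl_closed:
 assumes "f : carrier (Zl l)" "g : carrier (Zl l)"
 shows "f **@(Zl l) g : carrier (Zl l)"
proof -
 have "f (Suc n) * g (Suc n) mod int l ^ Suc n mod int l ^ n = f n * g n mod int l ^ n" for n
 proof -
  have "f (Suc n) * g (Suc n) mod int l ^ Suc n mod int l ^ n = f (Suc n) * g (Suc n) mod int l ^ n"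
   by (rule mod_mod_cancel) (simp add: le_imp_power_dvd)
  also have "... = (f (Suc n) mod int l ^ n) * (g (Suc n) mod int l ^ n) mod int l ^ n" by (simp add: mod_mult_eq)
  also have "... = f n * g n mod int l ^ n" using assms by (simp add: Zl_def)
  finally show ?thesis .
 qed
 then show ?thesis using l_pos by (simp add: Zl_def)
qed

lemma KZ_mult: "x : KZ ==> y : KZ ==> x ** y : KZ"
 using Ring.ring_hom_mult[OF iota(1)] Zl_closed by (force simp: image_iff)

lemma KZ_closed: "x : KZ ==> x : carrier L"
 using Ring.ring_hom_closed[OF iota(1)] by auto

lemma iota_zint_add: "\<iota> (zint (i + j)) = \<iota> (zint i) \<oplus> \<iota> (zint j)"
proof -
 have "zint (i + j) = zint i \<oplus>@(Zl l) zint j" by (rule ext) (simp add: Zl_def zint_def mod_add_eq)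
 then show ?thesis using Ring.ring_hom_add[OF iota(1) zint_closed zint_closed] by simp
qed

lemma iota_zint: "\<iota> (zint k) = icast k"
proof -
 have c: "\<iota> (zint k) : carrier L" for k using Ring.ring_hom_closed[OF iota(1) zint_closed] .
 have one: "\<iota> (zint 1) = \<one>"
 proof -
  have "zint 1 = \<one>@(Zl l)" by (rule ext) (simp add: Zl_def zint_def)
  then show ?thesis using Ring.ring_hom_one[OF iota(1)] by simp
 qed
 have "\<iota> (zint 0) \<oplus> \<iota> (zint 0) = \<iota> (zint 0)" using iota_zint_add[of 0 0] by simp
 then have zero: "\<iota> (zint 0) = \<zero>" using c[of 0] by (simp add: add.l_cancel_one)
 have nat: "\<iota> (zint (int n)) = icast (int n)" for n
  by (induction n) (use zero one in \<open>simp_all add: iota_zint_add icast_add\<close>)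
 show ?thesis
 proof (cases "k \<ge> 0")
  case True
  then show ?thesis using nat[of "nat k"] by simp
 next
  case False
  have "\<iota> (zint k) \<oplus> \<iota> (zint (int (nat (- k)))) = \<zero>" using False zero by (simp add: iota_zint_add[symmetric])
  then have "\<iota> (zint k) \<oplus> icast (- k) = \<zero>" using False unfolding nat by simp
  then show ?thesis using c minus_equality[of "\<iota> (zint k)" "icast (- k)"] by (simp add: icast_minus)
 qed
qed

lemma icast_KZ: "icast k : KZ" using iota_zint zint_closed by (metis imageI)

text \<open>If n vanished, it would be 0 modulo l^n, although 0 < n < l^n.\<close>

lemma char0: "n > 0 ==> add_pow L (n::nat) \<one> ~= \<zero>"
proof
 assume n: "n > 0" and "add_pow L n \<one> = \<zero>"
 then have "\<iota> (zint (int n)) = \<iota> (zint 0)" using iota_zint icast_nat by simp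
 then have e: "zint (int n) = zint 0" using inj_onD[OF iota(2)] zint_closed by blast
 have "n < l ^ n" using l_prime prime_gt_1_nat by (simp add: less_exp power_gt_expt)
 then have "int n mod int l ^ n = int n" by (simp add: of_nat_power[symmetric] del: of_nat_power)
 then show False using fun_cong[OF e, of n] n by (simp add: zint_def)
qed

text \<open>Inverses modulo the powers of l are unique, hence compatible, and so define an l-adic
  integer.\<close>

lemma inverse_exists:
 assumes p: "coprime p l"
 shows "EX P:KZ. icast (int p) ** P = \<one>"
proof -
 have cop: "coprime (int p) (int l ^ n)" for n using p by simp
 have "ALL n. EX b. [int p * b = 1] (mod int l ^ n)" using cop by (metis cong_solve_coprime_int)
 then obtain b where b: "!!n. [int p * b n = 1] (mod int l ^ n)" by metis
 define f where "f n = b n mod int l ^ n" for n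
 have "f (Suc n) mod int l ^ n = f n" for n
 proof -
  have "[int p * b (Suc n) = 1] (mod int l ^ n)"
   by (rule cong_dvd_modulus[OF b]) (simp add: le_imp_power_dvd)
  then have "[int p * b (Suc n) = int p * b n] (mod int l ^ n)" using b cong_sym cong_trans by blast
  then have "[b (Suc n) = b n] (mod int l ^ n)" using cop[of n] by (metis cong_mult_lcancel)
  moreover have "f (Suc n) mod int l ^ n = b (Suc n) mod int l ^ n"
   unfolding f_def by (rule mod_mod_cancel) (simp add: le_imp_power_dvd)
  ultimately show ?thesis by (simp add: f_def cong_def)
 qed
 then have f: "f : carrier (Zl l)" using l_pos by (simp add: Zl_def f_def)
 have "zint (int p) **@(Zl l) f = \<one>@(Zl l)"
  by (rule ext) (use b in \<open>simp add: Zl_def zint_def f_def cong_def mod_mult_eq\<close>)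
 then have "\<iota> (zint (int p)) ** \<iota> f = \<one>"
  using Ring.ring_hom_mult[OF iota(1) zint_closed f] Ring.ring_hom_one[OF iota(1)] by metis
 then show ?thesis using f iota_zint by auto
qed

text \<open>The ring generated by a root of unity z and by 1/p, where \<open>P\<close> is the
  inverse of p; everything that has to be reduced takes its values here.\<close>

definition cyc :: "'a => 'a => 'a set" where "cyc z P = {ev z f ** P [^] (k::nat) | f k. True}"

lemma cyc_integers:
 assumes z: "z : carrier L" "n > 0" "z [^] (n::nat) = \<one>" and P: "P : KZ"
 shows "cyc z P <= integers l L \<iota>"
proof
 fix x assume "x : cyc z P"
 then obtain f k where x: "x = ev z f ** P [^] (k::nat)" by (auto simp: cyc_def)
 have PL: "P : carrier L" by (rule KZ_closed[OF P])
 let ?y = "ev z f" and ?Q = "P [^] k"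
 have yL: "?y : carrier L" and QL: "?Q : carrier L" using z PL by auto
 have xL: "x : carrier L" using x yL QL by simp
 have one: "\<one> : KZ" using icast_KZ[of 1] by simp
 have QK: "?Q [^] (m::nat) : KZ" for m
 proof -
  have "P [^] (j::nat) : KZ" for j by (induction j) (auto intro: KZ_mult P one)
  then show ?thesis using PL by (simp add: nat_pow_pow)
 qed
 obtain p where p: "Polynomial.coeff p (Polynomial.degree p) = 1" "ev ?y p = \<zero>"
  using root_of_unity_integral[OF z] by blast
 define d where "d = Polynomial.degree p"
 \<comment> \<open>Rescales the monic integer polynomial of \<open>?y\<close> by powers of
   \<open>?Q\<close> into a monic one for the product, with coefficients in the image of the l-adic
   integers.\<close>
 define c where "c i = icast (Polynomial.coeff p i) ** ?Q [^] (d - i)" for i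
 have cK: "c i : KZ" for i unfolding c_def by (intro KZ_mult icast_KZ QK)
 have cL: "c i : carrier L" for i by (rule KZ_closed[OF cK])
 have cd: "c d = \<one>" using p by (simp add: c_def d_def)
 let ?q = "map c (rev [0..<Suc d])"
 have "eval ?q x = (\<Oplus>i\<in>{..<Suc d}. c i ** x [^] i)" by (rule eval_map_rev[OF xL cL])
 also have "... = (\<Oplus>i\<in>{..<Suc d}. ?Q [^] d ** (icast (Polynomial.coeff p i) ** ?y [^] i))"
 proof (rule fsc)
  fix i assume i: "i : {..<Suc d}"
  have "?Q [^] d = ?Q [^] (d - i) ** ?Q [^] i" using i QL by (simp add: nat_pow_mult)
  moreover have "x [^] i = ?y [^] i ** ?Q [^] i" using x yL QL by (simp add: nat_pow_distrib)
  ultimately show "c i ** x [^] i = ?Q [^] d ** (icast (Polynomial.coeff p i) ** ?y [^] i)"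
   using yL QL by (simp add: c_def m_ac)
 qed (use yL QL in auto)
 also have "... = ?Q [^] d ** (\<Oplus>i\<in>{..<Suc d}. icast (Polynomial.coeff p i) ** ?y [^] i)"
  by (rule fsr) (use yL QL in auto)
 also have "(\<Oplus>i\<in>{..<Suc d}. icast (Polynomial.coeff p i) ** ?y [^] i) = \<zero>"
  using ev_expand[OF yL, of p "Suc d"] p by (simp add: d_def)
 finally have "eval ?q x = \<zero>" using QL by simp
 moreover have "polynomial@L KZ ?q" unfolding polynomial_def using cK cd one by auto
 moreover have "hd ?q = \<one>" using cd by simp
 moreover have "?q ~= []" by simp
 ultimately show "x : integers l L \<iota>" unfolding integers_def using xL by blast
qed

text \<open>Sums are brought to a common power of \<open>P\<close>, using that p times
  \<open>P\<close> is 1.\<close>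

lemma cyc_ring:
 assumes z: "z : carrier L" and P: "P : KZ" "icast (int p) ** P = \<one>"
 shows "x : cyc z P ==> x : carrier L" "ev z f : cyc z P" "P : cyc z P"
  "x : cyc z P ==> y : cyc z P ==> x \<oplus> y : cyc z P"
  "x : cyc z P ==> y : cyc z P ==> x ** y : cyc z P"
  "x : cyc z P ==> \<ominus> x : cyc z P"
proof -
 have PL: "P : carrier L" by (rule KZ_closed[OF P(1)])
 note zp = z PL
 show "x : cyc z P ==> x : carrier L" using zp by (auto simp: cyc_def)
 show e: "ev z f : cyc z P" for f
  unfolding cyc_def using zp by (intro CollectI exI[of _ f] exI[of _ "0::nat"]) simp
 show "P : cyc z P"
  unfolding cyc_def using zp by (intro CollectI exI[of _ 1] exI[of _ "1::nat"]) simp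
 show "x : cyc z P ==> \<ominus> x : cyc z P"
 proof -
  assume "x : cyc z P"
  then obtain f and k :: nat where "x = ev z f ** P [^] k" by (auto simp: cyc_def)
  then have "\<ominus> x = ev z (- f) ** P [^] k" using zp by (simp add: ev_minus l_minus)
  then show ?thesis unfolding cyc_def by blast
 qed
 show "x ** y : cyc z P" if xy: "x : cyc z P" "y : cyc z P"
 proof -
  obtain f g and i j :: nat where fg: "x = ev z f ** P [^] i" "y = ev z g ** P [^] j" using xy by (auto simp: cyc_def)
  have "x ** y = ev z (f * g) ** P [^] (i + j)"
   unfolding fg using zp by (simp add: ev_mult nat_pow_mult[symmetric] m_ac)
  then show ?thesis unfolding cyc_def by blast
 qed
 show "x \<oplus> y : cyc z P" if xy: "x : cyc z P" "y : cyc z P"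
 proof -
  obtain f g and i j :: nat where fg: "x = ev z f ** P [^] i" "y = ev z g ** P [^] j" using xy by (auto simp: cyc_def)
  have ic: "icast (int p ^ j) ** P [^] j = \<one>" for j
  proof (induction j)
   case (Suc j)
   have "icast (int p ^ Suc j) ** P [^] Suc j = (icast (int p) ** P) ** (icast (int p ^ j) ** P [^] j)"
    using PL by (simp add: icast_mult m_ac)
   then show ?case using Suc P by simp
  qed simp
  have "ev z f ** P [^] i = ev z (Polynomial.smult (int p ^ j) f) ** P [^] (i + j)"
  proof -
   have "ev z (Polynomial.smult (int p ^ j) f) ** P [^] (i + j) = (icast (int p ^ j) ** P [^] j) ** (ev z f ** P [^] i)"
    using zp by (simp add: ev_smult nat_pow_mult[symmetric] m_ac)
   then show ?thesis using ic zp by simp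
  qed
  moreover have "ev z g ** P [^] j = ev z (Polynomial.smult (int p ^ i) g) ** P [^] (i + j)"
  proof -
   have "ev z (Polynomial.smult (int p ^ i) g) ** P [^] (i + j) = (icast (int p ^ i) ** P [^] i) ** (ev z g ** P [^] j)"
    using zp by (simp add: ev_smult nat_pow_mult[symmetric] m_ac)
   then show ?thesis using ic zp by simp
  qed
  ultimately have "x \<oplus> y = ev z (Polynomial.smult (int p ^ j) f + Polynomial.smult (int p ^ i) g) ** P [^] (i + j)"
   unfolding fg using zp by (simp add: ev_add l_distr)
  then show ?thesis unfolding cyc_def by blast
 qed
qed

lemma root_power_cyc:
 assumes z: "z : carrier L" and P: "P : KZ" "icast (int p) ** P = \<one>"
 shows "z [^] (i::nat) : cyc z P"
 using cyc_ring(2)[OF assms, of "[:0, 1:] ^ i"] z by (simp add: ev_power ev_X)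

end

section \<open>Construction of the data for lifting\<close>

text \<open>With the field split as \<open>H\<close> plus the prime field times \<open>a\<close>,
  the character is trivial on \<open>H\<close> and sends i a to z^i.\<close>

lemma (in Ring.field) additive_character:
 fixes z qi :: 'a
 assumes z: "z : carrier R" "z [^] CHAR('k::{finite,field}) = \<one>" "z ~= \<one>"
  and qi: "qi : carrier R" "add_pow R CARD('k) \<one> ** qi = \<one>"
 shows "EX py::'k => 'a. achar R py qi & (ALL x. py x : range (%i::nat. z [^] i))"
proof -
 let ?p = "CHAR('k)"
 obtain H :: "'k set" and a where H: "add_subgroup H" "bij_betw (%(h, i). h + of_nat i * a) (H \<times> {..<?p}) UNIV"
  using max_add_subgroup by blast
 have p0: "?p > 0" by (rule finite_imp_CHAR_pos) simp
 define ix where "ix x = (THE i. i < ?p & x - of_nat i * a : H)" for x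
 have ix_eq: "ix (h + of_nat i * a) = i mod ?p" if h: "h : H" for h and i :: nat
 proof -
  have im: "(of_nat i :: 'k) = of_nat (i mod ?p)" by (simp add: of_nat_eq_iff_cong_CHAR cong_def)
  show ?thesis unfolding ix_def
  proof (rule the_equality)
   show "i mod ?p < ?p & h + of_nat i * a - of_nat (i mod ?p) * a : H" using p0 h im by simp
   fix j assume j: "j < ?p & h + of_nat i * a - of_nat j * a : H"
   let ?h = "h + of_nat i * a - of_nat j * a"
   have "(%(h, i). h + of_nat i * a) (?h, j) = (%(h, i). h + of_nat i * a) (h, i mod ?p)" using im by simp
   moreover have "(?h, j) : H \<times> {..<?p}" "(h, i mod ?p) : H \<times> {..<?p}" using j h p0 by auto
   ultimately show "j = i mod ?p" using inj_onD[OF bij_betw_imp_inj_on[OF H(2)]] by blast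
  qed
 qed
 have dec: "EX h i. h : H & i < ?p & x = h + of_nat i * a" for x
 proof -
  have "x : (%(h, i). h + of_nat i * a) ` (H \<times> {..<?p})" using H(2) by (simp add: bij_betw_def)
  then show ?thesis by auto
 qed
 have zmod: "z [^] (i mod ?p) = z [^] i" for i :: nat
 proof -
  have "z [^] (?p * (i div ?p) + i mod ?p) = (z [^] ?p) [^] (i div ?p) ** z [^] (i mod ?p)"
   using z(1) by (simp add: nat_pow_mult nat_pow_pow)
  then show ?thesis using z by simp
 qed
 define py where "py x = z [^] ix x" for x
 have psi: "py (h + of_nat i * a) = z [^] i" if "h : H" for h i
  using zmod by (simp add: py_def ix_eq[OF that])
 have cl: "py x : carrier R" for x using z by (simp add: py_def)
 have add: "py (x + y) = py x ** py y" for x y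
  proof -
   obtain h i where x: "h : H" "x = h + of_nat i * a" using dec by blast
   obtain h' i' where y: "h' : H" "y = h' + of_nat i' * a" using dec by blast
   have "h + h' : H" using x y H(1) by (auto simp: add_subgroup_def)
   moreover have "x + y = (h + h') + of_nat (i + i') * a" using x y by (simp add: algebra_simps)
   ultimately have "py (x + y) = z [^] (i + i')" using psi by metis
   then show ?thesis using x y psi z by (simp add: nat_pow_mult)
  qed
 have "achar R py qi"
 proof (unfold_locales)
  show "py x : carrier R" for x by (rule cl)
  show "qi : carrier R" "add_pow R CARD('k) \<one> ** qi = \<one>" by (rule qi)+
  show "py 0 = \<one>" using psi[of 0 0] H(1) by (simp add: add_subgroup_def)
  show "py (x + y) = py x ** py y" for x y by (rule add)
  fix b :: 'k assume b: "b ~= 0"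
  \<comment> \<open>A translation by a/b multiplies the sum by z, which is not 1.\<close>
  have pa: "py a = z" using psi[of 0 1] H(1) z by (simp add: add_subgroup_def)
  have "(\<Oplus>x\<in>UNIV. py (b * x)) = (\<Oplus>x\<in>UNIV. py (b * x) ** z)"
   by (rule fsw[of _ "%x. x + a / b" "%x. x - a / b"])
    (use b cl z in \<open>auto simp: pa[symmetric] add[symmetric] algebra_simps\<close>)
  also have "... = (\<Oplus>x\<in>UNIV. py (b * x)) ** z" by (rule fsl) (use cl z in auto)
  finally have e: "(\<Oplus>x\<in>UNIV. py (b * x)) = (\<Oplus>x\<in>UNIV. py (b * x)) ** z" .
  have S: "(\<Oplus>x\<in>UNIV. py (b * x)) : carrier R" using cl by auto
  show "(\<Oplus>x\<in>UNIV. py (b * x)) = \<zero>"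
  proof (rule ccontr)
   assume "(\<Oplus>x\<in>UNIV. py (b * x)) ~= \<zero>"
   then have "z = \<one>" using e S z m_lcancel[of "\<Oplus>x\<in>UNIV. py (b * x)" z \<one>] by simp
   then show False using z by simp
  qed
 qed
 then show ?thesis by (auto simp: py_def)
qed

text \<open>The data used to lift a representation of \<open>GL2\<close> over the field \<open>'k\<close>.\<close>

locale lifting = redn L F A red for L :: "'a ring" (structure) and F :: "'b ring" and A red +
 fixes l :: nat and om :: 'a and py :: "'k::{finite,field} => 'a" and qi :: 'a
 assumes l_prime: "Factorial_Ring.prime l"
  and charL: "n > 0 ==> add_pow L (n::nat) \<one> ~= \<zero>"
  and charF: "add_pow F l \<one>@F = \<zero>@F"
  and om_A: "om : A" and om_order: "om [^] (j::nat) = \<one> \<longleftrightarrow> CARD('k) * CARD('k) - 1 dvd j"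
  and achL: "achar L py qi" and psi_A: "py x : A" and qi_A: "qi : A"

theorem lifting_exists:
 fixes l :: nat and L :: "'a ring" and \<iota> :: "(nat => int) => 'a" and F :: "'b ring" and red :: "'a => 'b"
 assumes l: "Factorial_Ring.prime l" and lp: "l ~= CHAR('k::{finite,field})"
  and L: "is_Qlac l L \<iota>" and F: "is_Flac l F" and red: "is_reduction_map l L \<iota> F red"
 shows "EX A om (py :: 'k => 'a) qi. lifting L F A red l om py qi & A <= integers l L \<iota>"
proof -
 interpret L: algebraic_closure L "generate_field L (\<iota> ` carrier (Zl l))" using L by (simp add: is_Qlac_def)
 interpret L: padic L l \<iota>
  by unfold_locales (use L l in \<open>auto simp: is_Qlac_def\<close>)
 interpret F: Ring.field F using F by (simp add: is_Flac_def)
 let ?p = "CHAR('k)" and ?M = "CARD('k) * CARD('k) - 1"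
 have p: "Factorial_Ring.prime ?p" by (rule CHAR_prime_finite)
 obtain e where e: "CARD('k) = ?p ^ e" using card_finite_field by blast
 have q2: "CARD('k) \<ge> 2" by (rule cge2)
 have M0: "?M > 0" using q2 mult_le_mono[OF q2 q2] by simp
 have p1: "?p > 1" using p prime_gt_1_nat by blast
 \<comment> \<open>One root of unity serves both purposes: its power with exponent q^2 - 1 has order
   p and gives psi, and its p-th power has order q^2 - 1 and gives the multiplicative
   characters.\<close>
 obtain z where z: "z : carrier L" "!!j::nat. z [^]@L j = \<one>@L \<longleftrightarrow> ?p * ?M dvd j"
  using L.exists_primitive_root[OF L.char0, of "?p * ?M"] M0 p1 by auto
 obtain P where P: "P : L.KZ" "L.icast (int ?p) **@L P = \<one>@L"
  using L.inverse_exists[of ?p] primes_coprime[OF p l lp[symmetric]] by blast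
 define A where "A = L.cyc z P"
 note ring = L.cyc_ring[OF z(1) P, folded A_def]
 have sub: "A <= integers l L \<iota>"
  unfolding A_def by (rule L.cyc_integers[OF z(1) _ _ P(1), of "?p * ?M"]) (use z(2) M0 p1 in auto)
 have pw: "z [^]@L (i::nat) : A" for i unfolding A_def by (rule L.root_power_cyc[OF z(1) P])
 have zero: "\<zero>@L : A" using ring(2)[of 0] by simp
 have one: "\<one>@L : A" using pw[of 0] by simp
 have PL: "P : carrier L" by (rule L.KZ_closed[OF P(1)])
 let ?O = "L\<lparr>carrier := integers l L \<iota>\<rparr>"
 have hom: "red : Ring.ring_hom ?O F" using red by (simp add: is_reduction_map_def Let_def)
 have rd: "redn L F A red"
 proof unfold_locales
  show "x : A ==> x : carrier L" for x by (rule ring(1))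
  show "\<zero>@L : A" "\<one>@L : A" by (rule zero one)+
  show "x : A ==> y : A ==> x \<oplus>@L y : A" for x y by (rule ring(4))
  show "x : A ==> y : A ==> x **@L y : A" for x y by (rule ring(5))
  show "x : A ==> \<ominus>@L x : A" for x by (rule ring(6))
  show "x : A ==> red x : carrier F" for x using Ring.ring_hom_closed[OF hom, of x] sub by auto
  show "x : A ==> y : A ==> red (x \<oplus>@L y) = red x \<oplus>@F red y" for x y
   using Ring.ring_hom_add[OF hom, of x y] sub by auto
  show "x : A ==> y : A ==> red (x **@L y) = red x **@F red y" for x y
   using Ring.ring_hom_mult[OF hom, of x y] sub by auto
  show "red \<one>@L = \<one>@F" using Ring.ring_hom_one[OF hom] by simp
 qed
 let ?zp = "z [^]@L ?M"
 have zp: "?zp : carrier L" "?zp [^]@L ?p = \<one>@L" "?zp ~= \<one>@L"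
 proof -
  show "?zp : carrier L" using z by simp
  show "?zp [^]@L ?p = \<one>@L" unfolding L.nat_pow_pow[OF z(1)] z(2) by (simp add: mult.commute)
  have "~ ?p * ?M dvd ?M" using M0 p1 by (simp add: nat_dvd_not_less)
  then show "?zp ~= \<one>@L" using z(2) by blast
 qed
 let ?qi = "P [^]@L e"
 have "L.icast (int (?p ^ j)) **@L P [^]@L j = \<one>@L" for j
 proof (induction j)
  case (Suc j)
  have "L.icast (int (?p ^ Suc j)) **@L P [^]@L Suc j
   = (L.icast (int ?p) **@L P) **@L (L.icast (int (?p ^ j)) **@L P [^]@L j)"
   using PL by (simp add: L.icast_mult L.m_ac)
  then show ?case using Suc P by simp
 qed simp
 then have "L.icast (int CARD('k)) **@L ?qi = \<one>@L" unfolding e .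
 then have qi: "?qi : carrier L" "add_pow L CARD('k) \<one>@L **@L ?qi = \<one>@L" using PL by (auto simp: L.icast_nat)
 obtain py :: "'k => 'a" where psi: "achar L py ?qi" "!!x. py x : range (%i::nat. ?zp [^]@L i)"
  using L.additive_character[OF zp qi] by blast
 have om: "(z [^]@L ?p) [^]@L (j::nat) = \<one>@L \<longleftrightarrow> ?M dvd j" for j
  unfolding L.nat_pow_pow[OF z(1)] z(2) using p1 by simp
 have "lifting L F A red l (z [^]@L ?p) py ?qi"
  unfolding lifting_def lifting_axioms_def
 proof (intro conjI allI impI)
  show "redn L F A red" by (rule rd)
  show "Factorial_Ring.prime l" by (rule l)
  show "add_pow L n \<one>@L ~= \<zero>@L" if "0 < n" for n :: nat using L.char0[OF that] .
  show "add_pow F l \<one>@F = \<zero>@F" using F by (simp add: is_Flac_def)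
  show "z [^]@L ?p : A" by (rule pw)
  show "(z [^]@L ?p) [^]@L j = \<one>@L \<longleftrightarrow> ?M dvd j" for j by (rule om)
  show "achar L py ?qi" by (rule psi)
  show "py x : A" for x using psi(2)[of x] pw z(1) by (auto simp: L.nat_pow_pow)
  have "P [^]@L (j::nat) : A" for j by (induction j) (use one ring(3,5) in auto)
  then show "?qi : A" .
 qed
 then show ?thesis using sub by blast
qed

section \<open>Characters of finite fields\<close>

definition isgen :: "'f::{finite,field} => bool" where
 "isgen g \<longleftrightarrow> g ~= 0 & bij_betw (%i. g ^ i) {..<CARD('f) - 1} (UNIV - {0})"
definition dlg :: "'f::{finite,field} => 'f => nat" where
 "dlg g = inv_into {..<CARD('f) - 1} (%i. g ^ i)"
text \<open>The character that sends the generator g to z; characters are thus parametrised by roots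
  of unity.\<close>

definition (in Ring.cring) chr :: "'f::{finite,field} => 'a => 'f => 'a" where
 "chr g z t = z [^] dlg g t"

lemma isgen_exists: "EX g::'f::{finite,field}. isgen g"
 using finite_field_generator by (auto simp: isgen_def)

lemma dlg:
 fixes g :: "'f::{finite,field}"
 assumes g: "isgen g"
 shows "t ~= 0 ==> g ^ dlg g t = t" "t ~= 0 ==> dlg g t < CARD('f) - 1"
  "dlg g (g ^ i) = i mod (CARD('f) - 1)"
proof -
 let ?n = "CARD('f) - 1"
 have b: "bij_betw (%i. g ^ i) {..<?n} (UNIV - {0})" and g0: "g ~= 0" using g by (auto simp: isgen_def)
 show 1: "t ~= 0 ==> g ^ dlg g t = t" for t
  unfolding dlg_def using bij_betw_inv_into_right[OF b, of t] by simp
 show 2: "t ~= 0 ==> dlg g t < ?n" for t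
  unfolding dlg_def using inv_into_into[of t "%i. g ^ i" "{..<?n}"] b by (auto simp: bij_betw_def)
 have n: "?n > 0" using cge2[where ?'f = 'f] by simp
 have "g ^ i = g ^ (?n * (i div ?n) + i mod ?n)" by (simp only: mult_div_mod_eq)
 also have "... = g ^ (i mod ?n)" by (simp only: power_add power_mult ffp[OF g0] power_one mult_1_left)
 finally have "dlg g (g ^ i) = dlg g (g ^ (i mod ?n))" by simp
 also have "... = i mod ?n" unfolding dlg_def using n by (intro bij_betw_inv_into_left[OF b]) simp
 finally show "dlg g (g ^ i) = i mod ?n" .
qed

lemma isgenI:
 fixes g :: "'f::{finite,field}"
 assumes g0: "g ~= 0" and s: "!!t. t ~= 0 ==> EX i. g ^ i = t"
 shows "isgen g"
proof -
 let ?n = "CARD('f) - 1"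
 have n: "?n > 0" using cge2[where ?'f = 'f] by simp
 have "(%i. g ^ i) ` {..<?n} = UNIV - {0}"
 proof
  show "(%i. g ^ i) ` {..<?n} <= UNIV - {0}" using g0 by auto
  show "UNIV - {0} <= (%i. g ^ i) ` {..<?n}"
  proof
   fix t assume "t : UNIV - {0::'f}"
   then obtain i where i: "g ^ i = t" using s by auto
   have "g ^ i = g ^ (?n * (i div ?n) + i mod ?n)" by (simp only: mult_div_mod_eq)
   also have "... = g ^ (i mod ?n)" by (simp only: power_add power_mult ffp[OF g0] power_one mult_1_left)
   finally show "t : (%i. g ^ i) ` {..<?n}" unfolding i using n by (intro image_eqI[of _ _ "i mod ?n"]) simp_all
  qed
 qed
 moreover have "card (UNIV - {0::'f}) = ?n" by (simp add: card_Diff_singleton)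
 ultimately have "inj_on (%i. g ^ i) {..<?n}" by (intro eq_card_imp_inj_on) auto
 then show ?thesis using \<open>(%i. g ^ i) ` {..<?n} = UNIV - {0}\<close> g0 by (simp add: isgen_def bij_betw_def)
qed

text \<open>The norm is a surjective homomorphism. With the generators g and \<open>Nm g\<close>, a
  character composed with the norm keeps the same parameter.\<close>

lemma isgen_Nm:
 fixes g :: "'k::{finite,field} q2"
 assumes g: "isgen g" shows "isgen (Nm g)"
proof (rule isgenI)
 show "Nm g ~= 0" using g by (simp add: isgen_def)
 fix t :: 'k assume t: "t ~= 0"
 obtain s where s: "Nm s = t" using Nm_surj[OF t] .
 then have "s ~= 0" using t by auto
 then have "g ^ dlg g s = s" using dlg(1)[OF g] by simp
 then show "EX i. Nm g ^ i = t" using s by (metis Nm_power)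
qed

lemma dvd_less_double:
 assumes "(n::nat) dvd x" "0 < x" "x < 2 * n" shows "x = n"
proof -
 obtain k where k: "x = n * k" using assms by blast
 have "k < 2" using assms(3) unfolding k by (metis mult.commute mult_less_cancel1)
 moreover have "k ~= 0" using assms(2) k by auto
 ultimately have "k = 1" by simp
 then show ?thesis using k by simp
qed

context Ring.cring
begin

context
 fixes g :: "'f::{finite,field}" and z
 assumes g: "isgen g" and z: "z : carrier R" "z [^] (CARD('f) - 1) = \<one>"
begin

lemma pow_mod: "z [^] (i mod (CARD('f) - 1)) = z [^] i" for i :: nat
proof -
 let ?n = "CARD('f) - 1"
 have "z [^] (?n * (i div ?n) + i mod ?n) = (z [^] ?n) [^] (i div ?n) ** z [^] (i mod ?n)"
  using z(1) by (simp add: nat_pow_mult nat_pow_pow)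
 then show ?thesis using z by simp
qed

lemma chr_closed [simp, intro]: "chr g z t : carrier R" using z by (simp add: chr_def)
lemma chr_pow: "chr g z (g ^ i) = z [^] i" using pow_mod by (simp add: chr_def dlg(3)[OF g])
lemma chr_1: "chr g z 1 = \<one>" using chr_pow[of 0] by simp
lemma chr_gen: "chr g z g = z" using chr_pow[of 1] z by simp

lemma chr_mult: "s ~= 0 ==> t ~= 0 ==> chr g z (s * t) = chr g z s ** chr g z t"
 using chr_pow[of "dlg g s + dlg g t"] z by (simp add: power_add dlg(1)[OF g] nat_pow_mult[symmetric] chr_def)

end

end

text \<open>Fourier inversion on a cyclic group.\<close>

lemma (in Ring.field) chr_separate:
 fixes g :: "'f::{finite,field}"
 assumes g: "isgen g" and w: "w : carrier R" "!!j::nat. w [^] j = \<one> \<longleftrightarrow> CARD('f) - 1 dvd j"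
  and n: "add_pow R (CARD('f) - 1) \<one> ~= \<zero>" and C: "!!t. t ~= 0 ==> C t : carrier R"
  and z: "!!i::nat. i < CARD('f) - 1 ==> (\<Oplus>t\<in>UNIV - {0}. C t ** chr g (w [^] i) t) = \<zero>"
  and t: "t ~= 0"
 shows "C t = \<zero>"
proof -
 let ?n = "CARD('f) - 1" and ?k = "dlg g"
 note k = dlg(2)[OF g]
 have e: "w [^] (i * (?n - ?k t)) ** (C s ** chr g (w [^] i) s) = C s ** (w [^] (?n - ?k t + ?k s)) [^] i" if "s ~= 0" for i s
 proof -
  have "chr g (w [^] i) s = w [^] (i * ?k s)" using w by (simp add: chr_def nat_pow_pow)
  moreover have "(w [^] (?n - ?k t + ?k s)) [^] i = w [^] (i * (?n - ?k t)) ** w [^] (i * ?k s)"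
   using w(1) by (simp add: nat_pow_pow nat_pow_mult algebra_simps)
  ultimately show ?thesis using w(1) C[OF that] by (simp add: m_lcomm)
 qed
 have ck: "chr g (w [^] (i::nat)) s : carrier R" for i s using w(1) by (simp add: chr_def)
 have "\<zero> = (\<Oplus>i\<in>{..<?n}. w [^] (i * (?n - ?k t)) ** (\<Oplus>s\<in>UNIV - {0}. C s ** chr g (w [^] i) s))"
  by (rule fs_zero[symmetric]) (use z w(1) in simp)
 also have "... = (\<Oplus>i\<in>{..<?n}. \<Oplus>s\<in>UNIV - {0}. C s ** (w [^] (?n - ?k t + ?k s)) [^] i)"
 proof (rule fsc)
  fix i
  have "w [^] (i * (?n - ?k t)) ** (\<Oplus>s\<in>UNIV - {0}. C s ** chr g (w [^] i) s)
   = (\<Oplus>s\<in>UNIV - {0}. w [^] (i * (?n - ?k t)) ** (C s ** chr g (w [^] i) s))"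
   by (rule fsr[symmetric]) (use C ck w(1) in auto)
  also have "... = (\<Oplus>s\<in>UNIV - {0}. C s ** (w [^] (?n - ?k t + ?k s)) [^] i)"
   by (rule fsc) (use C e w(1) in auto)
  finally show "w [^] (i * (?n - ?k t)) ** (\<Oplus>s\<in>UNIV - {0}. C s ** chr g (w [^] i) s)
   = (\<Oplus>s\<in>UNIV - {0}. C s ** (w [^] (?n - ?k t + ?k s)) [^] i)" .
 qed (use C w(1) in auto)
 also have "... = (\<Oplus>s\<in>UNIV - {0}. \<Oplus>i\<in>{..<?n}. C s ** (w [^] (?n - ?k t + ?k s)) [^] i)"
  by (rule fs_swap) (use C w(1) in auto)
 also have "... = (\<Oplus>s\<in>UNIV - {0}. if s = t then C t ** add_pow R ?n \<one> else \<zero>)"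
 proof (rule fsc)
  fix s :: 'f assume s: "s : UNIV - {0}"
  let ?x = "w [^] (?n - ?k t + ?k s)"
  have x: "?x : carrier R" using w(1) by simp
  have "(\<Oplus>i\<in>{..<?n}. C s ** ?x [^] i) = C s ** (\<Oplus>i\<in>{..<?n}. ?x [^] i)"
   by (rule fsr) (use C s x in auto)
  also have "(\<Oplus>i\<in>{..<?n}. ?x [^] i) = (if s = t then add_pow R ?n \<one> else \<zero>)"
  proof (cases "s = t")
   case True
   then have "?x = \<one>" using k[OF t] w(2) by simp
   then show ?thesis using True by (simp add: fs_const)
  next
   case False
   have ne: "?k s ~= ?k t" using False s t dlg(1)[OF g] by (metis DiffE singletonI)
   \<comment> \<open>The exponent lies strictly between 0 and 2n, so divisibility would force it to
     be n and the two logarithms to agree.\<close>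
   have "~ ?n dvd ?n - ?k t + ?k s"
   proof
    assume "?n dvd ?n - ?k t + ?k s"
    moreover have "?n - ?k t + ?k s > 0" "?n - ?k t + ?k s < 2 * ?n" using k[OF t] k[of s] s by auto
    ultimately have "?n - ?k t + ?k s = ?n" by (rule dvd_less_double)
    then show False using ne k[OF t] by simp
   qed
   then have "?x ~= \<one>" using w(2) by blast
   moreover have "?x [^] ?n = \<one>"
   proof -
    have "?n dvd (?n - ?k t + ?k s) * ?n" by simp
    then show ?thesis unfolding nat_pow_pow[OF w(1)] w(2) .
   qed
   ultimately show ?thesis using geometric_zero[OF x] False by simp
  qed
  finally show "(\<Oplus>i\<in>{..<?n}. C s ** ?x [^] i) = (if s = t then C t ** add_pow R ?n \<one> else \<zero>)"
   using C s by auto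
 qed (use C t in auto)
 also have "... = C t ** add_pow R ?n \<one>" by (subst fs_only[of _ t]) (use t C in auto)
 finally show ?thesis using integral[of "C t" "add_pow R ?n \<one>"] n C t by auto
qed

section \<open>Eigenvalue systems of the Hecke algebra and their separation\<close>

context grep
begin

lemma psv_closed:
 "psv a v ==> psv a w ==> psv a (v \<oplus>@M w)" "c : carrier R ==> psv a v ==> psv a (c \<odot>@M v)" "psv a \<zero>@M"
proof -
 show "psv a v ==> psv a w ==> psv a (v \<oplus>@M w)" by (auto simp: psv_def act_add M.smult_r_distr)
 show "c : carrier R ==> psv a v ==> psv a (c \<odot>@M v)"
  by (auto simp: psv_def act_smult M.smult_assoc1[symmetric] m_comm)
 show "psv a \<zero>@M" by (auto simp: psv_def act_zero M.smult_r_null)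
qed

lemma Tb_one: "psv 1 v ==> Tb (0, 1) v = v"
proof -
 assume v: "psv 1 v"
 have "bel (0::'k, 1) = m2one" by (simp add: bel_def dg_def m2one_def)
 then show ?thesis using v pe_psv[OF v, of 1] act_one psvD(1)[OF v] by (simp add: Tb_def)
qed

lemma Tb_lin:
 assumes "b : BD D"
 shows "v : carrier M ==> w : carrier M ==> Tb b (v \<oplus>@M w) = Tb b v \<oplus>@M Tb b w"
  "c : carrier R ==> v : carrier M ==> Tb b (c \<odot>@M v) = c \<odot>@M Tb b v"
 using bel_GD[OF assms] by (auto simp: Tb_def act_add act_smult pe_add pe_smult)

lemma one_BD: "(0, 1) : BD D" by (simp add: BD_def)

lemma smult_eqD: "a : carrier R ==> b : carrier R ==> v : carrier M ==> v ~= \<zero>@M ==> a \<odot>@M v = b \<odot>@M v ==> a = b"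
proof (rule ccontr)
 assume a: "a : carrier R" "b : carrier R" and v: "v : carrier M" "v ~= \<zero>@M" and e: "a \<odot>@M v = b \<odot>@M v" and ne: "a ~= b"
 let ?c = "a \<ominus> b"
 have c: "?c : Units R" using ne a dze[of a b] by (auto simp: field_Units)
 have "?c \<odot>@M v = \<zero>@M"
  using a v e by (simp add: a_minus_def M.smult_l_distr M.smult_l_minus M.M.r_neg)
 then have "inv ?c \<odot>@M (?c \<odot>@M v) = \<zero>@M" using c by (simp add: M.smult_r_null)
 moreover have "inv ?c \<odot>@M (?c \<odot>@M v) = (inv ?c ** ?c) \<odot>@M v"
  by (rule M.smult_assoc1[symmetric]) (use c v in auto)
 ultimately show False using c v by simp
qed

text \<open>A system realised by an eigenvector inherits the multiplication rule of the operators;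
  this is how the explicit sums get theirs.\<close>

lemma hev_mult:
 assumes h: "hev lam v" and b: "b : BD D" "b' : BD D"
 shows "lam b ** lam b' = (\<Oplus>s\<in>UNIV. stc b b' s ** lam (nxt b b' s))" "lam (0, 1) = \<one>"
proof -
 have v: "psv 1 v" "v ~= \<zero>@M" and l: "!!b. b : BD D ==> lam b : carrier R" "!!b. b : BD D ==> Tb b v = lam b \<odot>@M v"
  using h by (auto simp: hev_def)
 have vM: "v : carrier M" by (rule psvD(1)[OF v(1)])
 have nx: "nxt b b' s : BD D" for s by (rule nxt_BD[OF D b])
 have "(lam b ** lam b') \<odot>@M v = Tb b (Tb b' v)"
  using l b vM by (simp add: Tb_lin(2) M.smult_assoc1 m_comm[of "lam b"])
 also have "... = (\<Oplus>@M s\<in>UNIV. (stc b b' s ** lam (nxt b b' s)) \<odot>@M v)"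
  unfolding Tb_mult[OF v(1) b] by (rule M.M.fsc) (use l nx vM in \<open>auto simp: M.smult_assoc1\<close>)
 also have "... = (\<Oplus>s\<in>UNIV. stc b b' s ** lam (nxt b b' s)) \<odot>@M v"
  by (rule fs_smult_l[symmetric]) (use l nx vM in auto)
 finally show "lam b ** lam b' = (\<Oplus>s\<in>UNIV. stc b b' s ** lam (nxt b b' s))"
  by (intro smult_eqD[OF _ _ vM v(2)]) (use l b nx in auto)
 have "lam (0, 1) \<odot>@M v = \<one> \<odot>@M v" using l(2)[OF one_BD] Tb_one[OF v(1)] vM by simp
 then show "lam (0, 1) = \<one>" by (intro smult_eqD[OF _ _ vM v(2)]) (use l one_BD in auto)
qed

end

text \<open>The separation property of the two families of eigenvalue systems: \<open>C\<close> and \<open>E\<close> below are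
 the coefficients of a vanishing linear combination in terms of the characters.\<close>

lemma (in achar) separate_core:
 fixes Ph :: "'k \<times> 'k => 'a" and D :: "'k set"
 assumes D: "subgrp D" and two: "\<one> \<oplus> \<one> ~= \<zero>" and P: "!!b. Ph b : carrier R"
  and C: "!!t::'k q2. t ~= 0 ==> (\<Oplus>z\<in>{z. z ~= 0 & z * z : D & emb z = t}. Ph (0, z))
    \<ominus> (if Nm t : D then qi ** (\<Oplus>c\<in>UNIV - {0}. Ph (c, Nm t) ** py (- Tr t / c)) else \<zero>) = \<zero>"
  and E: "!!d t::'k. d ~= 0 ==> t ~= 0 ==> (if t * t : D & d = t * t then Ph (0, t) else \<zero>)
    \<oplus> (if d : D then qi ** (\<Oplus>c\<in>UNIV - {0}. Ph (c, d) ** py (- (t + d / t) / c)) else \<zero>) = \<zero>"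
  and b: "b : BD D"
 shows "Ph b = \<zero>"
proof -
 let ?S = "%d s. qi ** (\<Oplus>c\<in>UNIV - {0}. Ph (c, d) ** py (- s / c))"
 have D0: "0 \<notin> D" using D by (simp add: subgrp_def)
 have Sc: "?S d s : carrier R" for d s using P by auto
 \<comment> \<open>At a scalar z the same Bessel term occurs with sign - in the equation
   \<open>C\<close> and with sign + in \<open>E\<close>; adding the two leaves twice the
   coefficient.\<close>
 have sc: "Ph (0, z) = \<zero>" if z: "z * z : D" for z
 proof -
  have z0: "z ~= 0" using z D0 by auto
  have "{z'. z' ~= 0 & z' * z' : D & emb z' = emb z} = {z}" using z z0 by auto
  moreover have "finsum R (%z. Ph (0, z)) {z} = Ph (0, z)" by (subst fs_only[of _ z]) (use P in auto)
  moreover have "Tr (emb z) = z + z" by (rule emb_simps(7)[THEN iffD1]) (simp add: emb_Tr cnj2_simps)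
  ultimately have 1: "Ph (0, z) \<ominus> ?S (z * z) (z + z) = \<zero>" using C[of "emb z"] z z0 by simp
  have 2: "Ph (0, z) \<oplus> ?S (z * z) (z + z) = \<zero>" using E[of "z * z" z] z z0 by simp
  have "(\<one> \<oplus> \<one>) ** Ph (0, z) = (Ph (0, z) \<ominus> ?S (z * z) (z + z)) \<oplus> (Ph (0, z) \<oplus> ?S (z * z) (z + z))"
   using P Sc[of "z * z" "z + z"] by (simp add: a_minus_def l_distr a_ac r_neg2 r_neg1 r_neg l_neg)
  then have "(\<one> \<oplus> \<one>) ** Ph (0, z) = \<zero>" unfolding 1 2 by simp
  then show ?thesis using integral[of "\<one> \<oplus> \<one>" "Ph (0, z)"] two P by auto
 qed
 obtain c d where bb: "b = (c, d)" by force
 show ?thesis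
 proof (cases "c = 0")
  case True
  then show ?thesis using b sc bb by (simp add: BD_def)
 next
  case False
  then have d: "d : D" using b bb by (simp add: BD_def)
  then have d0: "d ~= 0" using D0 by auto
  \<comment> \<open>A transform of the coefficients with fixed determinant d. With the scalar terms
    gone, it vanishes at the traces of all elements of norm d in both tori.\<close>
  define W where "W s = (\<Oplus>c'\<in>UNIV - {0}. Ph (c', d) ** py (- s / c'))" for s
  have Wc: "W s : carrier R" for s using P by (auto simp: W_def)
  have W0: "W s = \<zero>" if "?S d s = \<zero>" for s
   using that qq_nonzero(2) integral[of qi "W s"] Wc unfolding W_def[symmetric] by auto
  have WT: "W (Tr t) = \<zero>" if t: "Nm t = d" for t :: "'k q2"
  proof (rule W0)
   have t0: "t ~= 0" using t d0 by auto
   have "(\<Oplus>z\<in>{z. z ~= 0 & z * z : D & emb z = t}. Ph (0, z)) = \<zero>" by (rule fs_zero) (use sc in auto)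
   then have "\<ominus> ?S d (Tr t) = \<zero>" using C[OF t0] t d Sc[of d "Tr t"] by (simp add: a_minus_def)
   then show "?S d (Tr t) = \<zero>" using Sc[of d "Tr t"] by (metis minus_minus minus_zero)
  qed
  have WS: "W (a + d / a) = \<zero>" if a: "a ~= 0" for a
  proof (rule W0)
   have "(if a * a : D & d = a * a then Ph (0, a) else \<zero>) = \<zero>" using sc by simp
   then show "?S d (a + d / a) = \<zero>" using E[OF d0 a] d Sc[of d "a + d / a"] by simp
  qed
  have ex: "(\<Oplus>x\<in>X'. py (f x / c) ** W (f x)) = (\<Oplus>c'\<in>UNIV - {0}. Ph (c', d) ** (\<Oplus>x\<in>X'. py ((1 / c - 1 / c') * f x)))"
   if "finite X'" for X' :: "'x set" and f
  proof -
   have "(\<Oplus>x\<in>X'. py (f x / c) ** W (f x)) = (\<Oplus>x\<in>X'. \<Oplus>c'\<in>UNIV - {0}. Ph (c', d) ** py ((1 / c - 1 / c') * f x))"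
   proof (rule fsc)
    fix x
    have "py (f x / c) ** W (f x) = (\<Oplus>c'\<in>UNIV - {0}. py (f x / c) ** (Ph (c', d) ** py (- f x / c')))"
     unfolding W_def by (rule fsr[symmetric]) (use P in auto)
    also have "... = (\<Oplus>c'\<in>UNIV - {0}. Ph (c', d) ** py ((1 / c - 1 / c') * f x))"
    proof (rule fsc)
     fix c'
     have "py ((1 / c - 1 / c') * f x) = py (f x / c) ** py (- f x / c')"
      unfolding psi_add[symmetric] by (simp add: algebra_simps)
     then show "py (f x / c) ** (Ph (c', d) ** py (- f x / c')) = Ph (c', d) ** py ((1 / c - 1 / c') * f x)"
      using P by (simp add: m_lcomm)
    qed (use P in auto)
    finally show "py (f x / c) ** W (f x) = (\<Oplus>c'\<in>UNIV - {0}. Ph (c', d) ** py ((1 / c - 1 / c') * f x))" .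
   qed (use P in auto)
   also have "... = (\<Oplus>c'\<in>UNIV - {0}. \<Oplus>x\<in>X'. Ph (c', d) ** py ((1 / c - 1 / c') * f x))"
    by (rule fs_swap) (use P that in auto)
   also have "... = (\<Oplus>c'\<in>UNIV - {0}. Ph (c', d) ** (\<Oplus>x\<in>X'. py ((1 / c - 1 / c') * f x)))"
    by (rule fsc) (use P in \<open>auto simp: fsr\<close>)
   finally show ?thesis .
  qed
  let ?K = "%z. (\<Oplus>t\<in>{t. Nm t = d}. py (z * Tr t))" and ?L = "%z. (\<Oplus>a\<in>UNIV - {0}. py (z * (a + d / a)))"
  have "(\<Oplus>t\<in>{t. Nm t = d}. py (Tr t / c) ** W (Tr t)) = \<zero>" by (rule fs_zero) (use WT in auto)
  moreover have "(\<Oplus>a\<in>UNIV - {0}. py ((a + d / a) / c) ** W (a + d / a)) = \<zero>" by (rule fs_zero) (use WS in auto)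
  \<comment> \<open>Inverting the transform over both tori together: by \<open>kloosterman\<close>
    the kernels cancel unless c' = c, where they add up to (q + 1) + (q - 1) = 2q.\<close>
  ultimately have "\<zero> = (\<Oplus>c'\<in>UNIV - {0}. Ph (c', d) ** ?K (1 / c - 1 / c')) \<oplus> (\<Oplus>c'\<in>UNIV - {0}. Ph (c', d) ** ?L (1 / c - 1 / c'))"
   by (subst (asm) (1 2) ex) auto
  also have "... = (\<Oplus>c'\<in>UNIV - {0}. Ph (c', d) ** ?K (1 / c - 1 / c') \<oplus> Ph (c', d) ** ?L (1 / c - 1 / c'))"
   by (rule fs_add[symmetric]) (use P in auto)
  also have "... = (\<Oplus>c'\<in>UNIV - {0}. if c' = c then Ph (c, d) ** ((\<one> \<oplus> \<one>) ** qq) else \<zero>)"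
  proof (rule fsc)
   fix c' :: 'k assume c': "c' : UNIV - {0}"
   show "Ph (c', d) ** ?K (1 / c - 1 / c') \<oplus> Ph (c', d) ** ?L (1 / c - 1 / c')
    = (if c' = c then Ph (c, d) ** ((\<one> \<oplus> \<one>) ** qq) else \<zero>)"
   proof (cases "c' = c")
    case True
    have "(\<Oplus>t\<in>{t. Nm t = d}. \<one>) = qq \<oplus> \<one>" by (simp add: fs_const card_Nm_fiber[OF d0] qq_def a_comm)
    moreover have "(\<Oplus>a\<in>UNIV - {0::'k}. \<one>) = qq \<ominus> \<one>" using psi_sum_nz[of 0] by simp
    moreover have "(qq \<oplus> \<one>) \<oplus> (qq \<ominus> \<one>) = (qq \<oplus> qq) \<oplus> (\<one> \<ominus> \<one>)"
     by (simp add: a_minus_def a_ac del: r_neg l_neg)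
    then have "(qq \<oplus> \<one>) \<oplus> (qq \<ominus> \<one>) = (\<one> \<oplus> \<one>) ** qq" by (simp add: a_minus_def r_neg l_distr)
    ultimately show ?thesis using True P by (simp add: r_distr[symmetric])
   next
    case ne: False
    then have "1 / c - 1 / c' ~= 0" using c' False by (simp add: field_simps)
    then have "?K (1 / c - 1 / c') = \<ominus> ?L (1 / c - 1 / c')" by (rule kloosterman[OF _ d0])
    then show ?thesis using ne P by (simp add: r_minus l_neg)
   qed
  qed (use P in auto)
  also have "... = Ph (c, d) ** ((\<one> \<oplus> \<one>) ** qq)" by (subst fs_only[of _ c]) (use False P in auto)
  finally show ?thesis using integral[of "Ph (c, d)" "(\<one> \<oplus> \<one>) ** qq"] integral[of "\<one> \<oplus> \<one>" qq] qq_nonzero two P bb by auto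
 qed
qed

context theta
begin

text \<open>A character of the quadratic extension which factors through the norm gives the same
 eigenvalues as a principal series, by the Kloosterman sum identity.\<close>

lemma J_norm_char:
 assumes x: "!!t. t ~= 0 ==> te t = cx (Nm t)" and cx: "!!t. cx t : carrier R" and c: "c ~= 0" and d: "d ~= 0"
 shows "J c d = qi ** (\<Oplus>t\<in>UNIV - {0}. cx d ** py (- (t + d / t) / c))"
proof -
 have "(\<Oplus>t\<in>{t. Nm t = d}. py (- Tr t / c) ** te t) = (\<Oplus>t\<in>{t. Nm t = d}. py (- 1 / c * Tr t) ** cx d)"
  by (rule fsc) (use x cx d in auto)
 also have "... = (\<Oplus>t\<in>{t. Nm t = d}. py (- 1 / c * Tr t)) ** cx d" by (rule fsl) (use cx in auto)
 also have "(\<Oplus>t\<in>{t. Nm t = d}. py (- 1 / c * Tr t)) = \<ominus> (\<Oplus>a\<in>UNIV - {0}. py (- 1 / c * (a + d / a)))"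
  by (rule kloosterman) (use c d in auto)
 also have "(\<Oplus>a\<in>UNIV - {0}. py (- 1 / c * (a + d / a))) = (\<Oplus>a\<in>UNIV - {0}. py (- (a + d / a) / c))"
  by (rule fsc) (auto simp: field_simps)
 finally have "J c d = qi ** (cx d ** (\<Oplus>a\<in>UNIV - {0}. py (- (a + d / a) / c)))"
  unfolding J_def using cx by (simp add: l_minus r_minus m_comm)
 also have "cx d ** (\<Oplus>a\<in>UNIV - {0}. py (- (a + d / a) / c)) = (\<Oplus>t\<in>UNIV - {0}. cx d ** py (- (t + d / t) / c))"
  by (rule fsr[symmetric]) (use cx in auto)
 finally show ?thesis .
qed

lemma th_regular:
 assumes u: "Nm u = 1" "te u ~= \<one>" shows "(\<Oplus>t\<in>{t. Nm t = 1}. te t) = \<zero>"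
proof -
 have u0: "u ~= 0" using u by auto
 have "(\<Oplus>t\<in>{t. Nm t = 1}. te t) = (\<Oplus>t\<in>{t. Nm t = 1}. te u ** te t)"
 proof (rule fsw[of _ "%t. u * t" "%t. t / u"])
  fix t :: "'k q2" assume t: "t : {t. Nm t = 1}"
  then have "t ~= 0" by auto
  then show "te t = te u ** te (t / u)" using u0 by (simp add: th_mult[symmetric])
 qed (use u u0 in \<open>auto simp: Nm_divide\<close>)
 then have "(te u \<ominus> \<one>) ** (\<Oplus>t\<in>{t. Nm t = 1}. te t) = \<zero>"
  by (subst (asm) fsr) (auto simp: a_minus_def l_distr l_minus r_neg)
 then show ?thesis using integral[of "te u \<ominus> \<one>"] dze[of "te u" \<one>] u by auto
qed

text \<open>If the Hecke eigenvalues vanish on a nonsquare \<open>Nm g\<close>, Fourier inversion gives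
 \<open>te g + te (cnj2 g) = 0\<close>.\<close>

lemma J_vanish_conj:
 assumes reg: "(\<Oplus>t\<in>{t. Nm t = 1}. te t) = \<zero>" and g: "Nm g ~= 0"
  and J0: "!!c. c ~= 0 ==> J c (Nm g) = \<zero>"
 shows "te g \<oplus> te (cnj2 g) = \<zero> \<or> (cnj2 g = g & te g = \<zero>)"
proof -
 let ?T = "{t. Nm t = Nm g}"
 have 0: "(\<Oplus>t\<in>?T. py (z * Tr t) ** te t) = \<zero>" for z
 proof (cases "z = 0")
  case True
  then show ?thesis using th_sum_norm[OF reg g] by simp
 next
  case False
  have "\<zero> = \<ominus> qi ** (\<Oplus>t\<in>?T. py (- Tr t / (- 1 / z)) ** te t)"
   using J0[of "- 1 / z"] False by (simp add: J_def)
  also have "(\<Oplus>t\<in>?T. py (- Tr t / (- 1 / z)) ** te t) = (\<Oplus>t\<in>?T. py (z * Tr t) ** te t)"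
   by (rule fsc) (use False in \<open>auto simp: mult.commute\<close>)
  finally have "qi ** (\<Oplus>t\<in>?T. py (z * Tr t) ** te t) = \<zero>"
   using add.inv_eq_1_iff[of "qi ** (\<Oplus>t\<in>?T. py (z * Tr t) ** te t)"] by (simp add: l_minus)
  then show ?thesis using qq_nonzero integral[of qi "\<Oplus>t\<in>?T. py (z * Tr t) ** te t"] by auto
 qed
 have "\<zero> = (\<Oplus>z\<in>UNIV. py (- (z * Tr g)) ** (\<Oplus>t\<in>?T. py (z * Tr t) ** te t))" unfolding 0 by (simp add: fs_zero)
 also have "... = (\<Oplus>z\<in>UNIV. \<Oplus>t\<in>?T. py (z * (Tr t - Tr g)) ** te t)"
 proof (rule fsc)
  fix z
  have "py (- (z * Tr g)) ** (\<Oplus>t\<in>?T. py (z * Tr t) ** te t) = (\<Oplus>t\<in>?T. py (- (z * Tr g)) ** (py (z * Tr t) ** te t))"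
   by (rule fsr[symmetric]) auto
  also have "... = (\<Oplus>t\<in>?T. py (z * (Tr t - Tr g)) ** te t)"
   by (rule fsc) (auto simp: m_assoc[symmetric] psi_add[symmetric] algebra_simps)
  finally show "py (- (z * Tr g)) ** (\<Oplus>t\<in>?T. py (z * Tr t) ** te t) = (\<Oplus>t\<in>?T. py (z * (Tr t - Tr g)) ** te t)" .
 qed auto
 also have "... = (\<Oplus>t\<in>?T. \<Oplus>z\<in>UNIV. py (z * (Tr t - Tr g)) ** te t)" by (rule fs_swap) auto
 also have "... = (\<Oplus>t\<in>?T. if Tr t = Tr g then qq ** te t else \<zero>)"
  by (rule fsc) (auto simp: fsl psi_sum_eq')
 also have "... = (\<Oplus>t\<in>{g, cnj2 g}. qq ** te t)"
 proof (rule trans[OF fs_restrict])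
  have "Tr (cnj2 g) = Tr g" by (rule emb_simps(7)[THEN iffD1]) (simp add: emb_Tr add.commute)
  then have "{t : ?T. Tr t = Tr g} = {g, cnj2 g}" using quadratic_root2 by auto
  then show "(\<Oplus>t\<in>{t : ?T. Tr t = Tr g}. qq ** te t) = (\<Oplus>t\<in>{g, cnj2 g}. qq ** te t)" by simp
 qed auto
 also have "... = qq ** (\<Oplus>t\<in>{g, cnj2 g}. te t)" by (rule fsr) auto
 finally have "(\<Oplus>t\<in>{g, cnj2 g}. te t) = \<zero>"
  using integral[of qq "\<Oplus>t\<in>{g, cnj2 g}. te t"] qq_nonzero by auto
 moreover have "(\<Oplus>t\<in>{g, cnj2 g}. te t) = (if cnj2 g = g then te g else te g \<oplus> te (cnj2 g))"
 proof (cases "cnj2 g = g")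
  case True
  then show ?thesis by (simp add: fs_only[of _ g])
 next
  case False
  then have "(\<Oplus>t\<in>insert g {cnj2 g}. te t) = te g \<oplus> (\<Oplus>t\<in>{cnj2 g}. te t)" by (intro fsi) auto
  then show ?thesis using False by (simp add: fs_only[of _ "cnj2 g"])
 qed
 ultimately show ?thesis by (auto split: if_splits)
qed

end

section \<open>Existence of eigenvectors over the residue field\<close>

text \<open>The cuspidal eigenvalue formula for an arbitrary character, regular or not.\<close>

definition lamT :: "('a,'r) ring_scheme => ('k::{finite,field} => 'a) => 'a => ('k q2 => 'a) => 'k \<times> 'k => 'a" where
 "lamT R py qi te b = (if fst b = 0 then te (emb (snd b)) else theta.J R py qi te (fst b) (snd b))"

lemma (in abelian_monoid) BD_sum:
 fixes D :: "'k::{finite,field} set"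
 assumes D: "subgrp D" and f: "!!b. f b : carrier G"
 shows "finsum G f (BD D) = (\<Oplus>z\<in>{z. z * z : D}. f (0, z)) \<oplus> (\<Oplus>d\<in>D. \<Oplus>c\<in>UNIV - {0}. f (c, d))"
proof -
 let ?Z = "{z. z * z : D}" and ?P = "(UNIV - {0::'k}) \<times> D"
 have e: "BD D = Pair 0 ` ?Z \<union> ?P" by (auto simp: BD_def)
 have "finsum G f (Pair 0 ` ?Z) = (\<Oplus>z\<in>?Z. f (0, z))"
  by (rule fs_reindex) (use f in \<open>auto simp: bij_betw_def inj_on_def\<close>)
 moreover have "finsum G f ?P = (\<Oplus>d\<in>D. finsum G f {p : ?P. snd p = d})"
  by (rule fs_group) (use f in auto)
 moreover have "(\<Oplus>d\<in>D. finsum G f {p : ?P. snd p = d}) = (\<Oplus>d\<in>D. \<Oplus>c\<in>UNIV - {0}. f (c, d))"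
 proof (rule fsc)
  fix d assume "d : D"
  then show "finsum G f {p : ?P. snd p = d} = (\<Oplus>c\<in>UNIV - {0}. f (c, d))"
   by (intro fsw[of _ "%c. (c, d)" fst]) (use f in auto)
 qed (use f in auto)
 moreover have "finsum G f (BD D) = finsum G f (Pair 0 ` ?Z) \<oplus> finsum G f ?P"
  unfolding e by (rule fs_Un) (use f in auto)
 ultimately show ?thesis by simp
qed

context theta
begin

lemma lamT_closed [simp, intro]: "lamT R py qi te b : carrier R" by (simp add: lamT_def)

text \<open>Collects a linear combination of eigenvalues by values of \<open>te\<close>, so that
  Fourier inversion over all characters can be applied to the coefficients; \<open>lamP_sum\<close>
  does the same for pairs of characters.\<close>

lemma lamT_sum:
 fixes D :: "'k set"
 assumes D: "subgrp D" and P: "!!b. Ph b : carrier R"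
 shows "(\<Oplus>b\<in>BD D. Ph b ** lamT R py qi te b) = (\<Oplus>t\<in>UNIV - {0}. ((\<Oplus>z\<in>{z. z ~= 0 & z * z : D & emb z = t}. Ph (0, z))
    \<ominus> (if Nm t : D then qi ** (\<Oplus>c\<in>UNIV - {0}. Ph (c, Nm t) ** py (- Tr t / c)) else \<zero>)) ** te t)"
  (is "?l = (\<Oplus>t\<in>?T. (?A t \<ominus> ?B t) ** te t)")
proof -
 have D0: "0 \<notin> D" using D by (simp add: subgrp_def)
 have AB: "?A t : carrier R" "?B t : carrier R" for t using P by auto
 have 1: "(\<Oplus>z\<in>{z. z * z : D}. Ph (0, z) ** te (emb z)) = (\<Oplus>t\<in>?T. ?A t ** te t)"
 proof -
  have "(\<Oplus>z\<in>{z. z * z : D}. Ph (0, z) ** te (emb z)) = (\<Oplus>t\<in>?T. \<Oplus>z\<in>{z : {z. z * z : D}. emb z = t}. Ph (0, z) ** te (emb z))"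
   by (rule fs_group) (use P D0 in auto)
  also have "... = (\<Oplus>t\<in>?T. ?A t ** te t)"
  proof (rule fsc)
   fix t
   have s: "{z : {z. z * z : D}. emb z = t} = {z. z ~= 0 & z * z : D & emb z = t}" using D0 by auto
   have "(\<Oplus>z\<in>{z. z ~= 0 & z * z : D & emb z = t}. Ph (0, z) ** te (emb z))
    = (\<Oplus>z\<in>{z. z ~= 0 & z * z : D & emb z = t}. Ph (0, z) ** te t)" by (rule fsc) (use P in auto)
   then show "(\<Oplus>z\<in>{z : {z. z * z : D}. emb z = t}. Ph (0, z) ** te (emb z)) = ?A t ** te t"
    unfolding s using P by (simp add: fsl)
  qed (use AB in auto)
  finally show ?thesis .
 qed
 have 2: "(\<Oplus>c\<in>UNIV - {0}. Ph (c, d) ** J c d) = (\<Oplus>t\<in>{t. Nm t = d}. (\<ominus> ?B t) ** te t)" if d: "d : D" for d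
 proof -
  let ?e = "%c t. Ph (c, d) ** py (- Tr t / c)"
  have "(\<Oplus>c\<in>UNIV - {0}. Ph (c, d) ** J c d) = (\<Oplus>c\<in>UNIV - {0}. \<Oplus>t\<in>{t. Nm t = d}. (\<ominus> qi ** te t) ** ?e c t)"
  proof (rule fsc)
   fix c
   have "(\<Oplus>t\<in>{t. Nm t = d}. (\<ominus> qi ** te t) ** ?e c t) = (\<Oplus>t\<in>{t. Nm t = d}. (Ph (c, d) ** \<ominus> qi) ** (py (- Tr t / c) ** te t))"
    by (rule fsc) (use P in \<open>auto simp: m_ac\<close>)
   also have "... = Ph (c, d) ** J c d" unfolding J_def using P by (subst fsr) (auto simp: m_assoc)
   finally show "Ph (c, d) ** J c d = (\<Oplus>t\<in>{t. Nm t = d}. (\<ominus> qi ** te t) ** ?e c t)" by simp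
  qed (use P in auto)
  also have "... = (\<Oplus>t\<in>{t. Nm t = d}. \<Oplus>c\<in>UNIV - {0}. (\<ominus> qi ** te t) ** ?e c t)" by (rule fs_swap) (use P in auto)
  also have "... = (\<Oplus>t\<in>{t. Nm t = d}. (\<ominus> ?B t) ** te t)"
  proof (rule fsc)
   fix t assume "t : {t. Nm t = d}"
   then have "Nm t = d" by simp
   moreover have "(\<Oplus>c\<in>UNIV - {0}. (\<ominus> qi ** te t) ** ?e c t) = (\<ominus> qi ** te t) ** (\<Oplus>c\<in>UNIV - {0}. ?e c t)"
    by (rule fsr) (use P in auto)
   moreover have "(\<Oplus>c\<in>UNIV - {0}. ?e c t) : carrier R" using P by auto
   ultimately show "(\<Oplus>c\<in>UNIV - {0}. (\<ominus> qi ** te t) ** ?e c t) = (\<ominus> ?B t) ** te t"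
    using d by (simp add: l_minus r_minus m_ac)
  qed (use P in auto)
  finally show ?thesis .
 qed
 have "(\<Oplus>d\<in>D. \<Oplus>c\<in>UNIV - {0}. Ph (c, d) ** J c d) = (\<Oplus>d\<in>D. \<Oplus>t\<in>{t : {t. Nm t : D}. Nm t = d}. (\<ominus> ?B t) ** te t)"
 proof (rule fsc)
  fix d assume d: "d : D"
  then have "{t : {t. Nm t : D}. Nm t = d} = {t. Nm t = d}" by auto
  then show "(\<Oplus>c\<in>UNIV - {0}. Ph (c, d) ** J c d) = (\<Oplus>t\<in>{t : {t. Nm t : D}. Nm t = d}. (\<ominus> ?B t) ** te t)"
   using 2[OF d] by simp
 qed (use AB in auto)
 also have "... = (\<Oplus>t\<in>{t. Nm t : D}. (\<ominus> ?B t) ** te t)" by (rule fs_group[symmetric]) (use P in auto)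
 also have "... = (\<Oplus>t\<in>?T. (\<ominus> ?B t) ** te t)" by (rule fs_mono[symmetric]) (use AB D0 P in auto)
 finally have 3: "(\<Oplus>d\<in>D. \<Oplus>c\<in>UNIV - {0}. Ph (c, d) ** J c d) = (\<Oplus>t\<in>?T. (\<ominus> ?B t) ** te t)" .
 have "?l = (\<Oplus>z\<in>{z. z * z : D}. Ph (0, z) ** lamT R py qi te (0, z)) \<oplus> (\<Oplus>d\<in>D. \<Oplus>c\<in>UNIV - {0}. Ph (c, d) ** lamT R py qi te (c, d))"
  by (rule BD_sum[OF D]) (use P in auto)
 also have "(\<Oplus>z\<in>{z. z * z : D}. Ph (0, z) ** lamT R py qi te (0, z)) = (\<Oplus>t\<in>?T. ?A t ** te t)" using 1 by (simp add: lamT_def)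
 also have "(\<Oplus>d\<in>D. \<Oplus>c\<in>UNIV - {0}. Ph (c, d) ** lamT R py qi te (c, d)) = (\<Oplus>d\<in>D. \<Oplus>c\<in>UNIV - {0}. Ph (c, d) ** J c d)"
  by (intro fsc) (use P in \<open>auto simp: lamT_def\<close>)
 also have "(\<Oplus>t\<in>?T. ?A t ** te t) \<oplus> ... = (\<Oplus>t\<in>?T. ?A t ** te t \<oplus> (\<ominus> ?B t) ** te t)"
  unfolding 3 by (rule fs_add[symmetric]) (use AB in auto)
 also have "... = (\<Oplus>t\<in>?T. (?A t \<ominus> ?B t) ** te t)"
  by (rule fsc) (use AB in \<open>auto simp only: a_minus_def l_distr th_closed a_inv_closed intro!: m_closed a_closed\<close>)
 finally show ?thesis .
qed

end

context psr
begin

lemma lamP_closed [simp, intro]: "lamP b : carrier R" by (simp add: lamP_def)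

lemma lamP_sum:
 fixes D :: "'k set"
 assumes D: "subgrp D" and P: "!!b. Ph b : carrier R"
 shows "(\<Oplus>b\<in>BD D. Ph b ** lamP b) = (\<Oplus>d\<in>KX. (\<Oplus>t\<in>KX. ((if t * t : D & d = t * t then Ph (0, t) else \<zero>)
    \<oplus> (if d : D then qi ** (\<Oplus>c\<in>KX. Ph (c, d) ** py (- (t + d / t) / c)) else \<zero>)) ** nu t) ** cx d)"
  (is "_ = (\<Oplus>d\<in>KX. (\<Oplus>t\<in>KX. (?A d t \<oplus> ?B d t) ** nu t) ** cx d)")
proof -
 have D0: "0 \<notin> D" using D by (simp add: subgrp_def)
 have AB: "?A d t : carrier R" "?B d t : carrier R" for d t using P by auto
 have "(\<Oplus>d\<in>KX. (\<Oplus>t\<in>KX. (?A d t \<oplus> ?B d t) ** nu t) ** cx d)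
  = (\<Oplus>d\<in>KX. (\<Oplus>t\<in>KX. ?A d t ** nu t ** cx d) \<oplus> (\<Oplus>t\<in>KX. ?B d t ** nu t ** cx d))"
 proof (rule fsc)
  fix d
  have "(\<Oplus>t\<in>KX. (?A d t \<oplus> ?B d t) ** nu t) ** cx d = (\<Oplus>t\<in>KX. (?A d t \<oplus> ?B d t) ** nu t ** cx d)"
   by (rule fsl[symmetric]) (use AB in \<open>auto simp only: intro!: m_closed a_closed nu_closed ch_closed\<close>)
  also have "... = (\<Oplus>t\<in>KX. ?A d t ** nu t ** cx d \<oplus> ?B d t ** nu t ** cx d)"
   by (rule fsc) (use AB in \<open>auto simp only: l_distr nu_closed ch_closed m_closed intro!: m_closed a_closed\<close>)
  also have "... = (\<Oplus>t\<in>KX. ?A d t ** nu t ** cx d) \<oplus> (\<Oplus>t\<in>KX. ?B d t ** nu t ** cx d)"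
   by (rule fs_add) (use AB in \<open>auto simp only: intro!: m_closed nu_closed ch_closed\<close>)
  finally show "(\<Oplus>t\<in>KX. (?A d t \<oplus> ?B d t) ** nu t) ** cx d = (\<Oplus>t\<in>KX. ?A d t ** nu t ** cx d) \<oplus> (\<Oplus>t\<in>KX. ?B d t ** nu t ** cx d)" .
 qed (use AB in \<open>auto simp only: intro!: m_closed a_closed nu_closed ch_closed fs_closed\<close>)
 also have "... = (\<Oplus>d\<in>KX. \<Oplus>t\<in>KX. ?A d t ** nu t ** cx d) \<oplus> (\<Oplus>d\<in>KX. \<Oplus>t\<in>KX. ?B d t ** nu t ** cx d)"
  by (rule fs_add) (use AB in \<open>auto simp only: intro!: m_closed nu_closed ch_closed fs_closed\<close>)
 also have "(\<Oplus>d\<in>KX. \<Oplus>t\<in>KX. ?A d t ** nu t ** cx d) = (\<Oplus>t\<in>KX. \<Oplus>d\<in>KX. ?A d t ** nu t ** cx d)"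
  by (rule fs_swap) (use P in auto)
 also have "... = (\<Oplus>t\<in>KX. if t * t : D then Ph (0, t) ** lamP (0, t) else \<zero>)"
  by (rule fsc, subst fs_only[of _ "t * t" for t]) (use P in \<open>auto simp: lamP_def m_ac\<close>)
 also have "... = (\<Oplus>z\<in>{z : KX. z * z : D}. Ph (0, z) ** lamP (0, z))" by (rule fs_restrict) (use P in auto)
 also have "{z : KX. z * z : D} = {z. z * z : D}" using D0 by auto
 also have "(\<Oplus>d\<in>KX. \<Oplus>t\<in>KX. ?B d t ** nu t ** cx d) = (\<Oplus>d\<in>D. \<Oplus>t\<in>KX. ?B d t ** nu t ** cx d)"
  by (rule fs_mono) (use P D0 in \<open>auto intro!: fs_zero\<close>)
 also have "... = (\<Oplus>d\<in>D. \<Oplus>c\<in>KX. Ph (c, d) ** lamP (c, d))"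
 proof (rule fsc)
  fix d assume d: "d : D"
  let ?e = "%c t. Ph (c, d) ** py (- (t + d / t) / c)"
  have "(\<Oplus>t\<in>KX. ?B d t ** nu t ** cx d) = (\<Oplus>t\<in>KX. \<Oplus>c\<in>KX. (qi ** nu t ** cx d) ** ?e c t)"
  proof (rule fsc)
   fix t
   have "(\<Oplus>c\<in>KX. (qi ** nu t ** cx d) ** ?e c t) = (qi ** nu t ** cx d) ** (\<Oplus>c\<in>KX. ?e c t)"
    by (rule fsr) (use P in auto)
   moreover have "(\<Oplus>c\<in>KX. ?e c t) : carrier R" using P by auto
   ultimately show "?B d t ** nu t ** cx d = (\<Oplus>c\<in>KX. (qi ** nu t ** cx d) ** ?e c t)" using d by (simp add: m_ac)
  qed (use P in auto)
  also have "... = (\<Oplus>c\<in>KX. \<Oplus>t\<in>KX. (qi ** nu t ** cx d) ** ?e c t)" by (rule fs_swap) (use P in auto)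
  also have "... = (\<Oplus>c\<in>KX. Ph (c, d) ** lamP (c, d))"
  proof (rule fsc)
   fix c assume c: "c : KX"
   have "(\<Oplus>t\<in>KX. (qi ** nu t ** cx d) ** ?e c t) = (\<Oplus>t\<in>KX. (Ph (c, d) ** qi) ** (cx d ** nu t ** py (- (t + d / t) / c)))"
    by (rule fsc) (use P in \<open>auto simp: m_ac\<close>)
   also have "... = Ph (c, d) ** lamP (c, d)" using c P by (subst fsr) (auto simp: lamP_def m_assoc)
   finally show "(\<Oplus>t\<in>KX. (qi ** nu t ** cx d) ** ?e c t) = Ph (c, d) ** lamP (c, d)" .
  qed (use P in auto)
  finally show "(\<Oplus>t\<in>KX. ?B d t ** nu t ** cx d) = (\<Oplus>c\<in>KX. Ph (c, d) ** lamP (c, d))" .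
 qed (use P in auto)
 also have "(\<Oplus>z\<in>{z. z * z : D}. Ph (0, z) ** lamP (0, z)) \<oplus> ... = (\<Oplus>b\<in>BD D. Ph b ** lamP b)"
  by (rule BD_sum[OF D, symmetric]) (use P in auto)
 finally show ?thesis by simp
qed

end

context achar
begin

lemma chr_theta:
 assumes "isgen (g :: 'k q2)" "z : carrier R" "z [^] (CARD('k) * CARD('k) - 1) = \<one>"
 shows "theta R py qi (chr g z)"
proof -
 note a = assms(1,2) assms(3)[folded card_q2]
 show ?thesis by unfold_locales (use chr_closed[OF a] chr_mult[OF a] chr_1[OF a] in auto)
qed

lemma chr_psr:
 assumes "isgen (g :: 'k)" "c : carrier R" "c [^] (CARD('k) - 1) = \<one>" "n : carrier R" "n [^] (CARD('k) - 1) = \<one>"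
 shows "psr R py qi (chr g c) (chr g n)"
proof -
 note a = assms(1,2,3) and b = assms(1,4,5)
 show ?thesis
  by unfold_locales (use chr_closed[OF a] chr_mult[OF a] chr_1[OF a] chr_closed[OF b] chr_mult[OF b] chr_1[OF b] in auto)
qed

lemma chr_norm:
 assumes g: "isgen (g :: 'k q2)" and z: "z : carrier R" "z [^] (CARD('k) - 1) = \<one>" and t: "t ~= 0"
 shows "chr g z t = chr (Nm g) z (Nm t)"
proof -
 have "chr (Nm g) z (Nm g ^ dlg g t) = z [^] dlg g t" by (rule chr_pow[OF isgen_Nm[OF g] z])
 then show ?thesis using dlg(1)[OF g t] by (simp add: chr_def[of g] Nm_power[symmetric])
qed

lemma lamT_lamP:
 assumes g: "isgen (g :: 'k q2)" and z: "z : carrier R" "z [^] (CARD('k) - 1) = \<one>" and b: "b : BD D" and D: "subgrp D"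
 shows "lamT R py qi (chr g z) b = psr.lamP R py qi (chr (Nm g) z) (chr (Nm g) \<one>) b"
proof -
 have zM: "z [^] (CARD('k) * CARD('k) - 1) = \<one>"
 proof -
  have "CARD('k) * CARD('k) - 1 = (CARD('k) - 1) * (CARD('k) + 1)" by (simp add: algebra_simps)
  then show ?thesis using z nat_pow_pow[OF z(1), of "CARD('k) - 1" "CARD('k) + 1"] by simp
 qed
 interpret T: theta R py qi "chr g z" by (rule chr_theta[OF g z(1) zM])
 interpret P: psr R py qi "chr (Nm g) z" "chr (Nm g) \<one>" by (rule chr_psr[OF isgen_Nm[OF g] z]) auto
 obtain c d where bb: "b = (c, d)" by force
 have d0: "d ~= 0" using b D bb by (auto simp: BD_def subgrp_def split: if_splits)
 have o: "chr (Nm g) \<one> t = \<one>" for t by (simp add: chr_def)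
 show ?thesis
 proof (cases "c = 0")
  case True
  then show ?thesis using d0 chr_norm[OF g z, of "emb d"] by (simp add: lamT_def P.lamP_def bb o)
 next
  case False
  then show ?thesis using T.J_norm_char[of "chr (Nm g) z" c d] chr_norm[OF g z] d0 by (simp add: lamT_def P.lamP_def bb o)
 qed
qed

lemma hecke_P:
 assumes "psr R py qi cx nu" and D: "subgrp (D :: 'k set)" and b: "b : BD D" "b' : BD D"
 shows "psr.lamP R py qi cx nu b ** psr.lamP R py qi cx nu b' = (\<Oplus>s\<in>UNIV. stc b b' s ** psr.lamP R py qi cx nu (nxt b b' s))"
proof -
 interpret P: psr R py qi cx nu by fact
 interpret G: grep R py qi P.MP D P.actP by (rule P.grepP[OF D])
 show ?thesis by (rule G.hev_mult(1)[OF P.hevP[OF D] b])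
qed

text \<open>The element g^(q-1) has norm 1, and the character takes the value z^(q-1) there, which
  is not 1.\<close>

lemma chr_regular:
 assumes g: "isgen (g :: 'k q2)" and z: "z : carrier R" "z [^] (CARD('k) * CARD('k) - 1) = \<one>" "z [^] (CARD('k) - 1) ~= \<one>"
 shows "cusp R py qi (chr g z)"
proof -
 interpret T: theta R py qi "chr g z" by (rule chr_theta[OF g z(1,2)])
 have "Nm (g ^ (CARD('k) - 1)) = 1"
  unfolding Nm_power by (rule ffp) (use isgen_Nm[OF g] in \<open>simp add: isgen_def\<close>)
 moreover have "chr g z (g ^ (CARD('k) - 1)) = z [^] (CARD('k) - 1)" by (rule chr_pow[OF g z(1)]) (use z(2) in \<open>simp only: card_q2\<close>)
 ultimately show ?thesis using T.th_regular z(3) by unfold_locales simp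
qed

lemma lamT_lamC: "cusp R py qi te ==> lamT R py qi te = cusp.lamC R py qi te"
 by (rule ext) (simp add: lamT_def cusp.lamC_def)

text \<open>A regular character has a cuspidal model. Any other one factors through the norm, and
  then its values coincide with those of a principal series.\<close>

lemma hecke_T:
 assumes g: "isgen (g :: 'k q2)" and z: "z : carrier R" "z [^] (CARD('k) * CARD('k) - 1) = \<one>"
  and D: "subgrp (D :: 'k set)" and b: "b : BD D" "b' : BD D"
 shows "lamT R py qi (chr g z) b ** lamT R py qi (chr g z) b' = (\<Oplus>s\<in>UNIV. stc b b' s ** lamT R py qi (chr g z) (nxt b b' s))"
proof (cases "z [^] (CARD('k) - 1) = \<one>")
 case True
 note e = lamT_lamP[OF g z(1) True _ D]
 have p: "psr R py qi (chr (Nm g) z) (chr (Nm g) \<one>)" by (rule chr_psr[OF isgen_Nm[OF g] z(1) True]) auto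
 then interpret P: psr R py qi "chr (Nm g) z" "chr (Nm g) \<one>" .
 have "(\<Oplus>s\<in>UNIV. stc b b' s ** lamT R py qi (chr g z) (nxt b b' s)) = (\<Oplus>s\<in>UNIV. stc b b' s ** P.lamP (nxt b b' s))"
  by (rule fsc) (use e[OF nxt_BD[OF D b]] in auto)
 then show ?thesis unfolding e[OF b(1)] e[OF b(2)] using hecke_P[OF p D b] by simp
next
 case False
 have c: "cusp R py qi (chr g z)" by (rule chr_regular[OF g z False])
 interpret C: cusp R py qi "chr g z" by (rule c)
 interpret G: grep R py qi "fmod R C.KX" D C.actC by (rule C.grepC[OF D])
 show ?thesis unfolding lamT_lamC[OF c] by (rule G.hev_mult(1)[OF C.hevC[OF D] b])
qed

lemma separate:
 fixes Ph :: "'k \<times> 'k => 'a" and D :: "'k set"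
 defines "q \<equiv> CARD('k)"
 assumes D: "subgrp D" and n0: "!!n. n > 0 ==> add_pow R (n::nat) \<one> ~= \<zero>" and P: "!!b. Ph b : carrier R"
  and g: "isgen (g :: 'k q2)" and w: "w : carrier R" "!!j::nat. w [^] j = \<one> \<longleftrightarrow> q * q - 1 dvd j"
  and C: "!!i::nat. i < q * q - 1 ==> (\<Oplus>b\<in>BD D. Ph b ** lamT R py qi (chr g (w [^] i)) b) = \<zero>"
  and T: "!!i j::nat. i < q - 1 ==> j < q - 1 ==>
   (\<Oplus>b\<in>BD D. Ph b ** psr.lamP R py qi (chr (Nm g) ((w [^] (q + 1)) [^] i)) (chr (Nm g) ((w [^] (q + 1)) [^] j)) b) = \<zero>"
  and b: "b : BD D"
 shows "Ph b = \<zero>"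
proof -
 let ?w = "w [^] (q + 1)" and ?g = "Nm g"
 have q2: "q \<ge> 2" unfolding q_def by (rule cge2)
 have M: "q * q - 1 = (q - 1) * (q + 1)" by (simp add: algebra_simps)
 have wi: "(w [^] (i::nat)) [^] (q * q - 1) = \<one>" for i unfolding nat_pow_pow[OF w(1)] w(2) by simp
 have w': "?w : carrier R" "?w [^] j = \<one> \<longleftrightarrow> CARD('k) - 1 dvd j" for j :: nat
 proof -
  show "?w : carrier R" using w by simp
  have "(q + 1) * (q - 1) dvd (q + 1) * j \<longleftrightarrow> q - 1 dvd j" by (rule nat_mult_dvd_cancel1) simp
  then show "?w [^] j = \<one> \<longleftrightarrow> CARD('k) - 1 dvd j"
   unfolding nat_pow_pow[OF w(1)] w(2) M using q_def by (simp add: mult.commute)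
 qed
 have w'i: "(?w [^] (i::nat)) [^] (CARD('k) - 1) = \<one>" for i unfolding nat_pow_pow[OF w'(1)] w'(2) by simp
 have gN: "isgen ?g" by (rule isgen_Nm[OF g])
 let ?C = "%t. (\<Oplus>z\<in>{z. z ~= 0 & z * z : D & emb z = t}. Ph (0, z))
    \<ominus> (if Nm t : D then qi ** (\<Oplus>c\<in>UNIV - {0}. Ph (c, Nm t) ** py (- Tr t / c)) else \<zero>)"
 let ?E = "%d t. (if t * t : D & d = t * t then Ph (0, t) else \<zero>)
    \<oplus> (if d : D then qi ** (\<Oplus>c\<in>UNIV - {0}. Ph (c, d) ** py (- (t + d / t) / c)) else \<zero>)"
 have Cc: "?C t : carrier R" for t using P by (auto intro!: minus_closed)
 have Ec: "?E d t : carrier R" for d t using P by auto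
 show ?thesis
 proof (rule separate_core[OF D _ P _ _ b])
  show "\<one> \<oplus> \<one> ~= \<zero>" using n0[of 2] by (simp add: numeral_2_eq_2)
  show "?C t = \<zero>" if t: "t ~= 0" for t
  proof (rule chr_separate[OF g w(1) _ _ Cc _ t])
   show "w [^] j = \<one> \<longleftrightarrow> CARD('k q2) - 1 dvd j" for j :: nat unfolding card_q2 using w(2) q_def by simp
   have "q * q - 1 > 0" using mult_le_mono[OF q2 q2] by simp
   then show "add_pow R (CARD('k q2) - 1) \<one> ~= \<zero>" unfolding card_q2 using n0 q_def by simp
   fix i :: nat assume i: "i < CARD('k q2) - 1"
   interpret T: theta R py qi "chr g (w [^] i)" by (rule chr_theta[OF g]) (use w wi q_def in auto)
   show "(\<Oplus>t\<in>UNIV - {0}. ?C t ** chr g (w [^] i) t) = \<zero>"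
    by (rule trans[OF T.lamT_sum[OF D P, symmetric]]) (use C[of i] i in \<open>simp add: card_q2 q_def\<close>)
  qed
  show "?E d t = \<zero>" if d: "d ~= 0" and t: "t ~= 0" for d t
  proof -
   have n1: "add_pow R (CARD('k) - 1) \<one> ~= \<zero>" using n0 q2 q_def by simp
   have cc: "chr ?g (?w [^] (j::nat)) s : carrier R" for j s using w by (simp add: chr_def)
   show ?thesis
   proof (rule chr_separate[OF gN w' n1 Ec _ t])
    fix j :: nat assume j: "j < CARD('k) - 1"
    show "(\<Oplus>t\<in>UNIV - {0}. ?E d t ** chr ?g (?w [^] j) t) = \<zero>"
    proof (rule chr_separate[OF gN w' n1 _ _ d])
     fix i :: nat assume i: "i < CARD('k) - 1"
     interpret P: psr R py qi "chr ?g (?w [^] i)" "chr ?g (?w [^] j)"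
      by (rule chr_psr[OF gN]) (use w'i w'(1) in auto)
     show "(\<Oplus>d\<in>UNIV - {0}. (\<Oplus>t\<in>UNIV - {0}. ?E d t ** chr ?g (?w [^] j) t) ** chr ?g (?w [^] i) d) = \<zero>"
      by (rule trans[OF P.lamP_sum[OF D P, symmetric]]) (use T[of i j] i j in \<open>simp add: q_def\<close>)
    qed (use Ec cc in \<open>auto simp only: intro!: fs_closed m_closed\<close>)
   qed
  qed
 qed
qed

end

section \<open>Reduction of roots of unity and of eigenvalue systems\<close>

context lifting
begin

abbreviation "psF \<equiv> %x. red (py x)"
abbreviation "qiF \<equiv> red qi"

lemma A_pow [simp, intro]: "x : A ==> x [^] (n::nat) : A" by (induction n) auto
lemma red_pow: "x : A ==> red (x [^] (n::nat)) = red x [^]@F n"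
 by (induction n) (auto simp: red_mult)
lemma A_nat: "add_pow L (n::nat) \<one> : A & red (add_pow L n \<one>) = add_pow F n \<one>@F"
 by (induction n) (auto simp: red_add)

lemma achF: "achar F psF qiF"
proof -
 interpret a: achar L py qi by (rule achL)
 show ?thesis
 proof unfold_locales
  show "psF x : carrier F" for x using psi_A by auto
  show "psF (x + y) = psF x **@F psF y" for x y by (simp add: a.psi_add red_mult psi_A)
  show "psF 0 = \<one>@F" by simp
  show "b ~= 0 ==> finsum F (%x. psF (b * x)) UNIV = \<zero>@F" for b
   using a.psi_sum[of b] red_finsum[of UNIV "%x. py (b * x)"] psi_A by simp
  show "qiF : carrier F" using qi_A by auto
  show "add_pow F CARD('k) \<one>@F **@F qiF = \<one>@F"
   using arg_cong[OF a.q_qi, of red] A_nat[of "CARD('k)"] qi_A by (simp add: red_mult)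
 qed
qed

text \<open>Any nontrivial character of U that occurs may be taken as psi.\<close>

lemma rescale: "a ~= 0 ==> lifting L F A red l om (%x. py (a * x)) qi"
proof -
 assume a: "a ~= 0"
 interpret a: achar L py qi by (rule achL)
 have "achar L (%x. py (a * x)) qi"
 proof unfold_locales
  show "b ~= 0 ==> finsum L (%x. py (a * (b * x))) UNIV = \<zero>" for b
   using a.psi_sum[of "a * b"] a by (simp add: mult.assoc)
 qed (auto simp: a.psi_add distrib_left a.q_qi)
 then show ?thesis using lifting_axioms unfolding lifting_def lifting_axioms_def by blast
qed

lemma icastF_dvd: "int l dvd n ==> F.icast n = \<zero>@F"
 using charF F.icast_nat[of l] by (auto simp: F.icast_mult elim!: dvdE)

lemma natF_nonzero: "~ l dvd m ==> add_pow F m \<one>@F ~= \<zero>@F"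
proof
 assume "~ l dvd m" and z: "add_pow F m \<one>@F = \<zero>@F"
 then have "coprime (int m) (int l)" using l_prime prime_imp_coprime coprime_commute by (metis coprime_int_iff)
 then obtain u v where "u * int m + v * int l = 1" using bezout_int[of "int m" "int l"] by auto
 then have "F.icast (u * int m + v * int l) = \<one>@F" by simp
 then show False using z charF by (simp add: F.icast_add F.icast_mult F.icast_nat)
qed

text \<open>In characteristic l the inner binomial coefficients vanish, so y^l = 1 gives (y - 1)^l =
  0 and hence y = 1.\<close>

lemma frobenius_root:
 assumes x: "x : carrier F" "x [^]@F (l ^ k) = \<one>@F" shows "x = \<one>@F"
 using x
proof (induction k arbitrary: x)
 case (Suc k)
 have l1: "l > 1" using l_prime prime_gt_1_nat by blast
 let ?y = "x [^]@F (l ^ k)"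
 define u where "u = ?y \<ominus>@F \<one>@F"
 have y: "?y : carrier F" "?y [^]@F l = \<one>@F" using Suc.prems by (simp_all add: F.nat_pow_pow mult.commute)
 have u: "u : carrier F" "u \<oplus>@F \<one>@F = ?y" using y by (simp_all add: u_def a_minus_def F.a_assoc F.l_neg)
 have "([:0, 1:] + 1 :: int poly) ^ l = (\<Sum>i\<in>{..l}. of_nat (l choose i) * [:0, 1:] ^ i * 1 ^ (l - i))"
  by (rule binomial_ring)
 then have "([:0, 1:] + 1 :: int poly) ^ l = (\<Sum>i\<in>{..l}. Polynomial.smult (int (l choose i)) ([:0, 1:] ^ i))"
  by (simp add: of_nat_poly)
 then have "F.ev u (([:0, 1:] + 1) ^ l) = finsum F (%i. F.icast (int (l choose i)) **@F u [^]@F i) {..l}"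
  using u by (simp add: F.ev_sum F.ev_smult F.ev_power F.ev_X)
 also have "... = finsum F (%i. F.icast (int (l choose i)) **@F u [^]@F i) {0, l}"
 proof (rule F.fs_mono)
  fix i assume "i : {..l} - {0, l}"
  then have "l dvd (l choose i)" using l_prime by (intro dvd_choose_prime) auto
  then show "F.icast (int (l choose i)) **@F u [^]@F i = \<zero>@F" using icastF_dvd u by simp
 qed (use u in auto)
 also have "... = \<one>@F \<oplus>@F u [^]@F l"
  using u l1 by (subst F.fsi) (auto simp: F.fs_only[of _ l])
 finally have "?y [^]@F l = \<one>@F \<oplus>@F u [^]@F l" using u by (simp add: F.ev_power F.ev_add F.ev_X)
 then have "u [^]@F l = \<zero>@F" using y u by (metis F.add.r_cancel_one' F.nat_pow_closed F.one_closed F.a_comm)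
 moreover have "u = \<zero>@F" if "u [^]@F n = \<zero>@F" for n :: nat
  using that u F.integral by (induction n) auto
 ultimately have "u = \<zero>@F" by blast
 then have "?y = \<one>@F" using F.dze[of ?y "\<one>@F"] y u_def by simp
 then show ?case using Suc by simp
qed simp

text \<open>A root of unity other than 1 has geometric sum 0, but its reduction would have geometric
  sum m, which is nonzero modulo l.\<close>

lemma root_red_inj:
 assumes z: "z : A" "z [^] (m::nat) = \<one>" "~ l dvd m" "red z = \<one>@F" shows "z = \<one>"
proof (rule ccontr)
 assume "z ~= \<one>"
 then have "finsum L (%i. z [^] i) {..<m} = \<zero>" using L.geometric_zero[of z m] z A_sub by auto
 moreover have "red (finsum L (%i. z [^] i) {..<m}) = finsum F (%i. \<one>@F) {..<m}"
  by (subst red_finsum) (use z in \<open>auto simp: red_pow intro!: F.fsc\<close>)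
 ultimately show False using natF_nonzero[OF z(3)] by (simp add: F.fs_const)
qed

text \<open>The multiplicative representative of the reduction of a root of unity.\<close>

lemma teich:
 assumes z: "z : A" "z [^] (n::nat) = \<one>" "n > 0"
 shows "EX y:A. red y = red z & y [^] n = \<one> & (EX m::nat. ~ l dvd m & y [^] m = \<one>)"
proof -
 obtain k m where km: "~ l dvd m" "n = m * l ^ k" using prime_power_canonical[OF l_prime z(3)] by blast
 have m0: "m > 0" using km z(3) by auto
 let ?s = "k * totient m"
 have cop: "coprime l m" using km l_prime prime_imp_coprime by blast
 have "[l ^ totient m = 1] (mod m)" by (rule euler_theorem[OF cop])
 then have "[(l ^ totient m) ^ k = 1 ^ k] (mod m)" by (rule cong_pow)
 then have "m dvd l ^ ?s - 1" using cong_to_1_nat[of "l ^ ?s" m] by (simp add: power_mult[symmetric] mult.commute)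
 then obtain u where u: "l ^ ?s - 1 = m * u" by blast
 have "l ^ ?s > 0" using l_prime prime_gt_0_nat by simp
 then have ls: "l ^ ?s = Suc (m * u)" unfolding u[symmetric] by (rule Suc_pred[symmetric, unfolded One_nat_def[symmetric]])
 have "k * 1 <= ?s" by (rule mult_le_mono2) (use m0 in \<open>simp add: Suc_le_eq\<close>)
 then have lk: "l ^ ?s = l ^ k * l ^ (?s - k)" by (simp add: power_add[symmetric])
 have zL: "z : carrier L" by (rule A_sub[OF z(1)])
 \<comment> \<open>The exponent is divisible by l^k, which kills the l-part of z, and is 1 modulo m,
   which keeps the reduction.\<close>
 let ?y = "z [^] (l ^ ?s)"
 have "?y [^] m = (z [^] n) [^] (l ^ (?s - k))"
  unfolding L.nat_pow_pow[OF zL] lk km(2) by (simp only: mult_ac)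
 then have 1: "?y [^] m = \<one>" using z by simp
 have 2: "?y [^] n = \<one>"
  using L.nat_pow_pow[OF zL, of n "l ^ ?s"] L.nat_pow_pow[OF zL, of "l ^ ?s" n] z by (simp add: mult.commute)
 have r: "red z : carrier F" using z by auto
 have "(red z [^]@F m) [^]@F (l ^ k) = \<one>@F"
  using F.nat_pow_pow[OF r, of m "l ^ k"] km(2) red_pow[OF z(1), of n] z(2) by simp
 then have rm: "red z [^]@F m = \<one>@F" by (rule frobenius_root[rotated]) (use r in simp)
 have "red ?y = red z [^]@F (m * u) **@F red z" unfolding red_pow[OF z(1)] ls by simp
 also have "red z [^]@F (m * u) = \<one>@F" unfolding F.nat_pow_pow[OF r, symmetric] rm by simp
 finally have "red ?y = red z" using r by simp
 then show ?thesis using 1 2 km z by blast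
qed

lemma chr_A: "z : A ==> L.chr g z t : A" by (simp add: L.chr_def)
lemma red_chr: "z : A ==> red (L.chr g z t) = F.chr g (red z) t" by (simp add: L.chr_def F.chr_def red_pow)
lemma red_root: "z : A ==> z [^] (n::nat) = \<one> ==> red z [^]@F n = \<one>@F"
 using red_pow[of z n] by simp

lemma red_J:
 assumes "theta L py qi te" "theta F psF qiF (%t. red (te t))" "!!t. te t : A"
 shows "theta.J L py qi te c d : A" "red (theta.J L py qi te c d) = theta.J F psF qiF (%t. red (te t)) c d"
 unfolding theta.J_def[OF assms(1)] theta.J_def[OF assms(2)]
 using assms(3) psi_A qi_A by (auto simp: red_mult red_minus red_finsum A_finsum)

lemma red_lamT:
 assumes "theta L py qi te" "theta F psF qiF (%t. red (te t))" "!!t. te t : A"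
 shows "lamT L py qi te b : A" "red (lamT L py qi te b) = lamT F psF qiF (%t. red (te t)) b"
 using red_J[OF assms] assms(3) by (auto simp: lamT_def)

lemma red_lamP:
 assumes "psr L py qi cx nu" "psr F psF qiF (%t. red (cx t)) (%t. red (nu t))" "!!t. cx t : A" "!!t. nu t : A"
 shows "psr.lamP L py qi cx nu b : A"
  "red (psr.lamP L py qi cx nu b) = psr.lamP F psF qiF (%t. red (cx t)) (%t. red (nu t)) b"
 unfolding psr.lamP_def[OF assms(1)] psr.lamP_def[OF assms(2)]
 using assms(3,4) psi_A qi_A by (auto simp: red_mult red_finsum A_finsum)

lemma red_stc:
 "achar.stc L py qi b b' s : A" "red (achar.stc L py qi b b' s) = achar.stc F psF qiF b b' s"
 unfolding achar.stc_def[OF achL] achar.stc_def[OF achF] using psi_A qi_A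
 by (auto simp: red_mult split: prod.splits)

lemma charsF:
 assumes "isgen (g :: 'k q2)" "z : A" "z [^] (CARD('k) * CARD('k) - 1) = \<one>"
 shows "theta L py qi (L.chr g z)" "theta F psF qiF (%t. red (L.chr g z t))"
 using achar.chr_theta[OF achL assms(1) A_sub[OF assms(2)] assms(3)]
  achar.chr_theta[OF achF assms(1) red_closed[OF assms(2)] red_root[OF assms(2,3)]]
 by (simp_all add: red_chr[OF assms(2)])

lemma charsPF:
 assumes "isgen (g :: 'k)" "c : A" "c [^] (CARD('k) - 1) = \<one>" "n : A" "n [^] (CARD('k) - 1) = \<one>"
 shows "psr L py qi (L.chr g c) (L.chr g n)" "psr F psF qiF (%t. red (L.chr g c t)) (%t. red (L.chr g n t))"
 using achar.chr_psr[OF achL assms(1) A_sub[OF assms(2)] assms(3) A_sub[OF assms(4)] assms(5)]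
  achar.chr_psr[OF achF assms(1) red_closed[OF assms(2)] red_root[OF assms(2,3)] red_closed[OF assms(4)] red_root[OF assms(4,5)]]
 by (simp_all add: red_chr[OF assms(2)] red_chr[OF assms(4)])

text \<open>Applies \<open>eigenvector_lift\<close> to the psi-isotypic vectors and to the two
  explicit families of eigenvalue systems, which \<open>separate\<close> shows to be large
  enough.\<close>

lemma eigenvector:
 fixes M :: "('b, 'v) module" and D :: "'k set"
 assumes G: "grep F psF qiF M D act" and g: "isgen (g :: 'k q2)"
  and u: "u : carrier M" "grep.pe F psF qiF M act 1 u ~= \<zero>@M"
 shows "EX w. (EX z:A. z [^] (CARD('k) * CARD('k) - 1) = \<one> &
    grep.hev F psF qiF M D act (%b. red (lamT L py qi (L.chr g z) b)) w) \<or>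
   (EX c:A. EX n:A. c [^] (CARD('k) - 1) = \<one> & n [^] (CARD('k) - 1) = \<one> &
    grep.hev F psF qiF M D act (%b. red (psr.lamP L py qi (L.chr (Nm g) c) (L.chr (Nm g) n) b)) w)"
proof -
 let ?q = "CARD('k)"
 let ?M = "?q * ?q - 1"
 interpret G: grep F psF qiF M D act by (rule G)
 interpret a: achar L py qi by (rule achL)
 note D = G.D
 define w where "w = om [^] (?q + 1)"
 \<comment> \<open>\<open>Inl\<close> indexes the characters of the quadratic extension, and
   \<open>Inr\<close> the pairs of characters of k^*.\<close>
 define lam where "lam x = (case x of Inl i => lamT L py qi (L.chr g (om [^] i))
  | Inr (i, j) => psr.lamP L py qi (L.chr (Nm g) (w [^] i)) (L.chr (Nm g) (w [^] j)))" for x :: "nat + nat \<times> nat"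
 define Xs :: "(nat + nat \<times> nat) set" where "Xs = Inl ` {..<?M} \<union> Inr ` ({..<?q - 1} \<times> {..<?q - 1})"
 have omL: "om : carrier L" by (rule A_sub[OF om_A])
 have wA: "w : A" by (simp add: w_def om_A)
 have M: "?M = (?q + 1) * (?q - 1)" by (simp add: algebra_simps)
 have omi: "om [^] (i::nat) : A" "(om [^] i) [^] ?M = \<one>" for i
  using om_A by (auto simp: L.nat_pow_pow[OF omL] om_order)
 have wi: "w [^] (i::nat) : A" "(w [^] i) [^] (?q - 1) = \<one>" for i
 proof -
  have "?M dvd (?q + 1) * (i * (?q - 1))" unfolding M by (intro mult_dvd_mono) auto
  moreover have "(w [^] i) [^] (?q - 1) = om [^] ((?q + 1) * (i * (?q - 1)))"
   unfolding w_def L.nat_pow_pow[OF omL] by (simp only: mult.assoc)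
  ultimately show "w [^] i : A" "(w [^] i) [^] (?q - 1) = \<one>"
   using wA om_order by auto
 qed
 note gN = isgen_Nm[OF g]
 note tT = charsF[OF g omi] and tP = charsPF[OF gN wi wi]
 have lamA: "lam x b : A" for x b
  using red_lamT(1)[OF tT chr_A[OF omi(1)]] red_lamP(1)[OF tP chr_A[OF wi(1)] chr_A[OF wi(1)]]
  by (auto simp: lam_def split: sum.splits prod.splits)
 let ?V = "{v. G.psv 1 v}"
 have "EX v:?V. v ~= \<zero>@M & (EX x:Xs. ALL b:BD D. G.Tb b v = red (lam x b) \<odot>@M v)"
 proof (rule eigenvector_lift[where st = a.stc and nx = nxt and S = UNIV and ?b0.0 = "(0, 1)" and v = "G.pe 1 u"])
  show "module F M" by (rule G.M.module_axioms)
  show "u : ?V ==> u : carrier M" for u using G.psvD(1) by blast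
  show "\<zero>@M : ?V" "u : ?V ==> w : ?V ==> u \<oplus>@M w : ?V" "c : carrier F ==> u : ?V ==> c \<odot>@M u : ?V" for u w c
   using G.psv_closed by auto
  show "finite (BD D)" "finite Xs" by (simp_all add: Xs_def)
  show "b : BD D ==> u : ?V ==> G.Tb b u : ?V" for b u using G.Tb_psv G.psvD(1) by blast
  show "b : BD D ==> u : ?V ==> w : ?V ==> G.Tb b (u \<oplus>@M w) = G.Tb b u \<oplus>@M G.Tb b w" for b u w
   using G.Tb_lin(1) G.psvD(1) by blast
  show "b : BD D ==> c : carrier F ==> u : ?V ==> G.Tb b (c \<odot>@M u) = c \<odot>@M G.Tb b u" for b c u
   using G.Tb_lin(2) G.psvD(1) by blast
  show "lam x b : A" for x b by (rule lamA)
  show "a.stc b b' s : A" for b b' s by (rule red_stc)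
  show "b : BD D ==> b' : BD D ==> nxt b b' s : BD D" for b b' s by (rule nxt_BD[OF D])
  show "lam x b ** lam x b' = finsum L (%s. a.stc b b' s ** lam x (nxt b b' s)) UNIV" if b: "b : BD D" "b' : BD D" for x b b'
   using a.hecke_T[OF g A_sub[OF omi(1)] omi(2) D b] a.hecke_P[OF tP(1) D b]
   by (auto simp: lam_def split: sum.splits prod.splits)
  show "b : BD D ==> b' : BD D ==> u : ?V ==>
    G.Tb b (G.Tb b' u) = finsum M (%s. red (a.stc b b' s) \<odot>@M G.Tb (nxt b b' s) u) UNIV" for b b' u
   using G.Tb_mult by (simp add: red_stc(2))
  show "(0, 1) : BD D" by (rule G.one_BD)
  show "lam x (0, 1) = \<one>" for x
   using psr.lamP_def[OF tP(1)] L.chr_1[OF g A_sub[OF omi(1)]] omi(2) L.chr_1[OF gN A_sub[OF wi(1)] wi(2)]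
   by (auto simp: lam_def lamT_def card_q2 split: sum.splits prod.splits)
  show "u : ?V ==> G.Tb (0, 1) u = u" for u using G.Tb_one by simp
  show "G.pe 1 u : ?V" "G.pe 1 u ~= \<zero>@M" using u G.psv_pe by simp_all
  fix Ph and b :: "'k \<times> 'k"
  assume P: "!!b. b : BD D ==> Ph b : A" and z: "!!x. x : Xs ==> finsum L (%b. Ph b ** lam x b) (BD D) = \<zero>"
   and b: "b : BD D"
  \<comment> \<open>Extension by zero, as \<open>separate\<close> takes coefficients defined
    everywhere.\<close>
  define Ph' where "Ph' b = (if b : BD D then Ph b else \<zero>)" for b
  have P': "Ph' b : carrier L" for b using P A_sub by (simp add: Ph'_def)
  have z': "finsum L (%b. Ph' b ** lam x b) (BD D) = \<zero>" if "x : Xs" for x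
  proof -
   have "finsum L (%b. Ph' b ** lam x b) (BD D) = finsum L (%b. Ph b ** lam x b) (BD D)"
    by (rule L.fsc) (use P lamA A_sub in \<open>auto simp: Ph'_def\<close>)
   then show ?thesis using z[OF that] by simp
  qed
  have "Ph' b = \<zero>"
  proof (rule a.separate[OF D charL P' g omL om_order _ _ b])
   show "finsum L (%b. Ph' b ** lamT L py qi (L.chr g (om [^] i)) b) (BD D) = \<zero>" if "i < ?M" for i
    using z'[of "Inl i"] that by (simp add: Xs_def lam_def)
   show "finsum L (%b. Ph' b ** psr.lamP L py qi (L.chr (Nm g) ((om [^] (?q + 1)) [^] i))
     (L.chr (Nm g) ((om [^] (?q + 1)) [^] j)) b) (BD D) = \<zero>" if "i < ?q - 1" "j < ?q - 1" for i j
    unfolding w_def[symmetric] using z'[of "Inr (i, j)"] that by (simp add: Xs_def lam_def)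
  qed
  then show "Ph b = \<zero>" using b by (simp add: Ph'_def)
 qed
 then obtain v x where v: "G.psv 1 v" "v ~= \<zero>@M" and x: "!!b. b : BD D ==> G.Tb b v = red (lam x b) \<odot>@M v" by auto
 have h: "G.hev (%b. red (lam x b)) v" using v x lamA by (simp add: G.hev_def)
 show ?thesis
 proof (cases x)
  case (Inl i)
  then show ?thesis using h omi[of i] by (auto simp: lam_def)
 next
  case (Inr p)
  obtain i j where "p = (i, j)" by force
  then have "G.hev (%b. red (psr.lamP L py qi (L.chr (Nm g) (w [^] i)) (L.chr (Nm g) (w [^] j)) b)) v"
   using h Inr by (simp add: lam_def)
  then show ?thesis using wi[of i] wi[of j] by blast
 qed
qed

end

section \<open>Lifting irreducible representations\<close>

lemma (in grep) hev_cong: "hev lam v ==> (!!b. b : BD D ==> lam b = lam' b) ==> hev lam' v"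
 by (simp add: hev_def)

text \<open>The projection onto the psi-isotypic part serves as the map \<open>E\<close> in
  \<open>irr_iso\<close>; the matrix coefficients agree because both are
  \<open>mcoef lam\<close>.\<close>

lemma (in achar) match:
 assumes G: "grep R py qi M D act" and G': "grep R py qi M' D act'"
  and irr: "irrsub R M (GD D) act N" "irrsub R M' (GD D) act' N'"
  and h: "grep.hev R py qi M D act lam v" "grep.hev R py qi M' D act' lam' v'" "!!b. b : BD D ==> lam b = lam' b"
  and v: "v : N" "v' : N'"
 shows "EX T. eqv R M act N M' act' N' (GD D) T"
proof -
 interpret A: grep R py qi M D act by (rule G)
 interpret B: grep R py qi M' D act' by (rule G')
 have h': "B.hev lam v'" using B.hev_cong[OF h(2)] h(3) by simp
 have E: "A.pe 1 v = v" "B.pe 1 v' = v'" using h(1) h' A.pe_psv B.pe_psv by (auto simp: A.hev_def B.hev_def)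
 have lc: "mcoef lam g : carrier R" if g: "g : GD D" for g
 proof -
  obtain a b c d where gg: "g = (a, b, c, d)" by (cases g)
  have "(c, mdet g) : BD D" if "c ~= 0" using g that by (simp add: BD_def GD_def)
  moreover have "(0, d) : BD D" if "c = 0" "a = d" using g that by (simp add: BD_def GD_def gg)
  ultimately show ?thesis using h(1) by (auto simp: mcoef_def gg A.hev_def)
 qed
 have ne: "v ~= \<zero>@M" "v' ~= \<zero>@M'" using h(1) h' by (simp_all add: A.hev_def B.hev_def)
 have ev: "mcoef lam g : carrier R & A.pe 1 (act g v) = mcoef lam g \<odot>@M v & B.pe 1 (act' g v') = mcoef lam g \<odot>@M' v'"
  if "g : GD D" for g using lc[OF that] A.hev_pe_act[OF h(1) that] B.hev_pe_act[OF h' that] by simp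
 show ?thesis
  by (rule irr_iso[OF A.linact_axioms B.linact_axioms irr v(1) ne(1) v(2) ne(2) A.islin_pe E(1) B.islin_pe E(2) ev])
qed

text \<open>The delta functions at squares are a basis of the half \<open>sqC\<close>.\<close>

lemma (in cusp) half_cusp:
 assumes J0: "!!c d. c ~= 0 ==> d ~= 0 ==> ~ sq d ==> J c d = \<zero>"
 defines "Sq \<equiv> {x::'k. x ~= 0 & sq x}"
 shows "krep R (GD {1}) Sq (%h i j. actC h (dl R j) i)"
  "EX T. eqv R (fmod R Sq) (kact R Sq (%h i j. actC h (dl R j) i)) (carrier (fmod R Sq)) (fmod R KX) actC sqC (GD {1}) T"
proof -
 interpret G: grep R py qi "fmod R KX" "{1}" actC by (rule grepC[OF sgc(2)])
 have b: "dl R j : sqC" if "j : Sq" for j using that by (auto simp: sqC_def Sq_def dl_def fmr)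
 have ex: "f = finsum (fmod R KX) (%j. f j \<odot>@(fmod R KX) dl R j) Sq" if f: "f : sqC" for f
 proof -
  have fc: "f : carrier (fmod R KX)" using f by (simp add: sqC_def)
  have "finsum (fmod R KX) (%j. f j \<odot>@(fmod R KX) dl R j) KX = finsum (fmod R KX) (%j. f j \<odot>@(fmod R KX) dl R j) Sq"
  proof (rule G.M.M.fs_mono)
   fix j assume j: "j : KX - Sq"
   then have "f j = \<zero>" using f by (auto simp: sqC_def Sq_def)
   then show "f j \<odot>@(fmod R KX) dl R j = \<zero>@(fmod R KX)" using j by (simp only: G.M.smult_l_null[OF dl_closed[of j KX]] DiffD1)
  next
   fix j assume "j : Sq"
   then show "f j \<odot>@(fmod R KX) dl R j : carrier (fmod R KX)"
    by (intro G.M.smult_closed fmc[OF fc] dl_closed) (simp add: Sq_def)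
  qed (auto simp: Sq_def)
  then show ?thesis using fmod_expand[OF _ fc] by simp
 qed
 have dual: "dl R j i = (if i = j then \<one> else \<zero>)" for i j by (simp add: dl_def)
 have I: "invsub R (fmod R KX) (GD {1}) actC sqC" by (rule sqC_invsub) (rule J0)
 note bm = G.basis_model[OF I finite[of Sq], where b = "dl R" and \<kappa> = "%i f. f i"]
 show "krep R (GD {1}) Sq (%h i j. actC h (dl R j) i)"
  by (rule bm(1)[OF b _ _ _ dual ex]) (auto intro: fmc)
 show "EX T. eqv R (fmod R Sq) (kact R Sq (%h i j. actC h (dl R j) i)) (carrier (fmod R Sq)) (fmod R KX) actC sqC (GD {1}) T"
  by (rule bm(2)[OF b _ _ _ dual ex]) (auto intro: fmc)
qed

context lifting
begin

definition liftable :: "((nat => int) => 'a) => 'k set => nat => ('k m2 => nat => nat => 'b) => bool" where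
 "liftable \<iota> D n \<sigma> \<longleftrightarrow> (EX \<rho>. is_rep L (GD D) n \<rho> & reduces_to l L \<iota> F red (GD D) n \<rho> \<sigma> &
   (D = UNIV - {0} --> (EX m. has_length L (GD {1}) n \<rho> m & has_length F (GD {1}) n \<sigma> m)))"

text \<open>The common ending of all cases: a model over \<open>A\<close>, the identification of its
  reduction with a submodule \<open>N\<close> of some module \<open>M\<close>, an isomorphism from
  \<open>N\<close> to sigma, and the lengths on SL2.\<close>

lemma conclude:
 fixes D :: "'k set" and K :: "'k m2 => 'j => 'j => 'a"
 assumes AI: "A <= integers l L \<iota>" and D: "subgrp D" and J: "finite J" and KL: "krep L (GD D) J K"
  and KA: "!!g i j. g : GD D ==> i : J ==> j : J ==> K g i j : A"
  and KF: "krep F (GD D) J (%g i j. red (K g i j))" and \<sigma>: "is_rep F (GD D) n \<sigma>"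
  and T: "EX T. eqv F (fmod F J) (kact F J (%g i j. red (K g i j))) (carrier (fmod F J)) M act N (GD D) T"
  and S: "EX T. eqv F M act N (fmod F {..<n}) (kact F {..<n} \<sigma>) (carrier (fmod F {..<n})) (GD D) T"
  and len: "D = UNIV - {0} ==> hlen L (fmod L J) (GD {1}) (kact L J K) (carrier (fmod L J)) m &
   hlen F (fmod F J) (GD {1}) (kact F J (%g i j. red (K g i j))) (carrier (fmod F J)) m"
 shows "liftable \<iota> D n \<sigma>"
proof -
 obtain T S where "eqv F (fmod F J) (kact F J (%g i j. red (K g i j))) (carrier (fmod F J)) M act N (GD D) T"
  "eqv F M act N (fmod F {..<n}) (kact F {..<n} \<sigma>) (carrier (fmod F {..<n})) (GD D) S" using T S by blast
 then have E: "eqv F (fmod F J) (kact F J (%g i j. red (K g i j))) (carrier (fmod F J))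
   (fmod F {..<n}) (kact F {..<n} \<sigma>) (carrier (fmod F {..<n})) (GD D) (S \<circ> T)" by (rule eqv_trans)
 have sub: "GD {1} <= GD D" using D by (auto simp: GD_def subgrp_def)
 have int: "K h i j : integers l L \<iota>" if "h : GD D" "i : J" "j : J" for h i j using KA[OF that] AI by (rule subsetD[rotated])
 obtain \<rho> where p: "is_rep L (GD D) n \<rho> & reduces_to l L \<iota> F red (GD D) n \<rho> \<sigma> &
  (ALL G' m. G' <= GD D --> hlen L (fmod L J) G' (kact L J K) (carrier (fmod L J)) m --> has_length L G' n \<rho> m)"
  using pack[OF L.field_axioms F.field_axioms J KL int KF \<sigma> E] by (rule exE)
 have r: "is_rep L (GD D) n \<rho>" "reduces_to l L \<iota> F red (GD D) n \<rho> \<sigma>"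
  "hlen L (fmod L J) (GD {1}) (kact L J K) (carrier (fmod L J)) m ==> has_length L (GD {1}) n \<rho> m" for m
  using p sub by simp_all
 have "has_length F (GD {1}) n \<sigma> m" if "D = UNIV - {0}"
  unfolding has_length_hlen
  by (rule hlen_eqv[OF F.fmm F.fmm eqv_subset[OF E sub]])
   (use len[OF that] kri[OF F.field_axioms J krep_subset[OF KF sub]]
    kri[OF F.field_axioms _ krep_subset[OF _ sub], of "{..<n}" \<sigma>] \<sigma> in \<open>auto simp: is_rep_krep\<close>)
 then show ?thesis unfolding liftable_def using r len by blast
qed

lemma red_kact:
 assumes "!!i j. K g i j : A" "!!j. v j : A"
 shows "kact L I K g v i : A" "red (kact L I K g v i) = kact F I (%g i j. red (K g i j)) g (%j. red (v j)) i"
 using assms by (auto simp: kact_def red_finsum red_mult A_finsum)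

lemma eqv_refl: "EX T. eqv R M act N M act N G T"
 by (rule exI[of _ id]) (simp add: eqv_def)

section \<open>Lifting the several types of irreducible representations\<close>

context
 fixes g :: "'k q2" and \<iota> :: "(nat => int) => 'a" and D :: "'k set" and n :: nat and \<sigma> :: "'k m2 => nat => nat => 'b"
 assumes g: "isgen g" and AI: "A <= integers l L \<iota>" and D: "D = UNIV - {0} \<or> D = {1}"
  and \<sigma>: "is_rep F (GD D) n \<sigma>"
  and irr: "irrsub F (fmod F {..<n}) (GD D) (kact F {..<n} \<sigma>) (carrier (fmod F {..<n}))"
begin

lemma sD: "subgrp D" using D sgc by blast

lemma gN: "isgen (Nm g)" by (rule isgen_Nm[OF g])

lemma grepS: "grep F psF qiF (fmod F {..<n}) D (kact F {..<n} \<sigma>)"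
 using achF F.krep_linact[OF _ sD, of "{..<n}" \<sigma>] \<sigma> by (intro grep.intro) (auto simp: is_rep_krep)

lemma nonsq_gen: "~ sq (x::'k) ==> ~ sq (Nm g)"
proof
 assume x: "~ sq x" and s: "sq (Nm g)"
 have x0: "x ~= 0" using x by (auto simp: sq_def)
 have "sq (Nm g ^ i)" for i by (induction i) (use s sq_mult in auto)
 then show False using dlg(1)[OF gN x0] x by metis
qed

text \<open>Conjugation raises the value of the character at g^i to the power q, which multiplies it
  by (-1)^i. An element of nonsquare norm has odd i, so conjugation changes the sign of the Bessel
  sum, and 2 is invertible in \<open>L\<close>.\<close>

lemma J_vanish:
 assumes z: "z : A" "z [^] (CARD('k) * CARD('k) - 1) = \<one>" "z [^] (CARD('k) - 1) = \<ominus> \<one>"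
  and d: "d ~= 0" "~ sq d"
 shows "theta.J L py qi (L.chr g z) c d = \<zero>"
proof -
 interpret T: theta L py qi "L.chr g z" by (rule charsF(1)[OF g z(1,2)])
 have zL: "z : carrier L" by (rule A_sub[OF z(1)])
 have zq: "z [^] CARD('k) = \<ominus> z"
 proof -
  have "CARD('k) = Suc (CARD('k) - 1)" using cge2[where ?'f = 'k] by simp
  then have "z [^] CARD('k) = z [^] (CARD('k) - 1) ** z" by (metis L.nat_pow_Suc)
  then show ?thesis using z zL by (simp add: L.l_minus)
 qed
 have neg: "L.chr g z (cnj2 t) = \<ominus> L.chr g z t" if t: "Nm t = d" for t
 proof -
  define i where "i = dlg g t"
  have t0: "t ~= 0" using t d by auto
  have ti: "g ^ i = t" unfolding i_def by (rule dlg(1)[OF g t0])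
  have "odd i"
  proof
   assume "even i"
   then obtain j where "i = 2 * j" by blast
   then have "d = Nm (g ^ j) * Nm (g ^ j)" using t ti by (metis Nm_simps(3) mult_2 power_add)
   then show False using d(2) by (auto simp: sq_def)
  qed
  have "cnj2 t = g ^ (i * CARD('k))" unfolding cnj2_eq_power ti[symmetric] by (simp add: power_mult)
  then have "L.chr g z (cnj2 t) = z [^] (i * CARD('k))" using L.chr_pow[OF g zL] z(2) by (simp add: card_q2)
  also have "... = (\<ominus> z) [^] i" unfolding zq[symmetric] L.nat_pow_pow[OF zL] by (simp add: mult.commute)
  also have "... = \<ominus> (z [^] i)"
  proof -
   have "(\<ominus> z) [^] (k::nat) = (if odd k then \<ominus> (z [^] k) else z [^] k)" for k
    by (induction k) (use zL in \<open>auto simp: L.l_minus L.r_minus\<close>)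
   then show ?thesis using \<open>odd i\<close> by simp
  qed
  finally show ?thesis using i_def by (simp add: L.chr_def)
 qed
 let ?S = "finsum L (%t. py (- Tr t / c) ** L.chr g z t) {t. Nm t = d}"
 have Sc: "?S : carrier L" by auto
 have "?S = finsum L (%t. \<ominus> (py (- Tr t / c) ** L.chr g z t)) {t. Nm t = d}"
 proof (rule L.fsw[of _ cnj2 cnj2])
  fix t assume t: "t : {t. Nm t = d}"
  have "Tr (cnj2 t) = Tr t" by (rule emb_simps(7)[THEN iffD1]) (simp add: emb_Tr add.commute)
  then show "py (- Tr t / c) ** L.chr g z t = \<ominus> (py (- Tr (cnj2 t) / c) ** L.chr g z (cnj2 t))"
   using neg[of t] t by (simp add: L.r_minus)
 qed auto
 then have "?S = \<ominus> ?S" by (simp add: L.fs_uminus)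
 then have "?S \<oplus> ?S = (\<ominus> ?S) \<oplus> ?S" by (rule arg_cong[of _ _ "%y. y \<oplus> ?S"])
 then have "?S \<oplus> ?S = \<zero>" unfolding L.l_neg[OF Sc] .
 then have "(\<one> \<oplus> \<one>) ** ?S = \<zero>" using Sc by (simp add: L.l_distr)
 moreover have "\<one> \<oplus> \<one> ~= \<zero>" using charL[of 2] by (simp add: numeral_2_eq_2)
 ultimately have "?S = \<zero>" using L.integral[of "\<one> \<oplus> \<one>" ?S] Sc by auto
 then show ?thesis unfolding T.J_def by simp
qed

text \<open>The assumption \<open>V\<close> lets the condition that forces a splitting on SL2,
  namely z^(q-1) = -1, be lifted from the residue field.\<close>

lemma lift_cusp:
 assumes z: "z : A" "z [^] (CARD('k) * CARD('k) - 1) = \<one>" "z [^] (CARD('k) - 1) ~= \<one>"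
  and cF: "cusp F psF qiF (%t. red (L.chr g z t))"
  and V: "red z [^]@F (CARD('k) - 1) = \<ominus>@F \<one>@F ==> z [^] (CARD('k) - 1) = \<ominus> \<one>"
  and h: "grep.hev F psF qiF (fmod F {..<n}) D (kact F {..<n} \<sigma>) (%b. red (lamT L py qi (L.chr g z) b)) w"
 shows "liftable \<iota> D n \<sigma>"
proof -
 let ?te = "L.chr g z" let ?th = "%t. red (L.chr g z t)"
 interpret S: grep F psF qiF "fmod F {..<n}" D "kact F {..<n} \<sigma>" by (rule grepS)
 have cL: "cusp L py qi ?te" by (rule achar.chr_regular[OF achL g A_sub[OF z(1)] z(2,3)])
 interpret C: cusp L py qi ?te by (rule cL)
 interpret E: cusp F psF qiF ?th by (rule cF)
 note th = C.theta_axioms E.theta_axioms chr_A[OF z(1), of g]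
 note rJ = red_J[OF th]
 have KC: "C.KC h x y : A" "red (C.KC h x y) = E.KC h x y" for h x y
  using rJ psi_A chr_A[OF z(1), of g] by (auto simp: C.KC_def E.KC_def red_mult split: prod.splits)
 have lam: "red (lamT L py qi ?te b) = E.lamC b" for b
  using red_lamT(2)[OF th, of b] achar.lamT_lamC[OF achF cF] by simp
 have KF: "(%h x y. red (C.KC h x y)) = E.KC" using KC by (intro ext) simp
 interpret G: grep F psF qiF "fmod F E.KX" D E.actC by (rule E.grepC[OF sD])
 have hC: "G.hev E.lamC (dl F 1)" by (rule E.hevC[OF sD])
 have wS: "w : carrier (fmod F {..<n})" using h S.psvD(1) by (auto simp: S.hev_def)
 have whole: "liftable \<iota> D n \<sigma>" if i: "irrsub F (fmod F E.KX) (GD D) E.actC (carrier (fmod F E.KX))"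
  and len: "D = UNIV - {0} ==> hlen L (fmod L C.KX) (GD {1}) C.actC (carrier (fmod L C.KX)) m &
    hlen F (fmod F E.KX) (GD {1}) E.actC (carrier (fmod F E.KX)) m" for m
 proof (rule conclude[OF AI sD _ C.krepC[OF sD] KC(1) _ \<sigma>, unfolded KF])
  show "krep F (GD D) C.KX E.KC" by (rule E.krepC[OF sD])
  show "EX T. eqv F (fmod F C.KX) E.actC (carrier (fmod F C.KX)) (fmod F E.KX) E.actC (carrier (fmod F E.KX)) (GD D) T" by (rule eqv_refl)
  show "EX T. eqv F (fmod F E.KX) E.actC (carrier (fmod F E.KX)) (fmod F {..<n}) (kact F {..<n} \<sigma>) (carrier (fmod F {..<n})) (GD D) T"
   by (rule achar.match[OF achF G.grep_axioms grepS i irr hC h]) (use lam wS in auto)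
 qed (use len in auto)
 show ?thesis
 \<comment> \<open>Either the model is irreducible on SL2 over both fields, or nonsquares exist and
   the Bessel function vanishes at all of them modulo l.\<close>
 proof (cases "(EX x::'k. x ~= 0 & ~ sq x) & (ALL c d. c ~= 0 --> d ~= 0 --> ~ sq d --> E.J c d = \<zero>@F)")
  case False
  then have nd: "EX c d. c ~= 0 & d ~= 0 & ~ sq d & E.J c d ~= \<zero>@F" if "x ~= 0" "~ sq (x::'k)" for x using that by blast
  have ndL: "EX c d. c ~= 0 & d ~= 0 & ~ sq d & C.J c d ~= \<zero>" if "x ~= 0" "~ sq (x::'k)" for x
   using nd[OF that] rJ(2) red_zero by metis
  have iF: "irrsub F (fmod F E.KX) (GD {1}) E.actC (carrier (fmod F E.KX))" by (rule E.cusp_irr_SL) (rule nd)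
  have iL: "irrsub L (fmod L C.KX) (GD {1}) C.actC (carrier (fmod L C.KX))" by (rule C.cusp_irr_SL) (rule ndL)
  interpret GL: grep L py qi "fmod L C.KX" "{1}" C.actC by (rule C.grepC[OF sgc(2)])
  interpret GF: grep F psF qiF "fmod F E.KX" "{1}" E.actC by (rule E.grepC[OF sgc(2)])
  have ne: "carrier (fmod R (UNIV - {0::'k})) ~= {\<zero>@(fmod R (UNIV - {0::'k}))}" if "Ring.field R" for R :: "'c ring"
  proof -
   interpret R: Ring.field R by fact
   have "dl R (1::'k) 1 ~= \<zero>@(fmod R (UNIV - {0::'k})) 1" by (simp add: dl_def)
   then have n: "dl R (1::'k) ~= \<zero>@(fmod R (UNIV - {0::'k}))" by metis
   have "dl R (1::'k) : carrier (fmod R (UNIV - {0::'k}))" by (rule R.dl_closed) simp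
   with n show ?thesis by blast
  qed
  show ?thesis
  proof (rule whole)
   show "irrsub F (fmod F E.KX) (GD D) E.actC (carrier (fmod F E.KX))" using iF E.cusp_irr_GL D by auto
   show "hlen L (fmod L C.KX) (GD {1}) C.actC (carrier (fmod L C.KX)) 1 &
     hlen F (fmod F E.KX) (GD {1}) E.actC (carrier (fmod F E.KX)) 1"
    by (rule conjI[OF GL.hlen_1[OF iL ne[OF L.field_axioms]] GF.hlen_1[OF iF ne[OF F.field_axioms]]])
  qed
 next
  case True
  then obtain x :: 'k where x: "x ~= 0" "~ sq x" by blast
  have J0: "E.J c d = \<zero>@F" if "c ~= 0" "d ~= 0" "~ sq d" for c d using True that by blast
  have g0: "g ~= 0" "Nm g ~= 0" using g by (auto simp: isgen_def)
  have rz: "red z : carrier F" using z by auto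
  have zL: "z : carrier L" by (rule A_sub[OF z(1)])
  have thg: "?th g = red z" "?th (cnj2 g) = red z [^]@F CARD('k)"
   using L.chr_pow[OF g zL, of 1] L.chr_pow[OF g zL, of "CARD('k)"] z zL by (simp_all add: cnj2_eq_power card_q2 red_pow)
  \<comment> \<open>Vanishing at the norm of the generator means that the values at g and at its
    conjugate cancel, so z^(q-1) reduces to -1.\<close>
  have "red z \<oplus>@F red z [^]@F CARD('k) = \<zero>@F"
   using E.J_vanish_conj[OF E.reg g0(2)] J0[OF _ g0(2) nonsq_gen[OF x(2)]] E.th_unit[OF g0(1)] thg by auto
  then have s: "red z [^]@F CARD('k) = \<ominus>@F red z"
   using rz by (intro F.minus_equality[symmetric]) (auto simp: F.a_comm)
  have "CARD('k) = Suc (CARD('k) - 1)" using cge2[where ?'f = 'k] by simp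
  then have "red z [^]@F CARD('k) = red z [^]@F (CARD('k) - 1) **@F red z" by (metis F.nat_pow_Suc)
  then have "red z [^]@F (CARD('k) - 1) **@F red z = (\<ominus>@F \<one>@F) **@F red z" using s rz by (simp add: F.l_minus)
  moreover have "red z ~= \<zero>@F" using E.th_unit[OF g0(1)] thg by simp
  ultimately have "red z [^]@F (CARD('k) - 1) = \<ominus>@F \<one>@F" using rz F.m_rcancel by simp
  then have zm: "z [^] (CARD('k) - 1) = \<ominus> \<one>" by (rule V)
  have J0L: "C.J c d = \<zero>" if "c ~= 0" "d ~= 0" "~ sq d" for c d
   by (rule J_vanish[OF z(1,2) zm that(2,3)])
  show ?thesis
  proof (cases "D = {1}")
   case False
   then have DK: "D = UNIV - {0}" using D by blast
   show ?thesis
   proof (rule whole)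
    show "irrsub F (fmod F E.KX) (GD D) E.actC (carrier (fmod F E.KX))" using E.cusp_irr_GL DK by simp
    show "hlen L (fmod L C.KX) (GD {1}) C.actC (carrier (fmod L C.KX)) 2 &
     hlen F (fmod F E.KX) (GD {1}) E.actC (carrier (fmod F E.KX)) 2"
    proof (rule conjI)
     show "hlen L (fmod L C.KX) (GD {1}) C.actC (carrier (fmod L C.KX)) 2" by (rule C.cusp_hlen_2[OF _ x(2)]) (rule J0L)
     show "hlen F (fmod F E.KX) (GD {1}) E.actC (carrier (fmod F E.KX)) 2" by (rule E.cusp_hlen_2[OF _ x(2)]) (rule J0)
    qed
   qed
  next
   case D1: True
   \<comment> \<open>A nonsquare exists, so {1} is not all of k^* and no claim about lengths
     arises.\<close>
   have "x : UNIV - {0}" "x ~= 1" using x sq_1 by auto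
   then have DN: "D ~= UNIV - {0}" using D1 by blast
   have red_dl: "red (dl L j x) = dl F j x" "dl L j x : A" for j x :: 'k by (simp_all add: dl_def)
   have rK: "C.actC h (dl L j) i : A" "red (C.actC h (dl L j) i) = E.actC h (dl F j) i" for h i j
    using red_kact[where K = C.KC and v = "dl L j" and I = C.KX, OF KC(1) red_dl(2), of h i] unfolding KF red_dl by auto
   have d1: "dl F (1::'k) : E.sqC" by (auto simp: E.sqC_def dl_def fmr)
   have KFe: "(%h i j. red (C.actC h (dl L j) i)) = (%h i j. E.actC h (dl F j) i)" by (intro ext rK(2))
   have hL: "krep L (GD D) {x. x ~= 0 & sq x} (%h i j. C.actC h (dl L j) i)" unfolding D1 by (rule C.half_cusp(1)) (rule J0L)
   show ?thesis
   proof (rule conclude[OF AI sD _ hL rK(1) _ \<sigma>, unfolded KFe])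
    show "krep F (GD D) {x. x ~= 0 & sq x} (%h i j. E.actC h (dl F j) i)" unfolding D1 by (rule E.half_cusp(1)) (rule J0)
    show "EX T. eqv F (fmod F {x. x ~= 0 & sq x}) (kact F {x. x ~= 0 & sq x} (%h i j. E.actC h (dl F j) i))
     (carrier (fmod F {x. x ~= 0 & sq x})) (fmod F E.KX) E.actC E.sqC (GD D) T" unfolding D1 by (rule E.half_cusp(2)) (rule J0)
    have si: "irrsub F (fmod F E.KX) (GD D) E.actC E.sqC" unfolding D1 by (rule E.sqC_irr) (rule J0)
    show "EX T. eqv F (fmod F E.KX) E.actC E.sqC (fmod F {..<n}) (kact F {..<n} \<sigma>) (carrier (fmod F {..<n})) (GD D) T"
     by (rule achar.match[OF achF G.grep_axioms grepS si irr hC h _ d1 wS]) (simp add: lam)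
   qed (use DN in auto)
  qed
 qed
qed

lemma red_KP:
 assumes "psr L py qi cx nu" "psr F psF qiF (%t. red (cx t)) (%t. red (nu t))" "!!t. cx t : A" "!!t. nu t : A"
 shows "psr.KP L cx nu h i j : A" "(%h i j. red (psr.KP L cx nu h i j)) = psr.KP F (%t. red (cx t)) (%t. red (nu t))"
 using assms(3,4) by (auto simp: psr.KP_def[OF assms(1)] psr.KP_def[OF assms(2)] red_mult fun_eq_iff)

lemma hev_lamP:
 assumes c: "c : A" "c [^] (CARD('k) - 1) = \<one>" and m: "m : A" "m [^] (CARD('k) - 1) = \<one>"
  and T: "irrsub F (fmod F UNIV) (GD D) (kact F UNIV (psr.KP F (%t. red (L.chr (Nm g) c t)) (%t. red (L.chr (Nm g) m t)))) N"
   "psr.mv F psF 1 : N"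
  and h: "grep.hev F psF qiF (fmod F {..<n}) D (kact F {..<n} \<sigma>) (%b. red (psr.lamP L py qi (L.chr (Nm g) c) (L.chr (Nm g) m) b)) w"
 shows "EX T. eqv F (fmod F UNIV) (kact F UNIV (psr.KP F (%t. red (L.chr (Nm g) c t)) (%t. red (L.chr (Nm g) m t)))) N
   (fmod F {..<n}) (kact F {..<n} \<sigma>) (carrier (fmod F {..<n})) (GD D) T"
proof -
 note p = charsPF[OF gN c m]
 interpret E: psr F psF qiF "%t. red (L.chr (Nm g) c t)" "%t. red (L.chr (Nm g) m t)" by (rule p(2))
 interpret S: grep F psF qiF "fmod F {..<n}" D "kact F {..<n} \<sigma>" by (rule grepS)
 have wS: "w : carrier (fmod F {..<n})" using h S.psvD(1) by (auto simp: S.hev_def)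
 show ?thesis
  by (rule E.match[OF E.grepP[OF sD] grepS T(1) irr E.hevP[OF sD] h _ T(2) wS])
   (simp add: red_lamP(2)[OF p chr_A[OF c(1)] chr_A[OF m(1)]])
qed

lemma lift_steinberg:
 assumes c: "c : A" "c [^] (CARD('k) - 1) = \<one>" and q1: "achar.qq TYPE('k) F \<oplus>@F \<one>@F ~= \<zero>@F"
  and h: "grep.hev F psF qiF (fmod F {..<n}) D (kact F {..<n} \<sigma>) (%b. red (psr.lamP L py qi (L.chr (Nm g) c) (L.chr (Nm g) \<one>) b)) w"
 shows "liftable \<iota> D n \<sigma>"
proof -
 have m: "\<one> : A" "\<one> [^] (CARD('k) - 1) = \<one>" by auto
 note p = charsPF[OF gN c m]
 let ?cx = "L.chr (Nm g) c" and ?nu = "L.chr (Nm g) \<one>"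
 note aA = chr_A[OF c(1), of "Nm g"] chr_A[OF m(1), of "Nm g"]
 interpret PL: psr L py qi ?cx ?nu by (rule p(1))
 interpret PE: psr F psF qiF "%t. red (?cx t)" "%t. red (?nu t)" by (rule p(2))
 have one: "?nu t = \<one>" for t by (simp add: L.chr_def)
 have qq: "red PL.qq = PE.qq" "PL.qq : A" using A_nat by (simp_all add: PL.qq_def PE.qq_def)
 interpret E: stb F psF qiF "%t. red (?cx t)" "%t. red (?nu t)" by unfold_locales (use q1 one in auto)
 interpret C: stb L py qi ?cx ?nu
 proof unfold_locales
  show "PL.qq \<oplus> \<one> ~= \<zero>" using q1 qq red_add[of PL.qq "\<one>"] red_zero by auto
 qed (use one in auto)
 have bS: "red (C.bS j y) = E.bS j y" "C.bS j y : A" for j y by (auto simp: C.bS_def E.bS_def red_minus)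
 have rK: "C.KS h i j : A" "red (C.KS h i j) = E.KS h i j" for h i j
  using red_kact[where K = PL.KP and v = "C.bS j" and I = UNIV, OF red_KP(1)[OF p aA] bS(2), of h "Some i"]
  unfolding red_KP(2)[OF p aA] bS C.KS_def E.KS_def by auto
 have KFe: "(%h i j. red (C.KS h i j)) = E.KS" by (intro ext rK(2))
 show ?thesis
 proof (rule conclude[OF AI sD _ C.steinberg_model(1)[OF sD] rK(1) _ \<sigma>, unfolded KFe])
  show "krep F (GD D) UNIV E.KS" by (rule E.steinberg_model(1)[OF sD])
  show "EX T. eqv F (fmod F UNIV) (kact F UNIV E.KS) (carrier (fmod F UNIV)) PE.MP PE.actP E.N0 (GD D) T"
   by (rule E.steinberg_model(2)[OF sD])
  show "EX T. eqv F PE.MP PE.actP E.N0 (fmod F {..<n}) (kact F {..<n} \<sigma>) (carrier (fmod F {..<n})) (GD D) T"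
   by (rule hev_lamP[OF c m E.N0_irr[OF sD] E.mv_N0 h])
  show "hlen L (fmod L UNIV) (GD {1}) (kact L UNIV C.KS) (carrier (fmod L UNIV)) 1 &
   hlen F (fmod F UNIV) (GD {1}) (kact F UNIV E.KS) (carrier (fmod F UNIV)) 1"
   using C.steinberg_model(3)[OF sD] E.steinberg_model(3)[OF sD] by blast
 qed simp
qed

text \<open>As \<open>m\<close> has order prime to l, it is quadratic over \<open>L\<close> exactly
  when its reduction is, so both restrictions to SL2 split or neither does.\<close>

lemma lift_ps:
 assumes c: "c : A" "c [^] (CARD('k) - 1) = \<one>" and m: "m : A" "m [^] (CARD('k) - 1) = \<one>"
  and t: "~ l dvd r" "m [^] (r::nat) = \<one>" and m1: "red m ~= \<one>@F"
  and h: "grep.hev F psF qiF (fmod F {..<n}) D (kact F {..<n} \<sigma>) (%b. red (psr.lamP L py qi (L.chr (Nm g) c) (L.chr (Nm g) m) b)) w"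
 shows "liftable \<iota> D n \<sigma>"
proof -
 note p = charsPF[OF gN c m]
 let ?cx = "L.chr (Nm g) c" and ?nu = "L.chr (Nm g) m"
 note aA = chr_A[OF c(1), of "Nm g"] chr_A[OF m(1), of "Nm g"]
 interpret C: psr L py qi ?cx ?nu by (rule p(1))
 interpret E: psr F psF qiF "%t. red (?cx t)" "%t. red (?nu t)" by (rule p(2))
 note KF = red_KP(2)[OF p aA]
 have mL: "m : carrier L" by (rule A_sub[OF m(1)])
 have g0: "Nm g ~= 0" using gN by (simp add: isgen_def)
 have ng: "?nu (Nm g) = m" by (rule L.chr_gen[OF gN mL m(2)])
 have mv: "E.mv 1 : carrier E.MP" by (rule E.mv_closed)
 have whole: "liftable \<iota> D n \<sigma>" if i: "irrsub F E.MP (GD D) E.actP (carrier E.MP)"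
  and len: "D = UNIV - {0} ==> hlen L C.MP (GD {1}) C.actP (carrier C.MP) e & hlen F E.MP (GD {1}) E.actP (carrier E.MP) e" for e
 proof (rule conclude[OF AI sD _ C.krepP[OF sD] red_KP(1)[OF p aA] _ \<sigma>, unfolded KF])
  show "krep F (GD D) UNIV E.KP" by (rule E.krepP[OF sD])
  show "EX T. eqv F E.MP E.actP (carrier E.MP) E.MP E.actP (carrier E.MP) (GD D) T" by (rule eqv_refl)
  show "EX T. eqv F E.MP E.actP (carrier E.MP) (fmod F {..<n}) (kact F {..<n} \<sigma>) (carrier (fmod F {..<n})) (GD D) T"
   by (rule hev_lamP[OF c m i mv h])
 qed (use len in auto)
 have GLirr: "irrsub F E.MP (GD D) E.actP (carrier E.MP)" if "D = UNIV - {0}"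
  by (rule E.PS_irr[OF sD, of "Nm g" 1]) (use that g0 ng m1 in auto)
 show ?thesis
 proof (cases "red m **@F red m = \<one>@F")
  case False
  have mm: "m ** m ~= \<one>" using False red_mult[OF m(1) m(1)] by auto
  \<comment> \<open>The diagonal matrix with entries \<open>Nm g\<close> and its inverse
    distinguishes \<open>nu\<close> from its inverse.\<close>
  have inv: "?nu (inverse (Nm g)) ** m = \<one>" using C.nu_mult[of "inverse (Nm g)" "Nm g"] g0 ng by simp
  have neL: "?nu (Nm g) ~= ?nu (inverse (Nm g))" using inv mm ng by auto
  have neF: "red (?nu (Nm g)) ~= red (?nu (inverse (Nm g)))"
   using arg_cong[OF inv, of red] False ng aA(2) m by (auto simp: red_mult)
  have iL: "irrsub L C.MP (GD {1}) C.actP (carrier C.MP)" by (rule C.PS_irr[OF sgc(2) _ neL]) (use g0 in simp)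
  have iF: "irrsub F E.MP (GD {1}) E.actP (carrier E.MP)" by (rule E.PS_irr[OF sgc(2) _ neF]) (use g0 in simp)
  interpret GL: grep L py qi C.MP "{1}" C.actP by (rule C.grepP[OF sgc(2)])
  interpret GF: grep F psF qiF E.MP "{1}" E.actP by (rule E.grepP[OF sgc(2)])
  have "C.mv 1 (Some 0) ~= \<zero>@C.MP (Some 0)" by simp
  then have "C.mv 1 ~= \<zero>@C.MP" by metis
  then have nL: "carrier C.MP ~= {\<zero>@C.MP}" using C.mv_closed by blast
  have "E.mv 1 (Some 0) ~= \<zero>@E.MP (Some 0)" by simp
  then have "E.mv 1 ~= \<zero>@E.MP" by metis
  then have nF: "carrier E.MP ~= {\<zero>@E.MP}" using mv by blast
  show ?thesis by (rule whole[of 1]) (use GLirr iF D GL.hlen_1[OF iL nL] GF.hlen_1[OF iF nF] in auto)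
 next
  case True
  have "(m ** m) [^] r = \<one>" using t mL by (simp add: L.nat_pow_distrib)
  then have mm: "m ** m = \<one>"
   by (rule root_red_inj[OF A_mult[OF m(1) m(1)] _ t(1)]) (use True red_mult[OF m(1) m(1)] in simp)
  have qd: "?nu s ** ?nu s = \<one>" for s
   unfolding L.chr_def L.nat_pow_distrib[OF mL mL, symmetric] mm by (rule L.nat_pow_one)
  have nt: "red (?nu (Nm g)) ~= \<one>@F" using m1 ng by simp
  then have ntL: "?nu (Nm g) ~= \<one>" by auto
  interpret QL: psq L py qi ?cx ?nu by unfold_locales (use qd ntL g0 in blast)+
  interpret QF: psq F psF qiF "%t. red (?cx t)" "%t. red (?nu t)"
  proof unfold_locales
   show "red (?nu s) **@F red (?nu s) = \<one>@F" for s using arg_cong[OF qd[of s], of red] aA(2) by (simp add: red_mult)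
  qed (use nt g0 in blast)
  show ?thesis
  proof (cases "D = {1}")
   case False
   then have "D = UNIV - {0}" using D by blast
   then show ?thesis by (intro whole[of 2] GLirr) (use QL.PS_hlen_2 QF.PS_hlen_2 in auto)
  next
   case D1: True
   have "Nm g : UNIV - {0}" "Nm g ~= 1" using g0 ntL C.nu_one by (simp, metis)
   then have DN: "D ~= UNIV - {0}" using D1 by blast
   have b0: "QL.b0 : A" "red QL.b0 = QF.b0" "QL.gauss : A"
    using aA psi_A qi_A by (auto simp: QL.b0_def QF.b0_def QL.gauss_def QF.gauss_def red_mult red_finsum A_finsum)
   have bH: "red (QL.bH j y) = QF.bH j y" "QL.bH j y : A" for j y
    using psi_A b0 by (auto simp: QL.bH_def QF.bH_def QL.yv_def QF.yv_def C.wv_def E.wv_def C.mv_def E.mv_def red_mult split: option.splits)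
   have ac: "C.actP h (QL.bH j) y : A" "red (C.actP h (QL.bH j) y) = E.actP h (QF.bH j) y" for h j y
    using red_kact[where K = C.KP and v = "QL.bH j" and I = UNIV, OF red_KP(1)[OF p aA] bH(2), of h y] unfolding KF bH by auto
   have rK: "QL.KH h i j : A" "red (QL.KH h i j) = QF.KH h i j" for h i j
    using ac psi_A qi_A by (auto simp: QL.KH_def QF.KH_def QL.kH_def QF.kH_def C.chat_def E.chat_def red_mult red_finsum A_finsum)
   have KFe: "(%h i j. red (QL.KH h i j)) = QF.KH" by (intro ext rK(2))
   have o: "\<one>@F = \<one>@F \<or> \<one>@F = \<ominus>@F \<one>@F" by simp
   show ?thesis
   proof (rule conclude[OF AI sD _ QL.half_model(1)[folded D1] rK(1) _ \<sigma>, unfolded KFe])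
    show "krep F (GD D) {a. sq a} QF.KH" unfolding D1 by (rule QF.half_model(1))
    show "EX T. eqv F (fmod F {a. sq a}) (kact F {a. sq a} QF.KH) (carrier (fmod F {a. sq a})) E.MP E.actP (QF.Nh \<one>@F) (GD D) T"
     unfolding D1 by (rule QF.half_model(2))
    \<comment> \<open>Of the two halves, sigma matches the one that contains \<open>mv 1\<close>,
      since it has a psi-eigenvector and \<open>nu\<close> 1 = 1.\<close>
    show "EX T. eqv F E.MP E.actP (QF.Nh \<one>@F) (fmod F {..<n}) (kact F {..<n} \<sigma>) (carrier (fmod F {..<n})) (GD D) T"
     by (rule hev_lamP[OF c m _ _ h]) (use D1 QF.Nh_irr[OF o] QF.mv_Nh[OF o, of 1] in auto)
   qed (use DN in auto)
  qed
 qed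
qed

lemma lift_det:
 assumes c: "c : A" "c [^] (CARD('k) - 1) = \<one>" and w: "w : carrier (fmod F {..<n})" "w ~= \<zero>@(fmod F {..<n})"
  and h: "!!h. h : GD D ==> kact F {..<n} \<sigma> h w = red (L.chr (Nm g) c (mdet h)) \<odot>@(fmod F {..<n}) w"
 shows "liftable \<iota> D n \<sigma>"
proof -
 note p = charsPF[OF gN c c]
 let ?cx = "L.chr (Nm g) c"
 interpret C: psr L py qi ?cx ?cx by (rule p(1))
 interpret E: psr F psF qiF "%t. red (?cx t)" "%t. red (?cx t)" by (rule p(2))
 interpret S: grep F psF qiF "fmod F {..<n}" D "kact F {..<n} \<sigma>" by (rule grepS)
 have KFe: "(%h i j. red (C.KD h i j)) = E.KD" by (intro ext) (simp add: C.KD_def E.KD_def)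
 have lin: "linact F (fmod F {()}) D (kact F {()} E.KD)" by (rule F.krep_linact[OF E.krepD[OF sD] sD]) simp
 show ?thesis
 proof (rule conclude[OF AI sD _ C.krepD[OF sD] _ _ \<sigma>, unfolded KFe])
  show "C.KD h i j : A" for h i j by (simp add: C.KD_def chr_A[OF c(1)])
  show "krep F (GD D) {()} E.KD" by (rule E.krepD[OF sD])
  show "EX T. eqv F (fmod F {()}) (kact F {()} E.KD) (carrier (fmod F {()})) (fmod F {()}) (kact F {()} E.KD) (carrier (fmod F {()})) (GD D) T"
   by (rule eqv_refl)
  have d1: "dl F () : carrier (fmod F {()})" by (rule F.dl_closed) simp
  have "dl F () () ~= \<zero>@(fmod F {()}) ()" by (simp add: dl_def)
  then have d0: "dl F () ~= \<zero>@(fmod F {()})" by metis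
  have id: "islin F M M id" for M :: "('b, 'v) module" by (simp add: islin_def)
  show "EX T. eqv F (fmod F {()}) (kact F {()} E.KD) (carrier (fmod F {()})) (fmod F {..<n}) (kact F {..<n} \<sigma>) (carrier (fmod F {..<n})) (GD D) T"
  proof (rule irr_iso[OF lin S.linact_axioms E.KD_irr[OF sD] irr d1 d0 w id _ id, where lam = "%h. red (?cx (mdet h))"])
   show "red (?cx (mdet h')) : carrier F & id (kact F {()} E.KD h' (dl F ())) = red (?cx (mdet h')) \<odot>@(fmod F {()}) dl F () &
     id (kact F {..<n} \<sigma> h' w) = red (?cx (mdet h')) \<odot>@(fmod F {..<n}) w" if "h' : GD D" for h'
    unfolding id_apply using E.actD[OF d1, of h'] h[OF that] E.ch_closed[of "mdet h'"] by blast
  qed simp_all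
  show "hlen L (fmod L {()}) (GD {1}) (kact L {()} C.KD) (carrier (fmod L {()})) 1 &
   hlen F (fmod F {()}) (GD {1}) (kact F {()} E.KD) (carrier (fmod F {()})) 1" using C.KD_hlen E.KD_hlen by blast
 qed simp
qed

text \<open>Only the case of trivial \<open>nu\<close> with l dividing q + 1 is delicate; it is
  moved to a cuspidal representation with the same reduced eigenvalues.\<close>

lemma lift_T:
 assumes c: "c : A" "c [^] (CARD('k) - 1) = \<one>" and m: "m : A" "m [^] (CARD('k) - 1) = \<one>"
  and h: "grep.hev F psF qiF (fmod F {..<n}) D (kact F {..<n} \<sigma>) (%b. red (psr.lamP L py qi (L.chr (Nm g) c) (L.chr (Nm g) m) b)) w"
 shows "liftable \<iota> D n \<sigma>"
proof -
 interpret S: grep F psF qiF "fmod F {..<n}" D "kact F {..<n} \<sigma>" by (rule grepS)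
 let ?q = "CARD('k)"
 have q2: "?q \<ge> 2" by (rule cge2)
 then have n0: "?q - 1 > 0" by simp
 obtain c' where c': "c' : A" "red c' = red c" "c' [^] (?q - 1) = \<one>" using teich[OF c n0] by blast
 obtain m' r where m': "m' : A" "red m' = red m" "m' [^] (?q - 1) = \<one>" and r: "~ l dvd r" "m' [^] (r::nat) = \<one>"
  using teich[OF m n0] by blast
 have e: "red (psr.lamP L py qi (L.chr (Nm g) c') (L.chr (Nm g) m') b) = red (psr.lamP L py qi (L.chr (Nm g) c) (L.chr (Nm g) m) b)" for b
  unfolding red_lamP(2)[OF charsPF[OF gN c'(1,3) m'(1,3)] chr_A[OF c'(1)] chr_A[OF m'(1)]]
   red_lamP(2)[OF charsPF[OF gN c m] chr_A[OF c(1)] chr_A[OF m(1)]]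
  by (simp add: red_chr c' m' c m)
 have h': "S.hev (%b. red (psr.lamP L py qi (L.chr (Nm g) c') (L.chr (Nm g) m') b)) w" unfolding e by (rule h)
 show ?thesis
 proof (cases "red m' = \<one>@F")
  case False
  show ?thesis by (rule lift_ps[OF c'(1,3) m'(1,3) r False h'])
 next
  case True
  have m1: "m' = \<one>" by (rule root_red_inj[OF m'(1) r(2,1) True])
  show ?thesis
  proof (cases "S.qq \<oplus>@F \<one>@F = \<zero>@F")
   case False
   then show ?thesis using lift_steinberg[OF c'(1,3)] h' unfolding m1 by blast
  next
   case q1: True
   have "add_pow F (?q + 1) \<one>@F = \<zero>@F" using q1 by (simp add: S.qq_def F.a_comm)
   then have lq: "l dvd ?q + 1" using natF_nonzero by blast
   let ?M = "?q * ?q - 1"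
   have M: "?M = (?q - 1) * (?q + 1)" by (simp add: algebra_simps)
   then have M0: "?M > 0" using q2 by simp
   obtain k s where ks: "~ l dvd s" "?M = s * l ^ k" using prime_power_canonical[OF l_prime M0] by blast
   obtain t where t: "?q + 1 = l * t" using lq by blast
   have l0: "l > 0" using l_prime prime_gt_0_nat by blast
   have omL: "om : carrier L" by (rule A_sub[OF om_A])
   \<comment> \<open>\<open>y\<close> has l-power order, so it reduces to 1. The factor t = (q +
     1)/l makes y^(q-1) different from 1 with l-th power 1.\<close>
   define y where "y = om [^] (s * t)"
   have yA: "y : A" "y : carrier L" using om_A omL by (auto simp: y_def)
   have yo: "y [^] (j::nat) = \<one> \<longleftrightarrow> ?M dvd s * t * j" for j
    unfolding y_def L.nat_pow_pow[OF omL] om_order ..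
   have "?M dvd s * t * l ^ k" unfolding ks(2) by (metis dvd_triv_left mult.assoc mult.commute)
   then have "y [^] (l ^ k) = \<one>" using yo by blast
   then have ry: "red y = \<one>@F" using frobenius_root[of "red y" k] yA red_pow[OF yA(1), of "l ^ k"] by auto
   have y1: "y [^] (?q - 1) ~= \<one>"
   proof
    assume "y [^] (?q - 1) = \<one>"
    then have "?M dvd s * t * (?q - 1)" using yo by blast
    then have "l * ?M dvd l * (s * t * (?q - 1))" by (rule mult_dvd_mono[OF dvd_refl])
    also have "l * (s * t * (?q - 1)) = s * ?M" unfolding M t by (simp only: mult_ac)
    finally have "l * ?M dvd s * ?M" .
    then have "?M * l dvd ?M * s" by (simp only: mult.commute)
    then have "?M = 0 \<or> l dvd s" by (rule iffD1[OF nat_mult_dvd_cancel_disj])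
    then have "l dvd s" using M0 by (metis less_irrefl)
    then show False using ks by blast
   qed
   have yM: "y [^] ?M = \<one>" using yo by simp
   define z where "z = c' ** y"
   have cL: "c' : carrier L" by (rule A_sub[OF c'(1)])
   have zA: "z : A" using c' yA by (simp add: z_def)
   have cM: "c' [^] ?M = \<one>" unfolding M L.nat_pow_pow[OF cL, symmetric] c'(3) by simp
   have zM: "z [^] ?M = \<one>" unfolding z_def L.nat_pow_distrib[OF cL yA(2)] cM yM by simp
   have zq: "z [^] (?q - 1) = y [^] (?q - 1)"
    unfolding z_def L.nat_pow_distrib[OF cL yA(2)] c'(3) using yA by simp
   have rz: "red z = red c'" using c' yA ry red_closed[OF c(1)] by (simp add: z_def red_mult)
   have rc: "red c' [^]@F (?q - 1) = \<one>@F" by (rule red_root[OF c'(1,3)])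
   note tz = charsF[OF g zA zM] and tc = charsF[OF g c'(1) cM]
   have eq: "red (L.chr g z s) = red (L.chr g c' s)" for s by (simp add: red_chr zA c'(1) rz)
   interpret T: theta F psF qiF "%t. red (L.chr g z t)" by (rule tz(2))
   \<comment> \<open>Modulo l the character is constant 1 on the norm-one group, which has q + 1 = 0
     elements counted in \<open>F\<close>; the cuspidal model thus exists over \<open>F\<close> as
     well.\<close>
   have "finsum F (%t. red (L.chr g z t)) {t. Nm t = 1} = finsum F (%t. \<one>@F) {t::'k q2. Nm t = 1}"
   proof (rule F.fsc)
    fix t :: "'k q2" assume "t : {t. Nm t = 1}"
    then have t: "t ~= 0" "Nm t = 1" by auto
    have "L.chr g c' t = L.chr (Nm g) c' 1" using achar.chr_norm[OF achL g cL c'(3) t(1)] t(2) by simp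
    then show "red (L.chr g z t) = \<one>@F" unfolding eq using L.chr_1[OF gN cL c'(3)] by simp
   qed simp
   also have "... = \<zero>@F" using q1 card_Nm_fiber[of "1::'k"] by (simp add: F.fs_const S.qq_def F.a_comm)
   finally have cF: "cusp F psF qiF (%t. red (L.chr g z t))" by unfold_locales
   have hT: "S.hev (%b. red (lamT L py qi (L.chr g z) b)) w"
   proof (rule S.hev_cong[OF h'])
    fix b assume b: "b : BD D"
    have "red (lamT L py qi (L.chr g z) b) = red (lamT L py qi (L.chr g c') b)"
     unfolding red_lamT(2)[OF tz chr_A[OF zA]] red_lamT(2)[OF tc chr_A[OF c'(1)]] eq ..
    then show "red (psr.lamP L py qi (L.chr (Nm g) c') (L.chr (Nm g) m') b) = red (lamT L py qi (L.chr g z) b)"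
     unfolding m1 using achar.lamT_lamP[OF achL g cL c'(3) b sD] by simp
   qed
   show ?thesis
   proof (rule lift_cusp[OF zA zM _ cF _ hT])
    show "z [^] (?q - 1) ~= \<one>" unfolding zq by (rule y1)
    assume "red z [^]@F (?q - 1) = \<ominus>@F \<one>@F"
    then have "\<one>@F \<oplus>@F \<one>@F = (\<ominus>@F \<one>@F) \<oplus>@F \<one>@F" using rc rz by simp
    then have "add_pow F (2::nat) \<one>@F = \<zero>@F" by (simp add: numeral_2_eq_2 F.l_neg)
    then have "l dvd 2" using natF_nonzero by blast
    \<comment> \<open>The condition in \<open>V\<close> can only occur for l = 2, and then y^(q-1)
      has order exactly 2.\<close>
    then have l2: "l = 2" using l_prime primes_dvd_imp_eq two_is_prime_nat by blast
    let ?v = "y [^] (?q - 1)"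
    have e2: "s * t * ((?q - 1) * 2) = s * ?M" unfolding M t l2 by (simp only: mult_ac)
    have "?v [^] (2::nat) = \<one>" unfolding L.nat_pow_pow[OF yA(2)] yo e2 by (rule dvd_triv_right)
    then have "?v ** ?v = \<one>" using yA by (simp add: numeral_2_eq_2)
    then have "?v = \<one> \<or> ?v = \<ominus> \<one>" using L.square_eq_one[of ?v] yA by simp
    then show "z [^] (?q - 1) = \<ominus> \<one>" unfolding zq using y1 by blast
   qed
  qed
 qed
qed

text \<open>After passing to a parameter of order prime to l, the character either factors through
  the norm, which leads back to the principal series eigenvalues, or stays regular modulo l.\<close>

lemma lift_C:
 assumes z: "z : A" "z [^] (CARD('k) * CARD('k) - 1) = \<one>"
  and h: "grep.hev F psF qiF (fmod F {..<n}) D (kact F {..<n} \<sigma>) (%b. red (lamT L py qi (L.chr g z) b)) w"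
 shows "liftable \<iota> D n \<sigma>"
proof -
 interpret S: grep F psF qiF "fmod F {..<n}" D "kact F {..<n} \<sigma>" by (rule grepS)
 let ?q = "CARD('k)"
 let ?M = "?q * ?q - 1"
 have q2: "?q \<ge> 2" by (rule cge2)
 have M0: "?M > 0" using mult_le_mono[OF q2 q2] by simp
 obtain y r where y: "y : A" "red y = red z" "y [^] ?M = \<one>" and r: "~ l dvd r" "y [^] (r::nat) = \<one>"
  using teich[OF z M0] by blast
 have yL: "y : carrier L" by (rule A_sub[OF y(1)])
 note ty = charsF[OF g y(1,3)] and tz = charsF[OF g z]
 have "red (lamT L py qi (L.chr g y) b) = red (lamT L py qi (L.chr g z) b)" for b
  unfolding red_lamT(2)[OF ty chr_A[OF y(1)]] red_lamT(2)[OF tz chr_A[OF z(1)]] by (simp add: red_chr y z)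
 then have h': "S.hev (%b. red (lamT L py qi (L.chr g y) b)) w" using h by simp
 let ?v = "y [^] (?q - 1)"
 have vA: "?v : A" "?v : carrier L" using y yL by auto
 have vr: "?v [^] r = \<one>"
  using L.nat_pow_pow[OF yL, of "?q - 1" r] L.nat_pow_pow[OF yL, of r "?q - 1"] r(2) by (simp add: mult.commute)
 show ?thesis
 proof (cases "?v = \<one>")
  case True
  have "S.hev (%b. red (psr.lamP L py qi (L.chr (Nm g) y) (L.chr (Nm g) \<one>) b)) w"
   by (rule S.hev_cong[OF h']) (simp add: achar.lamT_lamP[OF achL g yL True _ sD])
  then show ?thesis by (rule lift_T[OF y(1) True A_one L.nat_pow_one])
 next
  case False
  have rv: "red y [^]@F (?q - 1) = red ?v" using y(1) by (simp add: red_pow)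
  have rv1: "red ?v ~= \<one>@F" using root_red_inj[OF vA(1) vr r(1)] False by blast
  have yM: "red y [^]@F ?M = \<one>@F" by (rule red_root[OF y(1,3)])
  have "cusp F psF qiF (F.chr g (red y))" by (rule achar.chr_regular[OF achF g _ yM]) (use red_closed[OF y(1)] rv rv1 in auto)
  moreover have "F.chr g (red y) = (%t. red (L.chr g y t))" by (rule ext) (simp add: red_chr[OF y(1)])
  ultimately have cF: "cusp F psF qiF (%t. red (L.chr g y t))" by simp
  show ?thesis
  proof (rule lift_cusp[OF y(1,3) False cF _ h'])
   assume "red y [^]@F (?q - 1) = \<ominus>@F \<one>@F"
   then have rm: "red ?v = \<ominus>@F \<one>@F" using rv by simp
   have "red (?v ** ?v) = \<one>@F" unfolding red_mult[OF vA(1) vA(1)] rm by (simp add: F.l_minus)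
   moreover have "(?v ** ?v) [^] r = \<one>" using vr vA(2) by (simp add: L.nat_pow_distrib)
   ultimately have "?v ** ?v = \<one>" using root_red_inj[OF A_mult[OF vA(1) vA(1)] _ r(1)] by blast
   then show "?v = \<ominus> \<one>" using L.square_eq_one[of ?v] vA(2) False by blast
  qed
 qed
qed

text \<open>As SL2 acts trivially, the group acts through the determinant. A common eigenvector of
  the matrices \<open>dg d 1\<close> is found with \<open>eigenvector_lift\<close>, now for the
  characters of k^* and with trivial structure constants.\<close>

lemma lift_degenerate:
 assumes n: "0 < n" and deg: "!!a v. a ~= 0 ==> v : carrier (fmod F {..<n}) ==> grep.pe F psF qiF (fmod F {..<n}) (kact F {..<n} \<sigma>) a v = \<zero>@(fmod F {..<n})"
 shows "liftable \<iota> D n \<sigma>"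
proof -
 let ?M = "fmod F {..<n}" and ?q = "CARD('k)"
 interpret S: grep F psF qiF ?M D "kact F {..<n} \<sigma>" by (rule grepS)
 have tr: "kact F {..<n} \<sigma> h v = v" if "mdet h = 1" "v : carrier ?M" for h v
  by (rule S.degenerate_trivial[OF deg that])
 define ta where "ta \<delta> = kact F {..<n} \<sigma> (dg \<delta> 1)" for \<delta>
 define u where "u = om [^] (?q + 1)"
 have omL: "om : carrier L" by (rule A_sub[OF om_A])
 have u: "u : A" "u : carrier L" using om_A omL by (auto simp: u_def)
 have M: "?q * ?q - 1 = (?q + 1) * (?q - 1)" by (simp add: algebra_simps)
 have uo: "u [^] (j::nat) = \<one> \<longleftrightarrow> ?q - 1 dvd j" for j
  unfolding u_def L.nat_pow_pow[OF omL] om_order M by (rule nat_mult_dvd_cancel1) simp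
 have ui: "u [^] (i::nat) : A" "u [^] i : carrier L" "(u [^] i) [^] (?q - 1) = \<one>" for i
  using u by (auto simp: L.nat_pow_pow uo)
 define lam where "lam i = L.chr (Nm g) (u [^] (i::nat))" for i
 have lamA: "lam i d : A" for i d by (simp add: lam_def chr_A[OF ui(1)])
 have D0: "d ~= 0" if "d : D" for d using that D by auto
 have dgG: "dg d 1 : GD D" if "d : D" for d using that by simp
 have d1: "dl F 0 : carrier ?M" using n by (intro F.dl_closed) simp
 have "dl F (0::nat) 0 ~= \<zero>@?M 0" by (simp add: dl_def)
 then have d0: "dl F (0::nat) ~= \<zero>@?M" by metis
 have s1: "finsum R f {()} = f ()" if "f () : carrier R" "abelian_monoid R" for R :: "('c, 'd) ring_scheme" and f
  using abelian_monoid.fs_only[OF that(2), of "{()}" "()" f] that(1) by simp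
 have "EX w:carrier ?M. w ~= \<zero>@?M & (EX i:{..<?q - 1}. ALL d:D. ta d w = red (lam i d) \<odot>@?M w)"
 proof (rule eigenvector_lift[where V = "carrier ?M" and S = "{()}" and st = "%_ _ _. \<one>" and nx = "%d d' _. d * d'" and ?b0.0 = 1 and v = "dl F 0"])
  show "module F ?M" by (rule F.fmm)
  show "\<zero>@?M : carrier ?M" by (rule S.M.M.zero_closed)
  show "x \<oplus>@?M y : carrier ?M" if "x : carrier ?M" "y : carrier ?M" for x y by (rule S.M.M.add.m_closed[OF that])
  show "c \<odot>@?M x : carrier ?M" if "c : carrier F" "x : carrier ?M" for c x by (rule S.M.smult_closed[OF that])
  show "ta d v : carrier ?M" if "d : D" "v : carrier ?M" for d v unfolding ta_def by (rule S.act_closed[OF dgG[OF that(1)] that(2)])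
  show "ta d (v \<oplus>@?M w) = ta d v \<oplus>@?M ta d w" if "d : D" "v : carrier ?M" "w : carrier ?M" for d v w
   unfolding ta_def by (rule S.act_add[OF dgG[OF that(1)] that(2,3)])
  show "ta d (c \<odot>@?M v) = c \<odot>@?M ta d v" if "d : D" "c : carrier F" "v : carrier ?M" for d c v
   unfolding ta_def by (rule S.act_smult[OF dgG[OF that(1)] that(3,2)])
  show "lam i d : A" for i d by (rule lamA)
  show "d : D ==> d' : D ==> d * d' : D" for d d' by (rule S.D_simps(3))
  show "lam i d ** lam i d' = finsum L (%s. \<one> ** lam i (d * d')) {()}" if "d : D" "d' : D" for i d d'
  proof -
   have "lam i (d * d') = lam i d ** lam i d'" unfolding lam_def by (rule L.chr_mult[OF gN ui(2,3) D0[OF that(1)] D0[OF that(2)]])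
   moreover have "lam i d : carrier L" for d by (rule A_sub[OF lamA])
   ultimately show ?thesis by (subst s1) (auto simp: L.abelian_monoid_axioms)
  qed
  show "ta d (ta d' v) = finsum ?M (%s. red \<one> \<odot>@?M ta (d * d') v) {()}" if "d : D" "d' : D" "v : carrier ?M" for d d' v
  proof -
   have "dg (d * d') 1 = m2mul (dg d 1) (dg d' 1)" by (simp add: dg_def m2s)
   then have t: "ta (d * d') v = ta d (ta d' v)" unfolding ta_def using S.act_mul[OF dgG[OF that(1)] dgG[OF that(2)] that(3)] by simp
   have c: "ta d (ta d' v) : carrier ?M" unfolding ta_def by (intro S.act_closed dgG that)
   have o: "red \<one> \<odot>@?M ta d (ta d' v) = ta d (ta d' v)" unfolding red_one by (rule S.M.smult_one[OF c])
   show ?thesis unfolding t o by (rule s1[symmetric, OF c S.M.M.abelian_monoid_axioms])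
  qed
  show "1 : D" by (rule S.D_simps(1))
  show "lam i 1 = \<one>" for i unfolding lam_def by (rule L.chr_1[OF gN ui(2,3)])
  show "ta 1 v = v" if "v : carrier ?M" for v unfolding ta_def by (rule tr) (use that in \<open>simp_all add: m2r\<close>)
  show "dl F 0 : carrier ?M" "dl F 0 ~= \<zero>@?M" by (rule d1, rule d0)
  fix Ph d
  assume P: "!!b. b : D ==> Ph b : A" and z: "!!i. i : {..<?q - 1} ==> finsum L (%d. Ph d ** lam i d) D = \<zero>" and d: "d : D"
  define Ph' where "Ph' d = (if d : D then Ph d else \<zero>)" for d
  have P': "Ph' d : carrier L" for d using P A_sub by (simp add: Ph'_def)
  have "Ph' d = \<zero>"
  proof (rule L.chr_separate[OF gN u(2) uo _ P' _ D0[OF d]])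
   show "add_pow L (?q - 1) \<one> ~= \<zero>" using charL[of "?q - 1"] cge2[where ?'f = 'k] by simp
   fix i assume i: "i < ?q - 1"
   have "finsum L (%t. Ph' t ** lam i t) (UNIV - {0}) = finsum L (%t. Ph' t ** lam i t) D"
    by (rule L.fs_mono) (use P' D0 A_sub[OF lamA] A_sub[OF P] in \<open>auto simp: Ph'_def\<close>)
   also have "... = finsum L (%d. Ph d ** lam i d) D" by (rule L.fsc) (use A_sub[OF P] A_sub[OF lamA] in \<open>auto simp: Ph'_def\<close>)
   finally show "finsum L (%t. Ph' t ** L.chr (Nm g) (u [^] i) t) (UNIV - {0}) = \<zero>" using z[of i] i by (simp add: lam_def)
  qed
  then show "Ph d = \<zero>" using d by (simp add: Ph'_def)
 qed simp_all
 then obtain w i where w: "w : carrier ?M" "w ~= \<zero>@?M" and ev: "!!d. d : D ==> ta d w = red (lam i d) \<odot>@?M w" by blast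
 show ?thesis
 proof (rule lift_det[OF ui(1) ui(3) w])
  fix h :: "'k m2" assume h: "h : GD D"
  let ?d = "mdet h"
  have d: "?d : D" using h by (simp add: GD_def)
  obtain x y z t where hh: "h = (x, y, z, t)" by (cases h)
  \<comment> \<open>Divides the first column by the determinant, so that h is an element of SL2
    times \<open>dg ?d 1\<close>.\<close>
  define h1 where "h1 = (x / ?d, y, z / ?d, t)"
  have "x * t - y * z = ?d" by (simp add: hh)
  then have m1: "mdet h1 = 1" using D0[OF d] by (simp add: h1_def divide_simps mult.commute)
  have e: "h = m2mul h1 (dg ?d 1)" using D0[OF d] by (simp add: h1_def dg_def m2s hh)
  have h1G: "h1 : GD D" using m1 S.D_simps(1) by (simp add: GD_def)
  have "kact F {..<n} \<sigma> h w = kact F {..<n} \<sigma> h1 (ta ?d w)" unfolding ta_def using S.act_mul[OF h1G dgG[OF d] w(1)] e by simp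
  also have "... = ta ?d w" unfolding ta_def by (rule tr[OF m1 S.act_closed[OF dgG[OF d] w(1)]])
  finally show "kact F {..<n} \<sigma> h w = red (L.chr (Nm g) (u [^] i) ?d) \<odot>@?M w" using ev[OF d] by (simp add: lam_def)
 qed
qed

lemma lift_nondegenerate:
 assumes "v : carrier (fmod F {..<n})" "grep.pe F psF qiF (fmod F {..<n}) (kact F {..<n} \<sigma>) 1 v ~= \<zero>@(fmod F {..<n})"
 shows "liftable \<iota> D n \<sigma>"
 using eigenvector[OF grepS g assms] lift_C lift_T by blast

end

theorem irreducible_liftable:
 fixes D :: "'k set"
 assumes AI: "A <= integers l L \<iota>" and D: "D = UNIV - {0} \<or> D = {1}" and \<sigma>: "irreducible_rep F (GD D) n \<sigma>"
 shows "liftable \<iota> D n \<sigma>"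
proof -
 obtain g :: "'k q2" where g: "isgen g" using isgen_exists by blast
 note s = irreducible_rep_irrsub[OF \<sigma> F.field_axioms]
 interpret S: grep F psF qiF "fmod F {..<n}" D "kact F {..<n} \<sigma>" by (rule grepS[OF g AI D s(2,1)])
 show ?thesis
 proof (cases "ALL a v. a ~= 0 --> v : carrier (fmod F {..<n}) --> S.pe a v = \<zero>@(fmod F {..<n})")
  case True
  then show ?thesis by (intro lift_degenerate[OF g AI D s(2,1,3)]) blast
 next
  case False
  then obtain a v where a: "a ~= 0" and v: "v : carrier (fmod F {..<n})" "S.pe a v ~= \<zero>@(fmod F {..<n})" by blast
  \<comment> \<open>Some nontrivial character psi(a x) of U occurs, and it takes over the role of
    psi; being \<open>liftable\<close> does not depend on this choice.\<close>
  interpret X: lifting L F A red l om "%x. py (a * x)" qi by (rule rescale[OF a])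
  interpret SX: grep F X.psF qiF "fmod F {..<n}" D "kact F {..<n} \<sigma>" by (rule X.grepS[OF g AI D s(2,1)])
  have "SX.pe 1 v = S.pe a v" by (simp add: SX.pe_def S.pe_def)
  then have "X.liftable \<iota> D n \<sigma>" using X.lift_nondegenerate[OF g AI D s(2,1) v(1)] v(2) by simp
  then show ?thesis by (simp add: X.liftable_def liftable_def)
 qed
qed

end

theorem theorem8p1:
  fixes l :: nat
    and L :: "'a ring" and \<iota> :: "(nat \<Rightarrow> int) \<Rightarrow> 'a"
    and F :: "'b ring" and red :: "'a \<Rightarrow> 'b"
  assumes "Factorial_Ring.prime l"
    and "l \<noteq> CHAR('k::{finite,field})"
    and "is_Qlac l L \<iota>"
    and "is_Flac l F"
    and "is_reduction_map l L \<iota> F red"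
  shows "(\<forall>n (\<sigma> :: 'k m2 \<Rightarrow> nat \<Rightarrow> nat \<Rightarrow> 'b). irreducible_rep F GL2 n \<sigma> \<longrightarrow>
            (\<exists>\<rho>. is_rep L GL2 n \<rho> \<and> reduces_to l L \<iota> F red GL2 n \<rho> \<sigma> \<and>
                 (\<exists>m. has_length L SL2 n \<rho> m \<and> has_length F SL2 n \<sigma> m)))
       \<and> (\<forall>n (\<sigma> :: 'k m2 \<Rightarrow> nat \<Rightarrow> nat \<Rightarrow> 'b). irreducible_rep F SL2 n \<sigma> \<longrightarrow>
            (\<exists>\<rho>. is_rep L SL2 n \<rho> \<and> reduces_to l L \<iota> F red SL2 n \<rho> \<sigma>))"
proof -
 obtain A om and \<psi> :: "'k => 'a" and qi where X: "lifting L F A red l om \<psi> qi" and AI: "A <= integers l L \<iota>"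
  using lifting_exists[OF assms] by blast
 interpret lifting L F A red l om \<psi> qi by (rule X)
 show ?thesis
 proof (intro conjI allI impI)
  fix n and \<sigma> :: "'k m2 => nat => nat => 'b"
  assume s: "irreducible_rep F GL2 n \<sigma>"
  have l: "liftable \<iota> (UNIV - {0::'k}) n \<sigma>" by (rule irreducible_liftable[OF AI]) (use s in \<open>simp_all add: GL2_GD\<close>)
  show "EX \<rho>. is_rep L GL2 n \<rho> & reduces_to l L \<iota> F red GL2 n \<rho> \<sigma> & (EX m. has_length L SL2 n \<rho> m & has_length F SL2 n \<sigma> m)"
   using l unfolding liftable_def GL2_GD SL2_GD by blast
 next
  fix n and \<sigma> :: "'k m2 => nat => nat => 'b"
  assume s: "irreducible_rep F SL2 n \<sigma>"
  have l: "liftable \<iota> {1::'k} n \<sigma>" by (rule irreducible_liftable[OF AI]) (use s in \<open>simp_all add: SL2_GD\<close>)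
  show "EX \<rho>. is_rep L SL2 n \<rho> & reduces_to l L \<iota> F red SL2 n \<rho> \<sigma>"
   using l unfolding liftable_def SL2_GD by blast
 qed
qed

end
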